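(* Let $F$ (depending on $p$) and $S(c)$ be as defined in the context. If $p\in(3,\frac{10}{3}]$, then there exists $\bar c>0$ such that for any $c\in(0,\bar c)$ there are no critical points of $F$ restricted to $S(c)$. If $p=3$, then for all $c>0$, $F$ has no critical points on the constraint $S(c)$.
   Context: For $p\in(2,6)$ and $u\in H^1(\mathbb{R}^3)$ define $$F(u)=\frac12\int_{\mathbb{R}^3}|\nabla u|^2dx+\frac14\int_{\mathbb{R}^3}\int_{\mathbb{R}^3}\frac{|u(x)|^2|u(y)|^2}{|x-y|}dxdy-\frac1p\int_{\mathbb{R}^3}|u|^pdx,$$ which is a $C^1$ functional on $H^1(\mathbb{R}^3)$. For $c>0$ let $S(c)=\{u\in H^1(\mathbb{R}^3):\int_{\mathbb{R}^3}|u|^2dx=c\}$. A critical point of $F$ restricted to $S(c)$ is a $u\in S(c)$ for which there is a Lagrange multiplier $\lambda\in\mathbb{R}$ with $F'(u)=\lambda u$, i.e. $u$ is a weak solution of $-\Delta u-\lambda u+(|x|^{-1}*|u|^2)u-|u|^{p-2}u=0$ in $\mathbb{R}^3$. *)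

theory Defs
  imports "HOL-Analysis.Analysis"
begin

text \<open>
  Elements of \<open>H\<^sup>1(\<real>\<^sup>3)\<close> are real-valued and handled through Borel
  representatives: every almost-everywhere class of Lebesgue measurable functions contains one,
  and everything below depends on the function only up to null sets.
\<close>

definition partial_deriv :: "3 \<Rightarrow> (real^3 \<Rightarrow> real) \<Rightarrow> real^3 \<Rightarrow> real" where
  "partial_deriv i f x = frechet_derivative f (at x) (axis i 1)"

fun Ck :: "nat \<Rightarrow> (real^3 \<Rightarrow> real) \<Rightarrow> bool" where
  "Ck 0 f \<longleftrightarrow> continuous_on UNIV f"
| "Ck (Suc k) f \<longleftrightarrow> (\<forall>x. f differentiable (at x)) \<and> (\<forall>i. Ck k (partial_deriv i f))"

definition test_function :: "(real^3 \<Rightarrow> real) \<Rightarrow> bool" where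
  "test_function \<phi> \<longleftrightarrow> (\<forall>k. Ck k \<phi>) \<and> compact (closure {x. \<phi> x \<noteq> 0})"

definition locally_integrable :: "(real^3 \<Rightarrow> 'b::euclidean_space) \<Rightarrow> bool" where
  "locally_integrable f \<longleftrightarrow>
     f \<in> borel_measurable lborel \<and> (\<forall>K. compact K \<longrightarrow> set_integrable lborel K f)"

definition has_weak_gradient :: "(real^3 \<Rightarrow> real) \<Rightarrow> (real^3 \<Rightarrow> real^3) \<Rightarrow> bool" where
  "has_weak_gradient u g \<longleftrightarrow>
     locally_integrable u \<and> locally_integrable g \<and>
     (\<forall>\<phi> i. test_function \<phi> \<longrightarrow>
        (LINT x|lborel. u x * partial_deriv i \<phi> x) = - (LINT x|lborel. g x $ i * \<phi> x))"

text \<open>A weak gradient is unique up to a null set, so the choice below is harmless.\<close>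

definition weak_gradient :: "(real^3 \<Rightarrow> real) \<Rightarrow> real^3 \<Rightarrow> real^3" where
  "weak_gradient u = (SOME g. has_weak_gradient u g)"

definition H1 :: "(real^3 \<Rightarrow> real) set" where
  "H1 = {u \<in> borel_measurable lborel. integrable lborel (\<lambda>x. \<bar>u x\<bar>\<^sup>2) \<and>
           (\<exists>g. has_weak_gradient u g \<and> integrable lborel (\<lambda>x. (norm (g x))\<^sup>2))}"

definition H1_norm :: "(real^3 \<Rightarrow> real) \<Rightarrow> real" where
  "H1_norm u = sqrt ((LINT x|lborel. \<bar>u x\<bar>\<^sup>2) + (LINT x|lborel. (norm (weak_gradient u x))\<^sup>2))"

text \<open>
  Frechet differentiability with respect to the \<open>H\<^sup>1\<close> norm, that is, the unfolding of
  \<^const>\<open>has_derivative\<close> on the normed space \<open>H\<^sup>1(\<real>\<^sup>3)\<close>, which is not a type here.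
\<close>

definition H1_bounded_linear :: "((real^3 \<Rightarrow> real) \<Rightarrow> real) \<Rightarrow> bool" where
  "H1_bounded_linear L \<longleftrightarrow>
     (\<forall>v\<in>H1. \<forall>w\<in>H1. L (\<lambda>x. v x + w x) = L v + L w) \<and>
     (\<forall>a. \<forall>v\<in>H1. L (\<lambda>x. a * v x) = a * L v) \<and>
     (\<exists>K. \<forall>v\<in>H1. \<bar>L v\<bar> \<le> K * H1_norm v)"

definition H1_has_derivative ::
  "((real^3 \<Rightarrow> real) \<Rightarrow> real) \<Rightarrow> ((real^3 \<Rightarrow> real) \<Rightarrow> real) \<Rightarrow> (real^3 \<Rightarrow> real) \<Rightarrow> bool" where
  "H1_has_derivative \<Phi> L u \<longleftrightarrow>
     H1_bounded_linear L \<and>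
     (\<forall>e>0. \<exists>d>0. \<forall>h\<in>H1. H1_norm h < d \<longrightarrow>
        \<bar>\<Phi> (\<lambda>x. u x + h x) - \<Phi> u - L h\<bar> \<le> e * H1_norm h)"

definition energy :: "real \<Rightarrow> (real^3 \<Rightarrow> real) \<Rightarrow> real" where
  "energy p u =
     1/2 * (LINT x|lborel. (norm (weak_gradient u x))\<^sup>2)
     + 1/4 * (LINT x|lborel. LINT y|lborel. \<bar>u x\<bar>\<^sup>2 * \<bar>u y\<bar>\<^sup>2 / norm (x - y))
     - 1/p * (LINT x|lborel. \<bar>u x\<bar> powr p)"

definition mass_sphere :: "real \<Rightarrow> (real^3 \<Rightarrow> real) set" where
  "mass_sphere c = {u \<in> H1. (LINT x|lborel. \<bar>u x\<bar>\<^sup>2) = c}"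

text \<open>
  In \<open>F'(u) = \<mu> u\<close> the function \<open>\<mu> u\<close> stands for the functional
  \<open>v \<mapsto> \<mu> \<integral> u v dx\<close> on \<open>H\<^sup>1(\<real>\<^sup>3)\<close>.
\<close>

definition constrained_critical_point :: "real \<Rightarrow> real \<Rightarrow> (real^3 \<Rightarrow> real) \<Rightarrow> bool" where
  "constrained_critical_point p c u \<longleftrightarrow>
     u \<in> mass_sphere c \<and>
     (\<exists>\<mu>. H1_has_derivative (energy p) (\<lambda>v. \<mu> * (LINT x|lborel. u x * v x)) u)"

end

theory Submission
  imports Defs
begin

text \<open>
Write \<open>A\<close> for the Dirichlet integral of \<open>u\<close>, \<open>B\<close> for its Coulomb double integral and \<open>C\<^sub>q\<close> for the integral of
\<open>|u|\<^sup>q\<close>. Testing the weak equation of a critical point against \<open>u\<close> and against \<open>x \<bullet> \<nabla>u\<close> yields the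
Nehari and Pohozaev identities, and eliminating the multiplier leaves \<open>A + B/4 = (3/2 - 3/p) C\<^sub>p\<close>.
No elliptic regularity is used: for a bounded \<open>C\<^sup>1\<close> field \<open>X\<close> the equation is tested with \<open>\<rho>\<^sub>n * (X \<bullet> \<nabla>(\<rho>\<^sub>n * u))\<close>
for a mollifier \<open>\<rho>\<^sub>n\<close>; since the nonlinear terms of an \<open>H\<^sup>1\<close> function lie in \<open>L\<^sup>2\<close>, one may let
\<open>n \<rightarrow> \<infinity>\<close>, and then \<open>X(x) = x/(1 + |x|\<^sup>2/n)\<close> tends to the dilation field.

On the other hand \<open>C\<^sub>3\<^sup>2 \<le> A B\<close>: insert the Riesz representation bound \<open>4\<pi>|u| \<le> |\<nabla>u| * |x|\<^sup>-\<^sup>2\<close> into one factor of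
\<open>|u|\<^sup>3\<close>, apply Cauchy-Schwarz, and use that \<open>|x|\<^sup>-\<^sup>2 * |x|\<^sup>-\<^sup>2\<close> is a multiple of the Coulomb kernel.
Hence \<open>C\<^sub>3 \<le> A + B/4\<close>, which contradicts \<open>A + B/4 = C\<^sub>3/2\<close> when \<open>p = 3\<close>. For \<open>3 < p \<le> 10/3\<close> one has
\<open>C\<^sub>p \<le> C\<^sub>3 + C\<^sub>1\<^sub>0\<^sub>/\<^sub>3\<close> and \<open>3/2 - 3/p \<le> 3/5\<close>, and the Gagliardo-Nirenberg inequality \<open>C\<^sub>1\<^sub>0\<^sub>/\<^sub>3 \<le> 3 c\<^sup>2\<^sup>/\<^sup>3 A\<close>
makes the last term harmless for small mass \<open>c\<close>.
\<close>

section \<open>Translations and \<open>L\<^sup>2\<close> functions\<close>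

text \<open>For u merely in H1 the function X . grad u is in general not an admissible test
  function, and its gradient would contain the Hessian of u. The inner mollifier makes that Hessian
  exist. The outer one moves by self-adjointness onto the gradient of u, so that the Hessian meets
  the same mollified gradient, and the symmetry of second derivatives turns it into half the
  derivative of |grad|^2 along X. The restriction \<open>p \<le> 4\<close> in the auxiliary results
  is the condition 2(p-1) <= 6 under which |u|^(p-1) is square integrable.

  The cubic estimate could also be obtained by testing the Poisson equation -Laplace phi = 4 pi u^2
  with |u|; the Riesz kernel avoids differentiating phi or |u|. Its constants are far from sharp,
  but a constant at most 1 in front of A B is good enough: 3/2 - 3/p is 1/2 at p = 3 and at most 3/5
  up to 10/3, which leaves room for the Gagliardo-Nirenberg term.\<close>

lemma distr_lborel_reflect:
  fixes a :: "'a::euclidean_space"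
  shows "distr lborel borel (\<lambda>x. a - x) = lborel"
  using lborel_affine[of "-1" a] by (simp add: density_1)

lemma distr_lborel_translate:
  fixes a :: "'a::euclidean_space"
  shows "distr lborel borel (\<lambda>x. x + a) = lborel"
  using lborel_distr_plus[of a] by (simp add: add.commute[of _ a])

lemma nn_integral_reflect:
  fixes a :: "'a::euclidean_space"
  assumes [measurable]: "f \<in> borel_measurable borel"
  shows "(\<integral>\<^sup>+x. f (a - x) \<partial>lborel) = (\<integral>\<^sup>+x. f x \<partial>lborel)"
  by (subst (2) distr_lborel_reflect[of a, symmetric]) (simp add: nn_integral_distr)

lemma nn_integral_translate:
  fixes a :: "'a::euclidean_space"
  assumes [measurable]: "f \<in> borel_measurable borel"
  shows "(\<integral>\<^sup>+x. f (x + a) \<partial>lborel) = (\<integral>\<^sup>+x. f x \<partial>lborel)"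
  by (subst (2) distr_lborel_translate[of a, symmetric]) (simp add: nn_integral_distr)

lemma integral_reflect:
  fixes a :: "'a::euclidean_space" and f :: "'a \<Rightarrow> 'b::{banach,second_countable_topology}"
  assumes [measurable]: "f \<in> borel_measurable borel"
  shows "(LINT x|lborel. f (a - x)) = (LINT x|lborel. f x)"
  by (subst (2) distr_lborel_reflect[of a, symmetric]) (simp add: integral_distr)

lemma integral_translate:
  fixes a :: "'a::euclidean_space" and f :: "'a \<Rightarrow> 'b::{banach,second_countable_topology}"
  assumes [measurable]: "f \<in> borel_measurable borel"
  shows "(LINT x|lborel. f (x + a)) = (LINT x|lborel. f x)"
  by (subst (2) distr_lborel_translate[of a, symmetric]) (simp add: integral_distr)

lemma integrable_reflect:
  fixes a :: "'a::euclidean_space" and f :: "'a \<Rightarrow> 'b::{banach,second_countable_topology}"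
  assumes [measurable]: "f \<in> borel_measurable borel"
  shows "integrable lborel (\<lambda>x. f (a - x)) \<longleftrightarrow> integrable lborel f"
  by (subst (2) distr_lborel_reflect[of a, symmetric]) (simp add: integrable_distr_eq)

lemma integrable_translate:
  fixes a :: "'a::euclidean_space" and f :: "'a \<Rightarrow> 'b::{banach,second_countable_topology}"
  assumes [measurable]: "f \<in> borel_measurable borel"
  shows "integrable lborel (\<lambda>x. f (x + a)) \<longleftrightarrow> integrable lborel f"
  by (subst (2) distr_lborel_translate[of a, symmetric]) (simp add: integrable_distr_eq)

text \<open>Only one half of the symmetric difference is estimated: for x in the open set U the
  point x - z_n is eventually in U, so the part of U missed by the translate tends to 0 by dominated
  convergence. The other half has the same measure because translation preserves the measure of
  U.\<close>

lemma open_translation_continuous: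
  fixes U :: "'a::euclidean_space set"
  assumes U: "open U" and fin: "emeasure lborel U < \<infinity>" and z: "z \<longlonglongrightarrow> 0"
  shows "(\<lambda>n. LINT x|lborel. \<bar>indicator U (x - z n) - indicator U x\<bar> :: real) \<longlonglongrightarrow> 0"
proof -
  have [measurable]: "U \<in> sets borel" using U by auto
  have int: "integrable lborel (indicator U :: 'a \<Rightarrow> real)"
    using fin by (simp add: integrable_indicator_iff)
  have int': "integrable lborel (\<lambda>x. indicator U (x - a) :: real)" for a
    using integrable_translate[of "indicator U :: 'a \<Rightarrow> real" "-a"] int by simp
  have eqint: "(LINT x|lborel. indicator U (x - a) :: real) = (LINT x|lborel. indicator U x)" for a
    using integral_translate[of "indicator U :: 'a \<Rightarrow> real" "-a"] by simp
  have lim: "(\<lambda>n. LINT x|lborel. indicator U x * (1 - indicator U (x - z n)) :: real) \<longlonglongrightarrow> (LINT x|(lborel::'a measure). 0)"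
  proof (rule integral_dominated_convergence[where w="indicator U"])
    show "AE x in lborel. (\<lambda>n. indicator U x * (1 - indicator U (x - z n)) :: real) \<longlonglongrightarrow> 0"
    proof (rule AE_I2)
      fix x :: 'a
      show "(\<lambda>n. indicator U x * (1 - indicator U (x - z n)) :: real) \<longlonglongrightarrow> 0"
      proof (cases "x \<in> U")
        case True
        have "(\<lambda>n. x - z n) \<longlonglongrightarrow> x - 0" by (intro tendsto_intros z)
        then have "eventually (\<lambda>n. x - z n \<in> U) sequentially"
          using topological_tendstoD[OF _ U] True by force
        then have "eventually (\<lambda>n. indicator U x * (1 - indicator U (x - z n)) = (0::real)) sequentially"
          by eventually_elim simp
        then show ?thesis by (rule tendsto_eventually)
      qed simp
    qed
  qed (use int in \<open>auto split: split_indicator\<close>)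
  have "(LINT x|lborel. \<bar>indicator U (x - a) - indicator U x\<bar> :: real)
      = 2 * (LINT x|lborel. indicator U x * (1 - indicator U (x - a)) :: real)" for a
  proof -
    have i3: "integrable lborel (\<lambda>x. indicator U x * (1 - indicator U (x - a)) :: real)"
      by (rule Bochner_Integration.integrable_bound[OF int]) (auto split: split_indicator)
    have "(LINT x|lborel. \<bar>indicator U (x - a) - indicator U x\<bar> :: real)
      = (LINT x|lborel. 2 * (indicator U x * (1 - indicator U (x - a))) + (indicator U (x - a) - indicator U x))"
      by (intro Bochner_Integration.integral_cong) (auto split: split_indicator)
    also have "\<dots> = (LINT x|lborel. 2 * (indicator U x * (1 - indicator U (x - a)))) + ((LINT x|lborel. indicator U (x - a)) - (LINT x|lborel. indicator U x))"
      using i3 int int' by (subst Bochner_Integration.integral_add) (auto simp: Bochner_Integration.integral_diff)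
    finally show ?thesis using eqint by simp
  qed
  with tendsto_mult[OF tendsto_const[of 2] lim] show ?thesis by simp
qed

text \<open>Outer regularity replaces A by an open superset U. The L1 distance of the two indicators
  is translation invariant, so it is paid twice, independently of the shift.\<close>

lemma indicator_translation_continuous:
  fixes A :: "'a::euclidean_space set"
  assumes A[measurable]: "A \<in> sets borel" and fin: "emeasure lborel A < \<infinity>" and z: "z \<longlonglongrightarrow> 0"
  shows "(\<lambda>n. LINT x|lborel. \<bar>indicator A (x - z n) - indicator A x\<bar> :: real) \<longlonglongrightarrow> 0"
proof (rule LIMSEQ_I)
  fix e :: real assume e: "e > 0"
  obtain U where U: "open U" "A \<subseteq> U" "emeasure lborel (U - A) < ennreal (e/4)"
    using outer_regular_lborel[OF A, of "e/4"] e by auto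
  have [measurable]: "U \<in> sets borel" using U by auto
  have "emeasure lborel U \<le> emeasure lborel A + emeasure lborel (U - A)"
    using U by (metis A Diff_partition emeasure_subadditive sets.Diff sets_lborel \<open>U \<in> sets borel\<close>)
  then have finU: "emeasure lborel U < \<infinity>" using fin U(3)
    by (auto simp: less_top[symmetric] top_unique)
  have intU: "integrable lborel (indicator U :: 'a \<Rightarrow> real)" and intA: "integrable lborel (indicator A :: 'a \<Rightarrow> real)"
    using finU fin by (simp_all add: integrable_indicator_iff)
  have intU': "integrable lborel (\<lambda>x. indicator U (x - a) :: real)" and intA': "integrable lborel (\<lambda>x. indicator A (x - a) :: real)" for a
    using integrable_translate[of "indicator U :: 'a \<Rightarrow> real" "-a"] integrable_translate[of "indicator A :: 'a \<Rightarrow> real" "-a"] intU intA by simp_all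
  have d: "(LINT x|lborel. indicator U x - indicator A x :: real) < e/4"
  proof -
    have "(LINT x|lborel. indicator U x - indicator A x :: real) = (LINT x|lborel. indicator (U - A) x)"
      using U(2) by (intro Bochner_Integration.integral_cong) (auto split: split_indicator)
    also have "\<dots> = measure lborel (U - A)" by simp
    also have "\<dots> < e/4"
    proof -
      have "emeasure lborel (U - A) = ennreal (measure lborel (U - A))"
        using U(3) by (intro emeasure_eq_ennreal_measure) auto
      with U(3) show ?thesis by (metis ennreal_less_iff measure_nonneg)
    qed
    finally show ?thesis .
  qed
  have d': "(LINT x|lborel. indicator U (x - a) - indicator A (x - a) :: real) < e/4" for a
    using integral_translate[of "\<lambda>x. indicator U x - indicator A x :: real" "-a"] d by simp
  from LIMSEQ_D[OF open_translation_continuous[OF U(1) finU z], of "e/4"] e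
  obtain N where N: "\<And>n. n \<ge> N \<Longrightarrow> (LINT x|lborel. \<bar>indicator U (x - z n) - indicator U x\<bar> :: real) < e/4"
    by force
  have "(LINT x|lborel. \<bar>indicator A (x - z n) - indicator A x\<bar> :: real) < e" if "n \<ge> N" for n
  proof -
    have "(LINT x|lborel. \<bar>indicator A (x - z n) - indicator A x\<bar> :: real)
       \<le> (LINT x|lborel. (indicator U (x - z n) - indicator A (x - z n)) + (\<bar>indicator U (x - z n) - indicator U x\<bar> + (indicator U x - indicator A x)))"
    proof (rule integral_mono)
      show "integrable lborel (\<lambda>x. \<bar>indicator A (x - z n) - indicator A x\<bar> :: real)"
        "integrable lborel (\<lambda>x. (indicator U (x - z n) - indicator A (x - z n)) + (\<bar>indicator U (x - z n) - indicator U x\<bar> + (indicator U x - indicator A x)) :: real)"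
        using intA intU intA' intU' by auto
    qed (use U(2) in \<open>auto split: split_indicator\<close>)
    also have "\<dots> = (LINT x|lborel. (indicator U (x - z n) - indicator A (x - z n))) + ((LINT x|lborel. \<bar>indicator U (x - z n) - indicator U x\<bar>) + (LINT x|lborel. (indicator U x - indicator A x)))"
      using intA intU intA' intU' by (simp add: Bochner_Integration.integral_add)
    also have "\<dots> < e/4 + (e/4 + e/4)" using d d'[of "z n"] N[OF that] by linarith
    finally show ?thesis using e by simp
  qed
  then show "\<exists>no. \<forall>n\<ge>no. norm ((LINT x|lborel. \<bar>indicator A (x - z n) - indicator A x\<bar> :: real) - 0) < e"
    by (intro exI[of _ N]) auto
qed

text \<open>Induction along the construction of integrable functions. In the limit case translation
  invariance makes the approximation error uniform in the shift, so one approximant serves all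
  z_n.\<close>

theorem L1_translation_continuous:
  fixes w :: "'a::euclidean_space \<Rightarrow> 'b::{banach,second_countable_topology}"
  assumes "integrable lborel w" and z: "z \<longlonglongrightarrow> 0"
  shows "(\<lambda>n. LINT x|lborel. norm (w (x - z n) - w x)) \<longlonglongrightarrow> 0"
  using assms(1)
proof (induction rule: integrable_induct)
  case (base A c)
  have "(\<lambda>x. norm (indicator A (x - z n) *\<^sub>R c - indicator A x *\<^sub>R c)) = (\<lambda>x. \<bar>indicator A (x - z n) - indicator A x\<bar> * norm c)" for n
    by (simp flip: scaleR_diff_left)
  then show ?case
    using tendsto_mult[OF indicator_translation_continuous[OF _ _ z, of A] tendsto_const[of "norm c"]] base by simp
next
  case (add f g)
  have [measurable]: "f \<in> borel_measurable borel" "g \<in> borel_measurable borel" using add(1,2) by auto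
  have f': "integrable lborel (\<lambda>x. f (x - a))" "integrable lborel (\<lambda>x. g (x - a))" for a
    using integrable_translate[of f "-a"] integrable_translate[of g "-a"] add by auto
  show ?case
  proof (rule tendsto_sandwich[OF _ _ tendsto_const])
    show "(\<lambda>n. (LINT x|lborel. norm (f (x - z n) - f x)) + (LINT x|lborel. norm (g (x - z n) - g x))) \<longlonglongrightarrow> 0"
      using tendsto_add[OF add(3,4)] by simp
    show "\<forall>\<^sub>F n in sequentially. (LINT x|lborel. norm (f (x - z n) + g (x - z n) - (f x + g x))) \<le> (LINT x|lborel. norm (f (x - z n) - f x)) + (LINT x|lborel. norm (g (x - z n) - g x))"
    proof (intro always_eventually allI)
      fix n
      have "(LINT x|lborel. norm (f (x - z n) + g (x - z n) - (f x + g x))) \<le> (LINT x|lborel. norm (f (x - z n) - f x) + norm (g (x - z n) - g x))"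
        by (intro integral_mono integrable_norm Bochner_Integration.integrable_add Bochner_Integration.integrable_diff f' add)
           (simp_all add: norm_diff_triangle_ineq)
      also have "\<dots> = (LINT x|lborel. norm (f (x - z n) - f x)) + (LINT x|lborel. norm (g (x - z n) - g x))"
        by (intro Bochner_Integration.integral_add integrable_norm Bochner_Integration.integrable_diff f' add)
      finally show "(LINT x|lborel. norm (f (x - z n) + g (x - z n) - (f x + g x))) \<le> \<dots>" .
    qed
  qed simp
next
  case (lim f s)
  have [measurable]: "f \<in> borel_measurable borel" "s i \<in> borel_measurable borel" for i using lim by auto
  have f': "integrable lborel (\<lambda>x. f (x - a))" "integrable lborel (\<lambda>x. s i (x - a))" for a i
    using integrable_translate[of f "-a"] integrable_translate[of "s i" "-a"] lim by auto
  have "(\<lambda>i. LINT x|lborel. norm (s i x - f x)) \<longlonglongrightarrow> (LINT x|(lborel::'a measure). 0)"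
  proof (rule integral_dominated_convergence[where w="\<lambda>x. 3 * norm (f x)"])
    show "AE x in lborel. (\<lambda>i. norm (s i x - f x)) \<longlonglongrightarrow> 0"
      by (intro AE_I2 tendsto_norm_zero LIM_zero lim.hyps(2))
    show "AE x in lborel. norm (norm (s i x - f x)) \<le> 3 * norm (f x)" for i
    proof (intro AE_I2)
      fix x show "norm (norm (s i x - f x)) \<le> 3 * norm (f x)"
        using lim.hyps(3)[of x i] norm_triangle_ineq4[of "s i x" "f x"] by simp
    qed
  qed (use lim in auto)
  then have conv: "(\<lambda>i. LINT x|lborel. norm (s i x - f x)) \<longlonglongrightarrow> 0" by simp
  show ?case
  proof (rule LIMSEQ_I)
    fix e :: real assume e: "e > 0"
    obtain i where i: "(LINT x|lborel. norm (s i x - f x)) < e/4"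
      using LIMSEQ_D[OF conv, of "e/4"] e by force
    have i': "(LINT x|lborel. norm (s i (x - a) - f (x - a))) < e/4" for a
      using integral_translate[of "\<lambda>x. norm (s i x - f x)" "-a"] i by simp
    from LIMSEQ_D[OF lim.IH[of i], of "e/4"] e
    obtain N where N: "\<And>n. n \<ge> N \<Longrightarrow> (LINT x|lborel. norm (s i (x - z n) - s i x)) < e/4" by force
    have "(LINT x|lborel. norm (f (x - z n) - f x)) < e" if "n \<ge> N" for n
    proof -
      have "(LINT x|lborel. norm (f (x - z n) - f x)) \<le> (LINT x|lborel. norm (s i (x - z n) - f (x - z n)) + (norm (s i (x - z n) - s i x) + norm (s i x - f x)))"
      proof (rule integral_mono)
        fix x show "norm (f (x - z n) - f x) \<le> norm (s i (x - z n) - f (x - z n)) + (norm (s i (x - z n) - s i x) + norm (s i x - f x))"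
          by (smt (verit) norm_triangle_ineq4 norm_triangle_ineq diff_add_cancel norm_minus_commute add_diff_eq)
      qed (intro integrable_norm Bochner_Integration.integrable_add Bochner_Integration.integrable_diff f' lim)+
      also have "\<dots> = (LINT x|lborel. norm (s i (x - z n) - f (x - z n))) + ((LINT x|lborel. norm (s i (x - z n) - s i x)) + (LINT x|lborel. norm (s i x - f x)))"
        by (simp add: Bochner_Integration.integral_add integrable_norm Bochner_Integration.integrable_add Bochner_Integration.integrable_diff f' lim)
      also have "\<dots> < e" using i i'[of "z n"] N[OF that] e by linarith
      finally show ?thesis .
    qed
    then show "\<exists>no. \<forall>n\<ge>no. norm ((LINT x|lborel. norm (f (x - z n) - f x)) - 0) < e"
      by (intro exI[of _ N]) auto
  qed
qed

section \<open>Square integrable functions and strong convergence\<close>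

definition L2 :: "('a::euclidean_space \<Rightarrow> 'b::euclidean_space) \<Rightarrow> bool" where
  "L2 f \<longleftrightarrow> f \<in> borel_measurable borel \<and> integrable lborel (\<lambda>x. (norm (f x))\<^sup>2)"

lemma L2_measurable[measurable_dest]: "L2 f \<Longrightarrow> f \<in> borel_measurable borel"
  and L2_integrable: "L2 f \<Longrightarrow> integrable lborel (\<lambda>x. (norm (f x))\<^sup>2)"
  by (simp_all add: L2_def)

lemma L2_bound:
  assumes "L2 f" "g \<in> borel_measurable borel" "\<And>x. norm (g x) \<le> K * norm (f x)"
  shows "L2 g"
  unfolding L2_def
proof
  show "integrable lborel (\<lambda>x. (norm (g x))\<^sup>2)"
  proof (rule Bochner_Integration.integrable_bound)
    show "integrable lborel (\<lambda>x. K\<^sup>2 * (norm (f x))\<^sup>2)" using assms(1) by (simp add: L2_def)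
    show "AE x in lborel. norm ((norm (g x))\<^sup>2) \<le> norm (K\<^sup>2 * (norm (f x))\<^sup>2)"
      using power_mono[OF assms(3) norm_ge_zero, of _ 2] by (auto simp: power_mult_distrib)
  qed (use assms(2) in measurable)
qed fact

lemma L2_add:
  assumes f: "L2 f" and g: "L2 g" shows "L2 (\<lambda>x. f x + g x)"
  unfolding L2_def
proof
  note [measurable] = L2_measurable[OF f] L2_measurable[OF g]
  show "(\<lambda>x. f x + g x) \<in> borel_measurable borel" by measurable
  show "integrable lborel (\<lambda>x. (norm (f x + g x))\<^sup>2)"
  proof (rule Bochner_Integration.integrable_bound)
    show "integrable lborel (\<lambda>x. 2 * (norm (f x))\<^sup>2 + 2 * (norm (g x))\<^sup>2)"
      using assms by (simp add: L2_def)
    have "(norm (f x + g x))\<^sup>2 \<le> 2 * (norm (f x))\<^sup>2 + 2 * (norm (g x))\<^sup>2" for x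
      using power_mono[OF norm_triangle_ineq norm_ge_zero, of "f x" "g x" 2] sum_squares_bound[of "norm (f x)" "norm (g x)"]
      by (simp add: power2_sum)
    then show "AE x in lborel. norm ((norm (f x + g x))\<^sup>2) \<le> norm (2 * (norm (f x))\<^sup>2 + 2 * (norm (g x))\<^sup>2)"
      by auto
  qed measurable
qed

lemma L2_scaleR: "L2 f \<Longrightarrow> L2 (\<lambda>x. c *\<^sub>R f x)"
  by (rule L2_bound[where K="\<bar>c\<bar>"]) (auto simp: L2_def)

lemma L2_cmult: "L2 (f::_ \<Rightarrow> real) \<Longrightarrow> L2 (\<lambda>x. c * f x)"
  using L2_scaleR[of f c] by simp

lemma L2_minus: "L2 f \<Longrightarrow> L2 (\<lambda>x. - f x)"
  using L2_scaleR[of f "-1"] by simp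

lemma L2_diff: "L2 f \<Longrightarrow> L2 g \<Longrightarrow> L2 (\<lambda>x. f x - g x)"
  using L2_add[of f "\<lambda>x. - g x"] L2_minus[of g] by simp

lemma L2_inner_const: "L2 f \<Longrightarrow> L2 (\<lambda>x. f x \<bullet> e)"
  by (rule L2_bound[where K="norm e"]) (auto simp: L2_def Cauchy_Schwarz_ineq2 mult.commute[of "norm e"])

lemma L2_translate: 
  assumes f: "L2 f" shows "L2 (\<lambda>x. f (x - a))"
proof -
  note [measurable] = L2_measurable[OF f]
  show ?thesis
    using integrable_translate[of "\<lambda>x. (norm (f x))\<^sup>2" "-a"] f by (simp add: L2_def)
qed

lemma L2_bounded_scaleR:
  assumes "L2 f" "h \<in> borel_measurable borel" "\<And>x. \<bar>h x\<bar> \<le> K"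
  shows "L2 (\<lambda>x. h x *\<^sub>R f x)"
proof (rule L2_bound[OF assms(1)])
  note [measurable] = L2_measurable[OF assms(1)] assms(2)
  show "(\<lambda>x. h x *\<^sub>R f x) \<in> borel_measurable borel" by measurable
  show "norm (h x *\<^sub>R f x) \<le> K * norm (f x)" for x
    using mult_right_mono[OF assms(3) norm_ge_zero] by simp
qed

lemma L2_integrable_norm_mult:
  assumes f: "L2 f" and g: "L2 g" shows "integrable lborel (\<lambda>x. norm (f x) * norm (g x))"
proof (rule Bochner_Integration.integrable_bound)
  note [measurable] = L2_measurable[OF f] L2_measurable[OF g]
  show "integrable lborel (\<lambda>x. (norm (f x))\<^sup>2 + (norm (g x))\<^sup>2)"
    using assms by (simp add: L2_def)
  have "norm (f x) * norm (g x) \<le> (norm (f x))\<^sup>2 + (norm (g x))\<^sup>2" for x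
    using sum_squares_bound[of "norm (f x)" "norm (g x)"] mult_nonneg_nonneg[OF norm_ge_zero norm_ge_zero, of "f x" "g x"]
    by linarith
  then show "AE x in lborel. norm (norm (f x) * norm (g x)) \<le> norm ((norm (f x))\<^sup>2 + (norm (g x))\<^sup>2)"
    by auto
qed (use assms in \<open>measurable\<close>)

lemma L2_integrable_inner:
  assumes f: "L2 f" and g: "L2 g" shows "integrable lborel (\<lambda>x. f x \<bullet> g x)"
proof (rule Bochner_Integration.integrable_bound[OF L2_integrable_norm_mult[OF assms]])
  note [measurable] = L2_measurable[OF f] L2_measurable[OF g]
  show "(\<lambda>x. f x \<bullet> g x) \<in> borel_measurable lborel" by measurable
qed (simp add: Cauchy_Schwarz_ineq2)

lemma L2_integrable_mult:
  assumes "L2 f" "L2 g" shows "integrable lborel (\<lambda>x. f x * g x :: real)"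
  using L2_integrable_inner[OF assms] by simp

lemma L2_nn:
  assumes "L2 f" shows "(\<integral>\<^sup>+x. ennreal ((norm (f x))\<^sup>2) \<partial>lborel) = ennreal (LINT x|lborel. (norm (f x))\<^sup>2)"
  by (intro nn_integral_eq_integral) (use assms in \<open>auto simp: L2_def\<close>)

lemma L2_I_nn:
  assumes "f \<in> borel_measurable borel" "(\<integral>\<^sup>+x. ennreal ((norm (f x))\<^sup>2) \<partial>lborel) < \<infinity>"
  shows "L2 f"
  using assms by (auto simp: L2_def intro!: integrableI_nonneg)

lemma L2_Cauchy_Schwarz:
  assumes f: "L2 f" and g: "L2 g"
  shows "\<bar>LINT x|lborel. f x \<bullet> g x\<bar> \<le> sqrt (LINT x|lborel. (norm (f x))\<^sup>2) * sqrt (LINT x|lborel. (norm (g x))\<^sup>2)"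
proof -
  note [measurable] = L2_measurable[OF f] L2_measurable[OF g]
  let ?I = "LINT x|lborel. norm (f x) * norm (g x)"
  have I: "0 \<le> ?I" by (intro integral_nonneg_AE) auto
  have "(ennreal ?I)\<^sup>2 = (\<integral>\<^sup>+x. ennreal (norm (f x)) * ennreal (norm (g x)) \<partial>lborel)\<^sup>2"
    by (subst nn_integral_eq_integral[symmetric]) (auto intro!: L2_integrable_norm_mult f g simp: ennreal_mult)
  also have "\<dots> \<le> (\<integral>\<^sup>+x. ennreal (norm (f x)) ^ 2 \<partial>lborel) * (\<integral>\<^sup>+x. ennreal (norm (g x)) ^ 2 \<partial>lborel)"
    by (rule Cauchy_Schwarz_nn_integral) measurable
  also have "\<dots> = ennreal ((LINT x|lborel. (norm (f x))\<^sup>2) * (LINT x|lborel. (norm (g x))\<^sup>2))"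
    by (simp add: ennreal_power L2_nn[OF f] L2_nn[OF g] ennreal_mult'[symmetric])
  finally have "?I\<^sup>2 \<le> (LINT x|lborel. (norm (f x))\<^sup>2) * (LINT x|lborel. (norm (g x))\<^sup>2)"
    using I by (subst (asm) ennreal_power) (auto simp: ennreal_le_iff)
  then have "?I \<le> sqrt ((LINT x|lborel. (norm (f x))\<^sup>2) * (LINT x|lborel. (norm (g x))\<^sup>2))"
    by (rule real_le_rsqrt)
  moreover have "\<bar>LINT x|lborel. f x \<bullet> g x\<bar> \<le> ?I"
    using integral_norm_bound[of lborel "\<lambda>x. f x \<bullet> g x"]
    unfolding real_norm_def
    by (rule order_trans)
       (auto intro!: integral_mono L2_integrable_norm_mult integrable_abs L2_integrable_inner f g Cauchy_Schwarz_ineq2)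
  ultimately show ?thesis by (simp add: real_sqrt_mult)
qed

text \<open>Membership of the sequence and of the limit is part of the notion, since a divergent
  Bochner integral has the default value 0 and would make the convergence meaningless.\<close>

definition L2_tendsto :: "(nat \<Rightarrow> 'a::euclidean_space \<Rightarrow> 'b::euclidean_space) \<Rightarrow> ('a \<Rightarrow> 'b) \<Rightarrow> bool" where
  "L2_tendsto f g \<longleftrightarrow> (\<forall>n. L2 (f n)) \<and> L2 g \<and> (\<lambda>n. LINT x|lborel. (norm (f n x - g x))\<^sup>2) \<longlonglongrightarrow> 0"

lemma L2_tendstoD: "L2_tendsto f g \<Longrightarrow> L2 (f n)" "L2_tendsto f g \<Longrightarrow> L2 g"
  "L2_tendsto f g \<Longrightarrow> (\<lambda>n. LINT x|lborel. (norm (f n x - g x))\<^sup>2) \<longlonglongrightarrow> 0"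
  by (auto simp: L2_tendsto_def)

lemma tendsto_0_le_cmult:
  fixes f g :: "nat \<Rightarrow> real"
  assumes "\<And>n. 0 \<le> f n" "\<And>n. f n \<le> K * g n" "g \<longlonglongrightarrow> 0"
  shows "f \<longlonglongrightarrow> 0"
  using tendsto_sandwich[of "\<lambda>_. 0" f sequentially "\<lambda>n. K * g n" 0] assms(1,2) tendsto_mult[OF tendsto_const[of K] assms(3)]
  by auto

lemma L2_tendsto_const: "L2 f \<Longrightarrow> L2_tendsto (\<lambda>n. f) f"
  by (simp add: L2_tendsto_def)

text \<open>Carries L2 convergence through maps that are Lipschitz pointwise: absolute values,
  Lipschitz compositions and bounded fields all enter through it.\<close>

lemma L2_tendsto_bound:
  assumes g: "\<And>n. L2 (g n)" "L2 h" and f: "L2_tendsto f f0"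
    and b: "\<And>n x. norm (g n x - h x) \<le> K * norm (f n x - f0 x)"
  shows "L2_tendsto g h"
  unfolding L2_tendsto_def
proof (intro conjI allI g)
  have i: "integrable lborel (\<lambda>x. (norm (f n x - f0 x))\<^sup>2)" "integrable lborel (\<lambda>x. (norm (g n x - h x))\<^sup>2)" for n
    using L2_diff[OF L2_tendstoD(1)[OF f, of n] L2_tendstoD(2)[OF f]] L2_diff[OF g(1)[of n] g(2)] by (auto simp: L2_def)
  have "(LINT x|lborel. (norm (g n x - h x))\<^sup>2) \<le> (LINT x|lborel. K\<^sup>2 * (norm (f n x - f0 x))\<^sup>2)" for n
    using power_mono[OF b norm_ge_zero, of _ _ 2] i by (intro integral_mono) (auto simp: power_mult_distrib)
  then have le: "(LINT x|lborel. (norm (g n x - h x))\<^sup>2) \<le> K\<^sup>2 * (LINT x|lborel. (norm (f n x - f0 x))\<^sup>2)" for n by simp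
  show "(\<lambda>n. LINT x|lborel. (norm (g n x - h x))\<^sup>2) \<longlonglongrightarrow> 0"
    using tendsto_0_le_cmult[OF _ le L2_tendstoD(3)[OF f]] by simp
qed

lemma L2_tendsto_inner_const: "L2_tendsto f g \<Longrightarrow> L2_tendsto (\<lambda>n x. f n x \<bullet> e) (\<lambda>x. g x \<bullet> e)"
  by (rule L2_tendsto_bound[where K="norm e"])
     (auto intro: L2_inner_const dest: L2_tendstoD simp: inner_diff_left[symmetric] Cauchy_Schwarz_ineq2 mult.commute[of "norm e"])

lemma L2_tendsto_bounded_scaleR:
  assumes "L2_tendsto f g" "h \<in> borel_measurable borel" "\<And>x. \<bar>h x\<bar> \<le> K"
  shows "L2_tendsto (\<lambda>n x. h x *\<^sub>R f n x) (\<lambda>x. h x *\<^sub>R g x)"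
proof (rule L2_tendsto_bound[OF _ _ assms(1)])
  show "norm (h x *\<^sub>R f n x - h x *\<^sub>R g x) \<le> K * norm (f n x - g x)" for n x
    using mult_right_mono[OF assms(3) norm_ge_zero] by (simp flip: scaleR_diff_right)
qed (rule L2_bounded_scaleR[OF _ assms(2,3)], rule L2_tendstoD[OF assms(1)])+

lemma L2_tendsto_trans:
  assumes f: "L2_tendsto f g" and h: "\<And>n. L2 (h n)" and "(\<lambda>n. LINT x|lborel. (norm (h n x - f n x))\<^sup>2) \<longlonglongrightarrow> 0"
  shows "L2_tendsto h g"
  unfolding L2_tendsto_def
proof (intro conjI allI h L2_tendstoD[OF f])
  have i: "integrable lborel (\<lambda>x. (norm (f n x - g x))\<^sup>2)" "integrable lborel (\<lambda>x. (norm (h n x - f n x))\<^sup>2)" 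
     "integrable lborel (\<lambda>x. (norm (h n x - g x))\<^sup>2)" for n
    using L2_diff[OF L2_tendstoD(1)[OF f, of n] L2_tendstoD(2)[OF f]] L2_diff[OF h[of n] L2_tendstoD(1)[OF f, of n]]
       L2_diff[OF h[of n] L2_tendstoD(2)[OF f]] by (auto simp: L2_def)
  have pt: "(norm (a - c))\<^sup>2 \<le> 2 * (norm (a - b))\<^sup>2 + 2 * (norm (b - c))\<^sup>2" for a b c :: 'b
    using power_mono[OF norm_triangle_ineq norm_ge_zero, of "a - b" "b - c" 2] sum_squares_bound[of "norm (a - b)" "norm (b - c)"]
    by (simp add: power2_sum)
  have "(LINT x|lborel. (norm (h n x - g x))\<^sup>2) \<le> (LINT x|lborel. 2 * (norm (h n x - f n x))\<^sup>2 + 2 * (norm (f n x - g x))\<^sup>2)" for n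
    using i pt by (intro integral_mono) auto
  then have le: "(LINT x|lborel. (norm (h n x - g x))\<^sup>2) \<le> 2 * (LINT x|lborel. (norm (h n x - f n x))\<^sup>2) + 2 * (LINT x|lborel. (norm (f n x - g x))\<^sup>2)" for n
    using i by simp
  have lim: "(\<lambda>n. 2 * (LINT x|lborel. (norm (h n x - f n x))\<^sup>2) + 2 * (LINT x|lborel. (norm (f n x - g x))\<^sup>2)) \<longlonglongrightarrow> 2 * 0 + 2 * 0"
    by (intro tendsto_intros assms(3) L2_tendstoD(3)[OF f])
  show "(\<lambda>n. LINT x|lborel. (norm (h n x - g x))\<^sup>2) \<longlonglongrightarrow> 0"
    by (rule tendsto_sandwich[OF _ _ tendsto_const]) (use le lim in \<open>auto intro: always_eventually\<close>)
qed

lemma L2_tendsto_norm: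
  assumes f: "L2_tendsto f g"
  shows "(\<lambda>n. LINT x|lborel. (norm (f n x))\<^sup>2) \<longlonglongrightarrow> (LINT x|lborel. (norm (g x))\<^sup>2)"
proof -
  note L = L2_tendstoD[OF f]
  let ?d = "\<lambda>n x. f n x - g x" and ?N = "\<lambda>f. LINT x|lborel. (norm (f x))\<^sup>2"
  have Ld: "L2 (?d n)" for n using L by (intro L2_diff)
  have eq: "?N (f n) = ?N (?d n) + 2 * (LINT x|lborel. ?d n x \<bullet> g x) + ?N g" for n
  proof -
    have "(norm (f n x))\<^sup>2 = (norm (?d n x))\<^sup>2 + 2 * (?d n x \<bullet> g x) + (norm (g x))\<^sup>2" for x
      by (simp add: power2_norm_eq_inner algebra_simps inner_commute)
    then show ?thesis
      using L2_integrable[OF Ld, of n] L2_integrable[OF L(2)] L2_integrable_inner[OF Ld L(2), of n]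
      by (simp add: Bochner_Integration.integral_add)
  qed
  have "(\<lambda>n. LINT x|lborel. ?d n x \<bullet> g x) \<longlonglongrightarrow> 0"
  proof (rule Lim_null_comparison)
    show "\<forall>\<^sub>F n in sequentially. norm (LINT x|lborel. ?d n x \<bullet> g x) \<le> sqrt (?N (?d n)) * sqrt (?N g)"
      using L2_Cauchy_Schwarz[OF Ld L(2)] by auto
    show "(\<lambda>n. sqrt (?N (?d n)) * sqrt (?N g)) \<longlonglongrightarrow> 0"
      using tendsto_mult[OF tendsto_real_sqrt[OF L(3)] tendsto_const[of "sqrt (?N g)"]] by simp
  qed
  then have "(\<lambda>n. ?N (?d n) + 2 * (LINT x|lborel. ?d n x \<bullet> g x) + ?N g) \<longlonglongrightarrow> 0 + 2 * 0 + ?N g"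
    by (intro tendsto_intros L(3))
  then show ?thesis using eq by simp
qed

text \<open>Writes <f_n, g_n> - <f0, g0> as <f_n - f0, g_n> + <g_n - g0, f0>; the norms of g_n stay
  bounded because they converge.\<close>

lemma L2_tendsto_inner:
  assumes f: "L2_tendsto f f0" and g: "L2_tendsto g g0"
  shows "(\<lambda>n. LINT x|lborel. f n x \<bullet> g n x) \<longlonglongrightarrow> (LINT x|lborel. f0 x \<bullet> g0 x)"
proof -
  note Lf = L2_tendstoD[OF f] and Lg = L2_tendstoD[OF g]
  let ?d = "\<lambda>n x. f n x - f0 x" and ?e = "\<lambda>n x. g n x - g0 x" and ?N = "\<lambda>f. LINT x|lborel. (norm (f x))\<^sup>2"
  have Ld: "L2 (?d n)" and Le: "L2 (?e n)" for n using Lf Lg by (auto intro!: L2_diff)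
  have eq: "(LINT x|lborel. f n x \<bullet> g n x) - (LINT x|lborel. f0 x \<bullet> g0 x) = (LINT x|lborel. ?d n x \<bullet> g n x) + (LINT x|lborel. ?e n x \<bullet> f0 x)" for n
  proof -
    have "f n x \<bullet> g n x = (f0 x \<bullet> g0 x) + ((?d n x \<bullet> g n x) + (?e n x \<bullet> f0 x))" for x
      by (simp add: algebra_simps inner_commute)
    then show ?thesis
      using L2_integrable_inner[OF Ld Lg(1), of n n] L2_integrable_inner[OF Le Lf(2), of n] L2_integrable_inner[OF Lf(2) Lg(2)]
      by (simp add: Bochner_Integration.integral_add)
  qed
  have "(\<lambda>n. (LINT x|lborel. ?d n x \<bullet> g n x) + (LINT x|lborel. ?e n x \<bullet> f0 x)) \<longlonglongrightarrow> 0"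
  proof (rule Lim_null_comparison)
    show "\<forall>\<^sub>F n in sequentially. norm ((LINT x|lborel. ?d n x \<bullet> g n x) + (LINT x|lborel. ?e n x \<bullet> f0 x))
         \<le> sqrt (?N (?d n)) * sqrt (?N (g n)) + sqrt (?N (?e n)) * sqrt (?N f0)"
    proof (intro always_eventually allI)
      fix n
      show "norm ((LINT x|lborel. ?d n x \<bullet> g n x) + (LINT x|lborel. ?e n x \<bullet> f0 x)) \<le> sqrt (?N (?d n)) * sqrt (?N (g n)) + sqrt (?N (?e n)) * sqrt (?N f0)"
        using L2_Cauchy_Schwarz[OF Ld Lg(1), of n n] L2_Cauchy_Schwarz[OF Le Lf(2), of n] unfolding real_norm_def by linarith
    qed
    have "(\<lambda>n. sqrt (?N (?d n)) * sqrt (?N (g n)) + sqrt (?N (?e n)) * sqrt (?N f0)) \<longlonglongrightarrow> sqrt 0 * sqrt (?N g0) + sqrt 0 * sqrt (?N f0)"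
      by (intro tendsto_intros Lf(3) Lg(3) L2_tendsto_norm[OF g])
    then show "(\<lambda>n. sqrt (?N (?d n)) * sqrt (?N (g n)) + sqrt (?N (?e n)) * sqrt (?N f0)) \<longlonglongrightarrow> 0" by simp
  qed
  then show ?thesis unfolding eq[symmetric] by (rule LIM_zero_cancel)
qed

lemma L2_tendsto_mult:
  assumes "L2_tendsto f f0" "L2_tendsto g g0"
  shows "(\<lambda>n. LINT x|lborel. f n x * g n x :: real) \<longlonglongrightarrow> (LINT x|lborel. f0 x * g0 x)"
  using L2_tendsto_inner[OF assms] by simp

text \<open>The map \<open>w \<mapsto> |w| w\<close> sends \<open>L\<^sup>2\<close> to \<open>L\<^sup>1\<close>, so this reduces continuity of translations in \<open>L\<^sup>2\<close> to the \<open>L\<^sup>1\<close> case.\<close>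

lemma norm_diff_signed_square:
  fixes a b :: "'a::real_inner"
  shows "(norm (a - b))\<^sup>2 \<le> 2 * norm (norm a *\<^sub>R a - norm b *\<^sub>R b)"
proof (cases "a = b")
  case False
  let ?A = "norm a" and ?B = "norm b" and ?D = "norm (a - b)"
  have D: "?D\<^sup>2 = ?A\<^sup>2 + ?B\<^sup>2 - 2 * (a \<bullet> b)"
    by (simp add: power2_norm_eq_inner inner_diff_left inner_diff_right inner_commute)
  \<comment> \<open>The signed square is monotone with a quantitative gain: its increment paired
    with a - b, doubled, equals (|a|+|b|) ((|a|-|b|)^2 + |a-b|^2), and |a|+|b| >= |a-b|.\<close>
  have "2 * ((?A *\<^sub>R a - ?B *\<^sub>R b) \<bullet> (a - b)) = 2 * ?A * ?A\<^sup>2 + 2 * ?B * ?B\<^sup>2 - (?A + ?B) * (2 * (a \<bullet> b))"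
    by (simp add: inner_diff_left inner_diff_right power2_norm_eq_inner inner_commute algebra_simps)
  also have "2 * (a \<bullet> b) = ?A\<^sup>2 + ?B\<^sup>2 - ?D\<^sup>2" using D by simp
  also have "2 * ?A * ?A\<^sup>2 + 2 * ?B * ?B\<^sup>2 - (?A + ?B) * (?A\<^sup>2 + ?B\<^sup>2 - ?D\<^sup>2) = (?A + ?B) * (?A - ?B)\<^sup>2 + (?A + ?B) * ?D\<^sup>2"
    by (simp add: power2_eq_square algebra_simps)
  also have "\<dots> \<ge> (?A + ?B) * ?D\<^sup>2" by simp
  also have "(?A + ?B) * ?D\<^sup>2 \<ge> ?D * ?D\<^sup>2" by (intro mult_right_mono norm_triangle_ineq4) auto
  finally have "?D * ?D\<^sup>2 \<le> 2 * ((?A *\<^sub>R a - ?B *\<^sub>R b) \<bullet> (a - b))" .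
  also have "\<dots> \<le> 2 * (norm (?A *\<^sub>R a - ?B *\<^sub>R b) * ?D)" by (intro mult_left_mono norm_cauchy_schwarz) auto
  finally have "?D * ?D\<^sup>2 \<le> ?D * (2 * norm (?A *\<^sub>R a - ?B *\<^sub>R b))" by (simp add: mult_ac)
  then show ?thesis using False by (subst (asm) mult_le_cancel_left_pos) auto
qed simp

theorem L2_translation_continuous:
  fixes w :: "'a::euclidean_space \<Rightarrow> 'b::euclidean_space"
  assumes w: "L2 w" and z: "z \<longlonglongrightarrow> 0"
  shows "(\<lambda>n. LINT x|lborel. (norm (w (x - z n) - w x))\<^sup>2) \<longlonglongrightarrow> 0"
proof -
  note [measurable] = L2_measurable[OF w]
  let ?s = "\<lambda>x. norm (w x) *\<^sub>R w x"
  have s: "integrable lborel ?s"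
    using L2_integrable[OF w] by (rule Bochner_Integration.integrable_bound) (auto simp: power2_eq_square)
  have s': "integrable lborel (\<lambda>x. ?s (x - a))" for a
    using integrable_translate[of ?s "-a"] s by simp
  have "(LINT x|lborel. (norm (w (x - z n) - w x))\<^sup>2) \<le> (LINT x|lborel. 2 * norm (?s (x - z n) - ?s x))" for n
    by (intro integral_mono L2_integrable L2_diff L2_translate w norm_diff_signed_square integrable_mult_right
          integrable_norm Bochner_Integration.integrable_diff s s')
  then have le: "(LINT x|lborel. (norm (w (x - z n) - w x))\<^sup>2) \<le> 2 * (LINT x|lborel. norm (?s (x - z n) - ?s x))" for n
    by simp
  show ?thesis
    using tendsto_0_le_cmult[OF _ le L1_translation_continuous[OF s z]] by simp
qed

section \<open>Convolution and mollification\<close>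

definition conv :: "('a::euclidean_space \<Rightarrow> real) \<Rightarrow> ('a \<Rightarrow> 'b::euclidean_space) \<Rightarrow> 'a \<Rightarrow> 'b" where
  "conv k w x = (LINT y|lborel. k (x - y) *\<^sub>R w y)"

lemma conv_measurable[measurable (raw)]:
  assumes [measurable]: "k \<in> borel_measurable borel" "w \<in> borel_measurable borel"
  shows "conv k w \<in> borel_measurable borel"
  unfolding conv_def[abs_def] by measurable

lemma conv_reflect:
  assumes [measurable]: "k \<in> borel_measurable borel" "w \<in> borel_measurable borel"
  shows "conv k w x = (LINT z|lborel. k z *\<^sub>R w (x - z))"
  using integral_reflect[of "\<lambda>y. k (x - y) *\<^sub>R w y" x] by (simp add: conv_def)

lemma conv_diff_const:
  assumes [measurable]: "w \<in> borel_measurable borel" and k: "integrable lborel k"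
    and fin: "(\<integral>\<^sup>+z. ennreal (\<bar>k z\<bar> * norm (w (x - z) - c)) \<partial>lborel) < \<infinity>"
  shows "ennreal (norm (conv k w x - (LINT z|lborel. k z) *\<^sub>R c)) \<le> (\<integral>\<^sup>+z. ennreal (\<bar>k z\<bar> * norm (w (x - z) - c)) \<partial>lborel)"
proof -
  have [measurable]: "k \<in> borel_measurable borel" using k by auto
  have i1: "integrable lborel (\<lambda>z. k z *\<^sub>R (w (x - z) - c))"
    using fin by (intro integrableI_bounded) auto
  have i2: "integrable lborel (\<lambda>z. k z *\<^sub>R c)" using k by simp
  have i3: "integrable lborel (\<lambda>z. k z *\<^sub>R w (x - z))"
    using Bochner_Integration.integrable_add[OF i1 i2] by (simp add: algebra_simps)
  have "conv k w x - (LINT z|lborel. k z) *\<^sub>R c = (LINT z|lborel. k z *\<^sub>R (w (x - z) - c))"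
    using i2 i3 k by (simp add: conv_reflect scaleR_diff_right Bochner_Integration.integral_diff)
  also have "ennreal (norm \<dots>) \<le> (\<integral>\<^sup>+z. ennreal (norm (k z *\<^sub>R (w (x - z) - c))) \<partial>lborel)"
    by (rule integral_norm_bound_ennreal[OF i1])
  finally show ?thesis by simp
qed

text \<open>Cauchy-Schwarz for the measure with density |k|. The free constant c gives the estimate
  two uses: c = 0 yields Young's inequality, c = \<open>w x\<close> the convergence of approximate
  identities.\<close>

lemma conv_diff_const_square:
  assumes [measurable]: "w \<in> borel_measurable borel" and k: "integrable lborel k"
  shows "ennreal ((norm (conv k w x - (LINT z|lborel. k z) *\<^sub>R c))\<^sup>2)
    \<le> ennreal (LINT z|lborel. \<bar>k z\<bar>) * (\<integral>\<^sup>+z. ennreal (\<bar>k z\<bar> * (norm (w (x - z) - c))\<^sup>2) \<partial>lborel)"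
proof -
  have [measurable]: "k \<in> borel_measurable borel" using k by auto
  let ?I = "\<integral>\<^sup>+z. ennreal (\<bar>k z\<bar> * norm (w (x - z) - c)) \<partial>lborel"
  let ?R = "ennreal (LINT z|lborel. \<bar>k z\<bar>) * (\<integral>\<^sup>+z. ennreal (\<bar>k z\<bar> * (norm (w (x - z) - c))\<^sup>2) \<partial>lborel)"
  have "?I = (\<integral>\<^sup>+z. ennreal (sqrt \<bar>k z\<bar>) * ennreal (sqrt \<bar>k z\<bar> * norm (w (x - z) - c)) \<partial>lborel)"
    by (intro nn_integral_cong) (simp add: ennreal_mult''[symmetric] mult.assoc[symmetric])
  then have "?I\<^sup>2 \<le> (\<integral>\<^sup>+z. (ennreal (sqrt \<bar>k z\<bar>))\<^sup>2 \<partial>lborel) * (\<integral>\<^sup>+z. (ennreal (sqrt \<bar>k z\<bar> * norm (w (x - z) - c)))\<^sup>2 \<partial>lborel)"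
    by (simp only:) (rule Cauchy_Schwarz_nn_integral; measurable)
  also have "(\<integral>\<^sup>+z. (ennreal (sqrt \<bar>k z\<bar>))\<^sup>2 \<partial>lborel) = ennreal (LINT z|lborel. \<bar>k z\<bar>)"
    using k by (simp add: ennreal_power nn_integral_eq_integral)
  also have "(\<integral>\<^sup>+z. (ennreal (sqrt \<bar>k z\<bar> * norm (w (x - z) - c)))\<^sup>2 \<partial>lborel) = (\<integral>\<^sup>+z. ennreal (\<bar>k z\<bar> * (norm (w (x - z) - c))\<^sup>2) \<partial>lborel)"
    by (simp add: ennreal_power power_mult_distrib)
  finally have CS: "?I\<^sup>2 \<le> ?R" .
  show ?thesis
  proof (cases "?I < \<infinity>")
    case True
    have "ennreal ((norm (conv k w x - (LINT z|lborel. k z) *\<^sub>R c))\<^sup>2) \<le> ?I\<^sup>2"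
      using power_mono[OF conv_diff_const[OF assms True], of 2] by (simp add: ennreal_power)
    with CS show ?thesis by (rule order_trans[rotated])
  next
    \<comment> \<open>Here the convolution integral may diverge and take its default value; the
      estimate survives because by \<open>CS\<close> the right-hand side is then infinite.\<close>
    case False
    then have "?I\<^sup>2 = top" by (auto simp: less_top[symmetric] power2_eq_square)
    with CS have "top \<le> ?R" by (simp only:)
    then show ?thesis by (simp add: top_unique)
  qed
qed

lemma Young_L2:
  fixes w :: "'a::euclidean_space \<Rightarrow> 'b::euclidean_space"
  assumes w: "L2 w" and k: "integrable lborel k"
  shows "L2 (conv k w)"
    and "(LINT x|lborel. (norm (conv k w x))\<^sup>2) \<le> (LINT z|lborel. \<bar>k z\<bar>)\<^sup>2 * (LINT x|lborel. (norm (w x))\<^sup>2)"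
proof -
  note [measurable] = L2_measurable[OF w]
  have [measurable]: "k \<in> borel_measurable borel" using k by auto
  let ?K = "LINT z|lborel. \<bar>k z\<bar>" and ?W = "LINT x|lborel. (norm (w x))\<^sup>2"
  have K: "?K \<ge> 0" and W: "?W \<ge> 0" by auto
  have "(\<integral>\<^sup>+x. ennreal ((norm (conv k w x))\<^sup>2) \<partial>lborel)
     \<le> (\<integral>\<^sup>+x. ennreal ?K * (\<integral>\<^sup>+z. ennreal (\<bar>k z\<bar> * (norm (w (x - z)))\<^sup>2) \<partial>lborel) \<partial>lborel)"
    using conv_diff_const_square[OF _ k, of w _ 0] by (intro nn_integral_mono) auto
  also have "\<dots> = ennreal ?K * (\<integral>\<^sup>+x. (\<integral>\<^sup>+z. ennreal (\<bar>k z\<bar> * (norm (w (x - z)))\<^sup>2) \<partial>lborel) \<partial>lborel)"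
    by (rule nn_integral_cmult) measurable
  also have "(\<integral>\<^sup>+x. (\<integral>\<^sup>+z. ennreal (\<bar>k z\<bar> * (norm (w (x - z)))\<^sup>2) \<partial>lborel) \<partial>lborel)
      = (\<integral>\<^sup>+z. (\<integral>\<^sup>+x. ennreal (\<bar>k z\<bar> * (norm (w (x - z)))\<^sup>2) \<partial>lborel) \<partial>lborel)"
    by (rule lborel_pair.Fubini') measurable
  also have "\<dots> = (\<integral>\<^sup>+z. ennreal \<bar>k z\<bar> * ennreal ?W \<partial>lborel)"
  proof (intro nn_integral_cong)
    fix z
    have "(\<integral>\<^sup>+x. ennreal (\<bar>k z\<bar> * (norm (w (x - z)))\<^sup>2) \<partial>lborel) = ennreal \<bar>k z\<bar> * (\<integral>\<^sup>+x. ennreal ((norm (w (x + - z)))\<^sup>2) \<partial>lborel)"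
      by (simp add: ennreal_mult nn_integral_cmult)
    also have "(\<integral>\<^sup>+x. ennreal ((norm (w (x + - z)))\<^sup>2) \<partial>lborel) = ennreal ?W"
      by (subst nn_integral_translate[of "\<lambda>x. ennreal ((norm (w x))\<^sup>2)"]) (simp_all add: L2_nn[OF w])
    finally show "(\<integral>\<^sup>+x. ennreal (\<bar>k z\<bar> * (norm (w (x - z)))\<^sup>2) \<partial>lborel) = ennreal \<bar>k z\<bar> * ennreal ?W" .
  qed
  also have "\<dots> = ennreal ?K * ennreal ?W"
    using k by (simp add: nn_integral_multc nn_integral_eq_integral)
  finally have le: "(\<integral>\<^sup>+x. ennreal ((norm (conv k w x))\<^sup>2) \<partial>lborel) \<le> ennreal (?K\<^sup>2 * ?W)"
    using K W by (simp add: ennreal_mult[symmetric] power2_eq_square mult.assoc)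
  then show L: "L2 (conv k w)"
    by (intro L2_I_nn) (auto intro: le_less_trans)
  show "(LINT x|lborel. (norm (conv k w x))\<^sup>2) \<le> ?K\<^sup>2 * ?W"
    using le K W by (simp add: L2_nn[OF L])
qed

section \<open>Approximate identities\<close>

text \<open>The mass M is kept free because two families are used: mollifiers with mass 1 and the
  regularized Riesz densities with mass 4 pi. The latter have no compact support, hence the
  condition on tails.\<close>

definition approx_id :: "(nat \<Rightarrow> 'a::euclidean_space \<Rightarrow> real) \<Rightarrow> real \<Rightarrow> bool" where
  "approx_id k M \<longleftrightarrow> (\<forall>n. (\<forall>z. 0 \<le> k n z) \<and> integrable lborel (k n) \<and> (LINT z|lborel. k n z) = M)
     \<and> (\<forall>d>0. (\<lambda>n. LINT z|lborel. k n z * indicator {z. d \<le> norm z} z) \<longlonglongrightarrow> 0)"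

text \<open>T stands for the modulus of translation of a function in L1 or L2. Near 0 it is small;
  away from 0 it is bounded and meets only the vanishing tail of the kernel.\<close>

lemma approx_id_tendsto_0:
  fixes k :: "nat \<Rightarrow> 'a::euclidean_space \<Rightarrow> real"
  assumes k: "approx_id k M" and T[measurable]: "T \<in> borel_measurable borel" and T0: "\<And>z. 0 \<le> T z" and TC: "\<And>z. T z \<le> C"
    and lim: "\<And>z. z \<longlonglongrightarrow> 0 \<Longrightarrow> (\<lambda>n. T (z n)) \<longlonglongrightarrow> 0"
  shows "(\<lambda>n. LINT z|lborel. k n z * T z) \<longlonglongrightarrow> 0"
proof (rule LIMSEQ_I)
  fix e :: real assume e: "e > 0"
  have k0: "0 \<le> k n z" and ki: "integrable lborel (k n)" and kM: "(LINT z|lborel. k n z) = M" for n z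
    using k by (auto simp: approx_id_def)
  have [measurable]: "k n \<in> borel_measurable borel" for n using ki[of n] by auto
  have M: "M \<ge> 0" using kM[of 0] k0[of 0] by (metis Bochner_Integration.integral_nonneg)
  \<comment> \<open>Dividing by M + 1 covers the case M = 0.\<close>
  define e' where "e' = e / (2 * (M + 1))"
  have e': "e' > 0" "e' * M < e / 2 + e / 4" using e M by (auto simp: e'_def field_simps intro!: add_pos_nonneg)
  have "(T \<longlongrightarrow> 0) (at 0)"
    unfolding tendsto_at_iff_sequentially using lim by (auto simp: o_def)
  then obtain d where d: "d > 0" "\<And>z. z \<noteq> 0 \<Longrightarrow> norm z < d \<Longrightarrow> T z < e'"
    using e' T0 unfolding tendsto_iff eventually_at by (force simp: dist_norm abs_less_iff)
  have "T 0 = 0" using lim[of "\<lambda>_. 0"] by (simp add: LIMSEQ_const_iff)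
  with d e' have d': "norm z < d \<Longrightarrow> T z \<le> e'" for z by (cases "z = 0") (auto intro: less_imp_le)
  have C: "C \<ge> 0" using T0[of 0] TC[of 0] by linarith
  have "(\<lambda>n. C * (LINT z|lborel. k n z * indicator {z. d \<le> norm z} z)) \<longlonglongrightarrow> C * 0"
    using k d by (intro tendsto_intros) (auto simp: approx_id_def)
  from LIMSEQ_D[OF this, of "e/4"] e obtain N where
    N: "\<And>n. n \<ge> N \<Longrightarrow> C * (LINT z|lborel. k n z * indicator {z. d \<le> norm z} z) < e/4" by force
  have "norm (LINT z|lborel. k n z * T z) < e" if "n \<ge> N" for n
  proof -
    have i1: "integrable lborel (\<lambda>z. k n z * T z)"
      by (rule Bochner_Integration.integrable_bound[where f="\<lambda>z. C * k n z"])
         (use ki[of n] T0 TC k0 C in \<open>auto intro!: mult_left_mono simp: abs_mult mult.commute[of C]\<close>)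
    have i2: "integrable lborel (\<lambda>z. k n z * indicator {z. d \<le> norm z} z)"
      using ki[of n] by (rule Bochner_Integration.integrable_bound) (auto split: split_indicator)
    have "(LINT z|lborel. k n z * T z) \<le> (LINT z|lborel. e' * k n z + C * (k n z * indicator {z. d \<le> norm z} z))"
    proof (rule integral_mono[OF i1])
      show "integrable lborel (\<lambda>z. e' * k n z + C * (k n z * indicator {z. d \<le> norm z} z))"
        using i2 ki[of n] by auto
      fix z show "k n z * T z \<le> e' * k n z + C * (k n z * indicator {z. d \<le> norm z} z)"
      proof (cases "norm z < d")
        case True
        then show ?thesis using mult_left_mono[OF d'[OF True] k0[of n z]] by (simp add: mult.commute)
      next
        case False
        have "0 \<le> e' * k n z" using e' k0 by simp
        then show ?thesis using mult_left_mono[OF TC[of z] k0[of n z]] False by (simp add: mult.commute)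
      qed
    qed
    also have "\<dots> = e' * M + C * (LINT z|lborel. k n z * indicator {z. d \<le> norm z} z)"
      using i2 ki[of n] kM[of n] by (simp add: Bochner_Integration.integral_add)
    also have "\<dots> < e" using e' N[OF that] by linarith
    finally show ?thesis using T0 k0 by (simp add: Bochner_Integration.integral_nonneg)
  qed
  then show "\<exists>no. \<forall>n\<ge>no. norm ((LINT z|lborel. k n z * T z) - 0) < e" by auto
qed

text \<open>By Tonelli the squared L2 error is at most M times the average of the squared
  translation modulus against the kernel, and that average tends to 0.\<close>

theorem approx_id_L2:
  fixes w :: "'a::euclidean_space \<Rightarrow> 'b::euclidean_space"
  assumes k: "approx_id k M" and w: "L2 w"
  shows "L2_tendsto (\<lambda>n. conv (k n) w) (\<lambda>x. M *\<^sub>R w x)"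
proof -
  note [measurable] = L2_measurable[OF w]
  have k0: "0 \<le> k n z" and ki: "integrable lborel (k n)" and kM: "(LINT z|lborel. k n z) = M" for n z
    using k by (auto simp: approx_id_def)
  have [measurable]: "k n \<in> borel_measurable borel" for n using ki[of n] by auto
  have M: "M \<ge> 0" using kM[of 0] k0[of 0] by (metis Bochner_Integration.integral_nonneg)
  define T where "T z = (LINT x|lborel. (norm (w (x - z) - w x))\<^sup>2)" for z
  have [measurable]: "T \<in> borel_measurable borel" unfolding T_def[abs_def] by measurable
  have T0: "T z \<ge> 0" for z unfolding T_def by auto
  have Td: "L2 (\<lambda>x. w (x - z) - w x)" for z by (intro L2_diff L2_translate w)
  have TC: "T z \<le> 4 * (LINT x|lborel. (norm (w x))\<^sup>2)" for z
  proof -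
    have "T z \<le> (LINT x|lborel. 2 * (norm (w (x - z)))\<^sup>2 + 2 * (norm (w x))\<^sup>2)"
      unfolding T_def
    proof (rule integral_mono)
      fix x
      show "(norm (w (x - z) - w x))\<^sup>2 \<le> 2 * (norm (w (x - z)))\<^sup>2 + 2 * (norm (w x))\<^sup>2"
        using power_mono[OF norm_triangle_ineq4 norm_ge_zero, of "w (x - z)" "w x" 2] sum_squares_bound[of "norm (w (x - z))" "norm (w x)"]
        by (simp add: power2_sum)
    qed (use L2_integrable[OF Td] L2_integrable[OF w] L2_integrable[OF L2_translate[OF w]] in auto)
    also have "\<dots> = 2 * (LINT x|lborel. (norm (w (x + - z)))\<^sup>2) + 2 * (LINT x|lborel. (norm (w x))\<^sup>2)"
      using L2_integrable[OF w] L2_integrable[OF L2_translate[OF w], of z] by simp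
    also have "\<dots> = 4 * (LINT x|lborel. (norm (w x))\<^sup>2)"
      using integral_translate[of "\<lambda>x. (norm (w x))\<^sup>2" "-z"] by simp
    finally show ?thesis .
  qed
  have lim: "(\<lambda>n. LINT z|lborel. k n z * T z) \<longlonglongrightarrow> 0"
    by (rule approx_id_tendsto_0[OF k _ T0 TC]) (use L2_translation_continuous[OF w] in \<open>auto simp: T_def\<close>)
  have L: "L2 (conv (k n) w)" for n by (rule Young_L2[OF w ki])
  have le: "(LINT x|lborel. (norm (conv (k n) w x - M *\<^sub>R w x))\<^sup>2) \<le> M * (LINT z|lborel. k n z * T z)" for n
  proof -
    have abs: "(LINT z|lborel. \<bar>k n z\<bar>) = M" using k0 kM by simp
    have iT: "integrable lborel (\<lambda>z. k n z * T z)"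
      by (rule Bochner_Integration.integrable_bound[where f="\<lambda>z. (4 * (LINT x|lborel. (norm (w x))\<^sup>2)) * k n z"])
         (use ki[of n] T0 TC k0 in \<open>auto simp: abs_mult mult.commute[of "k n _"] intro!: mult_right_mono\<close>)
    have "ennreal (LINT x|lborel. (norm (conv (k n) w x - M *\<^sub>R w x))\<^sup>2) = (\<integral>\<^sup>+x. ennreal ((norm (conv (k n) w x - M *\<^sub>R w x))\<^sup>2) \<partial>lborel)"
      by (rule L2_nn[OF L2_diff[OF L L2_scaleR[OF w]], symmetric])
    also have "\<dots> \<le> (\<integral>\<^sup>+x. ennreal M * (\<integral>\<^sup>+z. ennreal (k n z * (norm (w (x - z) - w x))\<^sup>2) \<partial>lborel) \<partial>lborel)"
      using conv_diff_const_square[OF _ ki[of n], of w] k0 by (intro nn_integral_mono) (simp add: abs kM)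
    also have "\<dots> = ennreal M * (\<integral>\<^sup>+x. (\<integral>\<^sup>+z. ennreal (k n z * (norm (w (x - z) - w x))\<^sup>2) \<partial>lborel) \<partial>lborel)"
      by (rule nn_integral_cmult) measurable
    also have "(\<integral>\<^sup>+x. (\<integral>\<^sup>+z. ennreal (k n z * (norm (w (x - z) - w x))\<^sup>2) \<partial>lborel) \<partial>lborel)
      = (\<integral>\<^sup>+z. (\<integral>\<^sup>+x. ennreal (k n z * (norm (w (x - z) - w x))\<^sup>2) \<partial>lborel) \<partial>lborel)"
      by (rule lborel_pair.Fubini') measurable
    also have "\<dots> = (\<integral>\<^sup>+z. ennreal (k n z * T z) \<partial>lborel)"
      using k0 L2_nn[OF Td] T0 by (simp add: ennreal_mult nn_integral_cmult T_def)
    also have "\<dots> = ennreal (LINT z|lborel. k n z * T z)"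
      using iT k0 T0 by (intro nn_integral_eq_integral) auto
    finally show ?thesis using M k0 T0
      by (simp add: ennreal_mult[symmetric] Bochner_Integration.integral_nonneg)
  qed
  show ?thesis
    unfolding L2_tendsto_def using L L2_scaleR[OF w] tendsto_0_le_cmult[OF _ le lim] by simp
qed

text \<open>The error is measured by a nonnegative integral, so integrability of the convolution is
  not a separate obligation.\<close>

theorem approx_id_L1:
  fixes w :: "'a::euclidean_space \<Rightarrow> 'b::euclidean_space"
  assumes k: "approx_id k M" and w: "integrable lborel w"
  shows "(\<lambda>n. \<integral>\<^sup>+x. ennreal (norm (conv (k n) w x - M *\<^sub>R w x)) \<partial>lborel) \<longlonglongrightarrow> 0"
proof -
  have k0: "0 \<le> k n z" and ki: "integrable lborel (k n)" and kM: "(LINT z|lborel. k n z) = M" for n z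
    using k by (auto simp: approx_id_def)
  have [measurable]: "k n \<in> borel_measurable borel" "w \<in> borel_measurable borel" for n using ki[of n] w by auto
  define T where "T z = (LINT x|lborel. norm (w (x - z) - w x))" for z
  have [measurable]: "T \<in> borel_measurable borel" unfolding T_def[abs_def] by measurable
  have T0: "T z \<ge> 0" for z unfolding T_def by auto
  have w': "integrable lborel (\<lambda>x. w (x - z))" for z using integrable_translate[of w "-z"] w by simp
  have TC: "T z \<le> 2 * (LINT x|lborel. norm (w x))" for z
  proof -
    have "T z \<le> (LINT x|lborel. norm (w (x - z)) + norm (w x))"
      unfolding T_def using w w' by (intro integral_mono norm_triangle_ineq4) auto
    also have "\<dots> = (LINT x|lborel. norm (w (x + - z))) + (LINT x|lborel. norm (w x))" using w w'[of z] by simp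
    also have "\<dots> = 2 * (LINT x|lborel. norm (w x))"
      using integral_translate[of "\<lambda>x. norm (w x)" "-z"] by simp
    finally show ?thesis .
  qed
  have lim: "(\<lambda>n. LINT z|lborel. k n z * T z) \<longlonglongrightarrow> 0"
    by (rule approx_id_tendsto_0[OF k _ T0 TC]) (use L1_translation_continuous[OF w] in \<open>auto simp: T_def\<close>)
  have le: "(\<integral>\<^sup>+x. ennreal (norm (conv (k n) w x - M *\<^sub>R w x)) \<partial>lborel) \<le> ennreal (LINT z|lborel. k n z * T z)" for n
  proof -
    have iT: "integrable lborel (\<lambda>z. k n z * T z)"
      by (rule Bochner_Integration.integrable_bound[where f="\<lambda>z. (2 * (LINT x|lborel. norm (w x))) * k n z"])
         (use ki[of n] T0 TC k0 in \<open>auto simp: abs_mult mult.commute[of "k n _"] intro!: mult_right_mono\<close>)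
    have "ennreal (norm (conv (k n) w x - M *\<^sub>R w x)) \<le> (\<integral>\<^sup>+z. ennreal (k n z * norm (w (x - z) - w x)) \<partial>lborel)" for x
    proof (cases "(\<integral>\<^sup>+z. ennreal (k n z * norm (w (x - z) - w x)) \<partial>lborel) < \<infinity>")
      case True
      then show ?thesis using conv_diff_const[OF _ ki[of n], of w x "w x"] k0 kM by simp
    qed (simp add: less_top[symmetric])
    then have "(\<integral>\<^sup>+x. ennreal (norm (conv (k n) w x - M *\<^sub>R w x)) \<partial>lborel)
       \<le> (\<integral>\<^sup>+x. (\<integral>\<^sup>+z. ennreal (k n z * norm (w (x - z) - w x)) \<partial>lborel) \<partial>lborel)"
      by (intro nn_integral_mono)
    also have "\<dots> = (\<integral>\<^sup>+z. (\<integral>\<^sup>+x. ennreal (k n z * norm (w (x - z) - w x)) \<partial>lborel) \<partial>lborel)"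
      by (rule lborel_pair.Fubini') measurable
    also have "\<dots> = (\<integral>\<^sup>+z. ennreal (k n z * T z) \<partial>lborel)"
      using k0 T0 w w' by (simp add: ennreal_mult nn_integral_cmult T_def nn_integral_eq_integral)
    also have "\<dots> = ennreal (LINT z|lborel. k n z * T z)"
      using iT k0 T0 by (intro nn_integral_eq_integral) auto
    finally show ?thesis .
  qed
  show ?thesis
  proof (rule tendsto_sandwich[OF _ _ tendsto_const])
    show "(\<lambda>n. ennreal (LINT z|lborel. k n z * T z)) \<longlonglongrightarrow> 0"
      using tendsto_ennrealI[OF lim] by simp
  qed (use le in auto)
qed

section \<open>Regularity of convolutions\<close>

text \<open>Closed balls suffice for convolution with compactly supported kernels, and unlike
  \<open>locally_integrable\<close> the notion is not tied to dimension three.\<close>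

definition loc_int :: "('a::euclidean_space \<Rightarrow> 'b::euclidean_space) \<Rightarrow> bool" where
  "loc_int w \<longleftrightarrow> w \<in> borel_measurable borel \<and> (\<forall>x r. integrable lborel (\<lambda>y. indicator (cball x r) y *\<^sub>R w y))"

lemma L2_indicator_cball: "L2 (indicator (cball x r) :: 'a::euclidean_space \<Rightarrow> real)"
proof -
  have "(\<lambda>y. (indicator (cball x r) y :: real)\<^sup>2) = indicator (cball x r)"
    by (auto split: split_indicator)
  moreover have "emeasure lborel (cball x r) < \<infinity>" by (rule emeasure_compact_finite) simp
  moreover have [measurable]: "cball x r \<in> sets borel" by (simp add: borel_closed)
  have "(indicator (cball x r) :: 'a \<Rightarrow> real) \<in> borel_measurable borel" by measurable
  ultimately show ?thesis by (simp add: L2_def integrable_indicator_iff)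
qed

lemma L2_loc_int:
  assumes w: "L2 w" shows "loc_int w"
proof -
  note [measurable] = L2_measurable[OF w]
  from L2_integrable_norm_mult[OF L2_indicator_cball w] have "integrable lborel (\<lambda>y. indicator (cball x r) y *\<^sub>R w y)" for x r
  proof (rule Bochner_Integration.integrable_bound)
    have [measurable]: "cball x r \<in> sets borel" by (simp add: borel_closed)
    show "(\<lambda>y. indicator (cball x r) y *\<^sub>R w y) \<in> borel_measurable lborel" by measurable
  qed auto
  then show ?thesis by (simp add: loc_int_def)
qed

text \<open>Enlarging the ball by 1 and taking d <= 1 leaves two cases: points closer than d lie
  both in the ball of radius R + 1, where compactness applies, or both where k vanishes.\<close>

lemma compact_support_uniformly_continuous:
  fixes k :: "'a::euclidean_space \<Rightarrow> 'b::real_normed_vector"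
  assumes k: "continuous_on UNIV k" and R: "\<And>z. R < norm z \<Longrightarrow> k z = 0" and e: "e > 0"
  obtains d where "d > 0" "d \<le> 1" "\<And>x y. norm (x - y) < d \<Longrightarrow> norm (k x - k y) < e"
proof -
  have "uniformly_continuous_on (cball 0 (R + 1)) k"
    by (intro compact_uniformly_continuous continuous_on_subset[OF k]) auto
  then obtain d where d: "d > 0" "\<And>x y. x \<in> cball 0 (R+1) \<Longrightarrow> y \<in> cball 0 (R+1) \<Longrightarrow> dist y x < d \<Longrightarrow> dist (k y) (k x) < e"
    using e unfolding uniformly_continuous_on_def by metis
  show ?thesis
  proof (rule that[of "min d 1"])
    fix x y :: 'a assume xy: "norm (x - y) < min d 1"
    show "norm (k x - k y) < e"
    proof (cases "norm x \<le> R + 1 \<and> norm y \<le> R + 1")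
      case True
      then show ?thesis using d(2)[of y x] xy by (auto simp: dist_norm)
    next
      case False
      have "norm x \<le> norm y + norm (x - y)" "norm y \<le> norm x + norm (x - y)"
        using norm_triangle_sub[of x y] norm_triangle_sub[of y x] by (simp_all add: norm_minus_commute)
      then have "R < norm x" "R < norm y" using False xy by auto
      then show ?thesis using R e by simp
    qed
  qed (use d in auto)
qed

lemma compact_support_bounded:
  fixes k :: "'a::euclidean_space \<Rightarrow> 'b::real_normed_vector"
  assumes k: "continuous_on UNIV k" and R: "\<And>z. R < norm z \<Longrightarrow> k z = 0"
  obtains B where "B > 0" "\<And>z. norm (k z) \<le> B"
proof -
  have "bounded (k ` cball 0 R)" by (intro compact_imp_bounded compact_continuous_image continuous_on_subset[OF k]) auto
  then obtain B where B: "B > 0" "\<And>z. z \<in> cball 0 R \<Longrightarrow> norm (k z) \<le> B" unfolding bounded_pos by auto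
  show ?thesis
  proof (rule that[OF B(1)])
    fix z show "norm (k z) \<le> B" using B(2)[of z] R[of z] B(1) by (cases "norm z \<le> R") auto
  qed
qed

lemma compact_support_loc_int_integrable:
  fixes k :: "'a::euclidean_space \<Rightarrow> real" and w :: "'a \<Rightarrow> 'b::euclidean_space"
  assumes k: "continuous_on UNIV k" and R: "\<And>z. R < norm z \<Longrightarrow> k z = 0" and w: "loc_int w"
  shows "integrable lborel (\<lambda>y. k (x - y) *\<^sub>R w y)"
proof -
  have [measurable]: "k \<in> borel_measurable borel" by (rule borel_measurable_continuous_onI[OF k])
  have [measurable]: "w \<in> borel_measurable borel" using w by (simp add: loc_int_def)
  obtain B where B: "B > 0" "\<And>z. norm (k z) \<le> B" using compact_support_bounded[of k R] k R by blast
  show ?thesis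
  proof (rule Bochner_Integration.integrable_bound)
    show "integrable lborel (\<lambda>y. B *\<^sub>R (indicator (cball x R) y *\<^sub>R w y))"
      by (intro integrable_scaleR_right) (use w in \<open>simp add: loc_int_def\<close>)
    show "AE y in lborel. norm (k (x - y) *\<^sub>R w y) \<le> norm (B *\<^sub>R (indicator (cball x R) y *\<^sub>R w y))"
    proof (rule AE_I2)
      fix y
      show "norm (k (x - y) *\<^sub>R w y) \<le> norm (B *\<^sub>R (indicator (cball x R) y *\<^sub>R w y))"
        using R[of "x - y"] B(1) mult_right_mono[OF B(2)[of "x - y"] norm_ge_zero[of "w y"]]
        by (auto split: split_indicator simp: dist_norm)
    qed
  qed measurable
qed

lemma frac_mult_less: "0 < e \<Longrightarrow> 0 \<le> J \<Longrightarrow> e / (J + 1) * J < (e::real)"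
  by (simp add: field_simps add_pos_nonneg)

text \<open>The integrand of the difference of the convolutions at x and x' lives in one ball of
  radius R + 1 around x, where w is integrable and the difference of the kernels is uniformly
  small.\<close>

lemma conv_continuous:
  fixes k :: "'a::euclidean_space \<Rightarrow> real" and w :: "'a \<Rightarrow> 'b::euclidean_space"
  assumes k: "continuous_on UNIV k" and R: "\<And>z. R < norm z \<Longrightarrow> k z = 0" and w: "loc_int w"
  shows "continuous_on UNIV (conv k w)"
proof (rule continuous_at_imp_continuous_on, rule ballI)
  fix x
  have [measurable]: "k \<in> borel_measurable borel" by (rule borel_measurable_continuous_onI[OF k])
  let ?J = "LINT y|lborel. norm (indicator (cball x (R + 1)) y *\<^sub>R w y)"
  have J: "?J \<ge> 0" by auto
  have iJ: "integrable lborel (\<lambda>y. indicator (cball x (R + 1)) y *\<^sub>R w y)" using w by (simp add: loc_int_def)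
  have ik: "integrable lborel (\<lambda>y. k (x - y) *\<^sub>R w y)" for x
    by (rule compact_support_loc_int_integrable[OF k R w])
  show "isCont (conv k w) x"
    unfolding continuous_at_eps_delta
  proof (intro allI impI)
    fix e :: real assume e: "e > 0"
    have e0: "e / (?J + 1) > 0" using e J by (simp add: add_nonneg_pos)
    obtain d where d: "d > 0" "d \<le> 1" "\<And>x y. norm (x - y) < d \<Longrightarrow> norm (k x - k y) < e / (?J + 1)"
      using compact_support_uniformly_continuous[OF k R e0] by blast
    have "dist (conv k w x') (conv k w x) < e" if x': "dist x' x < d" for x'
    proof -
      have "norm (conv k w x' - conv k w x) = norm (LINT y|lborel. (k (x' - y) - k (x - y)) *\<^sub>R w y)"
        unfolding conv_def using ik by (subst Bochner_Integration.integral_diff[symmetric]) (auto simp: scaleR_diff_left)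
      also have "\<dots> \<le> (LINT y|lborel. norm ((k (x' - y) - k (x - y)) *\<^sub>R w y))" by (rule integral_norm_bound)
      also have "\<dots> \<le> (LINT y|lborel. e / (?J + 1) * norm (indicator (cball x (R + 1)) y *\<^sub>R w y))"
      proof (rule integral_mono)
        show "integrable lborel (\<lambda>y. norm ((k (x' - y) - k (x - y)) *\<^sub>R w y))"
          using Bochner_Integration.integrable_diff[OF ik[of x'] ik[of x]] by (auto simp: scaleR_diff_left)
        show "integrable lborel (\<lambda>y. e / (?J + 1) * norm (indicator (cball x (R + 1)) y *\<^sub>R w y))"
          by (intro integrable_mult_right integrable_norm iJ)
        fix y
        show "norm ((k (x' - y) - k (x - y)) *\<^sub>R w y) \<le> e / (?J + 1) * norm (indicator (cball x (R + 1)) y *\<^sub>R w y)"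
        proof (cases "dist x y \<le> R + 1")
          case True
          have "\<bar>k (x' - y) - k (x - y)\<bar> < e / (?J + 1)"
            using d(3)[of "x' - y" "x - y"] x' by (simp add: dist_norm)
          from mult_right_mono[OF less_imp_le[OF this] norm_ge_zero[of "w y"]] True show ?thesis by simp
        next
          case False
          have "dist x y \<le> dist x' x + dist x' y" by (metis dist_commute dist_triangle)
          with False x' d(2) have "R < norm (x' - y)" "R < norm (x - y)" by (auto simp: dist_norm)
          then show ?thesis using R False by simp
        qed
      qed
      also have "\<dots> = e / (?J + 1) * ?J" by simp
      also have "\<dots> < e" by (rule frac_mult_less[OF e J])
      finally show ?thesis by (simp add: dist_norm)
    qed
    then show "\<exists>d>0. \<forall>x'. dist x' x < d \<longrightarrow> dist (conv k w x') (conv k w x) < e" using d(1) by blast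
  qed
qed

text \<open>Differentiation under the integral: uniform continuity of the gradient \<open>K\<close>
  makes the first-order remainder of \<open>k\<close> uniformly o(h), and all remainders live in one
  ball around x.\<close>

lemma conv_has_derivative:
  fixes k :: "'a::euclidean_space \<Rightarrow> real" and w :: "'a \<Rightarrow> 'b::euclidean_space"
  assumes k: "\<And>x. (k has_derivative (\<lambda>h. K x \<bullet> h)) (at x)" and K: "continuous_on UNIV K"
    and R: "\<And>z. R < norm z \<Longrightarrow> k z = 0" "\<And>z. R < norm z \<Longrightarrow> K z = 0" and w: "loc_int w"
  shows "(conv k w has_derivative (\<lambda>h. conv (\<lambda>z. K z \<bullet> h) w x)) (at x)"
proof -
  have kc: "continuous_on UNIV k"
    using k by (meson continuous_at_imp_continuous_on has_derivative_continuous)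
  let ?J = "LINT y|lborel. norm (indicator (cball x (R + 1)) y *\<^sub>R w y)"
  have J: "?J \<ge> 0" by auto
  have iJ: "integrable lborel (\<lambda>y. indicator (cball x (R + 1)) y *\<^sub>R w y)" using w by (simp add: loc_int_def)
  have ik: "integrable lborel (\<lambda>y. k (x - y) *\<^sub>R w y)" for x
    by (rule compact_support_loc_int_integrable[OF kc R(1) w])
  have iK: "integrable lborel (\<lambda>y. (K (x - y) \<bullet> h) *\<^sub>R w y)" for x h
    by (rule compact_support_loc_int_integrable[OF _ _ w, of "\<lambda>z. K z \<bullet> h" R]) (use R K in \<open>auto intro!: continuous_intros\<close>)
  have lin: "linear (\<lambda>h. conv (\<lambda>z. K z \<bullet> h) w x)"
  proof (rule linearI)
    fix h h' show "conv (\<lambda>z. K z \<bullet> (h + h')) w x = conv (\<lambda>z. K z \<bullet> h) w x + conv (\<lambda>z. K z \<bullet> h') w x"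
      unfolding conv_def using iK by (simp add: inner_add_right scaleR_add_left Bochner_Integration.integral_add)
  next
    fix c :: real and h show "conv (\<lambda>z. K z \<bullet> (c *\<^sub>R h)) w x = c *\<^sub>R conv (\<lambda>z. K z \<bullet> h) w x"
      unfolding conv_def by (simp flip: scaleR_scaleR)
  qed
  show ?thesis
    unfolding has_derivative_at_alt
  proof (intro conjI allI impI)
    show "bounded_linear (\<lambda>h. conv (\<lambda>z. K z \<bullet> h) w x)" using lin by (simp add: linear_conv_bounded_linear)
    fix e :: real assume e: "e > 0"
    have e0: "e / (?J + 1) > 0" using e J by (simp add: add_nonneg_pos)
    obtain d where d: "d > 0" "d \<le> 1" "\<And>x y. norm (x - y) < d \<Longrightarrow> norm (K x - K y) < e / (?J + 1)"
      using compact_support_uniformly_continuous[OF K R(2) e0] by blast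
    have est: "\<bar>k (z + h) - k z - K z \<bullet> h\<bar> \<le> e / (?J + 1) * norm h" if h: "norm h < d" for z h
    proof -
      \<comment> \<open>Mean value inequality for k minus its linearization at z, whose gradient K y
        - K z is small near z.\<close>
      have "norm ((\<lambda>z'. k z' - K z \<bullet> z') (z + h) - (\<lambda>z'. k z' - K z \<bullet> z') z) \<le> e / (?J + 1) * norm (z + h - z)"
      proof (rule differentiable_bound[where S="ball z d" and f'="\<lambda>y h. K y \<bullet> h - K z \<bullet> h"])
        fix y assume y: "y \<in> ball z d"
        show "((\<lambda>z'. k z' - K z \<bullet> z') has_derivative (\<lambda>h. K y \<bullet> h - K z \<bullet> h)) (at y within ball z d)"
          by (intro has_derivative_diff has_derivative_at_withinI[OF k] has_derivative_inner_right) (auto intro: derivative_eq_intros)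
        show "onorm (\<lambda>h. K y \<bullet> h - K z \<bullet> h) \<le> e / (?J + 1)"
        proof (rule onorm_le)
          fix h
          have "norm (K y \<bullet> h - K z \<bullet> h) \<le> norm (K y - K z) * norm h"
            by (simp flip: inner_diff_left add: Cauchy_Schwarz_ineq2)
          also have "\<dots> \<le> e / (?J + 1) * norm h"
            using d(3)[of y z] y by (intro mult_right_mono) (auto simp: dist_norm norm_minus_commute)
          finally show "norm (K y \<bullet> h - K z \<bullet> h) \<le> e / (?J + 1) * norm h" .
        qed
      qed (use h d in \<open>auto simp: dist_norm\<close>)
      then show ?thesis by (simp add: inner_add_right algebra_simps)
    qed
    have "norm (conv k w x' - conv k w x - conv (\<lambda>z. K z \<bullet> (x' - x)) w x) \<le> e * norm (x' - x)" if x': "norm (x' - x) < d" for x'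
    proof -
      let ?h = "x' - x"
      have "norm (conv k w x' - conv k w x - conv (\<lambda>z. K z \<bullet> ?h) w x) = norm (LINT y|lborel. (k (x' - y) - k (x - y) - K (x - y) \<bullet> ?h) *\<^sub>R w y)"
        unfolding conv_def using ik iK by (simp add: scaleR_diff_left Bochner_Integration.integral_diff)
      also have "\<dots> \<le> (LINT y|lborel. norm ((k (x' - y) - k (x - y) - K (x - y) \<bullet> ?h) *\<^sub>R w y))" by (rule integral_norm_bound)
      also have "\<dots> \<le> (LINT y|lborel. (e / (?J + 1) * norm ?h) * norm (indicator (cball x (R + 1)) y *\<^sub>R w y))"
      proof (rule integral_mono)
        show "integrable lborel (\<lambda>y. norm ((k (x' - y) - k (x - y) - K (x - y) \<bullet> ?h) *\<^sub>R w y))"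
          using ik[of x'] ik[of x] iK[of x ?h] by (auto simp: scaleR_diff_left)
        show "integrable lborel (\<lambda>y. (e / (?J + 1) * norm ?h) * norm (indicator (cball x (R + 1)) y *\<^sub>R w y))"
          by (intro integrable_mult_right integrable_norm iJ)
        fix y
        show "norm ((k (x' - y) - k (x - y) - K (x - y) \<bullet> ?h) *\<^sub>R w y) \<le> (e / (?J + 1) * norm ?h) * norm (indicator (cball x (R + 1)) y *\<^sub>R w y)"
        proof (cases "dist x y \<le> R + 1")
          case True
          have "x - y + ?h = x' - y" by simp
          then have "\<bar>k (x' - y) - k (x - y) - K (x - y) \<bullet> ?h\<bar> \<le> e / (?J + 1) * norm ?h"
            using est[OF x', of "x - y"] by simp
          from mult_right_mono[OF this norm_ge_zero[of "w y"]] True show ?thesis by simp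
        next
          case False
          have "dist x y \<le> dist x' x + dist x' y" by (metis dist_commute dist_triangle)
          with False x' d(2) have "R < norm (x' - y)" "R < norm (x - y)" by (auto simp: dist_norm)
          then show ?thesis using R False by simp
        qed
      qed
      also have "\<dots> = (e / (?J + 1) * ?J) * norm ?h" by simp
      also have "\<dots> \<le> e * norm ?h" by (intro mult_right_mono less_imp_le[OF frac_mult_less] e J) auto
      finally show ?thesis .
    qed
    then show "\<exists>d>0. \<forall>y. norm (y - x) < d \<longrightarrow> norm (conv k w y - conv k w x - conv (\<lambda>z. K z \<bullet> (y - x)) w x) \<le> e * norm (y - x)"
      using d(1) by blast
  qed
qed

text \<open>The integral of the derivative over a unit segment in direction e is psi(x+e) - psi(x).
  Integrating over x, translation invariance makes one side the wanted integral and the other side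
  0. Integrability replaces decay and compact support, which suits the later integrations by parts
  between L2 functions.\<close>

lemma integral_directional_derivative_eq_0:
  fixes \<psi> :: "'a::euclidean_space \<Rightarrow> real"
  assumes d: "\<And>x. (\<psi> has_derivative D x) (at x)" and D: "continuous_on UNIV (\<lambda>x. D x e)"
    and i: "integrable lborel \<psi>" "integrable lborel (\<lambda>x. D x e)"
  shows "(LINT x|lborel. D x e) = 0"
proof -
  let ?I = "LINT x|lborel. D x e" and ?g = "\<lambda>x. D x e"
  have [measurable]: "?g \<in> borel_measurable borel" by (rule borel_measurable_continuous_onI[OF D])
  have [measurable]: "\<psi> \<in> borel_measurable borel" using i by auto
  have gi: "integrable lborel (\<lambda>x. ?g (x + a))" for a using integrable_translate[of ?g a] i by simp
  have I': "(LINT x|lborel. ?g (x + a)) = ?I" for a using integral_translate[of ?g a] by simp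
  have ftc: "(LINT t|lborel. ?g (x + t *\<^sub>R e) * indicator {0..1} t) = \<psi> (x + e) - \<psi> x" for x
  proof -
    have "(LINT t|lborel. ?g (x + t *\<^sub>R e) * indicator {0..1} t) = \<psi> (x + 1 *\<^sub>R e) - \<psi> (x + 0 *\<^sub>R e)"
    proof (rule integral_FTC_Icc_real)
      fix t :: real
      have "((\<lambda>t. \<psi> (x + t *\<^sub>R e)) has_derivative (\<lambda>s. D (x + t *\<^sub>R e) (s *\<^sub>R e))) (at t)"
        by (rule has_derivative_compose[OF _ d]) (auto intro!: derivative_eq_intros)
      then show "((\<lambda>t. \<psi> (x + t *\<^sub>R e)) has_real_derivative ?g (x + t *\<^sub>R e)) (at t)"
        by (simp add: has_field_derivative_def mult_commute_abs linear_cmul[OF bounded_linear.linear[OF has_derivative_bounded_linear[OF d]]])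
      have "isCont ?g (x + t *\<^sub>R e)" using D by (simp add: continuous_on_eq_continuous_at)
      then show "isCont (\<lambda>t. ?g (x + t *\<^sub>R e)) t"
        by (intro isCont_o2[where g="?g" and f="\<lambda>t. x + t *\<^sub>R e"]) (auto intro!: continuous_intros)
    qed simp
    then show ?thesis by simp
  qed
  have meas: "(\<lambda>(x, t). ?g (x + t *\<^sub>R e) * indicator {0..1} t) \<in> borel_measurable (lborel \<Otimes>\<^sub>M lborel)"
  proof -
    have "(\<lambda>p::'a \<times> real. ?g (fst p + snd p *\<^sub>R e) * indicator {0..1} (snd p)) \<in> borel_measurable (lborel \<Otimes>\<^sub>M lborel)"
      by measurable
    then show ?thesis by (simp add: case_prod_beta')
  qed
  have norm_int: "(LINT x|lborel. norm (?g (x + t *\<^sub>R e) * indicator {0..1} t)) = indicator {0..1} t * (LINT x|lborel. \<bar>?g x\<bar>)" for t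
    using integral_translate[of "\<lambda>x. \<bar>?g x\<bar>" "t *\<^sub>R e"] by (simp add: abs_mult mult.commute)
  have "integrable (lborel \<Otimes>\<^sub>M lborel) (\<lambda>(t, x). ?g (x + t *\<^sub>R e) * indicator {0..1} t)"
  proof (rule lborel_pair.Fubini_integrable)
    show "(\<lambda>(t, x). ?g (x + t *\<^sub>R e) * indicator {0..1} t) \<in> borel_measurable (lborel \<Otimes>\<^sub>M lborel)"
    proof -
      have "(\<lambda>p::real \<times> 'a. ?g (snd p + fst p *\<^sub>R e) * indicator {0..1} (fst p)) \<in> borel_measurable (lborel \<Otimes>\<^sub>M lborel)"
        by measurable
      then show ?thesis by (simp add: case_prod_beta')
    qed
    show "integrable lborel (\<lambda>t. LINT x|lborel. norm (case (t, x) of (t, x) \<Rightarrow> ?g (x + t *\<^sub>R e) * indicator {0..1} t))"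
      by (simp only: prod.case norm_int) (intro integrable_mult_left integrable_real_indicator, auto)
    show "AE t in lborel. integrable lborel (\<lambda>x. case (t, x) of (t, x) \<Rightarrow> ?g (x + t *\<^sub>R e) * indicator {0..1} t)"
      using gi by auto
  qed
  then have "(LINT x|lborel. LINT t|lborel. ?g (x + t *\<^sub>R e) * indicator {0..1} t)
      = (LINT t|lborel. LINT x|lborel. ?g (x + t *\<^sub>R e) * indicator {0..1} t)"
    by (rule lborel_pair.Fubini_integral)
  also have "\<dots> = (LINT t|lborel. ?I * indicator {0..1} (t::real))"
    by (simp only: integral_mult_left_zero I')
  also have "\<dots> = ?I" by (simp add: measure_lborel_Icc)
  finally have "?I = (LINT x|lborel. \<psi> (x + e) - \<psi> x)" using ftc by simp
  also have "\<dots> = 0"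
    using i(1) integrable_translate[of \<psi> e] integral_translate[of \<psi> e] by (simp add: Bochner_Integration.integral_diff)
  finally show ?thesis .
qed

section \<open>Smooth bump functions and mollifiers\<close>

text \<open>Up to linear combinations the family t^(-m) exp(-1/t) is closed under differentiation,
  which keeps all derivatives of the mollifier explicit.\<close>

definition bump_exp :: "nat \<Rightarrow> real \<Rightarrow> real" where
  "bump_exp m t = (if t \<le> 0 then 0 else inverse t ^ m * exp (- inverse t))"

lemma bump_exp_nonneg: "0 \<le> bump_exp m t"
  and bump_exp_eq_0: "t \<le> 0 \<Longrightarrow> bump_exp m t = 0"
  and bump_exp_pos: "0 < t \<Longrightarrow> 0 < bump_exp m t"
  by (auto simp: bump_exp_def)

lemma DERIV_bump_exp: "(bump_exp m has_real_derivative bump_exp (m + 2) t - real m * bump_exp (m + 1) t) (at t)"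
proof (cases t "0::real" rule: linorder_cases)
  case less
  have "(bump_exp m has_real_derivative 0) (at t)"
    by (rule has_field_derivative_transform_within_open[of "\<lambda>_. 0" 0 t "{..<0}"]) (use less in \<open>auto simp: bump_exp_def\<close>)
  then show ?thesis using less by (simp add: bump_exp_def)
next
  case greater
  have "((\<lambda>t. inverse t ^ m * exp (- inverse t)) has_real_derivative
        inverse t ^ m * (exp (- inverse t) * (inverse t ^ 2)) + (real m * inverse t ^ (m - 1) * (- (inverse t ^ 2))) * exp (- inverse t)) (at t)"
    using greater by (auto intro!: derivative_eq_intros simp: power2_eq_square)
  moreover have "inverse t ^ m * (exp (- inverse t) * (inverse t ^ 2)) + (real m * inverse t ^ (m - 1) * (- (inverse t ^ 2))) * exp (- inverse t)
      = bump_exp (m + 2) t - real m * bump_exp (m + 1) t"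
    using greater by (cases m) (auto simp: bump_exp_def power2_eq_square algebra_simps)
  ultimately have "((\<lambda>t. inverse t ^ m * exp (- inverse t)) has_real_derivative bump_exp (m + 2) t - real m * bump_exp (m + 1) t) (at t)"
    by simp
  then show ?thesis
    by (rule has_field_derivative_transform_within_open[of _ _ t "{0<..}"]) (use greater in \<open>auto simp: bump_exp_def\<close>)
next
  \<comment> \<open>At the origin the right difference quotient is s^(m+1) exp(-s) with s = 1/t, and
    the left one is 0.\<close>
  case equal
  have "((\<lambda>y. bump_exp m y / y) \<longlongrightarrow> 0) (at_left 0)"
    by (rule tendsto_eventually) (auto simp: bump_exp_def eventually_at_filter)
  moreover have "((\<lambda>y. bump_exp m y / y) \<longlongrightarrow> 0) (at_right 0)"
  proof -
    have "((\<lambda>y::real. inverse y ^ (m + 1) / exp (inverse y)) \<longlongrightarrow> 0) (at_right 0)"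
      using filterlim_compose[OF tendsto_power_div_exp_0[of "m+1"] filterlim_inverse_at_top_right] .
    moreover have "\<forall>\<^sub>F y in at_right 0. inverse y ^ (m + 1) / exp (inverse y) = bump_exp m y / y"
      by (auto simp: bump_exp_def eventually_at_filter exp_minus field_simps)
    ultimately show ?thesis by (rule Lim_transform_eventually)
  qed
  ultimately have "((\<lambda>y. bump_exp m y / y) \<longlongrightarrow> 0) (at 0)" by (simp add: filterlim_split_at)
  then show ?thesis using equal by (simp add: has_field_derivative_iff bump_exp_eq_0)
qed

lemma has_derivative_bump_exp_ball:
  fixes a :: "'a::euclidean_space"
  shows "((\<lambda>x. bump_exp m (r - (norm (x - a))\<^sup>2)) has_derivative
    (\<lambda>h. (bump_exp (m + 2) (r - (norm (x - a))\<^sup>2) - real m * bump_exp (m + 1) (r - (norm (x - a))\<^sup>2)) * (- 2 * ((x - a) \<bullet> h)))) (at x)"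
proof -
  have "((\<lambda>x. r - (norm (x - a))\<^sup>2) has_derivative (\<lambda>h. - 2 * ((x - a) \<bullet> h))) (at x)"
    unfolding power2_norm_eq_inner by (auto intro!: derivative_eq_intros simp: inner_commute)
  from has_derivative_compose[OF this DERIV_bump_exp[unfolded has_field_derivative_def]]
  show ?thesis by (simp add: mult_ac)
qed

text \<open>A syntactic class that contains the shifted mollifiers and is closed under partial
  differentiation, so that \<open>Ck\<close> for all k follows by induction on k.\<close>

inductive smooth_gen :: "(real^3 \<Rightarrow> real) \<Rightarrow> bool" where
  const: "smooth_gen (\<lambda>x. c)"
| coord: "smooth_gen (\<lambda>x. x $ i)"
| bump: "smooth_gen (\<lambda>x. bump_exp m (r - (norm (x - a))\<^sup>2))"
| add: "smooth_gen f \<Longrightarrow> smooth_gen g \<Longrightarrow> smooth_gen (\<lambda>x. f x + g x)"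
| mult: "smooth_gen f \<Longrightarrow> smooth_gen g \<Longrightarrow> smooth_gen (\<lambda>x. f x * g x)"

lemma partial_deriv_eq: "(f has_derivative f') (at x) \<Longrightarrow> partial_deriv i f x = f' (axis i 1)"
  unfolding partial_deriv_def by (metis frechet_derivative_at)

lemma smooth_gen_step:
  assumes "smooth_gen f"
  shows "(\<forall>x. f differentiable at x) \<and> (\<forall>i. smooth_gen (partial_deriv i f))"
  using assms
proof induction
  case (const c)
  have "partial_deriv i (\<lambda>x. c) = (\<lambda>x. 0)" for i
    by (rule ext, subst partial_deriv_eq[of _ "\<lambda>h. 0"]) (auto intro!: derivative_eq_intros)
  then show ?case by (auto intro: smooth_gen.const)
next
  case (coord j)
  have d: "((\<lambda>x. x $ j) has_derivative (\<lambda>h. h $ j)) (at x)" for x :: "real^3"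
    by (rule bounded_linear_imp_has_derivative) (rule bounded_linear_vec_nth)
  then have "partial_deriv i (\<lambda>x. x $ j) = (\<lambda>x. axis i 1 $ j)" for i
    by (intro ext) (rule partial_deriv_eq)
  with d show ?case by (auto intro: smooth_gen.const simp: differentiable_def)
next
  case (bump m r a)
  have "partial_deriv i (\<lambda>x. bump_exp m (r - (norm (x - a))\<^sup>2)) = (\<lambda>x. (bump_exp (m + 2) (r - (norm (x - a))\<^sup>2) +
     (- real m) * bump_exp (m + 1) (r - (norm (x - a))\<^sup>2)) * (- 2 * (x $ i + (- (a $ i)))))" for i
    by (intro ext, subst partial_deriv_eq[OF has_derivative_bump_exp_ball]) (simp add: inner_axis)
  then have "smooth_gen (partial_deriv i (\<lambda>x. bump_exp m (r - (norm (x - a))\<^sup>2)))" for i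
    by (simp only:) (intro smooth_gen.intros)
  then show ?case
    by (blast intro: differentiableI has_derivative_bump_exp_ball)
next
  case (add f g)
  have "partial_deriv i (\<lambda>x. f x + g x) = (\<lambda>x. partial_deriv i f x + partial_deriv i g x)" for i
  proof (rule ext)
    fix x
    have "((\<lambda>x. f x + g x) has_derivative (\<lambda>h. frechet_derivative f (at x) h + frechet_derivative g (at x) h)) (at x)"
      using add.IH by (intro has_derivative_add) (auto simp: frechet_derivative_works)
    then show "partial_deriv i (\<lambda>x. f x + g x) x = partial_deriv i f x + partial_deriv i g x"
      by (subst partial_deriv_eq) (auto simp: partial_deriv_def)
  qed
  then show ?case using add.IH by (auto intro: smooth_gen.add)
next
  case (mult f g)
  have "partial_deriv i (\<lambda>x. f x * g x) = (\<lambda>x. f x * partial_deriv i g x + partial_deriv i f x * g x)" for i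
  proof (rule ext)
    fix x
    have "((\<lambda>x. f x * g x) has_derivative (\<lambda>h. f x * frechet_derivative g (at x) h + frechet_derivative f (at x) h * g x)) (at x)"
      using mult.IH by (intro has_derivative_mult) (auto simp: frechet_derivative_works)
    then show "partial_deriv i (\<lambda>x. f x * g x) x = f x * partial_deriv i g x + partial_deriv i f x * g x"
      by (subst partial_deriv_eq) (auto simp: partial_deriv_def)
  qed
  then show ?case using mult by (auto intro!: smooth_gen.intros)
qed

lemma smooth_gen_Ck: "smooth_gen f \<Longrightarrow> Ck k f"
proof (induction k arbitrary: f)
  case 0
  then show ?case using smooth_gen_step[OF 0]
    by (auto intro!: continuous_at_imp_continuous_on differentiable_imp_continuous_within)
next
  case (Suc k)
  then show ?case using smooth_gen_step[OF Suc.prems] by auto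
qed

lemma smooth_gen_test_function:
  assumes "smooth_gen f" "bounded {x. f x \<noteq> 0}"
  shows "test_function f"
  using assms by (simp add: test_function_def smooth_gen_Ck compact_closure)

text \<open>Supported in the ball of radius 1/(n+1). It is radial, hence even, and this makes
  convolution with it self-adjoint.\<close>

definition mollifier :: "nat \<Rightarrow> 'a::euclidean_space \<Rightarrow> real" where
  "mollifier n z = bump_exp 0 (inverse (real (Suc n)) ^ 2 - (norm z)\<^sup>2)
     / (LINT z|(lborel::'a measure). bump_exp 0 (inverse (real (Suc n)) ^ 2 - (norm z)\<^sup>2))"

definition mollifier_grad :: "nat \<Rightarrow> 'a::euclidean_space \<Rightarrow> 'a" where
  "mollifier_grad n z = (- 2 * bump_exp 2 (inverse (real (Suc n)) ^ 2 - (norm z)\<^sup>2)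
     / (LINT z|(lborel::'a measure). bump_exp 0 (inverse (real (Suc n)) ^ 2 - (norm z)\<^sup>2))) *\<^sub>R z"

lemma has_derivative_imp_continuous_on_UNIV:
  "(\<And>x. (f has_derivative f' x) (at x)) \<Longrightarrow> continuous_on UNIV f"
  by (meson continuous_at_imp_continuous_on has_derivative_continuous)

lemma continuous_bump_exp_ball: "continuous_on UNIV (\<lambda>x. bump_exp m (r - (norm (x - a::'a::euclidean_space))\<^sup>2))"
  by (rule has_derivative_imp_continuous_on_UNIV) (rule has_derivative_bump_exp_ball)

lemma continuous_bump_exp_ball0: "continuous_on UNIV (\<lambda>x. bump_exp m (r - (norm (x::'a::euclidean_space))\<^sup>2))"
  using continuous_bump_exp_ball[of m r 0] by simp

lemma bump_exp_outside: "inverse (real (Suc n)) < norm z \<Longrightarrow> bump_exp m (inverse (real (Suc n)) ^ 2 - (norm z)\<^sup>2) = 0"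
  by (intro bump_exp_eq_0) (simp add: power_mono)

lemma compact_support_integrable:
  fixes k :: "'a::euclidean_space \<Rightarrow> 'b::euclidean_space"
  assumes k: "continuous_on UNIV k" and R: "\<And>z. R < norm z \<Longrightarrow> k z = 0"
  shows "integrable lborel k"
proof -
  have "set_integrable lborel (cball 0 R) k"
    unfolding set_integrable_def using borel_integrable_compact[of "cball 0 R" k] continuous_on_subset[OF k] by simp
  moreover have "(\<lambda>x. indicator (cball 0 R) x *\<^sub>R k x) = k"
  proof
    fix x show "indicator (cball 0 R) x *\<^sub>R k x = k x" using R[of x] by (cases "norm x \<le> R") auto
  qed
  ultimately show ?thesis by (simp add: set_integrable_def)
qed

lemma mollifier_mass_pos: "0 < (LINT z|(lborel::'a::euclidean_space measure). bump_exp 0 (inverse (real (Suc n)) ^ 2 - (norm z)\<^sup>2))"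
proof -
  let ?r = "inverse (real (Suc n))" 
  let ?f = "\<lambda>z::'a. bump_exp 0 (?r ^ 2 - (norm z)\<^sup>2)"
  have i: "integrable lborel ?f"
    by (rule compact_support_integrable[OF continuous_bump_exp_ball0 bump_exp_outside])
  have r: "?r > 0" by simp
  have "(LINT z|lborel. ?f z) \<noteq> 0"
  proof
    assume "(LINT z|lborel. ?f z) = 0"
    then have "AE z in lborel. ?f z = 0"
      using integral_nonneg_eq_0_iff_AE[OF i] bump_exp_nonneg by auto
    moreover have "?f z \<noteq> 0" if "z \<in> ball 0 ?r" for z
      using that bump_exp_pos[of "?r ^ 2 - (norm z)\<^sup>2" 0] power_strict_mono[of "norm z" ?r 2] by auto
    ultimately have "AE z in lborel. z \<notin> (ball 0 ?r :: 'a set)" by (auto elim!: eventually_mono)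
    then have "(ball 0 ?r :: 'a set) \<in> null_sets lborel" by (subst AE_iff_null_sets) auto
    then have "emeasure lborel (ball 0 ?r :: 'a set) = 0" by (rule null_setsD1)
    then have "measure lborel (ball 0 ?r :: 'a set) = 0" by (simp add: measure_def)
    then show False using content_ball_gt_0_iff[of "0::'a" ?r] r by simp
  qed
  moreover have "0 \<le> (LINT z|lborel. ?f z)" using bump_exp_nonneg by (simp add: integral_nonneg_AE)
  ultimately show ?thesis by simp
qed

lemma mollifier_nonneg: "0 \<le> mollifier n z"
  unfolding mollifier_def using mollifier_mass_pos[of n, where 'a='a] bump_exp_nonneg by (intro divide_nonneg_pos) auto

lemma mollifier_outside:
  fixes z :: "'a::euclidean_space"
  shows "inverse (real (Suc n)) < norm z \<Longrightarrow> mollifier n z = 0" "inverse (real (Suc n)) < norm z \<Longrightarrow> mollifier_grad n z = 0"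
  unfolding mollifier_def mollifier_grad_def using bump_exp_outside by auto

lemma continuous_mollifier:
  "continuous_on UNIV (mollifier n :: 'a::euclidean_space \<Rightarrow> real)" "continuous_on UNIV (mollifier_grad n :: 'a \<Rightarrow> 'a)"
  unfolding mollifier_def[abs_def] mollifier_grad_def[abs_def]
  using mollifier_mass_pos[of n, where 'a='a]
  by (auto intro!: continuous_intros continuous_bump_exp_ball0)

lemma mollifier_has_derivative:
  fixes z :: "'a::euclidean_space"
  shows "(mollifier n has_derivative (\<lambda>h. mollifier_grad n z \<bullet> h)) (at z)"
proof -
  let ?m = "LINT z|(lborel::'a measure). bump_exp 0 (inverse (real (Suc n)) ^ 2 - (norm z)\<^sup>2)"
  have "((\<lambda>z. inverse ?m * bump_exp 0 (inverse (real (Suc n)) ^ 2 - (norm (z - 0))\<^sup>2)) has_derivative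
    (\<lambda>h. inverse ?m * ((bump_exp (0 + 2) (inverse (real (Suc n)) ^ 2 - (norm (z - 0))\<^sup>2) - real 0 * bump_exp (0 + 1) (inverse (real (Suc n)) ^ 2 - (norm (z - 0))\<^sup>2)) * (- 2 * ((z - 0) \<bullet> h))))) (at z)"
    by (rule has_derivative_mult_right[OF has_derivative_bump_exp_ball])
  then show ?thesis unfolding mollifier_def[abs_def] mollifier_grad_def
    by (simp add: divide_inverse mult_ac numeral_2_eq_2)
qed

lemma mollifier_integrable:
  "integrable lborel (mollifier n :: 'a::euclidean_space \<Rightarrow> real)" "integrable lborel (mollifier_grad n :: 'a \<Rightarrow> 'a)"
  using compact_support_integrable[OF continuous_mollifier(1) mollifier_outside(1)]
    compact_support_integrable[OF continuous_mollifier(2) mollifier_outside(2)] by auto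

lemma mollifier_integral: "(LINT z|(lborel::'a::euclidean_space measure). mollifier n z) = 1"
  unfolding mollifier_def using mollifier_mass_pos[of n, where 'a='a] by simp

lemma approx_id_mollifier: "approx_id (mollifier :: nat \<Rightarrow> 'a::euclidean_space \<Rightarrow> real) 1"
  unfolding approx_id_def
proof (intro conjI allI impI mollifier_nonneg mollifier_integrable mollifier_integral)
  fix d :: real assume "d > 0"
  then have "eventually (\<lambda>n. inverse (real (Suc n)) < d) sequentially"
    using order_tendstoD(2)[OF LIMSEQ_inverse_real_of_nat] by blast
  then have "eventually (\<lambda>n. (LINT z|lborel. mollifier n (z::'a) * indicator {z. d \<le> norm z} z) = 0) sequentially"
  proof eventually_elim
    case (elim n)
    have "(\<lambda>z. mollifier n (z::'a) * indicator {z. d \<le> norm z} z) = (\<lambda>z. 0)"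
    proof
      fix z :: 'a show "mollifier n z * indicator {z. d \<le> norm z} z = 0"
        using mollifier_outside(1)[of n z] elim by (cases "d \<le> norm z") auto
    qed
    then show ?case by simp
  qed
  then show "(\<lambda>n. LINT z|lborel. mollifier n (z::'a) * indicator {z. d \<le> norm z} z) \<longlonglongrightarrow> 0"
    by (rule tendsto_eventually)
qed

lemma mollifier_abs_integral: "(LINT z|(lborel::'a::euclidean_space measure). \<bar>mollifier n z\<bar>) = 1"
  using mollifier_integral[of n, where 'a='a] by (simp add: abs_of_nonneg mollifier_nonneg)

lemma locally_integrable_loc_int: "locally_integrable f \<Longrightarrow> loc_int f"
  by (simp add: locally_integrable_def loc_int_def set_integrable_def)

lemma loc_int_locally_integrable:
  assumes f: "loc_int f" shows "locally_integrable f"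
  unfolding locally_integrable_def
proof (intro conjI allI impI)
  show "f \<in> borel_measurable lborel" using f by (simp add: loc_int_def)
  fix K :: "(real^3) set" assume K: "compact K"
  then obtain R where "\<And>x. x \<in> K \<Longrightarrow> norm x \<le> R" using compact_imp_bounded[OF K] unfolding bounded_iff by blast
  then have R: "K \<subseteq> cball 0 R" by auto
  have "set_integrable lborel (cball 0 R) f" using f by (simp add: loc_int_def set_integrable_def)
  then show "set_integrable lborel K f"
    by (rule set_integrable_subset) (use K R in \<open>auto intro: borel_closed compact_imp_closed\<close>)
qed

text \<open>Displays the shifted kernel, as a function of y, in terms of the generators of
  \<open>smooth_gen\<close>.\<close>

lemma mollifier_shift:
  fixes x :: "real^3"
  shows "(\<lambda>y. mollifier n (x - y)) = (\<lambda>y. inverse (LINT z|(lborel::(real^3) measure). bump_exp 0 (inverse (real (Suc n)) ^ 2 - (norm z)\<^sup>2))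
     * bump_exp 0 (inverse (real (Suc n)) ^ 2 - (norm (y - x))\<^sup>2))"
  by (simp add: mollifier_def norm_minus_commute divide_inverse mult.commute)

lemma mollifier_grad_shift:
  fixes x :: "real^3"
  shows "(\<lambda>y. mollifier_grad n (x - y) $ j) = (\<lambda>y. (- 2 * inverse (LINT z|(lborel::(real^3) measure). bump_exp 0 (inverse (real (Suc n)) ^ 2 - (norm z)\<^sup>2)))
     * (bump_exp 2 (inverse (real (Suc n)) ^ 2 - (norm (y - x))\<^sup>2) * (x $ j + (-1) * y $ j)))"
  by (simp add: mollifier_grad_def norm_minus_commute divide_inverse mult_ac)

lemma bounded_mollifier_support:
  fixes x :: "'a::euclidean_space"
  assumes "\<And>y. inverse (real (Suc n)) < norm (x - y) \<Longrightarrow> f y = 0"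
  shows "bounded {y. f y \<noteq> (0::real)}"
  by (rule bounded_subset[OF bounded_cball[of x "inverse (real (Suc n))"]])
     (use assms in \<open>force simp: dist_norm\<close>)

lemma test_function_mollifier:
  fixes x :: "real^3"
  shows "test_function (\<lambda>y. mollifier n (x - y))"
    and "partial_deriv i (\<lambda>y. mollifier n (x - y)) y = - (mollifier_grad n (x - y) $ i)"
proof -
  have "smooth_gen (\<lambda>y. mollifier n (x - y))"
    unfolding mollifier_shift by (intro smooth_gen.intros)
  then show "test_function (\<lambda>y. mollifier n (x - y))"
    by (rule smooth_gen_test_function) (rule bounded_mollifier_support[OF mollifier_outside(1)])
  have "((\<lambda>y. mollifier n (x - y)) has_derivative (\<lambda>h. mollifier_grad n (x - y) \<bullet> (- h))) (at y)"
    by (rule has_derivative_compose[OF _ mollifier_has_derivative]) (auto intro!: derivative_eq_intros)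
  from partial_deriv_eq[OF this, of i]
  show "partial_deriv i (\<lambda>y. mollifier n (x - y)) y = - (mollifier_grad n (x - y) $ i)"
    by (simp add: inner_axis)
qed

text \<open>The second claim is the symmetry of the second derivatives of the mollifier, read off
  from the explicit formula. Mollified weak gradients inherit it.\<close>

lemma test_function_mollifier_grad:
  fixes x :: "real^3"
  shows "test_function (\<lambda>y. mollifier_grad n (x - y) $ j)"
    and "partial_deriv i (\<lambda>y. mollifier_grad n (x - y) $ j) y = partial_deriv j (\<lambda>y. mollifier_grad n (x - y) $ i) y"
proof -
  have "smooth_gen (\<lambda>y. mollifier_grad n (x - y) $ j)"
    unfolding mollifier_grad_shift by (intro smooth_gen.intros)
  then show "test_function (\<lambda>y. mollifier_grad n (x - y) $ j)"
    by (rule smooth_gen_test_function) (rule bounded_mollifier_support[of n x], simp add: mollifier_outside(2))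
  let ?c = "- 2 * inverse (LINT z|(lborel::(real^3) measure). bump_exp 0 (inverse (real (Suc n)) ^ 2 - (norm z)\<^sup>2))"
  let ?q = "inverse (real (Suc n)) ^ 2 - (norm (y - x))\<^sup>2"
  let ?X = "bump_exp (2 + 2) ?q - real 2 * bump_exp (2 + 1) ?q"
  have "partial_deriv i (\<lambda>y. mollifier_grad n (x - y) $ j) y
      = ?c * (bump_exp 2 ?q * (- (if i = j then 1 else 0)) + ?X * 2 * ((x $ i - y $ i) * (x $ j - y $ j)))" for i j
  proof -
    have lin: "((\<lambda>y. x $ j + (-1) * y $ j) has_derivative (\<lambda>h. - (h $ j))) (at y)"
      by (auto intro!: derivative_eq_intros bounded_linear.has_derivative[OF bounded_linear_vec_nth])
    have "((\<lambda>y. mollifier_grad n (x - y) $ j) has_derivative (\<lambda>h. ?c * (bump_exp 2 ?q * (- (h $ j)) +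
       (?X * (- 2 * ((y - x) \<bullet> h))) * (x $ j + (-1) * y $ j)))) (at y)"
      unfolding mollifier_grad_shift
      by (rule has_derivative_mult_right has_derivative_mult has_derivative_bump_exp_ball lin)+
    from partial_deriv_eq[OF this, of i]
    have "partial_deriv i (\<lambda>y. mollifier_grad n (x - y) $ j) y = ?c * (bump_exp 2 ?q * (- (axis i 1 $ j)) +
       (?X * (- 2 * (y $ i - x $ i))) * (x $ j + (-1) * y $ j))"
      by (simp only: inner_axis vector_minus_component inner_real_def mult_1_right)
    moreover have "(Z * (- 2 * (a - b))) * (c + (-1) * d) = Z * 2 * ((b - a) * (c - d))" for Z a b c d :: real
      by (simp add: algebra_simps)
    moreover have "axis i (1::real) $ j = (if i = j then 1 else 0)" by (simp add: axis_def)
    ultimately show ?thesis by (simp only:)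
  qed
  moreover have "(x $ i - y $ i) * (x $ j - y $ j) = (x $ j - y $ j) * (x $ i - y $ i)" by (rule mult.commute)
  ultimately show "partial_deriv i (\<lambda>y. mollifier_grad n (x - y) $ j) y = partial_deriv j (\<lambda>y. mollifier_grad n (x - y) $ i) y"
    by (simp only: eq_commute[of i j])
qed

lemma conv_mollifier_has_derivative:
  assumes "loc_int w"
  shows "(conv (mollifier n) w has_derivative (\<lambda>h. conv (\<lambda>z. mollifier_grad n z \<bullet> h) w x)) (at x)"
  by (rule conv_has_derivative[OF mollifier_has_derivative continuous_mollifier(2) mollifier_outside assms])

lemma continuous_mollifier_grad_inner: "continuous_on UNIV (\<lambda>z. mollifier_grad n z \<bullet> h)"
  by (intro continuous_intros continuous_mollifier)

lemma mollifier_grad_inner_outside: "inverse (real (Suc n)) < norm z \<Longrightarrow> mollifier_grad n z \<bullet> h = 0"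
  by (simp add: mollifier_outside(2))

lemma conv_mollifier_integrable:
  assumes "loc_int w"
  shows "integrable lborel (\<lambda>y. mollifier n (x - y) *\<^sub>R w y)"
    "integrable lborel (\<lambda>y. (mollifier_grad n (x - y) \<bullet> h) *\<^sub>R w y)"
  using compact_support_loc_int_integrable[OF continuous_mollifier(1) mollifier_outside(1) assms]
    compact_support_loc_int_integrable[OF continuous_mollifier_grad_inner mollifier_grad_inner_outside assms] by auto

lemma conv_mollifier_continuous:
  assumes "loc_int w"
  shows "continuous_on UNIV (conv (mollifier n) w)" "continuous_on UNIV (conv (\<lambda>z. mollifier_grad n z \<bullet> h) w)"
  using conv_continuous[OF continuous_mollifier(1) mollifier_outside(1) assms]
    conv_continuous[OF continuous_mollifier_grad_inner mollifier_grad_inner_outside assms] by auto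

lemma conv_mollifier_inner:
  assumes w: "loc_int w"
  shows "conv (mollifier n) w x \<bullet> h = (LINT y|lborel. mollifier n (x - y) * (w y \<bullet> h))"
    "conv (\<lambda>z. mollifier_grad n z \<bullet> e) w x \<bullet> h = (LINT y|lborel. (mollifier_grad n (x - y) \<bullet> e) * (w y \<bullet> h))"
  unfolding conv_def using conv_mollifier_integrable[OF w] by (simp_all flip: integral_inner_left)

section \<open>Weak gradients\<close>

lemma has_weak_gradientD:
  "has_weak_gradient u g \<Longrightarrow> test_function \<phi> \<Longrightarrow>
    (LINT x|lborel. u x * partial_deriv i \<phi> x) = - (LINT x|lborel. g x $ i * \<phi> x)"
  by (simp add: has_weak_gradient_def)

text \<open>Tests the weak gradient with y \<mapsto> \<open>mollifier n (x - y)\<close>;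
  differentiating in y rather than in x produces the sign that cancels the one in the definition.
  Together with the derivative of a convolution this says that mollification commutes with the weak
  gradient.\<close>

lemma weak_gradient_mollifier:
  assumes "has_weak_gradient u g"
  shows "conv (\<lambda>z. mollifier_grad n z \<bullet> h) u x = conv (mollifier n) g x \<bullet> h"
proof -
  have u: "loc_int u" and g: "loc_int g" using assms by (auto simp: has_weak_gradient_def intro: locally_integrable_loc_int)
  have "(\<lambda>h. conv (\<lambda>z. mollifier_grad n z \<bullet> h) u x) = (\<lambda>h. conv (mollifier n) g x \<bullet> h)"
  proof (rule linear_eq_stdbasis)
    show "linear (\<lambda>h. conv (\<lambda>z. mollifier_grad n z \<bullet> h) u x)"
      by (rule bounded_linear.linear[OF has_derivative_bounded_linear[OF conv_mollifier_has_derivative[OF u]]])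
    show "linear (\<lambda>h. conv (mollifier n) g x \<bullet> h)"
      by (rule bounded_linear.linear[OF bounded_linear_inner_right])
    fix b :: "real^3" assume "b \<in> Basis"
    then obtain i where b: "b = axis i 1" by (auto simp: Basis_vec_def)
    have "(LINT y|lborel. u y * (- (mollifier_grad n (x - y) $ i))) = - (LINT y|lborel. g y $ i * mollifier n (x - y))"
      using has_weak_gradientD[OF assms test_function_mollifier(1)[of n x], of i]
      by (simp only: test_function_mollifier(2))
    then show "conv (\<lambda>z. mollifier_grad n z \<bullet> b) u x = conv (mollifier n) g x \<bullet> b"
      using conv_mollifier_inner(1)[OF g, of n x b] by (simp add: b inner_axis conv_def mult.commute)
  qed
  then show ?thesis by metis
qed

text \<open>Testing the weak gradient with the partial derivatives of the mollifier reduces the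
  symmetry of the mollified Hessian to that of the second derivatives of the kernel. This identity
  later eliminates the Hessian.\<close>

lemma weak_gradient_mollifier_symmetric:
  assumes "has_weak_gradient u g"
  shows "conv (\<lambda>z. mollifier_grad n z \<bullet> h) g x \<bullet> h' = conv (\<lambda>z. mollifier_grad n z \<bullet> h') g x \<bullet> h"
proof -
  have g: "loc_int g" using assms by (auto simp: has_weak_gradient_def intro: locally_integrable_loc_int)
  let ?D = "\<lambda>h. conv (\<lambda>z. mollifier_grad n z \<bullet> h) g x"
  have lin: "linear ?D"
    by (rule bounded_linear.linear[OF has_derivative_bounded_linear[OF conv_mollifier_has_derivative[OF g]]])
  have sym: "?D (axis i 1) \<bullet> axis j 1 = ?D (axis j 1) \<bullet> axis i 1" for i j
  proof -
    have *: "(LINT y|lborel. u y * partial_deriv i (\<lambda>y. mollifier_grad n (x - y) $ j) y) = - (LINT y|lborel. g y $ i * mollifier_grad n (x - y) $ j)" for i j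
      by (rule has_weak_gradientD[OF assms test_function_mollifier_grad(1)])
    have "(LINT y|lborel. g y $ i * mollifier_grad n (x - y) $ j) = (LINT y|lborel. g y $ j * mollifier_grad n (x - y) $ i)"
      using *[of i j] *[of j i] by (simp add: test_function_mollifier_grad(2)[of i n x j])
    then show ?thesis
      unfolding conv_mollifier_inner(2)[OF g] by (simp add: inner_axis mult.commute)
  qed
  have 1: "?D h \<bullet> axis j 1 = ?D (axis j 1) \<bullet> h" for h j
  proof -
    have "(\<lambda>h. ?D h \<bullet> axis j 1) = (\<lambda>h. ?D (axis j 1) \<bullet> h)"
    proof (rule linear_eq_stdbasis)
      show "linear (\<lambda>h. ?D h \<bullet> axis j 1)" using linear_compose[OF lin bounded_linear.linear[OF bounded_linear_inner_left]] by (simp add: o_def)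
      show "linear (\<lambda>h. ?D (axis j 1) \<bullet> h)" by (rule bounded_linear.linear[OF bounded_linear_inner_right])
    qed (auto simp: Basis_vec_def sym)
    then show ?thesis by metis
  qed
  have "(\<lambda>h'. ?D h \<bullet> h') = (\<lambda>h'. ?D h' \<bullet> h)"
  proof (rule linear_eq_stdbasis)
    show "linear (\<lambda>h'. ?D h \<bullet> h')" by (rule bounded_linear.linear[OF bounded_linear_inner_right])
    show "linear (\<lambda>h'. ?D h' \<bullet> h)" using linear_compose[OF lin bounded_linear.linear[OF bounded_linear_inner_left]] by (simp add: o_def)
  qed (auto simp: Basis_vec_def 1)
  then show ?thesis by metis
qed

text \<open>As h is only locally integrable, it is cut off at radius R + 1 before the L1 convergence
  is applied; on the ball of radius R the mollifiers, supported in radius at most 1, do not notice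
  the cutoff.\<close>

lemma conv_mollifier_eq_0_imp_AE:
  fixes h :: "'a::euclidean_space \<Rightarrow> 'b::euclidean_space"
  assumes h: "loc_int h" and 0: "\<And>n x. conv (mollifier n) h x = 0"
  shows "AE x in lborel. h x = 0"
proof -
  have [measurable]: "h \<in> borel_measurable borel" using h by (simp add: loc_int_def)
  have "AE x in lborel. x \<in> cball 0 (real R) \<longrightarrow> h x = 0" for R :: nat
  proof -
    define hR where "hR x = indicator (cball 0 (real R + 1)) x *\<^sub>R h x" for x
    have hR: "integrable lborel hR" using h by (simp add: loc_int_def hR_def[abs_def])
    have [measurable]: "cball 0 (real R) \<in> sets (borel :: 'a measure)" by (simp add: borel_closed)
    have lim: "(\<lambda>n. \<integral>\<^sup>+x. ennreal (norm (conv (mollifier n) hR x - 1 *\<^sub>R hR x)) \<partial>lborel) \<longlonglongrightarrow> 0"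
      by (rule approx_id_L1[OF approx_id_mollifier hR])
    have le: "(\<integral>\<^sup>+x. ennreal (norm (indicator (cball 0 (real R)) x *\<^sub>R h x)) \<partial>lborel) \<le> (\<integral>\<^sup>+x. ennreal (norm (conv (mollifier n) hR x - 1 *\<^sub>R hR x)) \<partial>lborel)" for n
    proof (intro nn_integral_mono)
      fix x
      show "ennreal (norm (indicator (cball 0 (real R)) x *\<^sub>R h x)) \<le> ennreal (norm (conv (mollifier n) hR x - 1 *\<^sub>R hR x))"
      proof (cases "norm x \<le> real R")
        case True
        have "conv (mollifier n) hR x = conv (mollifier n) h x"
          unfolding conv_def
        proof (intro Bochner_Integration.integral_cong refl)
          fix y
          show "mollifier n (x - y) *\<^sub>R hR y = mollifier n (x - y) *\<^sub>R h y"
          proof (cases "norm y \<le> real R + 1")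
            case False
            have "norm y \<le> norm x + norm (x - y)" using norm_triangle_sub[of y x] by (simp add: norm_minus_commute)
            moreover have "inverse (real (Suc n)) \<le> 1" by (simp add: inverse_le_1_iff)
            ultimately have "inverse (real (Suc n)) < norm (x - y)" using True False by linarith
            then show ?thesis by (simp add: mollifier_outside(1))
          qed (simp add: hR_def)
        qed
        then show ?thesis using 0 True by (simp add: hR_def)
      qed simp
    qed
    have "(\<integral>\<^sup>+x. ennreal (norm (indicator (cball 0 (real R)) x *\<^sub>R h x)) \<partial>lborel) \<le> 0"
      by (rule tendsto_lowerbound[OF lim]) (use le in auto)
    then have "(\<integral>\<^sup>+x. ennreal (norm (indicator (cball 0 (real R)) x *\<^sub>R h x)) \<partial>lborel) = 0" by simp
    then have "AE x in lborel. ennreal (norm (indicator (cball 0 (real R)) x *\<^sub>R h x)) = 0"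
      by (subst (asm) nn_integral_0_iff_AE) auto
    then show ?thesis by eventually_elim (auto split: split_indicator_asm)
  qed
  then have "AE x in lborel. \<forall>R::nat. x \<in> cball 0 (real R) \<longrightarrow> h x = 0" by (subst AE_all_countable) blast
  then show ?thesis
  proof eventually_elim
    case (elim x)
    obtain R :: nat where "norm x \<le> real R" using real_arch_simple by blast
    then show ?case using elim by auto
  qed
qed

text \<open>Two weak gradients of u have the same mollifications, since both give the derivative of
  the mollified u.\<close>

lemma weak_gradient_unique:
  assumes a: "has_weak_gradient u g" and b: "has_weak_gradient u g'"
  shows "AE x in lborel. g x = g' x"
proof -
  have g: "loc_int g" "loc_int g'" using assms by (auto simp: has_weak_gradient_def intro: locally_integrable_loc_int)
  have "AE x in lborel. g x - g' x = 0"
  proof (rule conv_mollifier_eq_0_imp_AE)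
    show "loc_int (\<lambda>x. g x - g' x)" using g by (auto simp: loc_int_def scaleR_diff_right)
    fix n x
    have "conv (mollifier n) (\<lambda>x. g x - g' x) x = conv (mollifier n) g x - conv (mollifier n) g' x"
      unfolding conv_def using conv_mollifier_integrable(1)[OF g(1)] conv_mollifier_integrable(1)[OF g(2)]
      by (simp add: scaleR_diff_right Bochner_Integration.integral_diff)
    also have "\<dots> = 0"
      using weak_gradient_mollifier[OF a] weak_gradient_mollifier[OF b] by (metis right_minus_eq vector_eq_rdot)
    finally show "conv (mollifier n) (\<lambda>x. g x - g' x) x = 0" .
  qed
  then show ?thesis by simp
qed

lemma has_derivative_C1_continuous_on:
  "(\<And>x. (f has_derivative (\<lambda>h. G x \<bullet> h)) (at x)) \<Longrightarrow> continuous_on UNIV f"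
  by (rule has_derivative_imp_continuous_on_UNIV)

lemma test_function_facts:
  assumes "test_function \<phi>"
  obtains G B where "\<And>x. (\<phi> has_derivative (\<lambda>h. G x \<bullet> h)) (at x)" "continuous_on UNIV G"
    "\<And>x i. G x $ i = partial_deriv i \<phi> x" "\<And>x. \<bar>\<phi> x\<bar> \<le> B" "\<And>x. norm (G x) \<le> B"
proof -
  define G where "G x = (\<chi> i. partial_deriv i \<phi> x)" for x
  have Ck: "Ck (Suc 0) \<phi>" using assms unfolding test_function_def by blast
  then have cG: "continuous_on UNIV G" and diff: "\<phi> differentiable (at x)" for x
    by (auto simp: G_def[abs_def] intro!: continuous_on_vec_lambda)
  have d: "(\<phi> has_derivative (\<lambda>h. G x \<bullet> h)) (at x)" for x
  proof -
    have fd: "(\<phi> has_derivative frechet_derivative \<phi> (at x)) (at x)" using diff by (simp add: frechet_derivative_works)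
    have "frechet_derivative \<phi> (at x) = (\<lambda>h. G x \<bullet> h)"
    proof (rule linear_eq_stdbasis)
      show "linear (frechet_derivative \<phi> (at x))" by (rule bounded_linear.linear[OF has_derivative_bounded_linear[OF fd]])
      show "linear (\<lambda>h. G x \<bullet> h)" by (rule bounded_linear.linear[OF bounded_linear_inner_right])
    qed (auto simp: Basis_vec_def G_def partial_deriv_def inner_axis)
    with fd show ?thesis by simp
  qed
  have "bounded {x. \<phi> x \<noteq> 0}" using assms by (simp add: test_function_def compact_closure)
  then obtain R where R: "\<And>x. \<phi> x \<noteq> 0 \<Longrightarrow> norm x \<le> R" unfolding bounded_iff by auto
  have G0: "G x = 0" if "R < norm x" for x
  proof -
    have "(\<phi> has_derivative (\<lambda>h. 0)) (at x)"
    proof (rule has_derivative_transform_within_open[of "\<lambda>_. 0"])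
      show "open {x::real^3. R < norm x}" by (intro open_Collect_less continuous_intros)
    qed (use that R in \<open>force+\<close>)
    with d[of x] have "(\<lambda>h. G x \<bullet> h) = (\<lambda>h. 0)" by (rule has_derivative_unique)
    then show ?thesis by (metis inner_eq_zero_iff)
  qed
  obtain B1 where "B1 > 0" "\<And>x. norm (\<phi> x) \<le> B1"
    using compact_support_bounded[of \<phi> R] has_derivative_C1_continuous_on[OF d] R by (metis not_le)
  moreover obtain B2 where "B2 > 0" "\<And>x. norm (G x) \<le> B2"
    using compact_support_bounded[of G R] cG G0 by metis
  ultimately show ?thesis
    using that[OF d cG, of "max B1 B2"] by (force simp: G_def le_max_iff_disj)
qed

section \<open>Sobolev functions, mollification and the weak chain rule\<close>

text \<open>Carries a square integrable weak gradient along with the function, so the choice made in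
  \<open>weak_gradient\<close> is met only where the energy and the norm are unfolded.\<close>

definition H1_pair :: "(real^3 \<Rightarrow> real) \<Rightarrow> (real^3 \<Rightarrow> real^3) \<Rightarrow> bool" where
  "H1_pair u g \<longleftrightarrow> L2 u \<and> L2 g \<and> has_weak_gradient u g"

lemma H1_pairD: "H1_pair u g \<Longrightarrow> L2 u" "H1_pair u g \<Longrightarrow> L2 g" "H1_pair u g \<Longrightarrow> has_weak_gradient u g"
  by (auto simp: H1_pair_def)

lemma test_function_L2:
  assumes tf: "test_function \<phi>"
  shows "L2 \<phi>" "L2 (partial_deriv i \<phi>)"
proof -
  obtain F B where F: "\<And>x. (\<phi> has_derivative (\<lambda>h. F x \<bullet> h)) (at x)" "continuous_on UNIV F"
    "\<And>x i. F x $ i = partial_deriv i \<phi> x" "\<And>x. \<bar>\<phi> x\<bar> \<le> B" "\<And>x. norm (F x) \<le> B"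
    using test_function_facts[OF tf] by metis
  have "bounded {x. \<phi> x \<noteq> 0}" using tf by (simp add: test_function_def compact_closure)
  then obtain R where R: "\<And>x. \<phi> x \<noteq> 0 \<Longrightarrow> norm x \<le> R" unfolding bounded_iff by auto
  have F0: "F x = 0" if "R < norm x" for x
  proof -
    have "(\<phi> has_derivative (\<lambda>h. 0)) (at x)"
    proof (rule has_derivative_transform_within_open[of "\<lambda>_. 0"])
      show "open {x::real^3. R < norm x}" by (intro open_Collect_less continuous_intros)
    qed (use that R in \<open>force+\<close>)
    with F(1)[of x] have "(\<lambda>h. F x \<bullet> h) = (\<lambda>h. 0)" by (rule has_derivative_unique)
    then show ?thesis by (metis inner_eq_zero_iff)
  qed
  have m: "\<phi> \<in> borel_measurable borel" "(\<lambda>x. F x $ i) \<in> borel_measurable borel"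
    by (auto intro!: borel_measurable_continuous_onI has_derivative_C1_continuous_on[OF F(1)] continuous_intros F(2))
  show "L2 \<phi>"
  proof (rule L2_bound[OF L2_indicator_cball[of 0 R] m(1), of B])
    fix x show "norm (\<phi> x) \<le> B * norm (indicator (cball 0 R) x :: real)"
      using F(4)[of x] R[of x] by (cases "norm x \<le> R") auto
  qed
  have "L2 (\<lambda>x. F x $ i)"
  proof (rule L2_bound[OF L2_indicator_cball[of 0 R] m(2), of B])
    fix x show "norm (F x $ i) \<le> B * norm (indicator (cball 0 R) x :: real)"
      using component_le_norm_cart[of "F x" i] F(5)[of x] F0[of x] by (cases "norm x \<le> R") auto
  qed
  then show "L2 (partial_deriv i \<phi>)" by (simp add: F(3)[abs_def])
qed

text \<open>The derivative of the product of v with a test function has vanishing integral; square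
  integrability of v and G supplies all integrability.\<close>

lemma C1_imp_H1_pair:
  assumes d: "\<And>x. (v has_derivative (\<lambda>h. G x \<bullet> h)) (at x)" and c: "continuous_on UNIV G" and v: "L2 v" "L2 G"
  shows "H1_pair v G"
proof -
  have "(LINT x|lborel. v x * partial_deriv i \<phi> x) = - (LINT x|lborel. G x $ i * \<phi> x)" if tf: "test_function \<phi>" for \<phi> i
  proof -
    obtain F B where F: "\<And>x. (\<phi> has_derivative (\<lambda>h. F x \<bullet> h)) (at x)" "continuous_on UNIV F"
      "\<And>x i. F x $ i = partial_deriv i \<phi> x" "\<And>x. \<bar>\<phi> x\<bar> \<le> B" "\<And>x. norm (F x) \<le> B"
      using test_function_facts[OF tf] by metis
    have \<phi>c: "continuous_on UNIV \<phi>" by (rule has_derivative_C1_continuous_on[OF F(1)])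
    have L\<phi>: "L2 \<phi>" by (rule test_function_L2[OF tf])
    have LF: "L2 (\<lambda>x. F x $ i)" using test_function_L2(2)[OF tf, of i] by (simp add: F(3)[abs_def])
    have LG: "L2 (\<lambda>x. G x $ i)" using L2_inner_const[OF v(2), of "axis i 1"] by (simp add: inner_axis)
    have "(LINT x|lborel. v x * (F x \<bullet> axis i 1) + G x \<bullet> axis i 1 * \<phi> x) = 0"
    proof (rule integral_directional_derivative_eq_0[of "\<lambda>x. v x * \<phi> x" "\<lambda>x h. v x * (F x \<bullet> h) + (G x \<bullet> h) * \<phi> x"])
      show "continuous_on UNIV (\<lambda>x. v x * (F x \<bullet> axis i 1) + G x \<bullet> axis i 1 * \<phi> x)"
        by (intro continuous_intros has_derivative_C1_continuous_on[OF d] F(2) \<phi>c c)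
      show "integrable lborel (\<lambda>x. v x * \<phi> x)" by (rule L2_integrable_mult[OF v(1) L\<phi>])
      show "integrable lborel (\<lambda>x. v x * (F x \<bullet> axis i 1) + G x \<bullet> axis i 1 * \<phi> x)"
        using L2_integrable_mult[OF v(1) LF] L2_integrable_mult[OF LG L\<phi>] by (simp add: inner_axis)
    qed (rule has_derivative_mult[OF d F(1)])
    then show ?thesis
      using L2_integrable_mult[OF v(1) LF] L2_integrable_mult[OF LG L\<phi>]
      by (simp add: inner_axis F(3))
  qed
  then show ?thesis using v by (simp add: H1_pair_def has_weak_gradient_def L2_loc_int loc_int_locally_integrable)
qed

lemma L2_imp_L2_conv_mollifier:
  fixes w :: "'a::euclidean_space \<Rightarrow> 'b::euclidean_space"
  assumes "L2 w" shows "L2 (conv (mollifier n) w)" "L2 (conv (\<lambda>z. mollifier_grad n z \<bullet> h) w)"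
    "(LINT x|lborel. (norm (conv (mollifier n) w x))\<^sup>2) \<le> (LINT x|lborel. (norm (w x))\<^sup>2)"
  using Young_L2[OF assms mollifier_integrable(1), of n] mollifier_abs_integral[of n, where 'a='a] Young_L2(1)[OF assms integrable_inner_left[OF mollifier_integrable(2)], of n h] by auto

text \<open>The bound depends on n and is used only qualitatively, to place powers of mollified
  functions in L2.\<close>

lemma conv_mollifier_bounded:
  fixes w :: "'a::euclidean_space \<Rightarrow> 'b::euclidean_space"
  assumes w: "L2 w"
  obtains B where "\<And>x. norm (conv (mollifier n) w x) \<le> B"
proof -
  note [measurable] = L2_measurable[OF w]
  have "continuous_on UNIV (\<lambda>z::'a. (norm (mollifier n z))\<^sup>2)" by (intro continuous_intros continuous_mollifier)
  from compact_support_integrable[OF this, of "inverse (real (Suc n))"]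
  have Lm: "L2 (mollifier n :: 'a \<Rightarrow> real)" using mollifier_outside(1)[of n]
    by (auto simp: L2_def intro!: borel_measurable_continuous_onI continuous_mollifier)
  have [measurable]: "(mollifier n :: 'a \<Rightarrow> real) \<in> borel_measurable borel" by (rule L2_measurable[OF Lm])
  have "norm (conv (mollifier n) w x) \<le> (LINT y|lborel. (norm (mollifier n (y::'a)))\<^sup>2) + (LINT y|lborel. (norm (w y))\<^sup>2)" for x
  proof -
    have Lm': "integrable lborel (\<lambda>y. (norm (mollifier n (x - y)))\<^sup>2)"
      using integrable_reflect[of "\<lambda>y. (norm (mollifier n y :: real))\<^sup>2" x] L2_integrable[OF Lm] by simp
    have "norm (conv (mollifier n) w x) \<le> (LINT y|lborel. norm (mollifier n (x - y) *\<^sub>R w y))"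
      unfolding conv_def by (rule integral_norm_bound)
    also have "\<dots> \<le> (LINT y|lborel. (norm (mollifier n (x - y)))\<^sup>2 + (norm (w y))\<^sup>2)"
    proof (rule integral_mono)
      show "integrable lborel (\<lambda>y. norm (mollifier n (x - y) *\<^sub>R w y))"
        by (intro integrable_norm conv_mollifier_integrable L2_loc_int w)
      show "integrable lborel (\<lambda>y. (norm (mollifier n (x - y)))\<^sup>2 + (norm (w y))\<^sup>2)" using Lm' L2_integrable[OF w] by auto
      fix y
      have "2 * norm (mollifier n (x - y)) * norm (w y) \<le> (norm (mollifier n (x - y)))\<^sup>2 + (norm (w y))\<^sup>2" by (rule sum_squares_bound)
      moreover have "0 \<le> norm (mollifier n (x - y)) * norm (w y)" by simp
      ultimately show "norm (mollifier n (x - y) *\<^sub>R w y) \<le> (norm (mollifier n (x - y)))\<^sup>2 + (norm (w y))\<^sup>2"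
        unfolding norm_scaleR real_norm_def by linarith
    qed
    also have "\<dots> = (LINT y|lborel. (norm (mollifier n (y::'a)))\<^sup>2) + (LINT y|lborel. (norm (w y))\<^sup>2)"
      using Lm' L2_integrable[OF w] integral_reflect[of "\<lambda>y. (norm (mollifier n y :: real))\<^sup>2" x] by simp
    finally show ?thesis .
  qed
  then show ?thesis using that by blast
qed

lemma H1_pair_mollify:
  assumes "H1_pair u g"
  defines "un \<equiv> \<lambda>n. conv (mollifier n) u" and "gn \<equiv> \<lambda>n. conv (mollifier n) g"
  shows "\<And>n x. (un n has_derivative (\<lambda>h. gn n x \<bullet> h)) (at x)" "\<And>n. continuous_on UNIV (un n)" "\<And>n. continuous_on UNIV (gn n)"
    "\<And>n. L2 (un n)" "\<And>n. L2 (gn n)" "L2_tendsto un u" "L2_tendsto gn g" "\<And>n. H1_pair (un n) (gn n)"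
proof -
  have L: "loc_int u" "loc_int g" using H1_pairD[OF assms(1)] by (auto intro: L2_loc_int)
  show d: "(un n has_derivative (\<lambda>h. gn n x \<bullet> h)) (at x)" for n x
    using conv_mollifier_has_derivative[OF L(1)] weak_gradient_mollifier[OF H1_pairD(3)[OF assms(1)]] by (simp add: un_def gn_def)
  show c: "continuous_on UNIV (un n)" "continuous_on UNIV (gn n)" for n
    unfolding un_def gn_def by (rule conv_mollifier_continuous[OF L(1)] conv_mollifier_continuous[OF L(2)])+
  show l: "L2 (un n)" "L2 (gn n)" for n
    unfolding un_def gn_def by (rule L2_imp_L2_conv_mollifier[OF H1_pairD(1)[OF assms(1)]] L2_imp_L2_conv_mollifier[OF H1_pairD(2)[OF assms(1)]])+
  show "L2_tendsto un u" "L2_tendsto gn g"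
    using approx_id_L2[OF approx_id_mollifier H1_pairD(1)[OF assms(1)]] approx_id_L2[OF approx_id_mollifier H1_pairD(2)[OF assms(1)]]
    by (simp_all add: un_def gn_def)
  show "H1_pair (un n) (gn n)" for n by (rule C1_imp_H1_pair[OF d c(2) l])
qed

lemma C1_integration_by_parts:
  fixes v \<eta> :: "'a::euclidean_space \<Rightarrow> real"
  assumes v: "\<And>x. (v has_derivative v' x) (at x)" "continuous_on UNIV (\<lambda>x. v' x e)"
    and \<eta>: "\<And>x. (\<eta> has_derivative \<eta>' x) (at x)" "continuous_on UNIV (\<lambda>x. \<eta>' x e)"
    and i: "integrable lborel (\<lambda>x. v x * \<eta> x)" "integrable lborel (\<lambda>x. v x * \<eta>' x e)" "integrable lborel (\<lambda>x. v' x e * \<eta> x)"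
  shows "(LINT x|lborel. v x * \<eta>' x e) = - (LINT x|lborel. v' x e * \<eta> x)"
proof -
  have "(LINT x|lborel. v x * \<eta>' x e + v' x e * \<eta> x) = 0"
    by (rule integral_directional_derivative_eq_0[where D="\<lambda>x h. v x * \<eta>' x h + v' x h * \<eta> x", OF has_derivative_mult[OF v(1) \<eta>(1)] _ i(1)])
       (use i in \<open>auto intro!: continuous_intros v(2) \<eta>(2) has_derivative_imp_continuous_on_UNIV[OF v(1)] has_derivative_imp_continuous_on_UNIV[OF \<eta>(1)]\<close>)
  then show ?thesis using i by simp
qed

text \<open>Makes composition with \<Gamma> continuous from L2 to L1 although \<Gamma> itself may
  grow quadratically.\<close>

lemma primitive_Lipschitz_bound:
  fixes \<Gamma> \<gamma> :: "real \<Rightarrow> real"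
  assumes d: "\<And>t. (\<Gamma> has_real_derivative \<gamma> t) (at t)" and 0: "\<gamma> 0 = 0" and L: "\<And>a b. \<bar>\<gamma> a - \<gamma> b\<bar> \<le> L * \<bar>a - b\<bar>"
  shows "\<bar>\<Gamma> a - \<Gamma> b\<bar> \<le> L * (\<bar>a\<bar> + \<bar>b\<bar>) * \<bar>a - b\<bar>"
proof -
  have L0: "L \<ge> 0" using L[of 1 0] by simp
  have "norm (\<Gamma> a - \<Gamma> b) \<le> (L * (\<bar>a\<bar> + \<bar>b\<bar>)) * norm (a - b)"
  proof (rule field_differentiable_bound[where S="{- (\<bar>a\<bar> + \<bar>b\<bar>)..\<bar>a\<bar> + \<bar>b\<bar>}"])
    fix z assume z: "z \<in> {- (\<bar>a\<bar> + \<bar>b\<bar>)..\<bar>a\<bar> + \<bar>b\<bar>}"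
    show "(\<Gamma> has_real_derivative \<gamma> z) (at z within {- (\<bar>a\<bar> + \<bar>b\<bar>)..\<bar>a\<bar> + \<bar>b\<bar>})" by (rule has_field_derivative_at_within[OF d])
    have "norm (\<gamma> z) \<le> L * \<bar>z\<bar>" using L[of z 0] 0 by simp
    also have "\<dots> \<le> L * (\<bar>a\<bar> + \<bar>b\<bar>)" using z L0 by (intro mult_left_mono) auto
    finally show "norm (\<gamma> z) \<le> L * (\<bar>a\<bar> + \<bar>b\<bar>)" .
  qed auto
  then show ?thesis by simp
qed

lemma L2_tendsto_abs_diff:
  fixes f :: "nat \<Rightarrow> 'a::euclidean_space \<Rightarrow> real"
  assumes f: "L2_tendsto f g"
  shows "(\<lambda>n. LINT x|lborel. (\<bar>f n x\<bar> + \<bar>g x\<bar>) * \<bar>f n x - g x\<bar>) \<longlonglongrightarrow> 0"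
proof -
  note L = L2_tendstoD[OF f]
  have [measurable]: "f n \<in> borel_measurable borel" "g \<in> borel_measurable borel" for n using L by (auto simp: L2_def)
  have La: "L2 (\<lambda>x. \<bar>f n x\<bar>)" "L2 (\<lambda>x. \<bar>g x\<bar>)" for n using L by (auto simp: L2_def)
  have 1: "L2_tendsto (\<lambda>n x. \<bar>f n x\<bar> + \<bar>g x\<bar>) (\<lambda>x. \<bar>g x\<bar> + \<bar>g x\<bar>)"
    by (rule L2_tendsto_bound[OF L2_add[OF La(1) La(2)] L2_add[OF La(2) La(2)] f, where K=1]) auto
  have 2: "L2_tendsto (\<lambda>n x. \<bar>f n x - g x\<bar>) (\<lambda>x. 0)"
    by (rule L2_tendsto_bound[OF _ _ f, of _ _ 1]) (use L2_diff[OF L(1) L(2)] in \<open>auto simp: L2_def\<close>)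
  from L2_tendsto_mult[OF 1 2] show ?thesis by simp
qed

lemma L2_comp_Lipschitz:
  assumes "L2 f" "\<gamma> 0 = 0" "\<And>a b. \<bar>\<gamma> a - \<gamma> b\<bar> \<le> L * \<bar>a - b\<bar>" "\<gamma> \<in> borel_measurable borel"
  shows "L2 (\<lambda>x. \<gamma> (f x) :: real)"
proof (rule L2_bound[OF assms(1)])
  note [measurable] = assms(4) L2_measurable[OF assms(1)]
  show "(\<lambda>x. \<gamma> (f x)) \<in> borel_measurable borel" by measurable
  show "norm (\<gamma> (f x)) \<le> L * norm (f x)" for x using assms(3)[of "f x" 0] assms(2) by simp
qed

text \<open>Formulated for Lipschitz \<gamma> with \<gamma>(0) = 0 so that \<Gamma>(t) = t^2 is
  covered: \<Gamma>(u) is then only integrable, and the weight \<eta> has to be bounded. Both sides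
  pass to the limit along mollifications, the left one in L1, the right one as a pairing of two L2
  convergent sequences.\<close>

lemma weak_chain:
  fixes \<eta> :: "real^3 \<Rightarrow> real"
  assumes W: "H1_pair u g"
    and \<gamma>: "\<And>t. (\<Gamma> has_real_derivative \<gamma> t) (at t)" "\<Gamma> 0 = 0" "\<gamma> 0 = 0" "\<And>a b. \<bar>\<gamma> a - \<gamma> b\<bar> \<le> L * \<bar>a - b\<bar>"
    and \<eta>: "\<And>x. (\<eta> has_derivative \<eta>' x) (at x)" "continuous_on UNIV (\<lambda>x. \<eta>' x e)" "\<And>x. \<bar>\<eta> x\<bar> \<le> K" "\<And>x. \<bar>\<eta>' x e\<bar> \<le> K"
  shows "integrable lborel (\<lambda>x. \<Gamma> (u x) * \<eta>' x e)" "integrable lborel (\<lambda>x. \<eta> x * \<gamma> (u x) * (g x \<bullet> e))"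
    and "(LINT x|lborel. \<Gamma> (u x) * \<eta>' x e) = - (LINT x|lborel. \<eta> x * \<gamma> (u x) * (g x \<bullet> e))"
proof -
  define un where "un n = conv (mollifier n) u" for n
  define gn where "gn n = conv (mollifier n) g" for n
  note m = H1_pair_mollify[OF W, folded un_def gn_def]
  have \<Gamma>c: "continuous_on UNIV \<Gamma>" using \<gamma>(1) by (meson DERIV_isCont continuous_at_imp_continuous_on)
  have "L-lipschitz_on UNIV \<gamma>" using \<gamma>(4) \<gamma>(4)[of 1 0] by (intro lipschitz_onI) (auto simp: dist_real_def)
  then have \<gamma>c: "continuous_on UNIV \<gamma>" by (rule lipschitz_on_continuous_on)
  have \<eta>c: "continuous_on UNIV \<eta>" by (rule has_derivative_imp_continuous_on_UNIV[OF \<eta>(1)])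
  note [measurable] = borel_measurable_continuous_onI[OF \<Gamma>c] borel_measurable_continuous_onI[OF \<gamma>c]
    borel_measurable_continuous_onI[OF \<eta>c] borel_measurable_continuous_onI[OF \<eta>(2)] L2_measurable[OF m(4)] L2_measurable[OF m(5)]
    L2_measurable[OF H1_pairD(1)[OF W]] L2_measurable[OF H1_pairD(2)[OF W]]
  have K: "K \<ge> 0" using \<eta>(3)[of 0] by linarith
  have L0: "L \<ge> 0" using \<gamma>(4)[of 1 0] by simp
  have \<Gamma>b: "\<bar>\<Gamma> a\<bar> \<le> L * a\<^sup>2" for a
    using primitive_Lipschitz_bound[OF \<gamma>(1,3,4), of a 0] \<gamma>(2) by (simp add: power2_eq_square mult.assoc)
  have L\<gamma>: "L2 v \<Longrightarrow> L2 (\<lambda>x. \<gamma> (v x))" for v :: "real^3 \<Rightarrow> real"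
    by (rule L2_comp_Lipschitz[OF _ \<gamma>(3,4)]) auto
  have L\<eta>\<gamma>: "L2 v \<Longrightarrow> L2 (\<lambda>x. \<eta> x * \<gamma> (v x))" for v :: "real^3 \<Rightarrow> real"
    using L2_bounded_scaleR[OF L\<gamma> _ \<eta>(3)] by auto
  have i1: "integrable lborel (\<lambda>x. \<Gamma> (v x) * \<psi> x)" if v: "L2 v" and \<psi>: "\<psi> \<in> borel_measurable borel" "\<And>x. \<bar>\<psi> x\<bar> \<le> K" for v \<psi> :: "real^3 \<Rightarrow> real"
  proof (rule Bochner_Integration.integrable_bound)
    note [measurable] = L2_measurable[OF v] \<psi>(1)
    show "integrable lborel (\<lambda>x. L * K * (norm (v x))\<^sup>2)" using L2_integrable[OF v] by simp
    show "(\<lambda>x. \<Gamma> (v x) * \<psi> x) \<in> borel_measurable lborel" by measurable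
    show "AE x in lborel. norm (\<Gamma> (v x) * \<psi> x) \<le> norm (L * K * (norm (v x))\<^sup>2)"
    proof (rule AE_I2)
      fix x
      have "norm (\<Gamma> (v x) * \<psi> x) \<le> (L * (v x)\<^sup>2) * K" unfolding real_norm_def abs_mult
        using \<Gamma>b \<psi>(2) L0 by (intro mult_mono) auto
      also have "\<dots> \<le> norm (L * K * (norm (v x))\<^sup>2)" using L0 K by (simp add: mult_ac)
      finally show "norm (\<Gamma> (v x) * \<psi> x) \<le> norm (L * K * (norm (v x))\<^sup>2)" .
    qed
  qed
  have i2: "integrable lborel (\<lambda>x. \<eta> x * \<gamma> (v x) * (f x \<bullet> e))" if "L2 v" "L2 f" for v and f :: "real^3 \<Rightarrow> real^3"
    by (rule L2_integrable_mult[OF L\<eta>\<gamma>[OF that(1)] L2_inner_const[OF that(2)]])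
  show I1: "integrable lborel (\<lambda>x. \<Gamma> (u x) * \<eta>' x e)" by (rule i1[OF H1_pairD(1)[OF W] _ \<eta>(4)]) measurable
  show "integrable lborel (\<lambda>x. \<eta> x * \<gamma> (u x) * (g x \<bullet> e))" by (rule i2[OF H1_pairD(1,2)[OF W]])
  have eq: "(LINT x|lborel. \<Gamma> (un n x) * \<eta>' x e) = - (LINT x|lborel. \<eta> x * \<gamma> (un n x) * (gn n x \<bullet> e))" for n
  proof -
    have "(LINT x|lborel. \<Gamma> (un n x) * \<eta>' x e) = - (LINT x|lborel. (gn n x \<bullet> e * \<gamma> (un n x)) * \<eta> x)"
    proof (rule C1_integration_by_parts[where v'="\<lambda>x h. gn n x \<bullet> h * \<gamma> (un n x)"])
      show "((\<lambda>x. \<Gamma> (un n x)) has_derivative (\<lambda>h. gn n x \<bullet> h * \<gamma> (un n x))) (at x)" for x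
        using has_derivative_compose[OF m(1) \<gamma>(1)[unfolded has_field_derivative_def]] by (simp add: mult.commute)
      show "continuous_on UNIV (\<lambda>x. gn n x \<bullet> e * \<gamma> (un n x))"
        by (intro continuous_intros m(3) continuous_on_compose2[OF \<gamma>c m(2)]) auto
      show "integrable lborel (\<lambda>x. \<Gamma> (un n x) * \<eta> x)" by (rule i1[OF m(4) _ \<eta>(3)]) measurable
      show "integrable lborel (\<lambda>x. \<Gamma> (un n x) * \<eta>' x e)" by (rule i1[OF m(4) _ \<eta>(4)]) measurable
      show "integrable lborel (\<lambda>x. gn n x \<bullet> e * \<gamma> (un n x) * \<eta> x)" using i2[OF m(4,5)] by (simp add: mult_ac)
    qed (use \<eta> in auto)
    then show ?thesis by (simp add: mult_ac)
  qed
  have lim1: "(\<lambda>n. LINT x|lborel. \<Gamma> (un n x) * \<eta>' x e) \<longlonglongrightarrow> (LINT x|lborel. \<Gamma> (u x) * \<eta>' x e)"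
  proof (rule LIM_zero_cancel, rule Lim_null_comparison)
    have I1n: "integrable lborel (\<lambda>x. \<Gamma> (un n x) * \<eta>' x e)" for n by (rule i1[OF m(4) _ \<eta>(4)]) measurable
    have Ld: "integrable lborel (\<lambda>x. (\<bar>un n x\<bar> + \<bar>u x\<bar>) * \<bar>un n x - u x\<bar>)" for n
    proof (rule L2_integrable_mult)
      have a: "L2 (\<lambda>x. \<bar>un n x\<bar>)" "L2 (\<lambda>x. \<bar>u x\<bar>)" using m(4)[of n] H1_pairD(1)[OF W] by (auto simp: L2_def)
      then show "L2 (\<lambda>x. \<bar>un n x\<bar> + \<bar>u x\<bar>)" by (rule L2_add)
      show "L2 (\<lambda>x. \<bar>un n x - u x\<bar>)" using L2_diff[OF m(4)[of n] H1_pairD(1)[OF W]] by (auto simp: L2_def)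
    qed
    show "\<forall>\<^sub>F n in sequentially. norm ((LINT x|lborel. \<Gamma> (un n x) * \<eta>' x e) - (LINT x|lborel. \<Gamma> (u x) * \<eta>' x e))
       \<le> L * K * (LINT x|lborel. (\<bar>un n x\<bar> + \<bar>u x\<bar>) * \<bar>un n x - u x\<bar>)"
    proof (intro always_eventually allI)
      fix n
      have "norm ((LINT x|lborel. \<Gamma> (un n x) * \<eta>' x e) - (LINT x|lborel. \<Gamma> (u x) * \<eta>' x e)) = norm (LINT x|lborel. \<Gamma> (un n x) * \<eta>' x e - \<Gamma> (u x) * \<eta>' x e)"
        by (simp add: Bochner_Integration.integral_diff[OF I1n I1])
      also have "\<dots> \<le> (LINT x|lborel. norm (\<Gamma> (un n x) * \<eta>' x e - \<Gamma> (u x) * \<eta>' x e))" by (rule integral_norm_bound)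
      also have "\<dots> \<le> (LINT x|lborel. L * K * ((\<bar>un n x\<bar> + \<bar>u x\<bar>) * \<bar>un n x - u x\<bar>))"
      proof (rule integral_mono)
        fix x
        have "norm (\<Gamma> (un n x) * \<eta>' x e - \<Gamma> (u x) * \<eta>' x e) = \<bar>\<Gamma> (un n x) - \<Gamma> (u x)\<bar> * \<bar>\<eta>' x e\<bar>"
          by (simp add: left_diff_distrib[symmetric] abs_mult)
        also have "\<dots> \<le> (L * (\<bar>un n x\<bar> + \<bar>u x\<bar>) * \<bar>un n x - u x\<bar>) * K"
          by (intro mult_mono primitive_Lipschitz_bound[OF \<gamma>(1,3,4)] \<eta>(4)) (use L0 in auto)
        finally show "norm (\<Gamma> (un n x) * \<eta>' x e - \<Gamma> (u x) * \<eta>' x e) \<le> L * K * ((\<bar>un n x\<bar> + \<bar>u x\<bar>) * \<bar>un n x - u x\<bar>)"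
          by (simp add: mult_ac)
      qed (intro integrable_norm Bochner_Integration.integrable_diff I1n I1 integrable_mult_right Ld)+
      also have "\<dots> = L * K * (LINT x|lborel. (\<bar>un n x\<bar> + \<bar>u x\<bar>) * \<bar>un n x - u x\<bar>)" by simp
      finally show "norm ((LINT x|lborel. \<Gamma> (un n x) * \<eta>' x e) - (LINT x|lborel. \<Gamma> (u x) * \<eta>' x e)) \<le> \<dots>" .
    qed
    show "(\<lambda>n. L * K * (LINT x|lborel. (\<bar>un n x\<bar> + \<bar>u x\<bar>) * \<bar>un n x - u x\<bar>)) \<longlonglongrightarrow> 0"
      using tendsto_mult[OF tendsto_const[of "L * K"] L2_tendsto_abs_diff[OF m(6)]] by simp
  qed
  have "L2_tendsto (\<lambda>n x. \<eta> x * \<gamma> (un n x)) (\<lambda>x. \<eta> x * \<gamma> (u x))"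
  proof (rule L2_tendsto_bound[OF L\<eta>\<gamma>[OF m(4)] L\<eta>\<gamma>[OF H1_pairD(1)[OF W]] m(6)])
    fix n x
    have "\<bar>\<eta> x\<bar> * \<bar>\<gamma> (un n x) - \<gamma> (u x)\<bar> \<le> K * (L * \<bar>un n x - u x\<bar>)"
      using \<eta>(3) \<gamma>(4) K by (intro mult_mono) auto
    then show "norm (\<eta> x * \<gamma> (un n x) - \<eta> x * \<gamma> (u x)) \<le> (K * L) * norm (un n x - u x)"
      by (simp add: right_diff_distrib[symmetric] abs_mult mult_ac)
  qed
  from L2_tendsto_mult[OF this L2_tendsto_inner_const[OF m(7), of e]]
  have "(\<lambda>n. - (LINT x|lborel. \<eta> x * \<gamma> (un n x) * (gn n x \<bullet> e))) \<longlonglongrightarrow> - (LINT x|lborel. \<eta> x * \<gamma> (u x) * (g x \<bullet> e))"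
    by (rule tendsto_minus)
  with lim1 show "(LINT x|lborel. \<Gamma> (u x) * \<eta>' x e) = - (LINT x|lborel. \<eta> x * \<gamma> (u x) * (g x \<bullet> e))"
    unfolding eq by (rule LIMSEQ_unique)
qed

text \<open>The case \<Gamma>(t) = t falls outside \<open>weak_chain\<close>, where \<gamma>(0) = 0,
  and u need not be integrable; square integrable weights take the place of bounded ones. The Riesz
  fields are such weights.\<close>

lemma weak_linear:
  fixes \<eta> :: "real^3 \<Rightarrow> real"
  assumes W: "H1_pair u g"
    and \<eta>: "\<And>x. (\<eta> has_derivative \<eta>' x) (at x)" "continuous_on UNIV (\<lambda>x. \<eta>' x e)" "L2 \<eta>" "L2 (\<lambda>x. \<eta>' x e)"
  shows "(LINT x|lborel. u x * \<eta>' x e) = - (LINT x|lborel. \<eta> x * (g x \<bullet> e))"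
proof -
  define un where "un n = conv (mollifier n) u" for n
  define gn where "gn n = conv (mollifier n) g" for n
  note m = H1_pair_mollify[OF W, folded un_def gn_def]
  have eq: "(LINT x|lborel. un n x * \<eta>' x e) = - (LINT x|lborel. (gn n x \<bullet> e) * \<eta> x)" for n
    by (rule C1_integration_by_parts[where v'="\<lambda>x h. gn n x \<bullet> h"])
       (auto intro!: \<eta> m L2_integrable_mult L2_inner_const continuous_intros)
  have "(\<lambda>n. LINT x|lborel. un n x * \<eta>' x e) \<longlonglongrightarrow> (LINT x|lborel. u x * \<eta>' x e)"
    by (rule L2_tendsto_mult[OF m(6) L2_tendsto_const[OF \<eta>(4)]])
  moreover have "(\<lambda>n. - (LINT x|lborel. (gn n x \<bullet> e) * \<eta> x)) \<longlonglongrightarrow> - (LINT x|lborel. (g x \<bullet> e) * \<eta> x)"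
    by (intro tendsto_minus L2_tendsto_mult[OF L2_tendsto_inner_const[OF m(7)] L2_tendsto_const[OF \<eta>(3)]])
  ultimately show ?thesis unfolding eq by (simp add: LIMSEQ_unique mult.commute)
qed

section \<open>Bounded C1 vector fields\<close>

definition C1_field :: "(real^3 \<Rightarrow> real^3) \<Rightarrow> (real^3 \<Rightarrow> real^3 \<Rightarrow> real^3) \<Rightarrow> real \<Rightarrow> bool" where
  "C1_field Y Y' K \<longleftrightarrow> (\<forall>x. (Y has_derivative Y' x) (at x)) \<and> (\<forall>h. continuous_on UNIV (\<lambda>x. Y' x h))
     \<and> (\<forall>x. norm (Y x) \<le> K) \<and> (\<forall>x h. norm (Y' x h) \<le> K * norm h)"

definition divergence :: "(real^3 \<Rightarrow> real^3 \<Rightarrow> real^3) \<Rightarrow> real^3 \<Rightarrow> real" where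
  "divergence Y' x = (\<Sum>b\<in>Basis. Y' x b \<bullet> b)"

lemma C1_fieldD:
  assumes "C1_field Y Y' K"
  shows "(Y has_derivative Y' x) (at x)" "continuous_on UNIV (\<lambda>x. Y' x h)" "norm (Y x) \<le> K" "norm (Y' x h) \<le> K * norm h"
    "continuous_on UNIV Y" "continuous_on UNIV (divergence Y')" "\<bar>divergence Y' x\<bar> \<le> 3 * K"
proof -
  show a: "(Y has_derivative Y' x) (at x)" "continuous_on UNIV (\<lambda>x. Y' x h)" "norm (Y x) \<le> K" "norm (Y' x h) \<le> K * norm h" for x h
    using assms by (auto simp: C1_field_def)
  show "continuous_on UNIV Y" by (rule has_derivative_imp_continuous_on_UNIV[OF a(1)])
  show "continuous_on UNIV (divergence Y')"
    unfolding divergence_def[abs_def] by (intro continuous_intros a)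
  have "\<bar>divergence Y' x\<bar> \<le> (\<Sum>b\<in>(Basis::(real^3) set). K)"
    unfolding divergence_def
  proof (rule order_trans[OF sum_abs], rule sum_mono)
    fix b :: "real^3" assume b: "b \<in> Basis"
    have "\<bar>Y' x b \<bullet> b\<bar> \<le> norm (Y' x b) * norm b" by (rule Cauchy_Schwarz_ineq2)
    also have "\<dots> \<le> K" using a(4)[of x b] b by simp
    finally show "\<bar>Y' x b \<bullet> b\<bar> \<le> K" .
  qed
  then show "\<bar>divergence Y' x\<bar> \<le> 3 * K" by simp
qed

lemma C1_field_component:
  assumes Y: "C1_field Y Y' K" and b: "b \<in> Basis"
  shows "((\<lambda>x. Y x \<bullet> b) has_derivative (\<lambda>h. Y' x h \<bullet> b)) (at x)" "continuous_on UNIV (\<lambda>x. Y' x h \<bullet> b)"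
    "\<bar>Y x \<bullet> b\<bar> \<le> K" "\<bar>Y' x b \<bullet> b\<bar> \<le> K"
proof -
  show "((\<lambda>x. Y x \<bullet> b) has_derivative (\<lambda>h. Y' x h \<bullet> b)) (at x)"
    by (rule bounded_linear.has_derivative[OF bounded_linear_inner_left C1_fieldD(1)[OF Y]])
  show "continuous_on UNIV (\<lambda>x. Y' x h \<bullet> b)" by (intro continuous_intros C1_fieldD(2)[OF Y])
  show "\<bar>Y x \<bullet> b\<bar> \<le> K" using Basis_le_norm[OF b, of "Y x"] C1_fieldD(3)[OF Y, of x] by simp
  show "\<bar>Y' x b \<bullet> b\<bar> \<le> K" using Basis_le_norm[OF b, of "Y' x b"] C1_fieldD(4)[OF Y, of x b] b by simp
qed

lemma weak_chain_field:
  assumes W: "H1_pair u g"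
    and \<gamma>: "\<And>t. (\<Gamma> has_real_derivative \<gamma> t) (at t)" "\<Gamma> 0 = 0" "\<gamma> 0 = 0" "\<And>a b. \<bar>\<gamma> a - \<gamma> b\<bar> \<le> L * \<bar>a - b\<bar>"
    and Y: "C1_field Y Y' K"
  shows "(LINT x|lborel. \<Gamma> (u x) * divergence Y' x) = - (LINT x|lborel. \<gamma> (u x) * (Y x \<bullet> g x))"
proof -
  note c = C1_field_component[OF Y]
  have k: "integrable lborel (\<lambda>x. \<Gamma> (u x) * (Y' x b \<bullet> b))" "integrable lborel (\<lambda>x. (Y x \<bullet> b) * \<gamma> (u x) * (g x \<bullet> b))"
    "(LINT x|lborel. \<Gamma> (u x) * (Y' x b \<bullet> b)) = - (LINT x|lborel. (Y x \<bullet> b) * \<gamma> (u x) * (g x \<bullet> b))" if b: "b \<in> Basis" for b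
    by (rule weak_chain[OF W \<gamma> c(1)[OF b] c(2)[OF b] c(3)[OF b] c(4)[OF b]])+
  have "(LINT x|lborel. \<Gamma> (u x) * divergence Y' x) = (\<Sum>b\<in>Basis. LINT x|lborel. \<Gamma> (u x) * (Y' x b \<bullet> b))"
    unfolding divergence_def sum_distrib_left using k(1) by (rule Bochner_Integration.integral_sum)
  also have "\<dots> = - (\<Sum>b\<in>Basis. LINT x|lborel. (Y x \<bullet> b) * \<gamma> (u x) * (g x \<bullet> b))"
    using k(3) by (simp add: sum_negf)
  also have "(\<Sum>b\<in>Basis. LINT x|lborel. (Y x \<bullet> b) * \<gamma> (u x) * (g x \<bullet> b)) = (LINT x|lborel. (\<Sum>b\<in>Basis. (Y x \<bullet> b) * \<gamma> (u x) * (g x \<bullet> b)))"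
    using k(2) by (rule Bochner_Integration.integral_sum[symmetric])
  also have "\<dots> = (LINT x|lborel. \<gamma> (u x) * (Y x \<bullet> g x))"
    by (intro Bochner_Integration.integral_cong refl) (simp add: euclidean_inner[of "Y _" "g _"] sum_distrib_left mult_ac)
  finally show ?thesis .
qed

lemma weak_square_field:
  assumes W: "H1_pair u g" and Y: "C1_field Y Y' K"
  shows "(LINT x|lborel. (u x)\<^sup>2 * divergence Y' x) = - 2 * (LINT x|lborel. u x * (Y x \<bullet> g x))"
proof -
  have "(LINT x|lborel. (u x)\<^sup>2 * divergence Y' x) = - (LINT x|lborel. (2 * u x) * (Y x \<bullet> g x))"
    by (rule weak_chain_field[OF W _ _ _ _ Y, where L=2]) (auto intro!: derivative_eq_intros simp: abs_if)
  then show ?thesis by (simp add: mult.assoc)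
qed

section \<open>Hardy, Riesz and Sobolev inequalities\<close>

text \<open>The two measures are compared on half-lines, where the left one is the volume of a ball,
  so no angular variables are involved.\<close>

lemma distr_norm_lborel3:
  "distr (lborel :: (real^3) measure) borel norm = density lborel (\<lambda>r. ennreal (4 * pi * r\<^sup>2) * indicator {0..} r)" (is "?M = ?N")
proof (rule measure_eqI_generator_eq)
  show "Int_stable (range (atMost :: real \<Rightarrow> real set))"
    by (auto simp: Int_stable_def intro!: image_eqI[of _ _ "min _ _"])
  show "sets ?M = sigma_sets UNIV (range atMost)" "sets ?N = sigma_sets UNIV (range atMost)"
    by (simp_all add: borel_eq_atMost)
  show "range (\<lambda>n::nat. {..real n}) \<subseteq> range atMost" by auto
  show "(\<Union>n::nat. {..real n}) = UNIV" using real_arch_simple by auto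
  have M: "emeasure ?M {..a} = (if 0 \<le> a then ennreal (4/3 * pi * a^3) else 0)" for a
  proof -
    have "emeasure ?M {..a} = emeasure lborel (cball (0::real^3) a)"
      by (subst emeasure_distr) (auto simp: cball_def vimage_def)
    then show ?thesis by (auto simp: emeasure_cball unit_ball_vol_3)
  qed
  show "emeasure ?M {..real n} \<noteq> \<infinity>" for n by (simp add: M)
  show "emeasure ?M X = emeasure ?N X" if "X \<in> range atMost" for X
  proof -
    obtain a where X: "X = {..a}" using \<open>X \<in> range atMost\<close> by auto
    have "emeasure ?N X = (\<integral>\<^sup>+r. ennreal (4 * pi * r\<^sup>2) * indicator {0..} r * indicator {..a} r \<partial>lborel)"
      by (subst emeasure_density) (auto simp: X)
    also have "\<dots> = (\<integral>\<^sup>+r. ennreal (4 * pi * r\<^sup>2) * indicator {0..a} r \<partial>lborel)"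
      by (intro nn_integral_cong) (auto split: split_indicator)
    also have "\<dots> = (if 0 \<le> a then ennreal (4/3 * pi * a^3) else 0)"
    proof (cases "0 \<le> a")
      case True
      have "(\<integral>\<^sup>+r. ennreal (4 * pi * r\<^sup>2) * indicator {0..a} r \<partial>lborel) = ennreal (4/3 * pi * a^3 - 4/3 * pi * 0^3)"
        by (rule nn_integral_FTC_Icc) (use True in \<open>auto intro!: derivative_eq_intros\<close>)
      then show ?thesis using True by simp
    qed auto
    finally show ?thesis by (simp add: X M)
  qed
qed auto

lemma nn_integral_radial:
  assumes [measurable]: "f \<in> borel_measurable borel"
  shows "(\<integral>\<^sup>+x. f (norm (x::real^3)) \<partial>lborel) = (\<integral>\<^sup>+r. ennreal (4 * pi * r\<^sup>2) * f r * indicator {0..} r \<partial>lborel)"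
proof -
  have "(\<integral>\<^sup>+x. f (norm (x::real^3)) \<partial>lborel) = (\<integral>\<^sup>+r. f r \<partial>distr (lborel :: (real^3) measure) borel norm)"
    by (simp add: nn_integral_distr)
  also have "\<dots> = (\<integral>\<^sup>+r. ennreal (4 * pi * r\<^sup>2) * indicator {0..} r * f r \<partial>lborel)"
    unfolding distr_norm_lborel3 by (subst nn_integral_density) auto
  finally show ?thesis by (simp add: mult_ac)
qed

text \<open>The profile k is a function of the squared distance, so that the field is differentiable
  at its centre a as well.\<close>

definition radial_field :: "(real \<Rightarrow> real) \<Rightarrow> real^3 \<Rightarrow> real^3 \<Rightarrow> real^3" where
  "radial_field k a x = k ((norm (x - a))\<^sup>2) *\<^sub>R (x - a)"

definition radial_field_deriv :: "(real \<Rightarrow> real) \<Rightarrow> (real \<Rightarrow> real) \<Rightarrow> real^3 \<Rightarrow> real^3 \<Rightarrow> real^3 \<Rightarrow> real^3" where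
  "radial_field_deriv k k' a x h = k ((norm (x - a))\<^sup>2) *\<^sub>R h + (2 * k' ((norm (x - a))\<^sup>2) * ((x - a) \<bullet> h)) *\<^sub>R (x - a)"

lemma has_derivative_norm_square: "((\<lambda>x. (norm (x - a))\<^sup>2) has_derivative (\<lambda>h. 2 * ((x - a) \<bullet> h))) (at (x::'a::real_inner))"
  unfolding power2_norm_eq_inner by (auto intro!: derivative_eq_intros simp: inner_commute)

lemma radial_has_derivative:
  fixes x :: "'a::real_inner"
  assumes "\<And>s. 0 \<le> s \<Longrightarrow> (k has_real_derivative k' s) (at s)"
  shows "((\<lambda>x. k ((norm (x - a))\<^sup>2)) has_derivative (\<lambda>h. 2 * k' ((norm (x - a))\<^sup>2) * ((x - a) \<bullet> h))) (at x)"
  using has_derivative_compose[OF has_derivative_norm_square[of a x] assms[unfolded has_field_derivative_def, OF zero_le_power2[of "norm (x - a)"]]]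
  by (simp add: mult_ac)

lemma radial_field_deriv_bound:
  assumes "\<And>s. 0 \<le> s \<Longrightarrow> \<bar>k s\<bar> + 2 * \<bar>k' s\<bar> * s \<le> K"
  shows "norm (radial_field_deriv k k' a x h) \<le> K * norm h"
proof -
  let ?s = "(norm (x - a))\<^sup>2"
  have "norm (radial_field_deriv k k' a x h) \<le> \<bar>k ?s\<bar> * norm h + 2 * \<bar>k' ?s\<bar> * \<bar>(x - a) \<bullet> h\<bar> * norm (x - a)"
    unfolding radial_field_deriv_def by (rule order_trans[OF norm_triangle_ineq]) (simp add: abs_mult)
  also have "\<dots> \<le> \<bar>k ?s\<bar> * norm h + 2 * \<bar>k' ?s\<bar> * (norm (x - a) * norm h) * norm (x - a)"
    by (intro add_left_mono mult_right_mono mult_left_mono Cauchy_Schwarz_ineq2) auto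
  also have "\<dots> = (\<bar>k ?s\<bar> + 2 * \<bar>k' ?s\<bar> * ?s) * norm h" by (simp add: power2_eq_square algebra_simps)
  also have "\<dots> \<le> K * norm h" by (intro mult_right_mono assms) auto
  finally show ?thesis .
qed

lemma C1_radial_field:
  assumes k: "\<And>s. 0 \<le> s \<Longrightarrow> (k has_real_derivative k' s) (at s)" and k': "continuous_on {0..} k'"
    and K: "\<And>s. 0 \<le> s \<Longrightarrow> \<bar>k (s\<^sup>2)\<bar> * s \<le> K" "\<And>s. 0 \<le> s \<Longrightarrow> \<bar>k s\<bar> + 2 * \<bar>k' s\<bar> * s \<le> K"
  shows "C1_field (radial_field k a) (radial_field_deriv k k' a) K"
  unfolding C1_field_def
proof (intro conjI allI)
  fix x h :: "real^3"
  have d: "((\<lambda>x. k ((norm (x - a))\<^sup>2)) has_derivative (\<lambda>h. 2 * k' ((norm (x - a))\<^sup>2) * ((x - a) \<bullet> h))) (at x)" for x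
    by (rule radial_has_derivative[OF k])
  have "((\<lambda>x. k ((norm (x - a))\<^sup>2) *\<^sub>R (x - a)) has_derivative (\<lambda>h. k ((norm (x - a))\<^sup>2) *\<^sub>R h + (2 * k' ((norm (x - a))\<^sup>2) * ((x - a) \<bullet> h)) *\<^sub>R (x - a))) (at x)"
    by (rule has_derivative_scaleR[OF d]) (auto intro!: derivative_eq_intros)
  then show "(radial_field k a has_derivative radial_field_deriv k k' a x) (at x)"
    by (simp add: radial_field_def[abs_def] radial_field_deriv_def[abs_def])
  have "continuous_on UNIV (\<lambda>x. k' ((norm (x - a))\<^sup>2))"
    by (rule continuous_on_compose2[OF k']) (auto intro!: continuous_intros)
  then show "continuous_on UNIV (\<lambda>x. radial_field_deriv k k' a x h)"
    unfolding radial_field_deriv_def by (intro continuous_intros has_derivative_imp_continuous_on_UNIV[OF d])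
  show "norm (radial_field k a x) \<le> K" using K(1)[of "norm (x - a)"] by (simp add: radial_field_def)
  show "norm (radial_field_deriv k k' a x h) \<le> K * norm h" by (rule radial_field_deriv_bound[OF K(2)])
qed

lemma divergence_radial_field:
  "divergence (radial_field_deriv k k' a) x = 3 * k ((norm (x - a))\<^sup>2) + 2 * (norm (x - a))\<^sup>2 * k' ((norm (x - a))\<^sup>2)"
proof -
  have "divergence (radial_field_deriv k k' a) x = (\<Sum>b\<in>(Basis::(real^3) set). k ((norm (x - a))\<^sup>2) + 2 * k' ((norm (x - a))\<^sup>2) * (((x - a) \<bullet> b) * ((x - a) \<bullet> b)))"
    unfolding divergence_def radial_field_deriv_def
    by (intro sum.cong refl) (simp add: inner_add_left algebra_simps inner_same_Basis)
  also have "\<dots> = 3 * k ((norm (x - a))\<^sup>2) + 2 * k' ((norm (x - a))\<^sup>2) * ((x - a) \<bullet> (x - a))"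
    by (simp only: sum.distrib sum_distrib_left[symmetric] euclidean_inner[symmetric]) simp
  finally show ?thesis by (simp add: power2_norm_eq_inner mult_ac)
qed

lemma power2_add_pos: "0 < e \<Longrightarrow> 0 < (norm x)\<^sup>2 + (e::real)"
  by (simp add: add_nonneg_pos)

section \<open>Hardy's inequality\<close>

text \<open>Profile of the field (x-a)/(|x-a|^2 + e), whose divergence dominates the regularized
  Hardy weight.\<close>

abbreviation hardy_k :: "real \<Rightarrow> real \<Rightarrow> real" where "hardy_k e s \<equiv> inverse (s + e)"
abbreviation hardy_k' :: "real \<Rightarrow> real \<Rightarrow> real" where "hardy_k' e s \<equiv> - (inverse (s + e) * inverse (s + e))"

lemma C1_hardy_field:
  assumes e: "e > 0"
  shows "C1_field (radial_field (hardy_k e) a) (radial_field_deriv (hardy_k e) (hardy_k' e) a) (1 + 3 / e)"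
proof (rule C1_radial_field)
  fix s :: real assume s: "0 \<le> s"
  have pos: "s + e > 0" "s\<^sup>2 + e > 0" using s e by (auto intro: add_nonneg_pos)
  show "(hardy_k e has_real_derivative hardy_k' e s) (at s)"
    using pos by (auto intro!: derivative_eq_intros simp: power2_eq_square)
  have a: "inverse (s + e) \<le> 1 / e" using pos s e by (simp add: field_simps)
  have "s \<le> 1 + s\<^sup>2" using sum_squares_bound[of s 1] s by simp
  also have "\<dots> \<le> (1 + 1 / e) * (s\<^sup>2 + e)" using e by (simp add: field_simps)
  finally have "\<bar>inverse (s\<^sup>2 + e)\<bar> * s \<le> 1 + 1 / e" using pos by (simp add: field_simps)
  then show "\<bar>inverse (s\<^sup>2 + e)\<bar> * s \<le> 1 + 3 / e" using e by (simp add: field_simps)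
  have "inverse (s + e) * s \<le> 1" using pos e by (simp add: field_simps)
  then have "inverse (s + e) * (inverse (s + e) * s) \<le> (1/e) * 1" using a pos s e by (intro mult_mono) auto
  then show "\<bar>inverse (s + e)\<bar> + 2 * \<bar>hardy_k' e s\<bar> * s \<le> 1 + 3 / e"
    using a pos by (simp add: abs_mult mult.assoc)
qed (use e in \<open>auto intro!: continuous_intros simp: add_eq_0_iff\<close>)

text \<open>The divergence is 3/(s+e) - 2s/(s+e)^2 with s = |x-a|^2, and s/(s+e) <= 1.\<close>

lemma divergence_hardy:
  assumes e: "e > 0"
  shows "inverse ((norm (x - a))\<^sup>2 + e) \<le> divergence (radial_field_deriv (hardy_k e) (hardy_k' e) a) x"
proof -
  let ?s = "(norm (x - a))\<^sup>2"
  have pos: "?s + e > 0" using e by (rule power2_add_pos)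
  have "?s * inverse (?s + e) \<le> 1" using pos e by (simp add: field_simps)
  then have "(?s * inverse (?s + e)) * inverse (?s + e) \<le> 1 * inverse (?s + e)" using pos by (intro mult_right_mono) auto
  then show ?thesis by (simp add: divergence_radial_field)
qed

text \<open>Fatou in the form that removes a regularization: uniform bounds on the approximants pass
  to the almost everywhere limit.\<close>

lemma nn_integral_liminf_bound:
  assumes [measurable]: "\<And>n. f n \<in> borel_measurable M" "f0 \<in> borel_measurable M"
    and conv: "AE x in M. (\<lambda>n. f n x) \<longlonglongrightarrow> f0 x" and b: "\<And>n::nat. (\<integral>\<^sup>+x. f n x \<partial>M) \<le> C"
  shows "(\<integral>\<^sup>+x. f0 x \<partial>M) \<le> (C::ennreal)"
proof -
  have "(\<integral>\<^sup>+x. f0 x \<partial>M) = (\<integral>\<^sup>+x. liminf (\<lambda>n. f n x) \<partial>M)"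
    using conv by (intro nn_integral_cong_AE) (auto elim!: eventually_mono dest: lim_imp_Liminf[rotated])
  also have "\<dots> \<le> liminf (\<lambda>n. \<integral>\<^sup>+x. f n x \<partial>M)" by (rule nn_integral_liminf) measurable
  also have "\<dots> \<le> C" by (rule Liminf_le) (use b in \<open>auto intro: always_eventually\<close>)
  finally show ?thesis .
qed

text \<open>Pairing u^2 with the divergence of the field gives J <= 2 sqrt(J) sqrt(A) for the
  regularized integral J, which is finite because e > 0; dividing by sqrt(J) gives the constant 4.
  The bound is uniform in e and in the centre.\<close>

theorem hardy:
  assumes W: "H1_pair u g"
  shows "(\<integral>\<^sup>+x. ennreal ((u x)\<^sup>2 / (norm (x - a))\<^sup>2) \<partial>lborel) \<le> ennreal (4 * (LINT x|lborel. (norm (g x))\<^sup>2))"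
proof -
  note [measurable] = L2_measurable[OF H1_pairD(1)[OF W]] L2_measurable[OF H1_pairD(2)[OF W]]
  have e: "(LINT x|lborel. (u x)\<^sup>2 * inverse ((norm (x - a))\<^sup>2 + e)) \<le> 4 * (LINT x|lborel. (norm (g x))\<^sup>2)" 
     and ei: "integrable lborel (\<lambda>x. (u x)\<^sup>2 * inverse ((norm (x - a))\<^sup>2 + e))" if e: "e > 0" for e :: real
  proof -
    let ?s = "\<lambda>x. (norm (x - a))\<^sup>2" and ?A = "LINT x|lborel. (norm (g x))\<^sup>2"
    let ?Y = "radial_field (hardy_k e) a" and ?D = "divergence (radial_field_deriv (hardy_k e) (hardy_k' e) a)"
    let ?J = "LINT x|lborel. (u x)\<^sup>2 * inverse (?s x + e)"
    note Y = C1_hardy_field[OF e, of a]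
    have pos: "?s x + e > 0" for x using e by (rule power2_add_pos)
    have [measurable]: "?Y \<in> borel_measurable borel" "?D \<in> borel_measurable borel"
      by (intro borel_measurable_continuous_onI C1_fieldD[OF Y])+
    have u2: "integrable lborel (\<lambda>x. (u x)\<^sup>2)" using L2_integrable[OF H1_pairD(1)[OF W]] by simp
    have ii: "integrable lborel (\<lambda>x. (u x)\<^sup>2 * \<psi> x)" if "\<psi> \<in> borel_measurable borel" "\<And>x. \<bar>\<psi> x\<bar> \<le> K" for \<psi> K
    proof (rule Bochner_Integration.integrable_bound)
      show "integrable lborel (\<lambda>x. (u x)\<^sup>2 * K)" using u2 by simp
      show "AE x in lborel. norm ((u x)\<^sup>2 * \<psi> x) \<le> norm ((u x)\<^sup>2 * K)"
        using that(2) by (auto simp: abs_mult intro!: mult_left_mono order_trans[OF that(2) abs_ge_self])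
    qed (use that in measurable)
    show ei: "integrable lborel (\<lambda>x. (u x)\<^sup>2 * inverse (?s x + e))"
      by (rule ii[of _ "1/e"]) (use pos e in \<open>auto simp: abs_of_pos field_simps\<close>)
    have Jle: "?J \<le> (LINT x|lborel. (u x)\<^sup>2 * ?D x)"
      using divergence_hardy[OF e] C1_fieldD(7)[OF Y] by (intro integral_mono ei ii mult_left_mono) auto
    also have "\<dots> = - 2 * (LINT x|lborel. u x * (?Y x \<bullet> g x))" by (rule weak_square_field[OF W Y])
    also have "\<dots> = 2 * (- (LINT x|lborel. (u x *\<^sub>R ?Y x) \<bullet> g x))" by simp
    also have "\<dots> \<le> 2 * (sqrt (LINT x|lborel. (norm (u x *\<^sub>R ?Y x))\<^sup>2) * sqrt ?A)"
    proof -
      have "L2 (\<lambda>x. u x *\<^sub>R ?Y x)"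
        by (rule L2_bound[OF H1_pairD(1)[OF W], of _ "1 + 3/e"]) (use C1_fieldD(3)[OF Y] in \<open>auto simp: mult.commute[of _ "\<bar>u _\<bar>"] intro!: mult_left_mono\<close>)
      from L2_Cauchy_Schwarz[OF this H1_pairD(2)[OF W]] show ?thesis by linarith
    qed
    also have "\<dots> \<le> 2 * (sqrt ?J * sqrt ?A)"
    proof -
      have "(LINT x|lborel. (norm (u x *\<^sub>R ?Y x))\<^sup>2) \<le> ?J"
      proof (rule integral_mono')
        fix x
        have "?s x * inverse (?s x + e) \<le> 1" using pos[of x] e by (simp add: field_simps)
        then have "(?s x * inverse (?s x + e)) * inverse (?s x + e) \<le> 1 * inverse (?s x + e)"
          using pos[of x] by (intro mult_right_mono) auto
        then have "(u x)\<^sup>2 * ((?s x * inverse (?s x + e)) * inverse (?s x + e)) \<le> (u x)\<^sup>2 * inverse (?s x + e)"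
          by (intro mult_left_mono) auto
        then show "(norm (u x *\<^sub>R ?Y x))\<^sup>2 \<le> (u x)\<^sup>2 * inverse (?s x + e)"
          by (simp add: radial_field_def power_mult_distrib power2_eq_square mult_ac)
        show "0 \<le> (u x)\<^sup>2 * inverse (?s x + e)" using pos[of x] by (simp add: less_imp_le)
      qed (rule ei)
      then show ?thesis by (intro mult_left_mono mult_right_mono real_sqrt_le_mono) auto
    qed
    finally have *: "?J \<le> 2 * (sqrt ?J * sqrt ?A)" .
    have J0: "?J \<ge> 0" and A0: "?A \<ge> 0" using pos by (auto intro!: integral_nonneg_AE simp: less_imp_le)
    show "?J \<le> 4 * ?A"
    proof (cases "?J = 0")
      case False
      then have "sqrt ?J > 0" using J0 by simp
      moreover have "sqrt ?J * sqrt ?J \<le> sqrt ?J * (2 * sqrt ?A)" using * J0 by (simp add: mult_ac)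
      ultimately have "sqrt ?J \<le> 2 * sqrt ?A" by (rule mult_left_le_imp_le[rotated])
      then have "(sqrt ?J)\<^sup>2 \<le> (2 * sqrt ?A)\<^sup>2" using J0 by (intro power_mono) auto
      then show ?thesis using J0 A0 by (simp add: power_mult_distrib)
    qed (use A0 in simp)
  qed
  define f where "f n x = ennreal ((u x)\<^sup>2 * inverse ((norm (x - a))\<^sup>2 + inverse (real (Suc n))))" for n x
  \<comment> \<open>At x = a the value 0 is the one that division by zero yields, so
    \<open>f0\<close> coincides with the Hardy integrand everywhere.\<close>
  define f0 where "f0 x = (if x = a then 0 else ennreal ((u x)\<^sup>2 / (norm (x - a))\<^sup>2))" for x
  have [measurable]: "f n \<in> borel_measurable borel" "f0 \<in> borel_measurable borel" for n
    unfolding f_def[abs_def] f0_def[abs_def] by measurable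
  have "(\<integral>\<^sup>+x. f0 x \<partial>lborel) \<le> ennreal (4 * (LINT x|lborel. (norm (g x))\<^sup>2))"
  proof (rule nn_integral_liminf_bound)
    fix n
    have "(\<integral>\<^sup>+x. f n x \<partial>lborel) = ennreal (LINT x|lborel. (u x)\<^sup>2 * inverse ((norm (x - a))\<^sup>2 + inverse (real (Suc n))))"
      unfolding f_def by (intro nn_integral_eq_integral ei) (auto intro!: AE_I2 mult_nonneg_nonneg)
    also have "\<dots> \<le> ennreal (4 * (LINT x|lborel. (norm (g x))\<^sup>2))" by (intro ennreal_leI e) auto
    finally show "(\<integral>\<^sup>+x. f n x \<partial>lborel) \<le> ennreal (4 * (LINT x|lborel. (norm (g x))\<^sup>2))" .
  next
    have "AE x in lborel. x \<noteq> a" by (rule AE_lborel_singleton)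
    then show "AE x in lborel. (\<lambda>n. f n x) \<longlonglongrightarrow> f0 x"
    proof eventually_elim
      case (elim x)
      then have "(\<lambda>n. (u x)\<^sup>2 * inverse ((norm (x - a))\<^sup>2 + inverse (real (Suc n)))) \<longlonglongrightarrow> (u x)\<^sup>2 * inverse ((norm (x - a))\<^sup>2 + 0)"
        by (intro tendsto_intros LIMSEQ_inverse_real_of_nat) auto
      then show ?case using elim unfolding f_def f0_def by (intro tendsto_ennrealI[THEN tendsto_cong_limit]) (auto simp: divide_inverse)
    qed
  qed auto
  moreover have "f0 = (\<lambda>x. ennreal ((u x)\<^sup>2 / (norm (x - a))\<^sup>2))" by (auto simp: f0_def)
  ultimately show ?thesis by simp
qed

section \<open>Riesz representation by gradients\<close>

text \<open>Profile of z/(|z|^2+e)^(3/2), a regularization of the Coulomb field z/|z|^3, whose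
  divergence is 4 pi times the Dirac mass.\<close>

definition riesz_k :: "real \<Rightarrow> real \<Rightarrow> real" where "riesz_k e s = inverse ((s + e) * sqrt (s + e))"
definition riesz_k' :: "real \<Rightarrow> real \<Rightarrow> real" where "riesz_k' e s = - (3/2) * inverse ((s + e)\<^sup>2 * sqrt (s + e))"
text \<open>The divergence of the field with profile \<open>riesz_k\<close>, an approximate identity
  of mass 4 pi as e tends to 0.\<close>

definition riesz_density :: "real \<Rightarrow> real^3 \<Rightarrow> real" where
  "riesz_density e z = 3 * e * inverse (((norm z)\<^sup>2 + e)\<^sup>2 * sqrt ((norm z)\<^sup>2 + e))"

lemma DERIV_riesz_k:
  assumes "s + e > 0"
  shows "(riesz_k e has_real_derivative riesz_k' e s) (at s)"
proof -
  let ?S = "s + e" and ?q = "sqrt (s + e)"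
  have q: "?q > 0" "?q * ?q = ?S" using assms by auto
  have "((\<lambda>s. (s + e) * sqrt (s + e)) has_real_derivative ?q + ?S * (inverse ?q / 2)) (at s)"
    using assms by (auto intro!: derivative_eq_intros)
  moreover have "?q + ?S * (inverse ?q / 2) = 3/2 * ?q"
  proof -
    have "t + (t * t) * (inverse t / 2) = 3/2 * t" if "t > 0" for t :: real using that by simp
    from this[OF q(1)] show ?thesis unfolding q(2) .
  qed
  ultimately have "((\<lambda>s. (s + e) * sqrt (s + e)) has_real_derivative 3/2 * ?q) (at s)" by simp
  from DERIV_inverse'[OF this] have "((\<lambda>s. inverse ((s + e) * sqrt (s + e))) has_real_derivative
      - (inverse (?S * ?q) * (3/2 * ?q) * inverse (?S * ?q))) (at s)"
    using q(1) assms by simp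
  moreover have "- (inverse (?S * ?q) * (3/2 * ?q) * inverse (?S * ?q)) = riesz_k' e s"
    unfolding riesz_k'_def using q(1) assms by (simp add: power2_eq_square)
  ultimately show ?thesis by (simp add: riesz_k_def[abs_def])
qed

lemma C1_riesz_field:
  assumes e: "e > 0"
  shows "C1_field (radial_field (riesz_k e) a) (radial_field_deriv (riesz_k e) (riesz_k' e) a) (1 / e + 4 / (e * sqrt e))"
proof (rule C1_radial_field)
  fix s :: real assume s: "0 \<le> s"
  have pos: "s + e > 0" "s\<^sup>2 + e > 0" using s e by (auto intro: add_nonneg_pos)
  show "(riesz_k e has_real_derivative riesz_k' e s) (at s)" by (rule DERIV_riesz_k[OF pos(1)])
  have "s = sqrt (s\<^sup>2)" using s by simp
  also have "\<dots> \<le> sqrt (s\<^sup>2 + e)" using e by (intro real_sqrt_le_mono) simp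
  finally have "riesz_k e (s\<^sup>2) * s \<le> riesz_k e (s\<^sup>2) * sqrt (s\<^sup>2 + e)"
    using pos by (intro mult_left_mono) (auto simp: riesz_k_def)
  also have "\<dots> = inverse (s\<^sup>2 + e)" using pos by (simp add: riesz_k_def)
  also have "\<dots> \<le> 1 / e" using pos e by (simp add: field_simps)
  finally show "\<bar>riesz_k e (s\<^sup>2)\<bar> * s \<le> 1 / e + 4 / (e * sqrt e)"
    using e pos by (simp add: abs_of_pos riesz_k_def add_increasing2)
  have "(s + e) * sqrt (s + e) \<ge> e * sqrt e" using s e by (intro mult_mono) auto
  then have b: "riesz_k e s \<le> 1 / (e * sqrt e)"
    using le_imp_inverse_le[of "e * sqrt e"] e by (simp only: riesz_k_def inverse_eq_divide) simp
  have "2 * \<bar>riesz_k' e s\<bar> * s = 3 * (riesz_k e s * (inverse (s + e) * s))"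
    using pos by (simp add: riesz_k_def riesz_k'_def abs_mult power2_eq_square)
  also have "\<dots> \<le> 3 * (riesz_k e s * 1)"
  proof (intro mult_left_mono)
    show "inverse (s + e) * s \<le> 1" using pos e by (simp add: field_simps)
  qed (use pos in \<open>auto simp: riesz_k_def\<close>)
  also have "\<bar>riesz_k e s\<bar> + 3 * (riesz_k e s * 1) \<le> 4 * (1 / (e * sqrt e))"
    using b pos by (simp add: riesz_k_def)
  finally show "\<bar>riesz_k e s\<bar> + 2 * \<bar>riesz_k' e s\<bar> * s \<le> 1 / e + 4 / (e * sqrt e)"
    using e by (simp add: add_increasing)
qed (use e in \<open>auto intro!: continuous_intros simp: riesz_k'_def[abs_def] add_eq_0_iff\<close>)

lemma divergence_riesz:
  assumes e: "e > 0"
  shows "divergence (radial_field_deriv (riesz_k e) (riesz_k' e) a) x = riesz_density e (x - a)"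
proof -
  let ?s = "(norm (x - a))\<^sup>2"
  have pos: "?s + e > 0" using e by (rule power2_add_pos)
  have S_cancel: "inverse (S * q) = S * inverse (S\<^sup>2 * q)" if "S > 0" for S q :: real
    using that by (simp add: power2_eq_square)
  from pos have "3 * riesz_k e ?s = 3 * (?s + e) * inverse ((?s + e)\<^sup>2 * sqrt (?s + e))"
    using S_cancel[of "?s + e" "sqrt (?s + e)"] by (simp add: riesz_k_def)
  then have "3 * riesz_k e ?s + 2 * ?s * riesz_k' e ?s = (3 * (?s + e) - 3 * ?s) * inverse ((?s + e)\<^sup>2 * sqrt (?s + e))"
    by (simp add: riesz_k'_def algebra_simps)
  then show ?thesis by (simp add: divergence_radial_field riesz_density_def)
qed

lemma riesz_density_nonneg: "e > 0 \<Longrightarrow> 0 \<le> riesz_density e z"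
  using power2_add_pos[of e z] by (simp add: riesz_density_def)

lemma norm_riesz_field_le: "e > 0 \<Longrightarrow> norm (radial_field (riesz_k e) a x) \<le> 1 / (norm (x - a))\<^sup>2"
proof (cases "x = a")
  case False
  assume e: "e > 0"
  let ?s = "(norm (x - a))\<^sup>2" and ?r = "norm (x - a)"
  have r: "?r > 0" using False by simp
  have pos: "?s + e > 0" using e by (rule power2_add_pos)
  have "?s * ?r \<le> (?s + e) * sqrt (?s + e)"
  proof (intro mult_mono)
    show "?r \<le> sqrt (?s + e)" using e real_le_rsqrt by auto
  qed (use e in auto)
  then have "inverse ((?s + e) * sqrt (?s + e)) \<le> inverse (?s * ?r)"
    using r by (intro le_imp_inverse_le) auto
  then have "inverse ((?s + e) * sqrt (?s + e)) * ?r \<le> inverse (?s * ?r) * ?r" using r by (intro mult_right_mono) auto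
  also have "inverse (?s * ?r) * ?r = 1 / ?s" using r by (simp add: divide_inverse)
  finally show ?thesis using pos by (simp add: radial_field_def riesz_k_def abs_of_pos)
qed (simp add: radial_field_def)

text \<open>The primitive is the flux of the regularized field through the sphere of radius r, as
  the divergence theorem suggests.\<close>

lemma DERIV_riesz_mass:
  assumes e: "e > 0"
  shows "((\<lambda>r. 4 * pi * (r / sqrt (r\<^sup>2 + e))^3) has_real_derivative
    4 * pi * r\<^sup>2 * (3 * e * inverse ((r\<^sup>2 + e)\<^sup>2 * sqrt (r\<^sup>2 + e)))) (at r)"
proof -
  have pos: "r\<^sup>2 + e > 0" using e by (simp add: add_nonneg_pos)
  let ?S = "r\<^sup>2 + e" and ?q = "sqrt (r\<^sup>2 + e)"
  have q: "?q > 0" "?q * ?q = ?S" using pos by auto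
  have "((\<lambda>r. r / sqrt (r\<^sup>2 + e)) has_real_derivative ((?q - r * (r * inverse ?q)) / (?q * ?q))) (at r)"
    using pos by (auto intro!: derivative_eq_intros)
  moreover have "(?q - r * (r * inverse ?q)) / (?q * ?q) = e / (?S * ?q)"
  proof -
    have "?q - r * (r * inverse ?q) = (?q * ?q - r * r) / ?q" using q(1) by (simp add: field_simps)
    also have "\<dots> = e / ?q" unfolding q(2) by (simp add: power2_eq_square)
    finally show ?thesis unfolding q(2) using q(1) by simp
  qed
  ultimately have d: "((\<lambda>r. r / sqrt (r\<^sup>2 + e)) has_real_derivative e / (?S * ?q)) (at r)" by simp
  have "((\<lambda>r. 4 * pi * (r / sqrt (r\<^sup>2 + e))^3) has_real_derivative 4 * pi * (3 * (r / ?q)^2 * (e / (?S * ?q)))) (at r)"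
    by (rule DERIV_cmult) (use DERIV_power[OF d, of 3] in \<open>simp add: mult_ac\<close>)
  moreover have "4 * pi * (3 * (r / ?q)^2 * (e / (?S * ?q))) = 4 * pi * r\<^sup>2 * (3 * e * inverse (?S\<^sup>2 * ?q))"
  proof -
    have "(r / ?q)^2 = r\<^sup>2 / ?S" using pos by (simp add: power_divide)
    moreover have "r\<^sup>2 / S * (e / (S * q)) = r\<^sup>2 * (e * inverse (S\<^sup>2 * q))" for S q :: real
      by (simp add: divide_inverse power2_eq_square[of S])
    ultimately have "(r / ?q)^2 * (e / (?S * ?q)) = r\<^sup>2 * (e * inverse (?S\<^sup>2 * ?q))" by (simp only:)
    then have "4 * pi * 3 * ((r / ?q)^2 * (e / (?S * ?q))) = 4 * pi * 3 * (r\<^sup>2 * (e * inverse (?S\<^sup>2 * ?q)))" by (simp only:)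
    then show ?thesis by (simp only: mult_ac)
  qed
  ultimately show ?thesis by simp
qed

text \<open>For d = 0 this is the total mass 4 pi, for fixed d > 0 the tail that vanishes as e tends
  to 0.\<close>

lemma riesz_mass_tail:
  assumes e: "e > 0" and d: "d \<ge> 0"
  shows "(\<integral>\<^sup>+z. ennreal (riesz_density e z * indicator {z. d \<le> norm z} z) \<partial>lborel) = ennreal (4 * pi - 4 * pi * (d / sqrt (d\<^sup>2 + e))^3)"
proof -
  have pos: "r\<^sup>2 + e > 0" for r :: real using e by (simp add: add_nonneg_pos)
  have "(\<integral>\<^sup>+z. ennreal (riesz_density e z * indicator {z. d \<le> norm z} z) \<partial>lborel)
     = (\<integral>\<^sup>+z. (\<lambda>r. ennreal (3 * e * inverse ((r\<^sup>2 + e)\<^sup>2 * sqrt (r\<^sup>2 + e))) * indicator {d..} r) (norm (z::real^3)) \<partial>lborel)"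
    by (intro nn_integral_cong) (auto simp: riesz_density_def split: split_indicator)
  also have "\<dots> = (\<integral>\<^sup>+r. ennreal (4 * pi * r\<^sup>2) * (ennreal (3 * e * inverse ((r\<^sup>2 + e)\<^sup>2 * sqrt (r\<^sup>2 + e))) * indicator {d..} r) * indicator {0..} r \<partial>lborel)"
    by (rule nn_integral_radial) measurable
  also have "\<dots> = (\<integral>\<^sup>+r. ennreal (4 * pi * r\<^sup>2 * (3 * e * inverse ((r\<^sup>2 + e)\<^sup>2 * sqrt (r\<^sup>2 + e)))) * indicator {d..} r \<partial>lborel)"
    using d by (intro nn_integral_cong) (auto simp: ennreal_mult'[symmetric] mult_ac split: split_indicator)
  also have "\<dots> = ennreal (4 * pi - 4 * pi * (d / sqrt (d\<^sup>2 + e))^3)"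
  proof (rule nn_integral_FTC_atLeast)
    show "((\<lambda>r. 4 * pi * (r / sqrt (r\<^sup>2 + e))^3) has_real_derivative 4 * pi * r\<^sup>2 * (3 * e * inverse ((r\<^sup>2 + e)\<^sup>2 * sqrt (r\<^sup>2 + e)))) (at r)" for r
      by (rule DERIV_riesz_mass[OF e])
    have "((\<lambda>r. sqrt (1 - e * inverse (r\<^sup>2 + e))) \<longlongrightarrow> sqrt (1 - e * 0)) at_top"
    proof (intro tendsto_intros tendsto_inverse_0_at_top)
      show "filterlim (\<lambda>r. r\<^sup>2 + e) at_top at_top"
        using filterlim_tendsto_add_at_top[OF tendsto_const[of e] filterlim_pow_at_top[OF _ filterlim_ident, of 2]]
        by (simp add: add.commute)
    qed
    moreover have "\<forall>\<^sub>F r in at_top. sqrt (1 - e * inverse (r\<^sup>2 + e)) = r / sqrt (r\<^sup>2 + e)"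
      using eventually_ge_at_top[of 0]
    proof eventually_elim
      case (elim r)
      have "1 - e * inverse (r\<^sup>2 + e) = r\<^sup>2 / (r\<^sup>2 + e)" using pos[of r] by (simp add: field_simps)
      then show ?case using elim by (simp add: real_sqrt_divide)
    qed
    ultimately have "((\<lambda>r. r / sqrt (r\<^sup>2 + e)) \<longlongrightarrow> sqrt (1 - e * 0)) at_top" by (rule Lim_transform_eventually)
    then have "((\<lambda>r. r / sqrt (r\<^sup>2 + e)) \<longlongrightarrow> 1) at_top" by simp
    then have "((\<lambda>r. 4 * pi * (r / sqrt (r\<^sup>2 + e))^3) \<longlongrightarrow> 4 * pi * 1^3) at_top" by (intro tendsto_intros)
    then show "((\<lambda>r. 4 * pi * (r / sqrt (r\<^sup>2 + e))^3) \<longlongrightarrow> 4 * pi) at_top" by simp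
  qed (use e pos in auto)
  finally show ?thesis .
qed

lemma continuous_riesz_density: "e > 0 \<Longrightarrow> continuous_on UNIV (riesz_density e)"
proof -
  assume e: "e > 0"
  have "(norm x)\<^sup>2 + e \<noteq> 0" for x :: "real^3" using power2_add_pos[OF e, of x] by linarith
  then show ?thesis unfolding riesz_density_def[abs_def] by (auto intro!: continuous_intros)
qed

lemma riesz_density_integral:
  assumes e: "e > 0"
  shows "integrable lborel (riesz_density e)" "(LINT z|lborel. riesz_density e z) = 4 * pi"
proof -
  have [measurable]: "riesz_density e \<in> borel_measurable borel"
    by (rule borel_measurable_continuous_onI[OF continuous_riesz_density[OF e]])
  have nn: "(\<integral>\<^sup>+z. ennreal (riesz_density e z) \<partial>lborel) = ennreal (4 * pi)"
    using riesz_mass_tail[OF e, of 0] by simp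
  show i: "integrable lborel (riesz_density e)"
    by (rule integrableI_nonneg) (use nn riesz_density_nonneg[OF e] in auto)
  show "(LINT z|lborel. riesz_density e z) = 4 * pi"
    using nn nn_integral_eq_integral[OF i] riesz_density_nonneg[OF e] by (simp add: integral_nonneg_AE)
qed

lemma approx_id_riesz: "approx_id (\<lambda>n. riesz_density (inverse (real (Suc n)))) (4 * pi)"
  unfolding approx_id_def
proof (intro conjI allI impI riesz_density_nonneg riesz_density_integral)
  fix d :: real assume d: "d > 0"
  define e where "e n = inverse (real (Suc n))" for n
  have e: "e n > 0" for n by (simp add: e_def)
  have eq: "(LINT z|lborel. riesz_density (e n) z * indicator {z. d \<le> norm z} z) = 4 * pi - 4 * pi * (d / sqrt (d\<^sup>2 + e n))^3" for n
  proof -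
    have [measurable]: "riesz_density (e n) \<in> borel_measurable borel"
      by (rule borel_measurable_continuous_onI[OF continuous_riesz_density[OF e]])
    have "d \<le> sqrt (d\<^sup>2 + e n)" using e[of n] real_le_rsqrt by (simp add: less_imp_le)
    moreover have "sqrt (d\<^sup>2 + e n) > 0" using e[of n] by (simp add: add_nonneg_pos)
    ultimately have "(d / sqrt (d\<^sup>2 + e n))^3 \<le> 1" using d by (intro power_le_one) auto
    then have "4 * pi * (d / sqrt (d\<^sup>2 + e n))^3 \<le> 4 * pi * 1" by (intro mult_left_mono) auto
    then show ?thesis
      using riesz_mass_tail[OF e, of d n] d riesz_density_nonneg[OF e, of n]
      by (subst integral_eq_nn_integral) auto
  qed
  have "(\<lambda>n. 4 * pi - 4 * pi * (d / sqrt (d\<^sup>2 + e n))^3) \<longlonglongrightarrow> 4 * pi - 4 * pi * (d / sqrt (d\<^sup>2 + 0))^3"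
    unfolding e_def using d by (intro tendsto_intros LIMSEQ_inverse_real_of_nat) auto
  then show "(\<lambda>n. LINT z|lborel. riesz_density (inverse (real (Suc n))) z * indicator {z. d \<le> norm z} z) \<longlonglongrightarrow> 0"
    using d eq by (simp add: e_def)
qed auto

text \<open>Common majorant, up to constants, of the Riesz field and its derivative. In polar
  coordinates the integral is bounded by that of 1/(r^2+e), an arctangent.\<close>

lemma L2_inverse_square: 
  assumes e: "e > 0"
  shows "L2 (\<lambda>z::real^3. inverse ((norm z)\<^sup>2 + e))"
proof (rule L2_I_nn)
  have pos: "r\<^sup>2 + e > 0" for r :: real using e by (simp add: add_nonneg_pos)
  have "(\<integral>\<^sup>+z. ennreal ((norm (inverse ((norm (z::real^3))\<^sup>2 + e)))\<^sup>2) \<partial>lborel)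
    = (\<integral>\<^sup>+r. ennreal (4 * pi * r\<^sup>2) * ennreal ((inverse (r\<^sup>2 + e))\<^sup>2) * indicator {0..} r \<partial>lborel)"
  proof -
    have m: "(\<lambda>r. ennreal ((inverse (r\<^sup>2 + e))\<^sup>2)) \<in> borel_measurable borel" by measurable
    show ?thesis using nn_integral_radial[OF m] by (simp only: real_norm_def power2_abs)
  qed
  also have "\<dots> \<le> (\<integral>\<^sup>+r. ennreal (4 * pi * inverse (r\<^sup>2 + e)) * indicator {0..} r \<partial>lborel)"
  proof (intro nn_integral_mono mult_right_mono)
    fix r :: real
    have "r\<^sup>2 * inverse (r\<^sup>2 + e) \<le> 1" using pos[of r] e by (simp add: field_simps)
    then have "(r\<^sup>2 * inverse (r\<^sup>2 + e)) * inverse (r\<^sup>2 + e) \<le> 1 * inverse (r\<^sup>2 + e)" using pos[of r] by (intro mult_right_mono) auto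
    then have "4 * pi * r\<^sup>2 * (inverse (r\<^sup>2 + e))\<^sup>2 \<le> 4 * pi * inverse (r\<^sup>2 + e)" by (simp add: power2_eq_square mult_ac)
    then show "ennreal (4 * pi * r\<^sup>2) * ennreal ((inverse (r\<^sup>2 + e))\<^sup>2) \<le> ennreal (4 * pi * inverse (r\<^sup>2 + e))"
      by (simp add: ennreal_mult[symmetric] ennreal_leI)
  qed auto
  also have "\<dots> = ennreal (4 * pi / sqrt e * (pi / 2) - 4 * pi / sqrt e * arctan (0 / sqrt e))"
  proof (rule nn_integral_FTC_atLeast)
    fix r :: real
    have se: "sqrt e > 0" "sqrt e * sqrt e = e" using e by auto
    have "((\<lambda>r. 4 * pi / sqrt e * arctan (r / sqrt e)) has_real_derivative 4 * pi / sqrt e * (inverse (1 + (r / sqrt e)\<^sup>2) * (1 / sqrt e))) (at r)"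
      by (rule DERIV_cmult[OF DERIV_chain2[OF DERIV_arctan DERIV_cdivide[OF DERIV_ident]]])
    moreover have "4 * pi / sqrt e * (inverse (1 + (r / sqrt e)\<^sup>2) * (1 / sqrt e)) = 4 * pi * inverse (r\<^sup>2 + e)"
    proof -
      have "1 + (r / sqrt e)\<^sup>2 = (r\<^sup>2 + e) / e" using e by (simp add: power_divide field_simps)
      then have "inverse (1 + (r / sqrt e)\<^sup>2) = e * inverse (r\<^sup>2 + e)" by (simp add: divide_inverse)
      moreover have "4 * pi / t * ((E * Y) * (1 / t)) = 4 * pi * (E / (t * t)) * Y" for t E Y :: real
        by (simp add: divide_inverse mult_ac)
      ultimately have "4 * pi / sqrt e * (inverse (1 + (r / sqrt e)\<^sup>2) * (1 / sqrt e)) = 4 * pi * (e / (sqrt e * sqrt e)) * inverse (r\<^sup>2 + e)"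
        by (simp only:)
      moreover have "4 * pi * (e / (sqrt e * sqrt e)) * inverse (r\<^sup>2 + e) = 4 * pi * inverse (r\<^sup>2 + e)"
        unfolding se(2) using e by simp
      ultimately show ?thesis by (rule trans)
    qed
    ultimately show "((\<lambda>r. 4 * pi / sqrt e * arctan (r / sqrt e)) has_real_derivative 4 * pi * inverse (r\<^sup>2 + e)) (at r)" by simp
  next
    have "filterlim (\<lambda>r. r / sqrt e) at_top at_top"
      using e filterlim_tendsto_pos_mult_at_top[OF tendsto_const[of "inverse (sqrt e)"] _ filterlim_ident]
      by (simp add: divide_inverse mult.commute)
    then show "((\<lambda>r. 4 * pi / sqrt e * arctan (r / sqrt e)) \<longlongrightarrow> 4 * pi / sqrt e * (pi / 2)) at_top"
      by (intro tendsto_intros filterlim_compose[OF tendsto_arctan_at_top])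
  qed (use pos in \<open>auto simp: less_imp_le\<close>)
  finally show "(\<integral>\<^sup>+z. ennreal ((norm (inverse ((norm (z::real^3))\<^sup>2 + e)))\<^sup>2) \<partial>lborel) < \<infinity>" 
    by (rule le_less_trans) simp
qed measurable

text \<open>This is what \<open>weak_linear\<close> asks of its weights; both functions are bounded
  by multiples of 1/(|x-a|^2+e).\<close>

lemma L2_riesz_field:
  assumes e: "e > 0" and b: "b \<in> Basis"
  shows "L2 (\<lambda>x. radial_field (riesz_k e) a x \<bullet> b)" "L2 (\<lambda>x. radial_field_deriv (riesz_k e) (riesz_k' e) a x b \<bullet> b)"
proof -
  note Y = C1_riesz_field[OF e, of a] and c = C1_field_component[OF C1_riesz_field[OF e, of a] b]
  let ?S = "\<lambda>x. (norm (x - a))\<^sup>2 + e"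
  have L: "L2 (\<lambda>x. inverse (?S x))" using L2_translate[OF L2_inverse_square[OF e], of a] by simp
  have pos: "?S x > 0" for x using e by (rule power2_add_pos)
  have sq: "norm (x - a) \<le> sqrt (?S x)" for x using e real_le_rsqrt by auto
  show "L2 (\<lambda>x. radial_field (riesz_k e) a x \<bullet> b)"
  proof (rule L2_bound[OF L, of _ 1])
    show "(\<lambda>x. radial_field (riesz_k e) a x \<bullet> b) \<in> borel_measurable borel"
      by (intro borel_measurable_continuous_onI continuous_intros C1_fieldD[OF Y])
    fix x
    have "\<bar>radial_field (riesz_k e) a x \<bullet> b\<bar> \<le> norm (radial_field (riesz_k e) a x)" by (rule Basis_le_norm[OF b])
    also have "\<dots> = inverse (?S x * sqrt (?S x)) * norm (x - a)" using pos[of x] by (simp add: radial_field_def riesz_k_def abs_of_pos)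
    also have "\<dots> \<le> inverse (?S x * sqrt (?S x)) * sqrt (?S x)" using pos[of x] sq by (intro mult_left_mono) auto
    also have "\<dots> = inverse (?S x)" using pos[of x] by simp
    finally show "norm (radial_field (riesz_k e) a x \<bullet> b) \<le> 1 * norm (inverse (?S x))" using pos[of x] by simp
  qed
  show "L2 (\<lambda>x. radial_field_deriv (riesz_k e) (riesz_k' e) a x b \<bullet> b)"
  proof (rule L2_bound[OF L, of _ "4 / sqrt e"])
    show "(\<lambda>x. radial_field_deriv (riesz_k e) (riesz_k' e) a x b \<bullet> b) \<in> borel_measurable borel"
      by (rule borel_measurable_continuous_onI[OF c(2)])
    fix x
    let ?s = "(norm (x - a))\<^sup>2"
    have "norm (radial_field_deriv (riesz_k e) (riesz_k' e) a x b) \<le> (4 * inverse (?S x * sqrt (?S x))) * norm b"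
    proof -
      have "norm (radial_field_deriv (riesz_k e) (riesz_k' e) a x b) \<le> \<bar>riesz_k e ?s\<bar> * norm b + 2 * \<bar>riesz_k' e ?s\<bar> * \<bar>(x - a) \<bullet> b\<bar> * norm (x - a)"
        unfolding radial_field_deriv_def by (rule order_trans[OF norm_triangle_ineq]) (simp add: abs_mult)
      also have "\<dots> \<le> \<bar>riesz_k e ?s\<bar> * norm b + 2 * \<bar>riesz_k' e ?s\<bar> * (norm (x - a) * norm b) * norm (x - a)"
        by (intro add_left_mono mult_right_mono mult_left_mono Cauchy_Schwarz_ineq2) auto
      also have "\<dots> = (\<bar>riesz_k e ?s\<bar> + 2 * \<bar>riesz_k' e ?s\<bar> * ?s) * norm b" by (simp add: power2_eq_square algebra_simps)
      also have "2 * \<bar>riesz_k' e ?s\<bar> * ?s = 3 * (inverse (?S x * sqrt (?S x)) * (inverse (?S x) * ?s))"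
        using pos[of x] by (simp add: riesz_k'_def abs_mult power2_eq_square)
      also have "\<bar>riesz_k e ?s\<bar> + 3 * (inverse (?S x * sqrt (?S x)) * (inverse (?S x) * ?s)) \<le> inverse (?S x * sqrt (?S x)) + 3 * (inverse (?S x * sqrt (?S x)) * 1)"
        using pos[of x] e by (intro add_mono mult_left_mono) (auto simp: riesz_k_def field_simps)
      finally show ?thesis by (simp add: mult_right_mono)
    qed
    then have "\<bar>radial_field_deriv (riesz_k e) (riesz_k' e) a x b \<bullet> b\<bar> \<le> 4 * inverse (?S x * sqrt (?S x))"
      using Basis_le_norm[OF b, of "radial_field_deriv (riesz_k e) (riesz_k' e) a x b"] b by simp
    also have "\<dots> = 4 * inverse (sqrt (?S x)) * inverse (?S x)" by simp
    also have "\<dots> \<le> 4 * inverse (sqrt e) * inverse (?S x)"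
      using pos[of x] e by (intro mult_right_mono mult_left_mono le_imp_inverse_le) auto
    finally show "norm (radial_field_deriv (riesz_k e) (riesz_k' e) a x b \<bullet> b) \<le> 4 / sqrt e * norm (inverse (?S x))"
      using pos[of x] by (simp add: divide_inverse)
  qed
qed

lemma L2_tendsto_AE_subseq:
  assumes f: "L2_tendsto f g"
  obtains r :: "nat \<Rightarrow> nat" where "strict_mono r" "AE x in lborel. (\<lambda>n. f (r n) x) \<longlonglongrightarrow> g x"
proof -
  have i: "integrable lborel (\<lambda>x. (norm (f n x - g x))\<^sup>2)" for n
    by (intro L2_integrable L2_diff L2_tendstoD[OF f])
  have "\<exists>r::nat\<Rightarrow>nat. strict_mono r \<and> (AE x in lborel. (\<lambda>n. (norm (f (r n) x - g x))\<^sup>2) \<longlonglongrightarrow> 0)"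
    by (rule tendsto_L1_AE_subseq[OF i]) (use L2_tendstoD(3)[OF f] in simp)
  then obtain r :: "nat \<Rightarrow> nat" where r: "strict_mono r" "AE x in lborel. (\<lambda>n. (norm (f (r n) x - g x))\<^sup>2) \<longlonglongrightarrow> 0" by blast
  from r(2) have "AE x in lborel. (\<lambda>n. f (r n) x) \<longlonglongrightarrow> g x"
  proof eventually_elim
    case (elim x)
    from tendsto_real_sqrt[OF elim] have "(\<lambda>n. norm (f (r n) x - g x)) \<longlonglongrightarrow> 0" by simp
    then show ?case by (simp add: tendsto_norm_zero_iff LIM_zero_iff)
  qed
  with r(1) show ?thesis by (rule that)
qed

text \<open>Convolution with the Riesz densities converges to 4 pi \<psi> in L2, hence almost
  everywhere along a subsequence, and a bound independent of e survives the limit.\<close>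

lemma riesz_AE:
  fixes \<psi> :: "real^3 \<Rightarrow> real"
  assumes \<psi>: "L2 \<psi>" and I: "\<And>e x. e > 0 \<Longrightarrow> ennreal \<bar>conv (riesz_density e) \<psi> x\<bar> \<le> I x"
  shows "AE x in lborel. ennreal (4 * pi * \<bar>\<psi> x\<bar>) \<le> I x"
proof -
  define k where "k n = riesz_density (inverse (real (Suc n)))" for n
  obtain r :: "nat \<Rightarrow> nat" where r: "strict_mono r" "AE x in lborel. (\<lambda>n. conv (k (r n)) \<psi> x) \<longlonglongrightarrow> (4 * pi) *\<^sub>R \<psi> x"
    using L2_tendsto_AE_subseq[OF approx_id_L2[OF approx_id_riesz[folded k_def] \<psi>]] by blast
  from r(2) show ?thesis
  proof eventually_elim
    case (elim x)
    have "(\<lambda>n. ennreal \<bar>conv (k (r n)) \<psi> x\<bar>) \<longlonglongrightarrow> ennreal \<bar>(4 * pi) *\<^sub>R \<psi> x\<bar>"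
      by (intro tendsto_ennrealI tendsto_rabs elim)
    then have "ennreal \<bar>(4 * pi) *\<^sub>R \<psi> x\<bar> \<le> I x"
      by (rule tendsto_upperbound) (auto simp: k_def intro!: always_eventually I)
    then show ?case by (simp add: abs_mult)
  qed
qed

text \<open>The regularized density is a divergence, integration by parts moves the derivative onto
  \<psi>, and the remaining field is dominated by |z-a|^(-2) uniformly in e. The right-hand side is
  a nonnegative integral because it may be infinite.\<close>

lemma riesz_pair:
  fixes \<psi> :: "real^3 \<Rightarrow> real"
  assumes \<psi>: "L2 \<psi>" and [measurable]: "G \<in> borel_measurable borel"
    and int: "\<And>e a b. e > 0 \<Longrightarrow> b \<in> Basis \<Longrightarrow> integrable lborel (\<lambda>x. (radial_field (riesz_k e) a x \<bullet> b) * (G x \<bullet> b))"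
    and eq: "\<And>e a b. e > 0 \<Longrightarrow> b \<in> Basis \<Longrightarrow> (LINT x|lborel. \<psi> x * (radial_field_deriv (riesz_k e) (riesz_k' e) a x b \<bullet> b)) = - (LINT x|lborel. (radial_field (riesz_k e) a x \<bullet> b) * (G x \<bullet> b))"
  shows "AE x in lborel. ennreal (4 * pi * \<bar>\<psi> x\<bar>) \<le> (\<integral>\<^sup>+z. ennreal (norm (G z) / (norm (z - x))\<^sup>2) \<partial>lborel)"
proof (rule riesz_AE[OF \<psi>])
  fix e :: real and a :: "real^3" assume e: "e > 0"
  let ?Z = "radial_field (riesz_k e) a" and ?Z' = "radial_field_deriv (riesz_k e) (riesz_k' e) a"
  have [measurable]: "?Z \<in> borel_measurable borel"
    by (intro borel_measurable_continuous_onI C1_fieldD[OF C1_riesz_field[OF e]])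
  have "conv (riesz_density e) \<psi> a = (LINT x|lborel. \<psi> x * divergence ?Z' x)"
    unfolding conv_def divergence_riesz[OF e]
    by (intro Bochner_Integration.integral_cong refl) (simp add: riesz_density_def norm_minus_commute mult.commute)
  also have "\<dots> = (\<Sum>b\<in>Basis. LINT x|lborel. \<psi> x * (?Z' x b \<bullet> b))"
    unfolding divergence_def sum_distrib_left
    by (rule Bochner_Integration.integral_sum) (rule L2_integrable_mult[OF \<psi> L2_riesz_field(2)[OF e]])
  also have "\<dots> = - (\<Sum>b\<in>Basis. LINT x|lborel. (?Z x \<bullet> b) * (G x \<bullet> b))"
    using eq[OF e] by (simp add: sum_negf)
  also have "(\<Sum>b\<in>Basis. LINT x|lborel. (?Z x \<bullet> b) * (G x \<bullet> b)) = (LINT x|lborel. ?Z x \<bullet> G x)"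
    by (subst Bochner_Integration.integral_sum[symmetric]) (auto intro: int[OF e] simp: euclidean_inner[of "?Z _" "G _"])
  finally have c: "conv (riesz_density e) \<psi> a = - (LINT x|lborel. ?Z x \<bullet> G x)" .
  have iZ: "integrable lborel (\<lambda>x. ?Z x \<bullet> G x)"
    unfolding euclidean_inner[of "?Z _" "G _"] by (intro Bochner_Integration.integrable_sum int[OF e])
  have "ennreal \<bar>conv (riesz_density e) \<psi> a\<bar> = ennreal (norm (LINT x|lborel. ?Z x \<bullet> G x))" by (simp add: c)
  also have "\<dots> \<le> (\<integral>\<^sup>+x. ennreal (norm (?Z x \<bullet> G x)) \<partial>lborel)" by (rule integral_norm_bound_ennreal[OF iZ])
  also have "\<dots> \<le> (\<integral>\<^sup>+z. ennreal (norm (G z) / (norm (z - a))\<^sup>2) \<partial>lborel)"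
  proof (intro nn_integral_mono ennreal_leI)
    fix z
    have "norm (?Z z \<bullet> G z) \<le> norm (?Z z) * norm (G z)" by (simp add: Cauchy_Schwarz_ineq2)
    also have "\<dots> \<le> 1 / (norm (z - a))\<^sup>2 * norm (G z)" by (intro mult_right_mono norm_riesz_field_le[OF e]) auto
    finally show "norm (?Z z \<bullet> G z) \<le> norm (G z) / (norm (z - a))\<^sup>2" by simp
  qed
  finally show "ennreal \<bar>conv (riesz_density e) \<psi> a\<bar> \<le> (\<integral>\<^sup>+z. ennreal (norm (G z) / (norm (z - a))\<^sup>2) \<partial>lborel)" .
qed

lemma riesz_representation_bound:
  assumes W: "H1_pair u g"
  shows "AE x in lborel. ennreal (4 * pi * \<bar>u x\<bar>) \<le> (\<integral>\<^sup>+z. ennreal (norm (g z) / (norm (z - x))\<^sup>2) \<partial>lborel)"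
proof (rule riesz_pair[OF H1_pairD(1)[OF W] L2_measurable[OF H1_pairD(2)[OF W]]])
  fix e :: real and a b :: "real^3" assume e: "e > 0" and b: "b \<in> Basis"
  show "integrable lborel (\<lambda>x. (radial_field (riesz_k e) a x \<bullet> b) * (g x \<bullet> b))"
    by (rule L2_integrable_mult[OF L2_riesz_field(1)[OF e b] L2_inner_const[OF H1_pairD(2)[OF W]]])
  show "(LINT x|lborel. u x * (radial_field_deriv (riesz_k e) (riesz_k' e) a x b \<bullet> b)) = - (LINT x|lborel. (radial_field (riesz_k e) a x \<bullet> b) * (g x \<bullet> b))"
    by (rule weak_linear[OF W C1_field_component(1,2)[OF C1_riesz_field[OF e] b] L2_riesz_field[OF e b]])
qed

section \<open>The Sobolev inequality\<close>

lemma L2_power_bounded: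
  fixes v :: "'a::euclidean_space \<Rightarrow> real"
  assumes v: "L2 v" and B: "\<And>x. \<bar>v x\<bar> \<le> B"
  shows "L2 (\<lambda>x. (v x) ^ Suc k)"
proof (rule L2_bound[OF v])
  note [measurable] = L2_measurable[OF v]
  show "(\<lambda>x. (v x) ^ Suc k) \<in> borel_measurable borel" by measurable
  fix x
  have "\<bar>v x\<bar> ^ k * \<bar>v x\<bar> \<le> B ^ k * \<bar>v x\<bar>" by (intro mult_right_mono power_mono B) auto
  then show "norm ((v x) ^ Suc k) \<le> B ^ k * norm (v x)" by (simp add: abs_mult power_abs mult.commute)
qed

text \<open>Multiply the Riesz bound for \<open>v\<^sup>4\<close> by \<open>v\<^sup>2\<close>, integrate, and absorb the kernel \<open>|x|\<^sup>-\<^sup>2\<close> with Hardy's inequality.\<close>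

lemma sobolev_C1:
  fixes v :: "real^3 \<Rightarrow> real"
  assumes d: "\<And>x. (v has_derivative (\<lambda>h. G x \<bullet> h)) (at x)" and c: "continuous_on UNIV G" and v: "L2 v" and G: "L2 G"
    and B: "\<And>x. \<bar>v x\<bar> \<le> B"
  shows "(\<integral>\<^sup>+x. ennreal ((v x) ^ 6) \<partial>lborel) \<le> ennreal (2 * (LINT x|lborel. (norm (G x))\<^sup>2) ^ 3)"
proof -
  note [measurable] = L2_measurable[OF v] L2_measurable[OF G]
  let ?A = "LINT x|lborel. (norm (G x))\<^sup>2"
  have W: "H1_pair v G" by (rule C1_imp_H1_pair[OF d c v G])
  have vc: "continuous_on UNIV v" by (rule has_derivative_C1_continuous_on[OF d])
  have L3: "L2 (\<lambda>x. (v x) ^ 3)" and L4: "L2 (\<lambda>x. (v x) ^ 4)"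
    using L2_power_bounded[OF v B, of 2] L2_power_bounded[OF v B, of 3] by (simp_all add: numeral_eq_Suc)
  define G4 where "G4 x = (4 * (v x) ^ 3) *\<^sub>R G x" for x
  have [measurable]: "G4 \<in> borel_measurable borel" unfolding G4_def[abs_def] by measurable
  have d4: "((\<lambda>x. (v x) ^ 4) has_derivative (\<lambda>h. G4 x \<bullet> h)) (at x)" for x
    using has_derivative_power[OF d, of 4] by (simp add: G4_def mult_ac)
  have c4: "continuous_on UNIV G4" unfolding G4_def[abs_def] by (intro continuous_intros vc c)
  have LG4: "L2 G4"
  proof (rule L2_bound[OF G])
    fix x
    have "\<bar>v x\<bar> ^ 3 \<le> B ^ 3" by (intro power_mono B) auto
    then show "norm (G4 x) \<le> (4 * B ^ 3) * norm (G x)" by (simp add: G4_def abs_mult power_abs mult_right_mono)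
  qed measurable
  have W4: "H1_pair (\<lambda>x. (v x) ^ 4) G4" by (rule C1_imp_H1_pair[OF d4 c4 L4 LG4])
  let ?S = "LINT x|lborel. (v x) ^ 6" and ?T = "LINT x|lborel. \<bar>v x\<bar> ^ 3 * norm (G x)"
  have six: "(norm (v x ^ 3))\<^sup>2 = (v x) ^ 6" "(norm (\<bar>v x\<bar> ^ 3))\<^sup>2 = (v x) ^ 6" for x
    by (simp_all add: power_abs[symmetric] power_mult[symmetric] power_even_abs)
  have S: "(\<integral>\<^sup>+x. ennreal ((v x) ^ 6) \<partial>lborel) = ennreal ?S" using L2_nn[OF L3] by (simp only: six)
  have S0: "?S \<ge> 0" and A0: "?A \<ge> 0" by (auto intro!: integral_nonneg_AE simp: zero_le_even_power)
  have L3a: "L2 (\<lambda>x. \<bar>v x\<bar> ^ 3)" using L3 by (simp add: L2_def power_abs)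
  have LGn: "L2 (\<lambda>x. norm (G x))" using G by (simp add: L2_def)
  have iT: "integrable lborel (\<lambda>x. \<bar>v x\<bar> ^ 3 * norm (G x))" by (rule L2_integrable_mult[OF L3a LGn])
  have T: "?T \<le> sqrt ?S * sqrt ?A"
  proof -
    have "(norm (norm (G x)))\<^sup>2 = (norm (G x))\<^sup>2" for x by simp
    then show ?thesis using L2_Cauchy_Schwarz[OF L3a LGn] by (simp only: inner_real_def six)
  qed
  have "ennreal (4 * pi * ?S) = (\<integral>\<^sup>+x. ennreal ((v x)\<^sup>2) * ennreal (4 * pi * \<bar>(v x) ^ 4\<bar>) \<partial>lborel)"
  proof -
    have "ennreal ((v x)\<^sup>2) * ennreal (4 * pi * \<bar>(v x) ^ 4\<bar>) = ennreal (4 * pi) * ennreal ((v x) ^ 6)" for x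
      by (subst (1 2) ennreal_mult[symmetric]) (auto simp: power_add[symmetric] mult_ac)
    then show ?thesis using S S0 by (simp add: nn_integral_cmult ennreal_mult)
  qed
  also have "\<dots> \<le> (\<integral>\<^sup>+x. ennreal ((v x)\<^sup>2) * (\<integral>\<^sup>+z. ennreal (norm (G4 z) / (norm (z - x))\<^sup>2) \<partial>lborel) \<partial>lborel)"
    using riesz_representation_bound[OF W4] by (intro nn_integral_mono_AE) (auto elim!: eventually_mono intro: mult_left_mono)
  also have "\<dots> = (\<integral>\<^sup>+x. \<integral>\<^sup>+z. ennreal ((v x)\<^sup>2) * ennreal (norm (G4 z) / (norm (z - x))\<^sup>2) \<partial>lborel \<partial>lborel)"
    by (intro nn_integral_cong nn_integral_cmult[symmetric]) measurable
  also have "\<dots> = (\<integral>\<^sup>+z. \<integral>\<^sup>+x. ennreal ((v x)\<^sup>2) * ennreal (norm (G4 z) / (norm (z - x))\<^sup>2) \<partial>lborel \<partial>lborel)"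
    by (rule lborel_pair.Fubini') measurable
  also have "\<dots> = (\<integral>\<^sup>+z. ennreal (norm (G4 z)) * (\<integral>\<^sup>+x. ennreal ((v x)\<^sup>2 / (norm (x - z))\<^sup>2) \<partial>lborel) \<partial>lborel)"
    by (subst nn_integral_cmult[symmetric]) (auto intro!: nn_integral_cong simp: ennreal_mult'[symmetric] norm_minus_commute mult.commute)
  also have "\<dots> \<le> (\<integral>\<^sup>+z. ennreal (norm (G4 z)) * ennreal (4 * ?A) \<partial>lborel)"
    by (intro nn_integral_mono mult_left_mono hardy[OF W]) auto
  \<comment> \<open>The factor 16 is 4 from the gradient of v^4 times 4 from Hardy's
    inequality.\<close>
  also have "\<dots> = (\<integral>\<^sup>+z. ennreal (16 * ?A * (\<bar>v z\<bar> ^ 3 * norm (G z))) \<partial>lborel)"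
    using A0 by (intro nn_integral_cong) (simp add: ennreal_mult'[symmetric] G4_def abs_mult power_abs mult_ac)
  also have "\<dots> = ennreal (16 * ?A * ?T)"
    using iT A0 by (subst nn_integral_eq_integral) auto
  finally have "4 * pi * ?S \<le> 16 * ?A * ?T"
    using A0 by (subst (asm) ennreal_le_iff) (auto intro!: mult_nonneg_nonneg integral_nonneg_AE)
  also have "\<dots> \<le> 16 * ?A * (sqrt ?S * sqrt ?A)" using T A0 by (intro mult_left_mono) auto
  finally have main: "pi * ?S \<le> 4 * ?A * (sqrt ?S * sqrt ?A)" by simp
  \<comment> \<open>From pi sqrt(S) <= 4 A sqrt(A) follows S <= (16/pi^2) A^3, and pi^2 >= 8. The
    division by sqrt(S) is meaningful since boundedness of v makes the integral of v^6
    finite.\<close>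
  have "?S \<le> 2 * ?A ^ 3"
  proof (cases "?S = 0")
    case False
    with S0 have "?S > 0" by linarith
    then have s: "sqrt ?S > 0" by (simp only: real_sqrt_gt_0_iff)
    have "sqrt ?S * (pi * sqrt ?S) \<le> sqrt ?S * (4 * ?A * sqrt ?A)" using main S0 by (simp add: mult_ac)
    then have "pi * sqrt ?S \<le> 4 * ?A * sqrt ?A" using s by (rule mult_left_le_imp_le)
    then have "(pi * sqrt ?S)\<^sup>2 \<le> (4 * ?A * sqrt ?A)\<^sup>2" using S0 by (intro power_mono) auto
    then have "pi\<^sup>2 * ?S \<le> 16 * ?A ^ 3" using S0 A0 by (simp add: power_mult_distrib power2_eq_square power3_eq_cube mult_ac)
    moreover have "8 * ?S \<le> pi\<^sup>2 * ?S"
    proof (rule mult_right_mono[OF _ S0])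
      have "3 * 3 \<le> pi * pi" using pi_gt3 by (intro mult_mono) auto
      then show "8 \<le> pi\<^sup>2" by (simp add: power2_eq_square)
    qed
    ultimately show ?thesis by simp
  qed (use A0 in simp)
  then show ?thesis using S by (simp add: ennreal_leI)
qed

text \<open>Mollification does not increase the Dirichlet integral, so the bound for bounded C1
  functions is uniform along the mollified sequence; an almost everywhere convergent subsequence and
  Fatou give the general case.\<close>

theorem sobolev:
  assumes W: "H1_pair u g"
  shows "(\<integral>\<^sup>+x. ennreal ((u x) ^ 6) \<partial>lborel) \<le> ennreal (2 * (LINT x|lborel. (norm (g x))\<^sup>2) ^ 3)"
proof -
  note [measurable] = L2_measurable[OF H1_pairD(1)[OF W]]
  define un where "un n = conv (mollifier n) u" for n
  define gn where "gn n = conv (mollifier n) g" for n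
  note m = H1_pair_mollify[OF W, folded un_def gn_def]
  note [measurable] = L2_measurable[OF m(4)]
  obtain r :: "nat \<Rightarrow> nat" where r: "AE x in lborel. (\<lambda>n. un (r n) x) \<longlonglongrightarrow> u x"
    using L2_tendsto_AE_subseq[OF m(6)] by blast
  show ?thesis
  proof (rule nn_integral_liminf_bound)
    show "AE x in lborel. (\<lambda>n. ennreal (un (r n) x ^ 6)) \<longlonglongrightarrow> ennreal (u x ^ 6)"
      using r by eventually_elim (intro tendsto_ennrealI tendsto_power)
    fix n
    obtain B where B: "\<And>x. norm (un (r n) x) \<le> B" using conv_mollifier_bounded[OF H1_pairD(1)[OF W]] unfolding un_def by blast
    have "(\<integral>\<^sup>+x. ennreal (un (r n) x ^ 6) \<partial>lborel) \<le> ennreal (2 * (LINT x|lborel. (norm (gn (r n) x))\<^sup>2) ^ 3)"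
      by (rule sobolev_C1[OF m(1,3,4,5)]) (use B in auto)
    also have "\<dots> \<le> ennreal (2 * (LINT x|lborel. (norm (g x))\<^sup>2) ^ 3)"
      unfolding gn_def by (intro ennreal_leI mult_left_mono power_mono L2_imp_L2_conv_mollifier(3)[OF H1_pairD(2)[OF W]]) auto
    finally show "(\<integral>\<^sup>+x. ennreal (un (r n) x ^ 6) \<partial>lborel) \<le> ennreal (2 * (LINT x|lborel. (norm (g x))\<^sup>2) ^ 3)" .
  qed auto
qed

section \<open>Composition of inverse square kernels\<close>

text \<open>Majorant for a product of two inverse square kernels, with z measured from the nearer
  pole: the other distance is replaced by m inside the ball of radius m and by |z| outside. Each
  region contributes 4 pi / m.\<close>

lemma nn_integral_inverse_square_cutoff:
  assumes m: "m > 0"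
  shows "(\<integral>\<^sup>+z. ennreal (1 / ((norm (z::real^3))\<^sup>2 * (max m (norm z))\<^sup>2)) \<partial>lborel) \<le> ennreal (8 * pi / m)"
proof -
  have "(\<integral>\<^sup>+z. ennreal (1 / ((norm (z::real^3))\<^sup>2 * (max m (norm z))\<^sup>2)) \<partial>lborel)
    = (\<integral>\<^sup>+r. ennreal (4 * pi * r\<^sup>2) * ennreal (1 / (r\<^sup>2 * (max m r)\<^sup>2)) * indicator {0..} r \<partial>lborel)"
  proof -
    have [measurable]: "(\<lambda>r. ennreal (1 / (r\<^sup>2 * (max m r)\<^sup>2))) \<in> borel_measurable borel" by measurable
    show ?thesis by (rule nn_integral_radial) measurable
  qed
  also have "\<dots> \<le> (\<integral>\<^sup>+r. ennreal (4 * pi / m\<^sup>2) * indicator {0..m} r + ennreal (4 * pi / r\<^sup>2) * indicator {m..} r \<partial>lborel)"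
  proof (intro nn_integral_mono)
    fix r :: real
    show "ennreal (4 * pi * r\<^sup>2) * ennreal (1 / (r\<^sup>2 * (max m r)\<^sup>2)) * indicator {0..} r
      \<le> ennreal (4 * pi / m\<^sup>2) * indicator {0..m} r + ennreal (4 * pi / r\<^sup>2) * indicator {m..} r"
    proof (cases "0 < r")
      case True
      have *: "ennreal (4 * pi * r\<^sup>2) * ennreal (1 / (r\<^sup>2 * (max m r)\<^sup>2)) = ennreal (4 * pi / (max m r)\<^sup>2)"
        using True by (subst ennreal_mult'[symmetric]) auto
      show ?thesis
      proof (cases "r \<le> m")
        case True
        then show ?thesis using * \<open>0 < r\<close> by (simp add: max_def add_increasing2)
      next
        case False
        then show ?thesis using * \<open>0 < r\<close> by (simp add: max_def)
      qed
    qed (cases "r = 0"; simp)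
  qed
  also have "\<dots> = (\<integral>\<^sup>+r. ennreal (4 * pi / m\<^sup>2) * indicator {0..m} r \<partial>lborel) + (\<integral>\<^sup>+r. ennreal (4 * pi / r\<^sup>2) * indicator {m..} r \<partial>lborel)"
    by (rule nn_integral_add) measurable
  also have "(\<integral>\<^sup>+r. ennreal (4 * pi / m\<^sup>2) * indicator {0..m} r \<partial>lborel) = ennreal (4 * pi / m)"
    using m by (simp add: nn_integral_cmult_indicator ennreal_mult'[symmetric] power2_eq_square)
  also have "(\<integral>\<^sup>+r. ennreal (4 * pi / r\<^sup>2) * indicator {m..} r \<partial>lborel) = ennreal (0 - (- 4 * pi / m))"
  proof (rule nn_integral_FTC_atLeast)
    fix r assume "m \<le> r"
    then show "((\<lambda>r. - 4 * pi / r) has_real_derivative 4 * pi / r\<^sup>2) (at r)"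
      using m by (auto intro!: derivative_eq_intros simp: power2_eq_square)
  next
    show "((\<lambda>r. - 4 * pi / r) \<longlongrightarrow> 0) at_top"
      by (intro tendsto_divide_0[OF tendsto_const] filterlim_at_top_imp_at_infinity filterlim_ident)
  qed auto
  finally show ?thesis using m by (simp add: ennreal_plus[symmetric] del: ennreal_plus)
qed

text \<open>For every z the farther of x and y is at distance at least m = |x-y|/2 and at least as
  far as the nearer one, so its distance is bounded below by the maximum of m and the nearer
  distance. The two choices of the nearer pole cost 2 times 8 pi / m, which is 32 pi / |x-y|. The
  exact constant would be pi^3.\<close>

lemma inverse_square_composition:
  fixes x y :: "real^3"
  assumes "x \<noteq> y"
  shows "(\<integral>\<^sup>+z. ennreal (1 / ((norm (x - z))\<^sup>2 * (norm (y - z))\<^sup>2)) \<partial>lborel) \<le> ennreal (32 * pi / norm (x - y))"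
proof -
  define m where "m = norm (x - y) / 2"
  have m: "m > 0" using assms by (simp add: m_def)
  define h where "h r = 1 / (r\<^sup>2 * (max m r)\<^sup>2)" for r :: real
  have h0: "h r \<ge> 0" for r by (simp add: h_def)
  have [measurable]: "h \<in> borel_measurable borel" unfolding h_def[abs_def] by measurable
  have comp: "1 / (a\<^sup>2 * b\<^sup>2) \<le> h a" if "0 \<le> a" "a \<le> b" "m \<le> b" for a b :: real
  proof (cases "a = 0")
    case False
    have "a\<^sup>2 * (max m a)\<^sup>2 \<le> a\<^sup>2 * b\<^sup>2" using that m by (intro mult_left_mono power_mono) auto
    then show ?thesis unfolding h_def using False that m by (intro divide_left_mono) auto
  qed (simp add: h_def)
  have pt: "1 / ((norm (x - z))\<^sup>2 * (norm (y - z))\<^sup>2) \<le> h (norm (x - z)) + h (norm (y - z))" for z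
  proof -
    have tri: "2 * m \<le> norm (x - z) + norm (y - z)"
      unfolding m_def using norm_triangle_ineq4[of "x - z" "y - z"] by simp
    show ?thesis
    proof (cases "norm (x - z) \<le> norm (y - z)")
      case True
      then show ?thesis using comp[of "norm (x - z)" "norm (y - z)"] tri h0[of "norm (y - z)"] by simp
    next
      case False
      then show ?thesis using comp[of "norm (y - z)" "norm (x - z)"] tri h0[of "norm (x - z)"] by (simp add: mult.commute)
    qed
  qed
  have hI: "(\<integral>\<^sup>+z. ennreal (h (norm (a - z))) \<partial>lborel) \<le> ennreal (8 * pi / m)" for a :: "real^3"
    using nn_integral_inverse_square_cutoff[OF m] nn_integral_reflect[of "\<lambda>z. ennreal (h (norm z))" a] by (simp add: h_def)
  have "(\<integral>\<^sup>+z. ennreal (1 / ((norm (x - z))\<^sup>2 * (norm (y - z))\<^sup>2)) \<partial>lborel) \<le> (\<integral>\<^sup>+z. ennreal (h (norm (x - z))) + ennreal (h (norm (y - z))) \<partial>lborel)"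
    by (intro nn_integral_mono) (use pt h0 in \<open>simp add: ennreal_plus[symmetric] ennreal_leI del: ennreal_plus\<close>)
  also have "\<dots> = (\<integral>\<^sup>+z. ennreal (h (norm (x - z))) \<partial>lborel) + (\<integral>\<^sup>+z. ennreal (h (norm (y - z))) \<partial>lborel)"
    by (rule nn_integral_add) measurable
  also have "\<dots> \<le> ennreal (8 * pi / m) + ennreal (8 * pi / m)" by (intro add_mono hI)
  also have "\<dots> = ennreal (32 * pi / norm (x - y))"
    using m by (simp add: ennreal_plus[symmetric] m_def del: ennreal_plus)
  finally show ?thesis .
qed

section \<open>The Coulomb energy\<close>

definition potential :: "(real^3 \<Rightarrow> real) \<Rightarrow> real^3 \<Rightarrow> real" where
  "potential f x = (LINT y|lborel. f y / norm (x - y))"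

definition coulomb :: "(real^3 \<Rightarrow> real) \<Rightarrow> (real^3 \<Rightarrow> real) \<Rightarrow> real" where
  "coulomb f h = (LINT x|lborel. f x * potential h x)"

text \<open>A class on which the Coulomb form is finite, bilinear and symmetric. The uniform bound
  is put on a nonnegative integral, which includes absolute integrability; products of H1 functions
  belong to the class by Hardy's inequality.\<close>

definition pot_bounded :: "(real^3 \<Rightarrow> real) \<Rightarrow> bool" where
  "pot_bounded f \<longleftrightarrow> integrable lborel f \<and> (\<exists>K\<ge>0. \<forall>x. (\<integral>\<^sup>+y. ennreal (\<bar>f y\<bar> / norm (x - y)) \<partial>lborel) \<le> ennreal K)"

lemma pot_bounded_borel: "pot_bounded f \<Longrightarrow> f \<in> borel_measurable borel"
  by (auto simp: pot_bounded_def)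

lemma pot_bounded_integrable: "pot_bounded f \<Longrightarrow> integrable lborel f"
  by (auto simp: pot_bounded_def)

lemma potential_measurable[measurable (raw)]:
  assumes [measurable]: "f \<in> borel_measurable borel"
  shows "potential f \<in> borel_measurable borel"
  unfolding potential_def[abs_def] by measurable

lemma pot_bounded_potential_integrable:
  assumes "pot_bounded f"
  shows "integrable lborel (\<lambda>y. f y / norm (x - y))"
proof -
  note [measurable] = pot_bounded_borel[OF assms]
  obtain K where K: "(\<integral>\<^sup>+y. ennreal (\<bar>f y\<bar> / norm (x - y)) \<partial>lborel) \<le> ennreal K"
    using assms by (auto simp: pot_bounded_def)
  show ?thesis
    by (rule integrableI_bounded) (use K in \<open>auto intro: le_less_trans\<close>)
qed

lemma pot_bounded_bounds:
  assumes "pot_bounded f"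
  shows "\<exists>K\<ge>0. \<forall>x. \<bar>potential f x\<bar> \<le> K \<and> (LINT y|lborel. \<bar>f y\<bar> / norm (x - y)) \<le> K"
proof -
  obtain K where K: "K \<ge> 0" "\<And>x. (\<integral>\<^sup>+y. ennreal (\<bar>f y\<bar> / norm (x - y)) \<partial>lborel) \<le> ennreal K"
    using assms by (auto simp: pot_bounded_def)
  have ia: "integrable lborel (\<lambda>y. \<bar>f y\<bar> / norm (x - y))" for x
    using integrable_abs[OF pot_bounded_potential_integrable[OF assms, of x]] by simp
  have le: "(LINT y|lborel. \<bar>f y\<bar> / norm (x - y)) \<le> K" for x
    using K(2)[of x] K(1) by (subst (asm) nn_integral_eq_integral[OF ia]) auto
  have "\<bar>potential f x\<bar> \<le> K" for x
    using integral_norm_bound[of lborel "\<lambda>y. f y / norm (x - y)"] le[of x] by (simp add: potential_def)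
  then show ?thesis using K(1) le by blast
qed

lemma pot_bounded_mono:
  assumes f: "pot_bounded f" and [measurable]: "h \<in> borel_measurable borel" and le: "\<And>x. \<bar>h x\<bar> \<le> \<bar>f x\<bar>"
  shows "pot_bounded h"
proof -
  obtain K where K: "K \<ge> 0" "\<And>x. (\<integral>\<^sup>+y. ennreal (\<bar>f y\<bar> / norm (x - y)) \<partial>lborel) \<le> ennreal K"
    using f by (auto simp: pot_bounded_def)
  have "(\<integral>\<^sup>+y. ennreal (\<bar>h y\<bar> / norm (x - y)) \<partial>lborel) \<le> ennreal K" for x
    by (rule order_trans[OF nn_integral_mono K(2)[of x]]) (intro ennreal_leI divide_right_mono le, simp)
  moreover have "integrable lborel h"
    by (rule Bochner_Integration.integrable_bound[OF pot_bounded_integrable[OF f]]) (use le in auto)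
  ultimately show ?thesis using K(1) by (auto simp: pot_bounded_def)
qed

lemma pot_bounded_add:
  assumes f: "pot_bounded f" and h: "pot_bounded h"
  shows "pot_bounded (\<lambda>x. f x + h x)"
proof -
  note [measurable] = pot_bounded_borel[OF f] pot_bounded_borel[OF h]
  obtain K where K: "K \<ge> 0" "\<And>x. (\<integral>\<^sup>+y. ennreal (\<bar>f y\<bar> / norm (x - y)) \<partial>lborel) \<le> ennreal K"
    using f by (auto simp: pot_bounded_def)
  obtain L where L: "L \<ge> 0" "\<And>x. (\<integral>\<^sup>+y. ennreal (\<bar>h y\<bar> / norm (x - y)) \<partial>lborel) \<le> ennreal L"
    using h by (auto simp: pot_bounded_def)
  have "(\<integral>\<^sup>+y. ennreal (\<bar>f y + h y\<bar> / norm (x - y)) \<partial>lborel) \<le> ennreal (K + L)" for x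
  proof -
    have "(\<integral>\<^sup>+y. ennreal (\<bar>f y + h y\<bar> / norm (x - y)) \<partial>lborel) \<le> (\<integral>\<^sup>+y. ennreal (\<bar>f y\<bar> / norm (x - y)) + ennreal (\<bar>h y\<bar> / norm (x - y)) \<partial>lborel)"
    proof (intro nn_integral_mono)
      fix y
      have "\<bar>f y + h y\<bar> / norm (x - y) \<le> (\<bar>f y\<bar> + \<bar>h y\<bar>) / norm (x - y)" by (intro divide_right_mono) auto
      then show "ennreal (\<bar>f y + h y\<bar> / norm (x - y)) \<le> ennreal (\<bar>f y\<bar> / norm (x - y)) + ennreal (\<bar>h y\<bar> / norm (x - y))"
        by (subst ennreal_plus[symmetric]) (simp_all add: add_divide_distrib ennreal_leI del: ennreal_plus)
    qed
    also have "\<dots> = (\<integral>\<^sup>+y. ennreal (\<bar>f y\<bar> / norm (x - y)) \<partial>lborel) + (\<integral>\<^sup>+y. ennreal (\<bar>h y\<bar> / norm (x - y)) \<partial>lborel)"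
      by (rule nn_integral_add) measurable
    also have "\<dots> \<le> ennreal (K + L)" using K L by (auto simp: ennreal_plus intro: add_mono)
    finally show ?thesis .
  qed
  then show ?thesis using f h K(1) L(1) by (auto simp: pot_bounded_def intro!: exI[of _ "K + L"])
qed

lemma pot_bounded_cmult:
  assumes f: "pot_bounded f" shows "pot_bounded (\<lambda>x. c * f x)"
proof -
  note [measurable] = pot_bounded_borel[OF f]
  obtain K where K: "K \<ge> 0" "\<And>x. (\<integral>\<^sup>+y. ennreal (\<bar>f y\<bar> / norm (x - y)) \<partial>lborel) \<le> ennreal K"
    using f by (auto simp: pot_bounded_def)
  have "(\<integral>\<^sup>+y. ennreal (\<bar>c * f y\<bar> / norm (x - y)) \<partial>lborel) \<le> ennreal (\<bar>c\<bar> * K)" for x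
  proof -
    have "(\<integral>\<^sup>+y. ennreal (\<bar>c * f y\<bar> / norm (x - y)) \<partial>lborel) = ennreal \<bar>c\<bar> * (\<integral>\<^sup>+y. ennreal (\<bar>f y\<bar> / norm (x - y)) \<partial>lborel)"
      by (subst nn_integral_cmult[symmetric]) (auto intro!: nn_integral_cong simp: abs_mult ennreal_mult'[symmetric])
    also have "\<dots> \<le> ennreal \<bar>c\<bar> * ennreal K" by (intro mult_left_mono K) auto
    finally show ?thesis using K by (simp add: ennreal_mult)
  qed
  then show ?thesis using f K(1) by (auto simp: pot_bounded_def intro!: exI[of _ "\<bar>c\<bar> * K"])
qed

text \<open>Uses 1/r <= 1 + 1/r^2: the first term gives the mass, the second is Hardy's inequality
  with centre x, whose constant does not depend on x.\<close>

lemma pot_bounded_square: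
  assumes W: "H1_pair u g" shows "pot_bounded (\<lambda>x. (u x)\<^sup>2)"
proof -
  note [measurable] = L2_measurable[OF H1_pairD(1)[OF W]]
  let ?c = "LINT x|lborel. (norm (u x))\<^sup>2" and ?A = "LINT x|lborel. (norm (g x))\<^sup>2"
  have "(\<integral>\<^sup>+y. ennreal (\<bar>(u y)\<^sup>2\<bar> / norm (x - y)) \<partial>lborel) \<le> ennreal (?c + 4 * ?A)" for x
  proof -
    have "(\<integral>\<^sup>+y. ennreal (\<bar>(u y)\<^sup>2\<bar> / norm (x - y)) \<partial>lborel) \<le> (\<integral>\<^sup>+y. ennreal ((norm (u y))\<^sup>2) + ennreal ((u y)\<^sup>2 / (norm (y - x))\<^sup>2) \<partial>lborel)"
    proof (intro nn_integral_mono)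
      fix y
      have "1 / r \<le> 1 + 1 / r\<^sup>2" if "r > 0" for r :: real
      proof -
        have "0 \<le> (1 / r - 1)\<^sup>2" "0 \<le> 1 / r" using that by auto
        then have "0 \<le> 1 / r\<^sup>2 - 2 * (1 / r) + 1" by (simp add: power2_diff power_one_over)
        with \<open>0 \<le> 1 / r\<close> show ?thesis by linarith
      qed
      then have "1 / norm (x - y) \<le> 1 + 1 / (norm (x - y))\<^sup>2" by (cases "x = y") auto
      then have "(u y)\<^sup>2 * (1 / norm (x - y)) \<le> (u y)\<^sup>2 * (1 + 1 / (norm (x - y))\<^sup>2)" by (intro mult_left_mono) auto
      then have "\<bar>(u y)\<^sup>2\<bar> / norm (x - y) \<le> (norm (u y))\<^sup>2 + (u y)\<^sup>2 / (norm (y - x))\<^sup>2" by (simp add: distrib_left norm_minus_commute)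
      then show "ennreal (\<bar>(u y)\<^sup>2\<bar> / norm (x - y)) \<le> ennreal ((norm (u y))\<^sup>2) + ennreal ((u y)\<^sup>2 / (norm (y - x))\<^sup>2)"
        by (subst ennreal_plus[symmetric]) (simp_all add: ennreal_leI del: ennreal_plus)
    qed
    also have "\<dots> = (\<integral>\<^sup>+y. ennreal ((norm (u y))\<^sup>2) \<partial>lborel) + (\<integral>\<^sup>+y. ennreal ((u y)\<^sup>2 / (norm (y - x))\<^sup>2) \<partial>lborel)"
      by (rule nn_integral_add) measurable
    also have "\<dots> \<le> ennreal ?c + ennreal (4 * ?A)" by (intro add_mono hardy[OF W]) (simp only: L2_nn[OF H1_pairD(1)[OF W]] order_refl)
    finally show ?thesis by (subst ennreal_plus) auto
  qed
  then show ?thesis using L2_integrable[OF H1_pairD(1)[OF W]] by (auto simp: pot_bounded_def intro!: exI[of _ "?c + 4 * ?A"])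
qed

lemma pot_bounded_mult:
  assumes u: "H1_pair u g" and v: "H1_pair v h" shows "pot_bounded (\<lambda>x. u x * v x)"
proof (rule pot_bounded_mono[OF pot_bounded_add[OF pot_bounded_square[OF u] pot_bounded_square[OF v]]])
  note [measurable] = L2_measurable[OF H1_pairD(1)[OF u]] L2_measurable[OF H1_pairD(1)[OF v]]
  show "(\<lambda>x. u x * v x) \<in> borel_measurable borel" by measurable
  fix x
  have "2 * \<bar>u x\<bar> * \<bar>v x\<bar> \<le> \<bar>u x\<bar>\<^sup>2 + \<bar>v x\<bar>\<^sup>2" by (rule sum_squares_bound)
  moreover have "0 \<le> \<bar>u x\<bar> * \<bar>v x\<bar>" by simp
  ultimately show "\<bar>u x * v x\<bar> \<le> \<bar>(u x)\<^sup>2 + (v x)\<^sup>2\<bar>" unfolding abs_mult power2_abs by linarith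
qed

lemma coulomb_integrable:
  assumes f: "pot_bounded f" and h: "pot_bounded h"
  shows "integrable lborel (\<lambda>x. f x * potential h x)"
proof -
  note [measurable] = pot_bounded_borel[OF f] pot_bounded_borel[OF h]
  obtain K where K: "K \<ge> 0" "\<And>x. (LINT y|lborel. \<bar>h y\<bar> / norm (x - y)) \<le> K" "\<And>x. \<bar>potential h x\<bar> \<le> K"
    using pot_bounded_bounds[OF h] by blast
  show ?thesis
  proof (rule Bochner_Integration.integrable_bound)
    show "integrable lborel (\<lambda>x. K * f x)" using pot_bounded_integrable[OF f] by simp
    show "AE x in lborel. norm (f x * potential h x) \<le> norm (K * f x)"
      using K(1,3) by (auto simp: abs_mult mult.commute[of K] intro!: mult_left_mono)
  qed measurable
qed

lemma potential_add:
  assumes "pot_bounded f" "pot_bounded h"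
  shows "potential (\<lambda>x. f x + h x) x = potential f x + potential h x"
  using pot_bounded_potential_integrable[OF assms(1), of x] pot_bounded_potential_integrable[OF assms(2), of x]
  by (simp add: potential_def add_divide_distrib)

lemma potential_cmult: "potential (\<lambda>x. c * f x) x = c * potential f x"
  unfolding potential_def by (simp only: times_divide_eq_right[symmetric] integral_mult_right_zero)

lemma coulomb_add_left:
  assumes "pot_bounded f" "pot_bounded f'" "pot_bounded h"
  shows "coulomb (\<lambda>x. f x + f' x) h = coulomb f h + coulomb f' h"
  unfolding coulomb_def using coulomb_integrable[OF assms(1,3)] coulomb_integrable[OF assms(2,3)]
  by (simp add: distrib_right)

lemma coulomb_add_right:
  assumes "pot_bounded f" "pot_bounded h" "pot_bounded h'"
  shows "coulomb f (\<lambda>x. h x + h' x) = coulomb f h + coulomb f h'"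
  unfolding coulomb_def potential_add[OF assms(2,3)] using coulomb_integrable[OF assms(1,2)] coulomb_integrable[OF assms(1,3)]
  by (simp add: distrib_left)

lemma coulomb_cmult: "coulomb (\<lambda>x. c * f x) h = c * coulomb f h" "coulomb f (\<lambda>x. c * h x) = c * coulomb f h"
  unfolding coulomb_def potential_cmult by (simp_all only: mult.assoc mult.left_commute[of _ c] integral_mult_right_zero)

text \<open>The first factor is merely integrable because it will also be u (X . grad u), for which
  no bounded potential is available.\<close>

lemma coulomb_pair_integrable:
  assumes f: "integrable lborel f" and h: "pot_bounded h"
  shows "integrable (lborel \<Otimes>\<^sub>M lborel) (\<lambda>(x, y). f x * h y / norm (x - y))"
proof (rule lborel_pair.Fubini_integrable)
  note [measurable] = borel_measurable_integrable[OF f] pot_bounded_borel[OF h]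
  obtain K where K: "K \<ge> 0" "\<And>x. (LINT y|lborel. \<bar>h y\<bar> / norm (x - y)) \<le> K" "\<And>x. \<bar>potential h x\<bar> \<le> K"
    using pot_bounded_bounds[OF h] by blast
  show "(\<lambda>(x, y). f x * h y / norm (x - y)) \<in> borel_measurable (lborel \<Otimes>\<^sub>M lborel)" by measurable
  have eq: "(LINT y|lborel. norm (case (x, y) of (x, y) \<Rightarrow> f x * h y / norm (x - y))) = \<bar>f x\<bar> * (LINT y|lborel. \<bar>h y\<bar> / norm (x - y))" for x
    by (simp only: prod.case real_norm_def abs_mult abs_divide abs_norm_cancel times_divide_eq_right[symmetric] integral_mult_right_zero)
  show "integrable lborel (\<lambda>x. LINT y|lborel. norm (case (x, y) of (x, y) \<Rightarrow> f x * h y / norm (x - y)))"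
    unfolding eq
  proof (rule Bochner_Integration.integrable_bound)
    show "integrable lborel (\<lambda>x. K * f x)" using f by simp
    show "AE x in lborel. norm (\<bar>f x\<bar> * (LINT y|lborel. \<bar>h y\<bar> / norm (x - y))) \<le> norm (K * f x)"
    proof (rule AE_I2)
      fix x
      have "0 \<le> (LINT y|lborel. \<bar>h y\<bar> / norm (x - y))" by (auto intro!: integral_nonneg_AE)
      then show "norm (\<bar>f x\<bar> * (LINT y|lborel. \<bar>h y\<bar> / norm (x - y))) \<le> norm (K * f x)"
        using K(1) mult_left_mono[OF K(2)[of x] abs_ge_zero[of "f x"]] by (simp add: abs_mult mult.commute)
    qed
  qed measurable
  show "AE x in lborel. integrable lborel (\<lambda>y. case (x, y) of (x, y) \<Rightarrow> f x * h y / norm (x - y))"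
    by (simp only: prod.case times_divide_eq_right[symmetric]) (intro AE_I2 integrable_mult_right pot_bounded_potential_integrable[OF h])
qed

lemma coulomb_eq_double: "coulomb f h = (LINT x|lborel. LINT y|lborel. f x * h y / norm (x - y))"
  unfolding coulomb_def potential_def by (simp only: times_divide_eq_right[symmetric] integral_mult_right_zero)

lemma coulomb_commute:
  assumes f: "pot_bounded f" and h: "pot_bounded h"
  shows "coulomb f h = coulomb h f"
proof -
  have "coulomb f h = (LINT y|lborel. LINT x|lborel. f x * h y / norm (x - y))"
    unfolding coulomb_eq_double by (rule lborel_pair.Fubini_integral[OF coulomb_pair_integrable[OF pot_bounded_integrable[OF f] h], symmetric])
  then show ?thesis unfolding coulomb_eq_double by (simp add: norm_minus_commute mult.commute)
qed

lemma coulomb_square_nn: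
  assumes W: "H1_pair u g"
  shows "(\<integral>\<^sup>+x. \<integral>\<^sup>+y. ennreal ((u x)\<^sup>2 * (u y)\<^sup>2 / norm (x - y)) \<partial>lborel \<partial>lborel) = ennreal (coulomb (\<lambda>x. (u x)\<^sup>2) (\<lambda>x. (u x)\<^sup>2))"
proof -
  let ?f = "\<lambda>x. (u x)\<^sup>2"
  have f: "pot_bounded ?f" by (rule pot_bounded_square[OF W])
  have i: "integrable lborel (\<lambda>y. ?f y / norm (x - y))" for x by (rule pot_bounded_potential_integrable[OF f])
  have p0: "potential ?f x \<ge> 0" for x unfolding potential_def by (auto intro!: integral_nonneg_AE)
  have "(\<integral>\<^sup>+y. ennreal (?f x * ?f y / norm (x - y)) \<partial>lborel) = ennreal (?f x * potential ?f x)" for x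
    unfolding potential_def using i[of x]
    by (subst nn_integral_eq_integral) (simp_all only: times_divide_eq_right[symmetric] integral_mult_right_zero integrable_mult_right, auto)
  then show ?thesis
    unfolding coulomb_def using p0 by (simp add: nn_integral_eq_integral[OF coulomb_integrable[OF f f]])
qed

theorem cube_bound:
  assumes W: "H1_pair u g"
  shows "integrable lborel (\<lambda>x. \<bar>u x\<bar> ^ 3)"
    and "(LINT x|lborel. \<bar>u x\<bar> ^ 3)\<^sup>2 \<le> (LINT x|lborel. (norm (g x))\<^sup>2) * coulomb (\<lambda>x. (u x)\<^sup>2) (\<lambda>x. (u x)\<^sup>2)"
proof -
  note [measurable] = L2_measurable[OF H1_pairD(1)[OF W]] L2_measurable[OF H1_pairD(2)[OF W]]
  let ?A = "LINT x|lborel. (norm (g x))\<^sup>2" and ?B = "coulomb (\<lambda>x. (u x)\<^sup>2) (\<lambda>x. (u x)\<^sup>2)"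
  define H where "H z = (\<integral>\<^sup>+x. ennreal ((u x)\<^sup>2 / (norm (x - z))\<^sup>2) \<partial>lborel)" for z
  have [measurable]: "H \<in> borel_measurable borel" unfolding H_def[abs_def] by measurable
  have A0: "?A \<ge> 0" by simp
  have B0: "?B \<ge> 0" unfolding coulomb_def potential_def by (auto intro!: integral_nonneg_AE AE_I2 mult_nonneg_nonneg)
  have "ennreal (4 * pi) * (\<integral>\<^sup>+x. ennreal (\<bar>u x\<bar> ^ 3) \<partial>lborel) = (\<integral>\<^sup>+x. ennreal ((u x)\<^sup>2) * ennreal (4 * pi * \<bar>u x\<bar>) \<partial>lborel)"
    by (subst nn_integral_cmult[symmetric])
       (auto intro!: nn_integral_cong simp: ennreal_mult'[symmetric] power2_eq_square power3_eq_cube abs_mult_self_eq mult_ac)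
  also have "\<dots> \<le> (\<integral>\<^sup>+x. ennreal ((u x)\<^sup>2) * (\<integral>\<^sup>+z. ennreal (norm (g z) / (norm (z - x))\<^sup>2) \<partial>lborel) \<partial>lborel)"
    using riesz_representation_bound[OF W] by (intro nn_integral_mono_AE) (auto elim!: eventually_mono intro: mult_left_mono)
  also have "\<dots> = (\<integral>\<^sup>+x. \<integral>\<^sup>+z. ennreal ((u x)\<^sup>2) * ennreal (norm (g z) / (norm (z - x))\<^sup>2) \<partial>lborel \<partial>lborel)"
    by (intro nn_integral_cong nn_integral_cmult[symmetric]) measurable
  also have "\<dots> = (\<integral>\<^sup>+z. \<integral>\<^sup>+x. ennreal ((u x)\<^sup>2) * ennreal (norm (g z) / (norm (z - x))\<^sup>2) \<partial>lborel \<partial>lborel)"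
    by (rule lborel_pair.Fubini') measurable
  also have "\<dots> = (\<integral>\<^sup>+z. ennreal (norm (g z)) * H z \<partial>lborel)"
    unfolding H_def by (subst nn_integral_cmult[symmetric]) (auto intro!: nn_integral_cong simp: ennreal_mult'[symmetric] norm_minus_commute mult.commute)
  finally have 1: "ennreal (4 * pi) * (\<integral>\<^sup>+x. ennreal (\<bar>u x\<bar> ^ 3) \<partial>lborel) \<le> (\<integral>\<^sup>+z. ennreal (norm (g z)) * H z \<partial>lborel)" .
  \<comment> \<open>The square of the inner integral is opened into a double integral in x and y,
    and z is integrated first; this composes the two inverse square kernels.\<close>
  have "(\<integral>\<^sup>+z. (H z)\<^sup>2 \<partial>lborel) = (\<integral>\<^sup>+z. \<integral>\<^sup>+x. \<integral>\<^sup>+y. ennreal ((u x)\<^sup>2 / (norm (x - z))\<^sup>2) * ennreal ((u y)\<^sup>2 / (norm (y - z))\<^sup>2) \<partial>lborel \<partial>lborel \<partial>lborel)"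
    unfolding H_def power2_eq_square[of "nn_integral _ _"]
    by (intro nn_integral_cong) (simp add: nn_integral_cmult nn_integral_multc)
  also have "\<dots> = (\<integral>\<^sup>+x. \<integral>\<^sup>+z. \<integral>\<^sup>+y. ennreal ((u x)\<^sup>2 / (norm (x - z))\<^sup>2) * ennreal ((u y)\<^sup>2 / (norm (y - z))\<^sup>2) \<partial>lborel \<partial>lborel \<partial>lborel)"
    by (rule lborel_pair.Fubini') measurable
  also have "\<dots> = (\<integral>\<^sup>+x. \<integral>\<^sup>+y. \<integral>\<^sup>+z. ennreal ((u x)\<^sup>2 / (norm (x - z))\<^sup>2) * ennreal ((u y)\<^sup>2 / (norm (y - z))\<^sup>2) \<partial>lborel \<partial>lborel \<partial>lborel)"
    by (rule nn_integral_cong, rule lborel_pair.Fubini') measurable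
  also have "\<dots> \<le> (\<integral>\<^sup>+x. \<integral>\<^sup>+y. ennreal (32 * pi) * ennreal ((u x)\<^sup>2 * (u y)\<^sup>2 / norm (x - y)) \<partial>lborel \<partial>lborel)"
  proof (rule nn_integral_mono, rule nn_integral_mono_AE)
    fix x :: "real^3"
    have "AE y in lborel. y \<noteq> x" by (rule AE_lborel_singleton)
    then show "AE y in lborel. (\<integral>\<^sup>+z. ennreal ((u x)\<^sup>2 / (norm (x - z))\<^sup>2) * ennreal ((u y)\<^sup>2 / (norm (y - z))\<^sup>2) \<partial>lborel)
       \<le> ennreal (32 * pi) * ennreal ((u x)\<^sup>2 * (u y)\<^sup>2 / norm (x - y))"
    proof eventually_elim
      case (elim y)
      have "(\<integral>\<^sup>+z. ennreal ((u x)\<^sup>2 / (norm (x - z))\<^sup>2) * ennreal ((u y)\<^sup>2 / (norm (y - z))\<^sup>2) \<partial>lborel)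
        = ennreal ((u x)\<^sup>2 * (u y)\<^sup>2) * (\<integral>\<^sup>+z. ennreal (1 / ((norm (x - z))\<^sup>2 * (norm (y - z))\<^sup>2)) \<partial>lborel)"
        by (subst nn_integral_cmult[symmetric]) (auto intro!: nn_integral_cong simp: ennreal_mult'[symmetric])
      also have "\<dots> \<le> ennreal ((u x)\<^sup>2 * (u y)\<^sup>2) * ennreal (32 * pi / norm (x - y))"
        using elim by (intro mult_left_mono inverse_square_composition) auto
      also have "\<dots> = ennreal (32 * pi) * ennreal ((u x)\<^sup>2 * (u y)\<^sup>2 / norm (x - y))"
        by (simp add: ennreal_mult'[symmetric] mult_ac)
      finally show ?case .
    qed
  qed
  also have "\<dots> = ennreal (32 * pi) * ennreal ?B"
    by (simp add: nn_integral_cmult coulomb_square_nn[OF W])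
  finally have 2: "(\<integral>\<^sup>+z. (H z)\<^sup>2 \<partial>lborel) \<le> ennreal (32 * pi) * ennreal ?B" .
  have "(ennreal (4 * pi) * (\<integral>\<^sup>+x. ennreal (\<bar>u x\<bar> ^ 3) \<partial>lborel))\<^sup>2 \<le> (\<integral>\<^sup>+z. ennreal (norm (g z)) * H z \<partial>lborel)\<^sup>2"
    using 1 by (intro power_mono) auto
  also have "\<dots> \<le> (\<integral>\<^sup>+z. (ennreal (norm (g z)))\<^sup>2 \<partial>lborel) * (\<integral>\<^sup>+z. (H z)\<^sup>2 \<partial>lborel)"
    by (rule Cauchy_Schwarz_nn_integral) measurable
  also have "\<dots> \<le> ennreal ?A * (ennreal (32 * pi) * ennreal ?B)"
    by (intro mult_mono 2) (auto simp: ennreal_power L2_nn[OF H1_pairD(2)[OF W]])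
  also have "\<dots> = ennreal (32 * pi * (?A * ?B))" using A0 B0 by (simp add: ennreal_mult'[symmetric] mult_ac)
  finally have 3: "(ennreal (4 * pi) * (\<integral>\<^sup>+x. ennreal (\<bar>u x\<bar> ^ 3) \<partial>lborel))\<^sup>2 \<le> ennreal (32 * pi * (?A * ?B))" .
  \<comment> \<open>Finiteness of the cubic integral is read off from \<open>3\<close> itself, whose
    right-hand side is finite.\<close>
  have fin: "(\<integral>\<^sup>+x. ennreal (\<bar>u x\<bar> ^ 3) \<partial>lborel) < \<infinity>"
  proof (rule ccontr)
    assume "\<not> ?thesis"
    then have "(\<integral>\<^sup>+x. ennreal (\<bar>u x\<bar> ^ 3) \<partial>lborel) = top" by (simp add: less_top[symmetric])
    with 3 show False by (simp add: ennreal_mult_top power2_eq_square top_unique)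
  qed
  show i: "integrable lborel (\<lambda>x. \<bar>u x\<bar> ^ 3)" by (rule integrableI_nonneg) (use fin in auto)
  let ?C = "LINT x|lborel. \<bar>u x\<bar> ^ 3"
  have C0: "?C \<ge> 0" by (auto intro!: integral_nonneg_AE)
  \<comment> \<open>After cancellation this is C^2 <= (2/pi) A B, so the crude constant 32 pi is
    harmless.\<close>
  have "(4 * pi * ?C)\<^sup>2 \<le> 32 * pi * (?A * ?B)"
    using 3 C0 A0 B0 by (simp add: nn_integral_eq_integral[OF i] ennreal_mult'[symmetric] ennreal_power)
  then have "pi * (16 * pi * ?C\<^sup>2) \<le> pi * (32 * (?A * ?B))" by (simp add: power2_eq_square mult_ac)
  then have "16 * pi * ?C\<^sup>2 \<le> 32 * (?A * ?B)" by (rule mult_left_le_imp_le) simp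
  moreover have "16 * 2 * ?C\<^sup>2 \<le> 16 * pi * ?C\<^sup>2" using pi_gt3 by (intro mult_right_mono) auto
  ultimately show "?C\<^sup>2 \<le> ?A * ?B" by simp
qed

section \<open>The weak Euler-Lagrange equation\<close>

lemma powr_le_square_plus_six:
  fixes s :: real
  assumes "0 \<le> s" "2 \<le> q" "q \<le> 6"
  shows "s powr q \<le> s\<^sup>2 + s ^ 6"
proof (cases "s \<le> 1")
  case True
  then have "s powr q \<le> s powr 2" using assms by (intro powr_mono') auto
  then show ?thesis using assms(1) by (simp add: powr_numeral add_increasing2)
next
  case False
  then have "s powr q \<le> s powr 6" using assms by (intro powr_mono) auto
  then show ?thesis using assms(1) False by (simp add: powr_numeral add_increasing)
qed

lemma H1_six_integrable:
  assumes W: "H1_pair u g"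
  shows "integrable lborel (\<lambda>x. (u x) ^ 6)"
    and "(LINT x|lborel. (u x) ^ 6) \<le> 2 * (LINT x|lborel. (norm (g x))\<^sup>2) ^ 3"
proof -
  note [measurable] = L2_measurable[OF H1_pairD(1)[OF W]]
  have 0: "0 \<le> (u x) ^ 6" for x by (simp add: zero_le_even_power)
  show i: "integrable lborel (\<lambda>x. (u x) ^ 6)"
    by (rule integrableI_nonneg) (use 0 sobolev[OF W] in \<open>auto intro: le_less_trans\<close>)
  show "(LINT x|lborel. (u x) ^ 6) \<le> 2 * (LINT x|lborel. (norm (g x))\<^sup>2) ^ 3"
    using sobolev[OF W] by (subst (asm) nn_integral_eq_integral[OF i]) (use 0 in \<open>auto simp: ennreal_le_iff\<close>)
qed

text \<open>Provides the majorant for differentiating the power term along a line. The constant 64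
  is 2^6, from bounding a sum by twice the maximum.\<close>

lemma integrable_sum_powr:
  assumes u: "H1_pair u g" and v: "H1_pair v h" and q: "2 \<le> q" "q \<le> 6"
  shows "integrable lborel (\<lambda>x. (\<bar>u x\<bar> + \<bar>v x\<bar>) powr q)"
proof (rule Bochner_Integration.integrable_bound)
  note [measurable] = L2_measurable[OF H1_pairD(1)[OF u]] L2_measurable[OF H1_pairD(1)[OF v]]
  show "integrable lborel (\<lambda>x. 2 * ((norm (u x))\<^sup>2 + (norm (v x))\<^sup>2) + 64 * ((u x) ^ 6 + (v x) ^ 6))"
    using L2_integrable[OF H1_pairD(1)[OF u]] L2_integrable[OF H1_pairD(1)[OF v]] H1_six_integrable(1)[OF u] H1_six_integrable(1)[OF v] by simp
  show "(\<lambda>x. (\<bar>u x\<bar> + \<bar>v x\<bar>) powr q) \<in> borel_measurable lborel" by measurable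
  show "AE x in lborel. norm ((\<bar>u x\<bar> + \<bar>v x\<bar>) powr q) \<le> norm (2 * ((norm (u x))\<^sup>2 + (norm (v x))\<^sup>2) + 64 * ((u x) ^ 6 + (v x) ^ 6))"
  proof (rule AE_I2)
    fix x
    let ?a = "\<bar>u x\<bar>" and ?b = "\<bar>v x\<bar>"
    have "(?a + ?b)\<^sup>2 \<le> 2 * (?a\<^sup>2 + ?b\<^sup>2)" using sum_squares_bound[of ?a ?b] by (simp add: power2_sum)
    moreover have "(?a + ?b) ^ 6 \<le> 64 * (?a ^ 6 + ?b ^ 6)"
    proof -
      have "(?a + ?b) ^ 6 \<le> (2 * max ?a ?b) ^ 6" by (intro power_mono) auto
      also have "\<dots> = 64 * (max ?a ?b) ^ 6" by (simp add: power_mult_distrib)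
      also have "(max ?a ?b) ^ 6 \<le> ?a ^ 6 + ?b ^ 6" by (auto simp: max_def)
      finally show ?thesis by simp
    qed
    moreover have "?a ^ 6 = (u x) ^ 6" "?b ^ 6 = (v x) ^ 6" by (simp_all add: power_even_abs)
    moreover have "0 \<le> (u x) ^ 6" "0 \<le> (v x) ^ 6" by (simp_all add: zero_le_even_power)
    ultimately show "norm ((?a + ?b) powr q) \<le> norm (2 * ((norm (u x))\<^sup>2 + (norm (v x))\<^sup>2) + 64 * ((u x) ^ 6 + (v x) ^ 6))"
      using powr_le_square_plus_six[of "?a + ?b" q] q by simp
  qed
qed

lemma H1_pair_zero: "H1_pair (\<lambda>x. 0) (\<lambda>x. 0)"
  by (rule C1_imp_H1_pair) (auto simp: L2_def)

lemma H1_powr_integrable: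
  assumes u: "H1_pair u g" and q: "2 \<le> q" "q \<le> 6"
  shows "integrable lborel (\<lambda>x. \<bar>u x\<bar> powr q)"
  using integrable_sum_powr[OF u H1_pair_zero q] by simp

lemma H1_pair_add_cmult:
  assumes u: "H1_pair u g" and v: "H1_pair v h"
  shows "H1_pair (\<lambda>x. u x + s * v x) (\<lambda>x. g x + s *\<^sub>R h x)"
proof -
  have L: "L2 (\<lambda>x. u x + s * v x)" "L2 (\<lambda>x. g x + s *\<^sub>R h x)"
    using H1_pairD[OF u] H1_pairD[OF v] by (auto intro!: L2_add L2_cmult L2_scaleR)
  have "(LINT x|lborel. (u x + s * v x) * partial_deriv i \<phi> x) = - (LINT x|lborel. (g x + s *\<^sub>R h x) $ i * \<phi> x)" if tf: "test_function \<phi>" for \<phi> i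
  proof -
    note t = test_function_L2[OF tf]
    have "L2 (\<lambda>x. g x $ i)" "L2 (\<lambda>x. h x $ i)"
      using L2_inner_const[OF H1_pairD(2)[OF u], of "axis i 1"] L2_inner_const[OF H1_pairD(2)[OF v], of "axis i 1"] by (simp_all add: inner_axis)
    then have i: "integrable lborel (\<lambda>x. u x * partial_deriv i \<phi> x)" "integrable lborel (\<lambda>x. v x * partial_deriv i \<phi> x)"
      "integrable lborel (\<lambda>x. g x $ i * \<phi> x)" "integrable lborel (\<lambda>x. h x $ i * \<phi> x)"
      using H1_pairD(1)[OF u] H1_pairD(1)[OF v] t by (auto intro: L2_integrable_mult)
    have "(LINT x|lborel. (u x + s * v x) * partial_deriv i \<phi> x) = (LINT x|lborel. u x * partial_deriv i \<phi> x) + s * (LINT x|lborel. v x * partial_deriv i \<phi> x)"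
      using i by (simp add: distrib_right mult.assoc)
    also have "\<dots> = - ((LINT x|lborel. g x $ i * \<phi> x) + s * (LINT x|lborel. h x $ i * \<phi> x))"
      by (simp add: has_weak_gradientD[OF H1_pairD(3)[OF u] tf] has_weak_gradientD[OF H1_pairD(3)[OF v] tf])
    also have "(LINT x|lborel. g x $ i * \<phi> x) + s * (LINT x|lborel. h x $ i * \<phi> x) = (LINT x|lborel. (g x + s *\<^sub>R h x) $ i * \<phi> x)"
      using i by (simp add: distrib_right mult.assoc)
    finally show ?thesis .
  qed
  then show ?thesis using L by (simp add: H1_pair_def has_weak_gradient_def L2_loc_int loc_int_locally_integrable)
qed

text \<open>Interface to the given definitions: by uniqueness almost everywhere, any square
  integrable weak gradient computes the Dirichlet integral of the chosen one.\<close>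

lemma H1_pair_imp_H1:
  assumes W: "H1_pair u g"
  shows "u \<in> H1" "(LINT x|lborel. (norm (weak_gradient u x))\<^sup>2) = (LINT x|lborel. (norm (g x))\<^sup>2)"
proof -
  show "u \<in> H1" using W by (auto simp: H1_def H1_pair_def L2_def)
  have h: "has_weak_gradient u (weak_gradient u)"
    unfolding weak_gradient_def by (rule someI[of "has_weak_gradient u"]) (rule H1_pairD(3)[OF W])
  have "AE x in lborel. weak_gradient u x = g x" by (rule weak_gradient_unique[OF h H1_pairD(3)[OF W]])
  moreover have "weak_gradient u \<in> borel_measurable lborel" using h by (simp add: has_weak_gradient_def locally_integrable_def)
  moreover have "g \<in> borel_measurable lborel" using H1_pairD(2)[OF W] by (simp add: L2_def)
  ultimately show "(LINT x|lborel. (norm (weak_gradient u x))\<^sup>2) = (LINT x|lborel. (norm (g x))\<^sup>2)"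
    by (intro integral_cong_AE) auto
qed

lemma H1_imp_H1_pair:
  assumes "u \<in> H1" obtains g where "H1_pair u g"
  using assms by (auto simp: H1_def H1_pair_def L2_def has_weak_gradient_def locally_integrable_def)

lemma energy_H1_pair:
  assumes W: "H1_pair u g"
  shows "energy p u = 1/2 * (LINT x|lborel. (norm (g x))\<^sup>2) + 1/4 * coulomb (\<lambda>x. (u x)\<^sup>2) (\<lambda>x. (u x)\<^sup>2) - 1/p * (LINT x|lborel. \<bar>u x\<bar> powr p)"
  by (simp add: energy_def H1_pair_imp_H1(2)[OF W] coulomb_eq_double)

section \<open>Derivatives of the energy along lines\<close>

lemma DERIV_abs_powr:
  assumes p: "1 < p"
  shows "((\<lambda>t::real. \<bar>t\<bar> powr p) has_real_derivative p * (\<bar>t\<bar> powr (p - 2) * t)) (at t)"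
proof (cases t "0::real" rule: linorder_cases)
  case less
  have "((\<lambda>t. (- t) powr p) has_real_derivative p * (- t) powr (p - 1) * (- 1)) (at t)"
    using less by (auto intro!: derivative_eq_intros)
  then have "((\<lambda>t::real. \<bar>t\<bar> powr p) has_real_derivative p * (- t) powr (p - 1) * (- 1)) (at t)"
    by (rule has_field_derivative_transform_within_open[of _ _ t "{..<0}"]) (use less in auto)
  moreover have "(- t) powr (p - 1) = (- t) powr (p - 2) * (- t)"
    using less powr_add[of "- t" "p - 2" 1] by simp
  ultimately show ?thesis using less by (simp add: mult.assoc)
next
  case greater
  have "((\<lambda>t. t powr p) has_real_derivative p * t powr (p - 1)) (at t)"
    using greater by (auto intro!: derivative_eq_intros)
  then have "((\<lambda>t::real. \<bar>t\<bar> powr p) has_real_derivative p * t powr (p - 1)) (at t)"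
    by (rule has_field_derivative_transform_within_open[of _ _ t "{0<..}"]) (use greater in auto)
  moreover have "t powr (p - 1) = t powr (p - 2) * t"
    using greater powr_add[of t "p - 2" 1] by simp
  ultimately show ?thesis using greater by simp
next
  case equal
  have "((\<lambda>y::real. \<bar>y\<bar> powr (p - 1)) \<longlongrightarrow> \<bar>0\<bar> powr (p - 1)) (at 0)"
    by (rule tendsto_powr') (use p in \<open>auto intro!: tendsto_rabs_zero tendsto_ident_at\<close>)
  then have "((\<lambda>y::real. \<bar>y\<bar> powr (p - 1)) \<longlongrightarrow> 0) (at 0)" by simp
  then have "((\<lambda>y::real. \<bar>y\<bar> powr p / y) \<longlongrightarrow> 0) (at 0)"
  proof (rule Lim_null_comparison[rotated])
    show "\<forall>\<^sub>F y in at 0. norm (\<bar>y\<bar> powr p / y) \<le> \<bar>y\<bar> powr (p - 1)"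
      by (auto simp: eventually_at_filter abs_divide powr_diff)
  qed
  then show ?thesis using equal by (simp add: has_field_derivative_iff)
qed

lemma abs_powr_times: "0 < q \<Longrightarrow> \<bar>\<bar>t\<bar> powr (q - 1) * t\<bar> = \<bar>t::real\<bar> powr q"
  using powr_add[of "\<bar>t\<bar>" "q - 1" 1] by (cases "t = 0") (auto simp: abs_mult)

lemma abs_powr_diff_bound:
  fixes x y M :: real
  assumes p: "1 < p" and M: "\<bar>x\<bar> \<le> M" "\<bar>y\<bar> \<le> M"
  shows "\<bar>\<bar>x\<bar> powr p - \<bar>y\<bar> powr p\<bar> \<le> p * M powr (p - 1) * \<bar>x - y\<bar>"
proof -
  have "norm (\<bar>x\<bar> powr p - \<bar>y\<bar> powr p) \<le> (p * M powr (p - 1)) * norm (x - y)"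
  proof (rule field_differentiable_bound[where S="{-M..M}"])
    fix z assume z: "z \<in> {-M..M}"
    show "((\<lambda>t::real. \<bar>t\<bar> powr p) has_real_derivative p * (\<bar>z\<bar> powr (p - 2) * z)) (at z within {-M..M})"
      by (rule has_field_derivative_at_within[OF DERIV_abs_powr[OF p]])
    have "\<bar>\<bar>z\<bar> powr (p - 2) * z\<bar> = \<bar>z\<bar> powr (p - 1)" using abs_powr_times[of "p - 1" z] p by simp
    also have "\<dots> \<le> M powr (p - 1)" using z p by (intro powr_mono2) auto
    finally show "norm (p * (\<bar>z\<bar> powr (p - 2) * z)) \<le> p * M powr (p - 1)" using p by (simp add: abs_mult mult_left_mono)
  qed (use M in auto)
  then show ?thesis by simp
qed

text \<open>As the Frechet derivative is given, it need only be evaluated along one sequence of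
  positive steps, here bounded by 1. The same sequence later serves as regularization
  parameter.\<close>

definition null_step :: "nat \<Rightarrow> real" where "null_step n = inverse (real (Suc n))"

lemma null_step: "null_step \<longlonglongrightarrow> 0" "0 < null_step n" "null_step n \<le> 1"
  using LIMSEQ_inverse_real_of_nat by (auto simp: null_step_def[abs_def] inverse_le_1_iff)

text \<open>Dominated convergence: the steps are at most 1, so the mean value theorem bounds every
  quotient by p (|u|+|v|)^p.\<close>

lemma powr_integral_derivative:
  assumes u: "H1_pair u g" and v: "H1_pair v h" and p: "2 \<le> p" "p \<le> 6"
  shows "(\<lambda>n. ((LINT x|lborel. \<bar>u x + null_step n * v x\<bar> powr p) - (LINT x|lborel. \<bar>u x\<bar> powr p)) / null_step n)
     \<longlonglongrightarrow> p * (LINT x|lborel. (\<bar>u x\<bar> powr (p - 2) * u x) * v x)"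
proof -
  note [measurable] = L2_measurable[OF H1_pairD(1)[OF u]] L2_measurable[OF H1_pairD(1)[OF v]]
  let ?q = "\<lambda>n x. (\<bar>u x + null_step n * v x\<bar> powr p - \<bar>u x\<bar> powr p) / null_step n"
  have i: "integrable lborel (\<lambda>x. \<bar>u x + s * v x\<bar> powr p)" for s
    by (rule H1_powr_integrable[OF H1_pair_add_cmult[OF u v] p])
  have "(\<lambda>n. LINT x|lborel. ?q n x) \<longlonglongrightarrow> (LINT x|lborel. p * (\<bar>u x\<bar> powr (p - 2) * u x) * v x)"
  proof (rule integral_dominated_convergence)
    show "integrable lborel (\<lambda>x. p * (\<bar>u x\<bar> + \<bar>v x\<bar>) powr p)"
      using integrable_sum_powr[OF u v p] by simp
    show "AE x in lborel. (\<lambda>n. ?q n x) \<longlonglongrightarrow> p * (\<bar>u x\<bar> powr (p - 2) * u x) * v x"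
    proof (rule AE_I2)
      fix x
      have "((\<lambda>s. \<bar>u x + s * v x\<bar> powr p) has_real_derivative p * (\<bar>u x + 0 * v x\<bar> powr (p - 2) * (u x + 0 * v x)) * v x) (at 0)"
        by (rule DERIV_chain2[OF DERIV_abs_powr]) (use p in \<open>auto intro!: derivative_eq_intros\<close>)
      then have "((\<lambda>s. (\<bar>u x + s * v x\<bar> powr p - \<bar>u x\<bar> powr p) / s) \<longlongrightarrow> p * (\<bar>u x\<bar> powr (p - 2) * u x) * v x) (at 0)"
        by (simp add: has_field_derivative_iff)
      moreover have "filterlim null_step (at 0) sequentially"
        using null_step by (auto simp: filterlim_at intro!: always_eventually less_imp_neq[symmetric])
      ultimately show "(\<lambda>n. ?q n x) \<longlonglongrightarrow> p * (\<bar>u x\<bar> powr (p - 2) * u x) * v x" by (rule filterlim_compose)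
    qed
    fix n
    show "AE x in lborel. norm (?q n x) \<le> p * (\<bar>u x\<bar> + \<bar>v x\<bar>) powr p"
    proof (rule AE_I2)
      fix x
      let ?M = "\<bar>u x\<bar> + \<bar>v x\<bar>" and ?s = "null_step n"
      have s: "0 < ?s" "?s \<le> 1" by (rule null_step)+
      have sv: "\<bar>?s * v x\<bar> \<le> \<bar>v x\<bar>" using s by (simp add: abs_mult mult_left_le_one_le)
      have "\<bar>\<bar>u x + ?s * v x\<bar> powr p - \<bar>u x\<bar> powr p\<bar> \<le> p * ?M powr (p - 1) * \<bar>(u x + ?s * v x) - u x\<bar>"
        by (rule abs_powr_diff_bound) (use sv p in auto)
      also have "\<dots> = (p * ?M powr (p - 1) * \<bar>v x\<bar>) * ?s" using s by (simp add: abs_mult)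
      finally have "norm (?q n x) \<le> p * ?M powr (p - 1) * \<bar>v x\<bar>" using s by (simp add: abs_divide divide_le_eq)
      also have "\<dots> \<le> p * ?M powr (p - 1) * ?M" using p by (intro mult_left_mono) auto
      also have "\<dots> = p * ?M powr p" using powr_add[of ?M "p - 1" 1] by (cases "?M = 0") auto
      finally show "norm (?q n x) \<le> p * ?M powr p" .
    qed
  qed measurable
  note lim = this
  have eq: "(LINT x|lborel. ?q n x) = ((LINT x|lborel. \<bar>u x + null_step n * v x\<bar> powr p) - (LINT x|lborel. \<bar>u x\<bar> powr p)) / null_step n" for n
  proof -
    have "(LINT x|lborel. \<bar>u x + null_step n * v x\<bar> powr p - \<bar>u x\<bar> powr p) = (LINT x|lborel. \<bar>u x + null_step n * v x\<bar> powr p) - (LINT x|lborel. \<bar>u x\<bar> powr p)"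
      by (rule Bochner_Integration.integral_diff[OF i]) (use i[of 0] in simp)
    then show ?thesis by simp
  qed
  show ?thesis using lim unfolding eq by (simp add: mult.assoc)
qed

lemma dirichlet_derivative:
  assumes g: "L2 g" and h: "L2 h"
  shows "(\<lambda>n. ((LINT x|lborel. (norm (g x + null_step n *\<^sub>R h x))\<^sup>2) - (LINT x|lborel. (norm (g x))\<^sup>2)) / null_step n)
     \<longlonglongrightarrow> 2 * (LINT x|lborel. g x \<bullet> h x)"
proof -
  let ?I = "LINT x|lborel. g x \<bullet> h x" and ?H = "LINT x|lborel. (norm (h x))\<^sup>2"
  have "(LINT x|lborel. (norm (g x + s *\<^sub>R h x))\<^sup>2) = (LINT x|lborel. (norm (g x))\<^sup>2) + s * (2 * ?I + s * ?H)" for s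
  proof -
    have "(norm (g x + s *\<^sub>R h x))\<^sup>2 = (norm (g x))\<^sup>2 + ((2 * s) * (g x \<bullet> h x) + (s * s) * (norm (h x))\<^sup>2)" for x
      unfolding power2_norm_eq_inner by (simp add: inner_add_left inner_add_right inner_commute algebra_simps)
    then show ?thesis
      using L2_integrable[OF g] L2_integrable[OF h] L2_integrable_inner[OF g h] by (simp add: algebra_simps)
  qed
  then have "((LINT x|lborel. (norm (g x + null_step n *\<^sub>R h x))\<^sup>2) - (LINT x|lborel. (norm (g x))\<^sup>2)) / null_step n = 2 * ?I + null_step n * ?H" for n
    using null_step(2)[of n] by simp
  moreover have "(\<lambda>n. 2 * ?I + null_step n * ?H) \<longlonglongrightarrow> 2 * ?I + 0 * ?H" by (intro tendsto_intros null_step)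
  ultimately show ?thesis by simp
qed

text \<open>The density of u + s v is quadratic in s, so its Coulomb energy is a polynomial of
  degree four. In the nested form the difference quotient at s = 0 can be read off.\<close>

lemma coulomb_quadratic_curve:
  assumes a: "pot_bounded a" and b: "pot_bounded b" and d: "pot_bounded d"
  shows "coulomb (\<lambda>x. a x + s * (b x + s * d x)) (\<lambda>x. a x + s * (b x + s * d x))
     = coulomb a a + s * (2 * coulomb a b + s * (2 * coulomb a d + coulomb b b + s * (2 * coulomb b d + s * coulomb d d)))"
proof -
  have sd: "pot_bounded (\<lambda>x. s * d x)" by (rule pot_bounded_cmult[OF d])
  have be: "pot_bounded (\<lambda>x. b x + s * d x)" by (rule pot_bounded_add[OF b sd])
  have sbe: "pot_bounded (\<lambda>x. s * (b x + s * d x))" by (rule pot_bounded_cmult[OF be])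
  have all: "pot_bounded (\<lambda>x. a x + s * (b x + s * d x))" by (rule pot_bounded_add[OF a sbe])
  have 1: "coulomb a (\<lambda>x. b x + s * d x) = coulomb a b + s * coulomb a d"
    by (simp only: coulomb_add_right[OF a b sd] coulomb_cmult)
  have 2: "coulomb (\<lambda>x. b x + s * d x) (\<lambda>x. b x + s * d x) = (coulomb b b + s * coulomb b d) + s * (coulomb b d + s * coulomb d d)"
    unfolding coulomb_add_left[OF b sd be] coulomb_cmult coulomb_add_right[OF b b sd] coulomb_add_right[OF d b sd] coulomb_commute[OF d b] ..
  have "coulomb (\<lambda>x. a x + s * (b x + s * d x)) (\<lambda>x. a x + s * (b x + s * d x))
    = (coulomb a a + s * coulomb a (\<lambda>x. b x + s * d x)) + s * (coulomb a (\<lambda>x. b x + s * d x) + s * coulomb (\<lambda>x. b x + s * d x) (\<lambda>x. b x + s * d x))"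
    unfolding coulomb_add_left[OF a sbe all] coulomb_cmult coulomb_add_right[OF a a sbe] coulomb_add_right[OF be a sbe] coulomb_commute[OF be a] ..
  then show ?thesis unfolding 1 2 by (simp add: algebra_simps)
qed

lemma coulomb_derivative:
  assumes u: "H1_pair u g" and v: "H1_pair v h"
  shows "(\<lambda>n. (coulomb (\<lambda>x. (u x + null_step n * v x)\<^sup>2) (\<lambda>x. (u x + null_step n * v x)\<^sup>2) - coulomb (\<lambda>x. (u x)\<^sup>2) (\<lambda>x. (u x)\<^sup>2)) / null_step n)
     \<longlonglongrightarrow> 4 * (LINT x|lborel. potential (\<lambda>x. (u x)\<^sup>2) x * u x * v x)"
proof -
  let ?a = "\<lambda>x. (u x)\<^sup>2" and ?b = "\<lambda>x. 2 * (u x * v x)" and ?d = "\<lambda>x. (v x)\<^sup>2"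
  have a: "pot_bounded ?a" and b: "pot_bounded ?b" and d: "pot_bounded ?d" and uv: "pot_bounded (\<lambda>x. u x * v x)"
    using pot_bounded_square[OF u] pot_bounded_square[OF v] pot_bounded_cmult[OF pot_bounded_mult[OF u v]] pot_bounded_mult[OF u v] by auto
  have sq: "(\<lambda>x. (u x + s * v x)\<^sup>2) = (\<lambda>x. ?a x + s * (?b x + s * ?d x))" for s
    by (auto simp: power2_eq_square algebra_simps)
  note e = coulomb_quadratic_curve[OF a b d]
  have "(coulomb (\<lambda>x. (u x + null_step n * v x)\<^sup>2) (\<lambda>x. (u x + null_step n * v x)\<^sup>2) - coulomb ?a ?a) / null_step n
    = 2 * coulomb ?a ?b + null_step n * (2 * coulomb ?a ?d + coulomb ?b ?b + null_step n * (2 * coulomb ?b ?d + null_step n * coulomb ?d ?d))" for n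
    unfolding sq e using null_step(2)[of n] by simp
  moreover have "(\<lambda>n. 2 * coulomb ?a ?b + null_step n * (2 * coulomb ?a ?d + coulomb ?b ?b + null_step n * (2 * coulomb ?b ?d + null_step n * coulomb ?d ?d)))
    \<longlonglongrightarrow> 2 * coulomb ?a ?b + 0 * (2 * coulomb ?a ?d + coulomb ?b ?b + 0 * (2 * coulomb ?b ?d + 0 * coulomb ?d ?d))"
    by (intro tendsto_intros null_step)
  moreover have "coulomb ?a ?b = 2 * (LINT x|lborel. potential ?a x * u x * v x)"
    unfolding coulomb_cmult coulomb_commute[OF a uv] by (simp add: coulomb_def mult_ac)
  ultimately show ?thesis by simp
qed

text \<open>The right-hand side of the Euler-Lagrange equation in the form -Laplace u = f:
  everything except the Laplacian is collected in one function, which lies in L2 in the range of p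
  considered.\<close>

definition nonlinearity :: "real \<Rightarrow> real \<Rightarrow> (real^3 \<Rightarrow> real) \<Rightarrow> real^3 \<Rightarrow> real" where
  "nonlinearity p \<mu> u x = \<mu> * u x - potential (\<lambda>x. (u x)\<^sup>2) x * u x + \<bar>u x\<bar> powr (p - 2) * u x"

lemma L2_potential_mult:
  assumes u: "H1_pair u g" shows "L2 (\<lambda>x. potential (\<lambda>x. (u x)\<^sup>2) x * u x)"
proof -
  note [measurable] = L2_measurable[OF H1_pairD(1)[OF u]]
  obtain K where K: "\<And>x. \<bar>potential (\<lambda>x. (u x)\<^sup>2) x\<bar> \<le> K" using pot_bounded_bounds[OF pot_bounded_square[OF u]] by blast
  show ?thesis using L2_bounded_scaleR[OF H1_pairD(1)[OF u] _ K] by auto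
qed

text \<open>Here the upper bound on p enters: the square is |u|^(2(p-1)), and 2(p-1) <= 6 is the
  Sobolev range.\<close>

lemma L2_powr_mult:
  assumes u: "H1_pair u g" and p: "2 \<le> p" "p \<le> 4" shows "L2 (\<lambda>x. \<bar>u x\<bar> powr (p - 2) * u x)"
proof -
  note [measurable] = L2_measurable[OF H1_pairD(1)[OF u]]
  have "(norm (\<bar>u x\<bar> powr (p - 2) * u x))\<^sup>2 = \<bar>u x\<bar> powr (2 * (p - 1))" for x
    using abs_powr_times[of "p - 1" "u x"] p by (simp add: power2_eq_square powr_add[symmetric])
  then show ?thesis using H1_powr_integrable[OF u, of "2 * (p - 1)"] p by (simp add: L2_def)
qed

lemma L2_nonlinearity:
  assumes u: "H1_pair u g" and p: "2 \<le> p" "p \<le> 4" shows "L2 (nonlinearity p \<mu> u)"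
  unfolding nonlinearity_def[abs_def]
  by (intro L2_add L2_diff L2_cmult L2_potential_mult[OF u] L2_powr_mult[OF u p] H1_pairD(1)[OF u])

text \<open>The difference quotients of the energy along \<open>null_step\<close> have two
  expressions for their limit, the prescribed derivative and the sum of the termwise derivatives. In
  the latter the factors 1/2, 1/4 and 1/p cancel against 2, 4 and p.\<close>

theorem critical_point_weak_equation:
  assumes d: "H1_has_derivative (energy p) (\<lambda>v. \<mu> * (LINT x|lborel. u x * v x)) u"
    and u: "H1_pair u g" and v: "H1_pair v h" and p: "2 < p" "p \<le> 4"
  shows "(LINT x|lborel. g x \<bullet> h x) = (LINT x|lborel. nonlinearity p \<mu> u x * v x)"
proof -
  let ?L = "\<mu> * (LINT x|lborel. u x * v x)" and ?V = "potential (\<lambda>x. (u x)\<^sup>2)"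
  let ?N = "sqrt ((LINT x|lborel. \<bar>v x\<bar>\<^sup>2) + (LINT x|lborel. (norm (h x))\<^sup>2))"
  define q where "q n = (energy p (\<lambda>x. u x + null_step n * v x) - energy p u) / null_step n" for n
  have N: "?N \<ge> 0" by simp
  have v': "H1_pair (\<lambda>x. s * v x) (\<lambda>x. s *\<^sub>R h x)" for s using H1_pair_add_cmult[OF H1_pair_zero v, of s] by simp
  have Hn: "H1_norm (\<lambda>x. s * v x) = s * ?N" if "s > 0" for s
  proof -
    have "H1_norm (\<lambda>x. s * v x) = sqrt (s\<^sup>2 * ((LINT x|lborel. \<bar>v x\<bar>\<^sup>2) + (LINT x|lborel. (norm (h x))\<^sup>2)))"
      unfolding H1_norm_def H1_pair_imp_H1(2)[OF v'] by (simp add: power_mult_distrib distrib_left)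
    then show ?thesis using that by (simp add: real_sqrt_mult)
  qed
  have lim1: "q \<longlonglongrightarrow> ?L"
  proof (rule LIMSEQ_I)
    fix e :: real assume e: "e > 0"
    define e' where "e' = e / (?N + 1)"
    have e': "e' > 0" "e' * ?N < e" using e N frac_mult_less[OF e N] by (auto simp: e'_def add_nonneg_pos)
    obtain \<delta> where \<delta>: "\<delta> > 0" "\<And>w. w \<in> H1 \<Longrightarrow> H1_norm w < \<delta> \<Longrightarrow>
        \<bar>energy p (\<lambda>x. u x + w x) - energy p u - \<mu> * (LINT x|lborel. u x * w x)\<bar> \<le> e' * H1_norm w"
      using d e'(1) unfolding H1_has_derivative_def by blast
    have "(\<lambda>n. null_step n * ?N) \<longlonglongrightarrow> 0 * ?N" by (intro tendsto_intros null_step)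
    then have "\<forall>\<^sub>F n in sequentially. null_step n * ?N < \<delta>" using \<delta>(1) by (intro order_tendstoD) auto
    then obtain n0 where n0: "\<And>n. n \<ge> n0 \<Longrightarrow> null_step n * ?N < \<delta>" unfolding eventually_sequentially by blast
    have "norm (q n - ?L) < e" if "n \<ge> n0" for n
    proof -
      let ?s = "null_step n"
      have s: "?s > 0" by (rule null_step)
      have "\<bar>energy p (\<lambda>x. u x + ?s * v x) - energy p u - \<mu> * (LINT x|lborel. u x * (?s * v x))\<bar> \<le> e' * (?s * ?N)"
        using \<delta>(2)[OF H1_pair_imp_H1(1)[OF v', of ?s]] Hn[OF s] n0[OF that] by simp
      also have "\<mu> * (LINT x|lborel. u x * (?s * v x)) = ?s * ?L" by (simp add: mult.left_commute)
      also have "energy p (\<lambda>x. u x + ?s * v x) - energy p u - ?s * ?L = ?s * (q n - ?L)"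
      proof -
        have "?s * q n = energy p (\<lambda>x. u x + ?s * v x) - energy p u" using s by (simp add: q_def)
        then show ?thesis by (simp add: right_diff_distrib)
      qed
      finally have "?s * \<bar>q n - ?L\<bar> \<le> ?s * (e' * ?N)" using s by (simp add: abs_mult mult_ac)
      then have "\<bar>q n - ?L\<bar> \<le> e' * ?N" using s by (rule mult_left_le_imp_le)
      then show ?thesis using e'(2) by simp
    qed
    then show "\<exists>n0. \<forall>n\<ge>n0. norm (q n - ?L) < e" by blast
  qed
  have qeq: "q n = 1/2 * (((LINT x|lborel. (norm (g x + null_step n *\<^sub>R h x))\<^sup>2) - (LINT x|lborel. (norm (g x))\<^sup>2)) / null_step n)
      + 1/4 * ((coulomb (\<lambda>x. (u x + null_step n * v x)\<^sup>2) (\<lambda>x. (u x + null_step n * v x)\<^sup>2) - coulomb (\<lambda>x. (u x)\<^sup>2) (\<lambda>x. (u x)\<^sup>2)) / null_step n)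
      - 1/p * (((LINT x|lborel. \<bar>u x + null_step n * v x\<bar> powr p) - (LINT x|lborel. \<bar>u x\<bar> powr p)) / null_step n)" for n
    unfolding q_def energy_H1_pair[OF H1_pair_add_cmult[OF u v]] energy_H1_pair[OF u] by (simp add: diff_divide_distrib add_divide_distrib right_diff_distrib)
  have "q \<longlonglongrightarrow> 1/2 * (2 * (LINT x|lborel. g x \<bullet> h x)) + 1/4 * (4 * (LINT x|lborel. ?V x * u x * v x)) - 1/p * (p * (LINT x|lborel. (\<bar>u x\<bar> powr (p - 2) * u x) * v x))"
    unfolding qeq using p by (intro tendsto_intros dirichlet_derivative[OF H1_pairD(2)[OF u] H1_pairD(2)[OF v]] coulomb_derivative[OF u v] powr_integral_derivative[OF u v]) auto
  from LIMSEQ_unique[OF lim1 this]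
  have "?L = (LINT x|lborel. g x \<bullet> h x) + (LINT x|lborel. ?V x * u x * v x) - (LINT x|lborel. (\<bar>u x\<bar> powr (p - 2) * u x) * v x)"
    using p by simp
  moreover have "(LINT x|lborel. nonlinearity p \<mu> u x * v x) = ?L - (LINT x|lborel. ?V x * u x * v x) + (LINT x|lborel. (\<bar>u x\<bar> powr (p - 2) * u x) * v x)"
    unfolding nonlinearity_def
    using L2_integrable_mult[OF H1_pairD(1)[OF u] H1_pairD(1)[OF v]] L2_integrable_mult[OF L2_potential_mult[OF u] H1_pairD(1)[OF v]] L2_integrable_mult[OF L2_powr_mult[OF u] H1_pairD(1)[OF v], of p] p
    by (simp add: distrib_right left_diff_distrib mult.assoc[of \<mu>])
  ultimately show ?thesis by simp
qed

section \<open>Testing with a vector field\<close>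

lemma mollifier_minus: "mollifier n (- z) = mollifier n z"
  by (simp add: mollifier_def)

text \<open>Fubini and evenness of the mollifier; absolute integrability is reduced to pairing |f|
  with the mollification of |w|.\<close>

lemma conv_mollifier_adjoint:
  fixes f w :: "'a::euclidean_space \<Rightarrow> 'b::euclidean_space"
  assumes f: "L2 f" and w: "L2 w"
  shows "(LINT x|lborel. f x \<bullet> conv (mollifier n) w x) = (LINT x|lborel. conv (mollifier n) f x \<bullet> w x)"
proof -
  note [measurable] = L2_measurable[OF f] L2_measurable[OF w]
  have [measurable]: "(mollifier n :: 'a \<Rightarrow> real) \<in> borel_measurable borel"
    by (rule borel_measurable_continuous_onI[OF continuous_mollifier(1)])
  have lf: "loc_int f" and lw: "loc_int w" using f w by (auto intro: L2_loc_int)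
  have wn: "L2 (\<lambda>x. norm (w x))" using w by (simp add: L2_def)
  have lwn: "loc_int (\<lambda>x. norm (w x))" by (rule L2_loc_int[OF wn])
  have fn: "L2 (\<lambda>x. norm (f x))" using f by (simp add: L2_def)
  have "integrable (lborel \<Otimes>\<^sub>M lborel) (\<lambda>(x, y). f x \<bullet> (mollifier n (x - y) *\<^sub>R w y))"
  proof (rule Bochner_Integration.integrable_bound)
    show "integrable (lborel \<Otimes>\<^sub>M lborel) (\<lambda>(x, y). norm (f x) * (mollifier n (x - y) *\<^sub>R norm (w y)))"
    proof (rule lborel_pair.Fubini_integrable)
      show "(\<lambda>(x, y). norm (f x) * (mollifier n (x - y) *\<^sub>R norm (w y))) \<in> borel_measurable (lborel \<Otimes>\<^sub>M lborel)" by measurable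
      have "(LINT y|lborel. norm (case (x, y) of (x, y) \<Rightarrow> norm (f x) * (mollifier n (x - y) *\<^sub>R norm (w y)))) = norm (f x) * conv (mollifier n) (\<lambda>x. norm (w x)) x" for x
        unfolding conv_def integral_mult_right_zero[symmetric]
        by (intro Bochner_Integration.integral_cong refl) (simp add: abs_mult mollifier_nonneg)
      then show "integrable lborel (\<lambda>x. LINT y|lborel. norm (case (x, y) of (x, y) \<Rightarrow> norm (f x) * (mollifier n (x - y) *\<^sub>R norm (w y))))"
        using L2_integrable_mult[OF fn L2_imp_L2_conv_mollifier(1)[OF wn]] by simp
      show "AE x in lborel. integrable lborel (\<lambda>y. case (x, y) of (x, y) \<Rightarrow> norm (f x) * (mollifier n (x - y) *\<^sub>R norm (w y)))"
        by (simp only: prod.case) (intro AE_I2 integrable_mult_right conv_mollifier_integrable(1)[OF lwn])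
    qed
    show "(\<lambda>(x, y). f x \<bullet> (mollifier n (x - y) *\<^sub>R w y)) \<in> borel_measurable (lborel \<Otimes>\<^sub>M lborel)" by measurable
    show "AE z in lborel \<Otimes>\<^sub>M lborel. norm (case z of (x, y) \<Rightarrow> f x \<bullet> (mollifier n (x - y) *\<^sub>R w y)) \<le> norm (case z of (x, y) \<Rightarrow> norm (f x) * (mollifier n (x - y) *\<^sub>R norm (w y)))"
    proof (rule AE_I2, clarify)
      fix x y
      show "norm (f x \<bullet> (mollifier n (x - y) *\<^sub>R w y)) \<le> norm (norm (f x) * (mollifier n (x - y) *\<^sub>R norm (w y)))"
        using Cauchy_Schwarz_ineq2[of "f x" "mollifier n (x - y) *\<^sub>R w y"] by (simp add: abs_mult)
    qed
  qed
  from lborel_pair.Fubini_integral[OF this]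
  have "(LINT y|lborel. LINT x|lborel. f x \<bullet> (mollifier n (x - y) *\<^sub>R w y)) = (LINT x|lborel. LINT y|lborel. f x \<bullet> (mollifier n (x - y) *\<^sub>R w y))" .
  moreover have "(LINT y|lborel. f x \<bullet> (mollifier n (x - y) *\<^sub>R w y)) = f x \<bullet> conv (mollifier n) w x" for x
    unfolding conv_def by (rule integral_inner_right) (rule conv_mollifier_integrable(1)[OF lw])
  moreover have "(LINT x|lborel. f x \<bullet> (mollifier n (x - y) *\<^sub>R w y)) = conv (mollifier n) f y \<bullet> w y" for y
  proof -
    have "mollifier n (x - y) = mollifier n (y - x)" for x using mollifier_minus[of n "y - x"] by simp
    then have "(LINT x|lborel. f x \<bullet> (mollifier n (x - y) *\<^sub>R w y)) = (LINT x|lborel. (mollifier n (y - x) *\<^sub>R f x) \<bullet> w y)" by simp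
    also have "\<dots> = conv (mollifier n) f y \<bullet> w y"
      unfolding conv_def by (rule integral_inner_left) (rule conv_mollifier_integrable(1)[OF lf])
    finally show ?thesis .
  qed
  ultimately show ?thesis by simp
qed

text \<open>Serves test functions that are mollified twice with the same n. Mollification is an L2
  contraction, so the outer mollifier does not amplify the inner error.\<close>

lemma L2_tendsto_conv_mollifier:
  fixes w :: "'a::euclidean_space \<Rightarrow> 'b::euclidean_space"
  assumes w: "L2_tendsto wn w"
  shows "L2_tendsto (\<lambda>n. conv (mollifier n) (wn n)) w"
proof (rule L2_tendsto_trans[where f="\<lambda>n. conv (mollifier n) w"])
  note L = L2_tendstoD[OF w]
  show "L2_tendsto (\<lambda>n. conv (mollifier n) w) w" using approx_id_L2[OF approx_id_mollifier L(2)] by simp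
  show "L2 (conv (mollifier n) (wn n))" for n by (rule L2_imp_L2_conv_mollifier(1)[OF L(1)])
  have d: "L2 (\<lambda>x. wn n x - w x)" for n by (intro L2_diff L)
  have "conv (mollifier n) (wn n) x - conv (mollifier n) w x = conv (mollifier n) (\<lambda>x. wn n x - w x) x" for n x
    unfolding conv_def using conv_mollifier_integrable(1)[OF L2_loc_int[OF L(1)]] conv_mollifier_integrable(1)[OF L2_loc_int[OF L(2)]]
    by (simp add: scaleR_diff_right)
  then show "(\<lambda>n. LINT x|lborel. (norm (conv (mollifier n) (wn n) x - conv (mollifier n) w x))\<^sup>2) \<longlonglongrightarrow> 0"
    using tendsto_0_le_cmult[of "\<lambda>n. LINT x|lborel. (norm (conv (mollifier n) (\<lambda>x. wn n x - w x) x))\<^sup>2" 1, OF _ _ L(3)]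
      L2_imp_L2_conv_mollifier(3)[OF d] by simp
qed

lemma H1_pair_conv_mollifier: "H1_pair w G \<Longrightarrow> H1_pair (conv (mollifier n) w) (conv (mollifier n) G)"
  by (rule H1_pair_mollify(8))

lemma has_derivative_imp_gradient:
  fixes w :: "'a::euclidean_space \<Rightarrow> real"
  assumes d: "(w has_derivative D) (at x)"
  shows "(w has_derivative (\<lambda>h. (\<Sum>b\<in>Basis. D b *\<^sub>R b) \<bullet> h)) (at x)"
proof -
  interpret D: bounded_linear D using d by (rule has_derivative_bounded_linear)
  have "D h = (\<Sum>b\<in>Basis. D b *\<^sub>R b) \<bullet> h" for h
  proof -
    have "D h = D (\<Sum>b\<in>Basis. (h \<bullet> b) *\<^sub>R b)" by (simp add: euclidean_representation)
    also have "\<dots> = (\<Sum>b\<in>Basis. (h \<bullet> b) * D b)" by (simp add: D.sum D.scaleR)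
    also have "\<dots> = (\<Sum>b\<in>Basis. D b *\<^sub>R b) \<bullet> h"
      by (simp add: inner_sum_left inner_commute[of h] mult.commute[of _ "D _"])
    finally show ?thesis .
  qed
  then show ?thesis using d by (metis (no_types, lifting) ext)
qed

lemma C1_field_apply:
  assumes X: "C1_field X X' K"
  shows "linear (X' x)" and "f \<in> borel_measurable borel \<Longrightarrow> (\<lambda>x. X' x (f x)) \<in> borel_measurable borel"
proof -
  show lin: "linear (X' x)" for x by (rule bounded_linear.linear[OF has_derivative_bounded_linear[OF C1_fieldD(1)[OF X]]])
  assume [measurable]: "f \<in> borel_measurable borel"
  have [measurable]: "(\<lambda>x. X' x b) \<in> borel_measurable borel" for b by (rule borel_measurable_continuous_onI[OF C1_fieldD(2)[OF X]])
  have "X' x (f x) = (\<Sum>b\<in>Basis. (f x \<bullet> b) *\<^sub>R X' x b)" for x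
  proof -
    have "X' x (f x) = X' x (\<Sum>b\<in>Basis. (f x \<bullet> b) *\<^sub>R b)" by (simp add: euclidean_representation)
    also have "\<dots> = (\<Sum>b\<in>Basis. (f x \<bullet> b) *\<^sub>R X' x b)"
      by (simp add: linear_sum[OF lin] linear_cmul[OF lin])
    finally show ?thesis .
  qed
  then show "(\<lambda>x. X' x (f x)) \<in> borel_measurable borel" by simp
qed

text \<open>The gradient G of X . g_n contains the derivative Dg of g_n. Paired with g_n, its
  contribution is Dg(g_n) . X, which symmetry turns into Dg(X) . g_n, the derivative of |g_n|^2/2
  along X; integration by parts then leaves the divergence term. G is square integrable for each n,
  and no bound uniform in n is used.\<close>

lemma dirichlet_field_C1:
  assumes W: "H1_pair u g" and X: "C1_field X X' K"
  defines "gn \<equiv> \<lambda>n. conv (mollifier n) g"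
  obtains G where "\<And>n. H1_pair (\<lambda>x. X x \<bullet> gn n x) (G n)"
    "\<And>n. (LINT x|lborel. gn n x \<bullet> G n x) = (LINT x|lborel. X' x (gn n x) \<bullet> gn n x) - 1/2 * (LINT x|lborel. divergence X' x * (norm (gn n x))\<^sup>2)"
proof -
  define Dg where "Dg n x h = conv (\<lambda>z. mollifier_grad n z \<bullet> h) g x" for n x h
  define D where "D n x h = X' x h \<bullet> gn n x + X x \<bullet> Dg n x h" for n x h
  define G where "G n x = (\<Sum>b\<in>Basis. D n x b *\<^sub>R b)" for n x
  note g = H1_pairD(2)[OF W]
  have lg: "loc_int g" by (rule L2_loc_int[OF g])
  have gn: "gn n = conv (mollifier n) g" for n by (simp add: gn_def)
  note m = H1_pair_mollify[OF W, folded gn]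
  have dg: "(gn n has_derivative Dg n x) (at x)" for n x
    unfolding gn Dg_def by (rule conv_mollifier_has_derivative[OF lg])
  have Dgc: "continuous_on UNIV (\<lambda>x. Dg n x h)" for n h
    unfolding Dg_def by (rule conv_mollifier_continuous(2)[OF lg])
  have DgL: "L2 (\<lambda>x. Dg n x h)" for n h
    unfolding Dg_def by (rule L2_imp_L2_conv_mollifier(2)[OF g])
  have sym: "Dg n x h \<bullet> h' = Dg n x h' \<bullet> h" for n x h h'
    unfolding Dg_def by (rule weak_gradient_mollifier_symmetric[OF H1_pairD(3)[OF W]])
  have linDg: "linear (Dg n x)" for n x by (rule bounded_linear.linear[OF has_derivative_bounded_linear[OF dg]])
  note [measurable] = borel_measurable_continuous_onI[OF C1_fieldD(5)[OF X]] L2_measurable[OF m(5)] L2_measurable[OF DgL]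
    borel_measurable_continuous_onI[OF C1_fieldD(2)[OF X]] borel_measurable_continuous_onI[OF C1_fieldD(6)[OF X]]
  have K: "K \<ge> 0" using C1_fieldD(3)[OF X, of 0] norm_ge_zero[of "X 0"] by linarith
  have d: "((\<lambda>x. X x \<bullet> gn n x) has_derivative D n x) (at x)" for n x
  proof -
    have "((\<lambda>x. X x \<bullet> gn n x) has_derivative (\<lambda>h. X x \<bullet> Dg n x h + X' x h \<bullet> gn n x)) (at x)"
      by (rule has_derivative_inner[OF C1_fieldD(1)[OF X] dg])
    then show ?thesis by (simp add: D_def[abs_def] add.commute)
  qed
  have dG: "((\<lambda>x. X x \<bullet> gn n x) has_derivative (\<lambda>h. G n x \<bullet> h)) (at x)" for n x
    unfolding G_def by (rule has_derivative_imp_gradient[OF d])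
  have DG: "D n x h = G n x \<bullet> h" for n x h
    using has_derivative_unique[OF d dG] by (rule fun_cong)
  have cG: "continuous_on UNIV (G n)" for n
  proof -
    have "continuous_on UNIV (gn n)" by (rule m(3))
    then show ?thesis
      unfolding G_def[abs_def] D_def by (intro continuous_intros C1_fieldD(2,5)[OF X] Dgc)
  qed
  have LX: "L2 (\<lambda>x. X x \<bullet> f x)" if f: "L2 f" for f
  proof (rule L2_bound[OF f])
    note [measurable] = L2_measurable[OF f]
    show "(\<lambda>x. X x \<bullet> f x) \<in> borel_measurable borel" by measurable
    show "norm (X x \<bullet> f x) \<le> K * norm (f x)" for x
      using order_trans[OF Cauchy_Schwarz_ineq2 mult_right_mono[OF C1_fieldD(3)[OF X] norm_ge_zero]] by simp
  qed
  have LX': "L2 (\<lambda>x. X' x h \<bullet> gn n x)" for n h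
  proof (rule L2_bound[OF m(5)[of n]])
    show "norm (X' x h \<bullet> gn n x) \<le> (K * norm h) * norm (gn n x)" for x
      using order_trans[OF Cauchy_Schwarz_ineq2 mult_right_mono[OF C1_fieldD(4)[OF X] norm_ge_zero]] by simp
  qed measurable
  have LD: "L2 (\<lambda>x. D n x h)" for n h
    unfolding D_def by (intro L2_add LX' LX DgL)
  have LG: "L2 (G n)" for n
  proof -
    have "L2 (\<lambda>x. \<Sum>b\<in>B. D n x b *\<^sub>R b)" if "finite B" for B
      using that
    proof (induction B)
      case empty
      then show ?case by (simp add: L2_def)
    next
      case (insert b B)
      have "L2 (\<lambda>x. D n x b *\<^sub>R b)"
        by (rule L2_bound[OF LD[of n b], of _ "norm b"]) (use LD[of n b] in \<open>auto simp: L2_def\<close>)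
      with insert show ?case by (auto intro: L2_add)
    qed
    then show ?thesis by (simp add: G_def[abs_def])
  qed
  have W': "H1_pair (\<lambda>x. X x \<bullet> gn n x) (G n)" for n by (rule C1_imp_H1_pair[OF dG cG LX[OF m(5)] LG])
  \<comment> \<open>Integration by parts of the derivative of |g_n|^2/2 along X, one coordinate
    direction at a time.\<close>
  have half: "(LINT x|lborel. Dg n x (X x) \<bullet> gn n x) = - (1/2) * (LINT x|lborel. divergence X' x * (norm (gn n x))\<^sup>2)" 
    and half_int: "integrable lborel (\<lambda>x. Dg n x (X x) \<bullet> gn n x)" for n
  proof -
    have n2: "integrable lborel (\<lambda>x. (norm (gn n x))\<^sup>2)" by (rule L2_integrable[OF m(5)])
    have bi: "integrable lborel (\<lambda>x. (norm (gn n x))\<^sup>2 / 2 * \<eta> x)" if "\<eta> \<in> borel_measurable borel" "\<And>x. \<bar>\<eta> x\<bar> \<le> K" for \<eta>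
    proof (rule Bochner_Integration.integrable_bound)
      show "integrable lborel (\<lambda>x. (norm (gn n x))\<^sup>2 * K)" using n2 by simp
      show "AE x in lborel. norm ((norm (gn n x))\<^sup>2 / 2 * \<eta> x) \<le> norm ((norm (gn n x))\<^sup>2 * K)"
      proof (rule AE_I2)
        fix x
        have "(norm (gn n x))\<^sup>2 / 2 * \<bar>\<eta> x\<bar> \<le> (norm (gn n x))\<^sup>2 * K" using that(2)[of x] by (intro mult_mono) auto
        then show "norm ((norm (gn n x))\<^sup>2 / 2 * \<eta> x) \<le> norm ((norm (gn n x))\<^sup>2 * K)" using K by (simp add: abs_mult)
      qed
    qed (use that in measurable)
    have bi': "integrable lborel (\<lambda>x. (Dg n x b \<bullet> gn n x) * (X x \<bullet> b))" if b: "b \<in> Basis" for b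
    proof (rule Bochner_Integration.integrable_bound)
      show "integrable lborel (\<lambda>x. (Dg n x b \<bullet> gn n x) * K)" using L2_integrable_inner[OF DgL m(5)] by simp
      show "AE x in lborel. norm (Dg n x b \<bullet> gn n x * (X x \<bullet> b)) \<le> norm (Dg n x b \<bullet> gn n x * K)"
        using C1_field_component(3)[OF X b] K by (auto simp: abs_mult intro!: mult_left_mono)
    qed measurable
    have ibp: "(LINT x|lborel. (norm (gn n x))\<^sup>2 / 2 * (X' x b \<bullet> b)) = - (LINT x|lborel. (Dg n x b \<bullet> gn n x) * (X x \<bullet> b))" if b: "b \<in> Basis" for b
    proof (rule C1_integration_by_parts[where v'="\<lambda>x h. Dg n x h \<bullet> gn n x" and \<eta>'="\<lambda>x h. X' x h \<bullet> b" and e=b])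
      show "((\<lambda>x. (norm (gn n x))\<^sup>2 / 2) has_derivative (\<lambda>h. Dg n x h \<bullet> gn n x)) (at x)" for x
      proof -
        have "((\<lambda>x. inverse 2 * (gn n x \<bullet> gn n x)) has_derivative (\<lambda>h. inverse 2 * (gn n x \<bullet> Dg n x h + Dg n x h \<bullet> gn n x))) (at x)"
          by (rule has_derivative_mult_right[OF has_derivative_inner[OF dg dg]])
        then show ?thesis by (simp add: power2_norm_eq_inner inner_commute)
      qed
      show "continuous_on UNIV (\<lambda>x. Dg n x b \<bullet> gn n x)" by (intro continuous_intros Dgc m(3))
      show "integrable lborel (\<lambda>x. (norm (gn n x))\<^sup>2 / 2 * (X x \<bullet> b))"
        by (rule bi) (use C1_field_component(3)[OF X b] in auto)
      show "integrable lborel (\<lambda>x. (norm (gn n x))\<^sup>2 / 2 * (X' x b \<bullet> b))"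
        by (rule bi) (use C1_field_component(4)[OF X b] in auto)
    qed (use C1_field_component(1,2)[OF X b] bi'[OF b] in auto)
    have rep: "Dg n x (X x) \<bullet> gn n x = (\<Sum>b\<in>Basis. (Dg n x b \<bullet> gn n x) * (X x \<bullet> b))" for x
    proof -
      have "Dg n x (X x) = Dg n x (\<Sum>b\<in>Basis. (X x \<bullet> b) *\<^sub>R b)" by (simp add: euclidean_representation)
      also have "\<dots> = (\<Sum>b\<in>Basis. (X x \<bullet> b) *\<^sub>R Dg n x b)" by (simp add: linear_sum[OF linDg] linear_cmul[OF linDg])
      finally show ?thesis by (simp add: inner_sum_left mult.commute)
    qed
    show "integrable lborel (\<lambda>x. Dg n x (X x) \<bullet> gn n x)" unfolding rep by (intro Bochner_Integration.integrable_sum bi')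
    have "(LINT x|lborel. Dg n x (X x) \<bullet> gn n x) = (\<Sum>b\<in>Basis. LINT x|lborel. (Dg n x b \<bullet> gn n x) * (X x \<bullet> b))"
      unfolding rep by (rule Bochner_Integration.integral_sum[OF bi'])
    also have "\<dots> = - (\<Sum>b\<in>Basis. LINT x|lborel. (norm (gn n x))\<^sup>2 / 2 * (X' x b \<bullet> b))"
      using ibp by (simp add: sum_negf)
    also have "(\<Sum>b\<in>Basis. LINT x|lborel. (norm (gn n x))\<^sup>2 / 2 * (X' x b \<bullet> b)) = (LINT x|lborel. (\<Sum>b\<in>Basis. (norm (gn n x))\<^sup>2 / 2 * (X' x b \<bullet> b)))"
      by (rule Bochner_Integration.integral_sum[symmetric], rule bi) (use C1_field_component(4)[OF X] in auto)
    also have "\<dots> = (LINT x|lborel. 1/2 * (divergence X' x * (norm (gn n x))\<^sup>2))"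
      by (intro Bochner_Integration.integral_cong refl) (simp add: divergence_def sum_distrib_left sum_distrib_right mult_ac)
    also have "\<dots> = 1/2 * (LINT x|lborel. divergence X' x * (norm (gn n x))\<^sup>2)" by (rule integral_mult_right_zero)
    finally show "(LINT x|lborel. Dg n x (X x) \<bullet> gn n x) = - (1/2) * (LINT x|lborel. divergence X' x * (norm (gn n x))\<^sup>2)" by simp
  qed
  have eqG: "gn n x \<bullet> G n x = X' x (gn n x) \<bullet> gn n x + Dg n x (X x) \<bullet> gn n x" for n x
  proof -
    have "gn n x \<bullet> G n x = D n x (gn n x)" by (simp add: DG inner_commute)
    also have "\<dots> = X' x (gn n x) \<bullet> gn n x + Dg n x (gn n x) \<bullet> X x" by (simp add: D_def inner_commute)
    also have "Dg n x (gn n x) \<bullet> X x = Dg n x (X x) \<bullet> gn n x" by (rule sym)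
    finally show ?thesis .
  qed
  have "(LINT x|lborel. gn n x \<bullet> G n x) = (LINT x|lborel. X' x (gn n x) \<bullet> gn n x) - 1/2 * (LINT x|lborel. divergence X' x * (norm (gn n x))\<^sup>2)" for n
  proof -
    have "integrable lborel (\<lambda>x. X' x (gn n x) \<bullet> gn n x)"
      using Bochner_Integration.integrable_diff[OF L2_integrable_inner[OF m(5)[of n] LG[of n]] half_int[of n]] by (simp add: eqG)
    then show ?thesis unfolding eqG using half_int[of n] half[of n] by simp
  qed
  with W' show ?thesis by (rule that)
qed

text \<open>All second derivatives are gone before n tends to infinity: the left side has become
  quadratic in g_n, and on the right f in L2 is paired with test functions converging in L2 to X .
  g.\<close>

theorem weak_equation_field:
  assumes W: "H1_pair u g" and X: "C1_field X X' K" and f: "L2 f"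
    and eq: "\<And>v h. H1_pair v h \<Longrightarrow> (LINT x|lborel. g x \<bullet> h x) = (LINT x|lborel. f x * v x)"
  shows "(LINT x|lborel. X' x (g x) \<bullet> g x) - 1/2 * (LINT x|lborel. divergence X' x * (norm (g x))\<^sup>2) = (LINT x|lborel. f x * (X x \<bullet> g x))"
proof -
  define gn where "gn n = conv (mollifier n) g" for n
  note m = H1_pair_mollify[OF W, folded gn_def]
  obtain G where G: "\<And>n. H1_pair (\<lambda>x. X x \<bullet> gn n x) (G n)"
    "\<And>n. (LINT x|lborel. gn n x \<bullet> G n x) = (LINT x|lborel. X' x (gn n x) \<bullet> gn n x) - 1/2 * (LINT x|lborel. divergence X' x * (norm (gn n x))\<^sup>2)"
    using dirichlet_field_C1[OF W X] unfolding gn_def[symmetric] by blast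
  note [measurable] = borel_measurable_continuous_onI[OF C1_fieldD(5)[OF X]] L2_measurable[OF m(5)] L2_measurable[OF H1_pairD(2)[OF W]]
    borel_measurable_continuous_onI[OF C1_fieldD(6)[OF X]]
  have e: "(LINT x|lborel. X' x (gn n x) \<bullet> gn n x) - 1/2 * (LINT x|lborel. divergence X' x * (norm (gn n x))\<^sup>2) = (LINT x|lborel. f x * conv (mollifier n) (\<lambda>x. X x \<bullet> gn n x) x)" for n
  proof -
    \<comment> \<open>The outer mollifier makes the function admissible in the weak equation and,
      moved to the other factor, replaces g by g_n.\<close>
    have "(LINT x|lborel. f x * conv (mollifier n) (\<lambda>x. X x \<bullet> gn n x) x) = (LINT x|lborel. g x \<bullet> conv (mollifier n) (G n) x)"
      by (rule eq[OF H1_pair_conv_mollifier[OF G(1)], symmetric])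
    also have "\<dots> = (LINT x|lborel. gn n x \<bullet> G n x)"
      unfolding gn_def by (rule conv_mollifier_adjoint[OF H1_pairD(2)[OF W] H1_pairD(2)[OF G(1), unfolded gn_def]])
    finally show ?thesis using G(2) by simp
  qed
  have lin: "linear (X' x)" for x by (rule C1_field_apply(1)[OF X])
  have bX': "norm (X' x a - X' x b) \<le> K * norm (a - b)" for x a b
    using C1_fieldD(4)[OF X, of x "a - b"] by (simp add: linear_diff[OF lin])
  have LX': "L2 (\<lambda>x. X' x (w x))" if w: "L2 w" for w
    by (rule L2_bound[OF w C1_field_apply(2)[OF X L2_measurable[OF w]] C1_fieldD(4)[OF X]])
  have t1: "L2_tendsto (\<lambda>n x. X' x (gn n x)) (\<lambda>x. X' x (g x))"
    by (rule L2_tendsto_bound[OF LX'[OF m(5)] LX'[OF H1_pairD(2)[OF W]] m(7) bX'])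
  have t2: "L2_tendsto (\<lambda>n x. divergence X' x *\<^sub>R gn n x) (\<lambda>x. divergence X' x *\<^sub>R g x)"
    by (rule L2_tendsto_bounded_scaleR[OF m(7) _ C1_fieldD(7)[OF X]]) measurable
  have LX: "L2 (\<lambda>x. X x \<bullet> w x)" if w: "L2 w" for w
  proof (rule L2_bound[OF w])
    note [measurable] = L2_measurable[OF w]
    show "(\<lambda>x. X x \<bullet> w x) \<in> borel_measurable borel" by measurable
    show "norm (X x \<bullet> w x) \<le> K * norm (w x)" for x
      using order_trans[OF Cauchy_Schwarz_ineq2 mult_right_mono[OF C1_fieldD(3)[OF X] norm_ge_zero]] by simp
  qed
  have t3: "L2_tendsto (\<lambda>n x. X x \<bullet> gn n x) (\<lambda>x. X x \<bullet> g x)"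
  proof (rule L2_tendsto_bound[OF LX[OF m(5)] LX[OF H1_pairD(2)[OF W]] m(7)])
    show "norm (X x \<bullet> gn n x - X x \<bullet> g x) \<le> K * norm (gn n x - g x)" for n x
      unfolding inner_diff_right[symmetric]
      using order_trans[OF Cauchy_Schwarz_ineq2 mult_right_mono[OF C1_fieldD(3)[OF X] norm_ge_zero]] by simp
  qed
  have l1: "(\<lambda>n. (LINT x|lborel. X' x (gn n x) \<bullet> gn n x) - 1/2 * (LINT x|lborel. divergence X' x * (norm (gn n x))\<^sup>2))
     \<longlonglongrightarrow> (LINT x|lborel. X' x (g x) \<bullet> g x) - 1/2 * (LINT x|lborel. divergence X' x * (norm (g x))\<^sup>2)"
  proof (intro tendsto_diff tendsto_mult tendsto_const)
    show "(\<lambda>n. LINT x|lborel. X' x (gn n x) \<bullet> gn n x) \<longlonglongrightarrow> (LINT x|lborel. X' x (g x) \<bullet> g x)" by (rule L2_tendsto_inner[OF t1 m(7)])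
    show "(\<lambda>n. LINT x|lborel. divergence X' x * (norm (gn n x))\<^sup>2) \<longlonglongrightarrow> (LINT x|lborel. divergence X' x * (norm (g x))\<^sup>2)"
      using L2_tendsto_inner[OF t2 m(7)] by (simp add: power2_norm_eq_inner)
  qed
  have l2: "(\<lambda>n. LINT x|lborel. f x * conv (mollifier n) (\<lambda>x. X x \<bullet> gn n x) x) \<longlonglongrightarrow> (LINT x|lborel. f x * (X x \<bullet> g x))"
    by (rule L2_tendsto_mult[OF L2_tendsto_const[OF f] L2_tendsto_conv_mollifier[OF t3]])
  show ?thesis using LIMSEQ_unique[OF l1[unfolded e] l2] .
qed

section \<open>The power nonlinearity tested with a field\<close>

text \<open>A smooth bounded truncation that tends to the identity as e tends to 0. It is inserted
  because for p > 2 the derivative of |t|^p / p is not globally Lipschitz, as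
  \<open>weak_chain_field\<close> requires.\<close>

definition soft_clip :: "real \<Rightarrow> real \<Rightarrow> real" where "soft_clip e t = t / sqrt (1 + e * t\<^sup>2)"
definition soft_clip' :: "real \<Rightarrow> real \<Rightarrow> real" where "soft_clip' e t = inverse ((1 + e * t\<^sup>2) * sqrt (1 + e * t\<^sup>2))"

lemma one_add_mult_square_pos: "0 \<le> e \<Longrightarrow> 1 \<le> 1 + e * t\<^sup>2" "0 \<le> e \<Longrightarrow> 0 < 1 + e * (t::real)\<^sup>2"
proof -
  assume "0 \<le> e"
  then have "0 \<le> e * t\<^sup>2" by simp
  then show "1 \<le> 1 + e * t\<^sup>2" "0 < 1 + e * t\<^sup>2" by linarith+
qed

lemma DERIV_soft_clip:
  assumes e: "e \<ge> 0" shows "(soft_clip e has_real_derivative soft_clip' e t) (at t)"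
proof -
  let ?S = "1 + e * t\<^sup>2" and ?q = "sqrt (1 + e * t\<^sup>2)"
  have pos: "?S > 0" by (rule one_add_mult_square_pos[OF e])
  have q: "?q > 0" "?q * ?q = ?S" using pos by auto
  have "((\<lambda>t. sqrt (1 + e * t\<^sup>2)) has_real_derivative e * t * inverse ?q) (at t)"
    using pos by (auto intro!: derivative_eq_intros)
  then have "((\<lambda>t. t / sqrt (1 + e * t\<^sup>2)) has_real_derivative (1 * ?q - t * (e * t * inverse ?q)) / (?q * ?q)) (at t)"
    using q(1) by (intro DERIV_divide DERIV_ident) auto
  moreover have "(1 * ?q - t * (e * t * inverse ?q)) / (?q * ?q) = soft_clip' e t"
  proof -
    have "1 * ?q - t * (e * t * inverse ?q) = (?q * ?q - e * t\<^sup>2) / ?q" using q(1) by (simp add: field_simps power2_eq_square)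
    also have "\<dots> = 1 / ?q" unfolding q(2) by simp
    finally show ?thesis unfolding q(2) by (simp add: soft_clip'_def divide_inverse mult.commute)
  qed
  ultimately show ?thesis by (simp add: soft_clip_def[abs_def])
qed

lemma soft_clip_bounds:
  assumes e: "e \<ge> 0"
  shows "\<bar>soft_clip e t\<bar> \<le> \<bar>t\<bar>" "0 \<le> soft_clip' e t" "soft_clip' e t \<le> 1" "0 < e \<Longrightarrow> \<bar>soft_clip e t\<bar> \<le> 1 / sqrt e"
proof -
  let ?S = "1 + e * t\<^sup>2"
  have S: "?S \<ge> 1" by (rule one_add_mult_square_pos[OF e])
  have q: "sqrt ?S \<ge> 1" using S by simp
  have "\<bar>t\<bar> / sqrt ?S \<le> \<bar>t\<bar> / 1" using q by (intro divide_left_mono) auto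
  then show "\<bar>soft_clip e t\<bar> \<le> \<bar>t\<bar>" using q by (simp add: soft_clip_def abs_divide)
  show "0 \<le> soft_clip' e t" using S by (simp add: soft_clip'_def)
  have "1 * 1 \<le> ?S * sqrt ?S" using S q by (intro mult_mono) auto
  then have "inverse (?S * sqrt ?S) \<le> inverse (1 * 1)" by (intro le_imp_inverse_le) auto
  then show "soft_clip' e t \<le> 1" by (simp only: soft_clip'_def mult_1 inverse_1)
  assume e0: "0 < e"
  have "sqrt e * \<bar>t\<bar> = sqrt (e * t\<^sup>2)" using e by (simp add: real_sqrt_mult)
  also have "\<dots> \<le> sqrt ?S" by simp
  finally have "\<bar>t\<bar> \<le> sqrt ?S / sqrt e" using e0 by (simp add: pos_le_divide_eq mult.commute)
  then have "\<bar>t\<bar> / sqrt ?S \<le> (sqrt ?S / sqrt e) / sqrt ?S" using q by (intro divide_right_mono) auto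
  also have "\<dots> = 1 / sqrt e" using q by simp
  finally have "\<bar>t\<bar> / sqrt ?S \<le> 1 / sqrt e" .
  then show "\<bar>soft_clip e t\<bar> \<le> 1 / sqrt e" using q by (simp add: soft_clip_def abs_divide)
qed

lemma soft_clip'_Lipschitz:
  assumes e: "0 < e"
  shows "\<bar>soft_clip' e a - soft_clip' e b\<bar> \<le> 3 * sqrt e * \<bar>a - b\<bar>"
proof -
  have "norm (soft_clip' e a - soft_clip' e b) \<le> (3 * sqrt e) * norm (a - b)"
  proof (rule field_differentiable_bound[where S=UNIV])
    fix t :: real
    let ?S = "1 + e * t\<^sup>2" and ?q = "sqrt (1 + e * t\<^sup>2)"
    have pos: "?S > 0" and S1: "?S \<ge> 1" using one_add_mult_square_pos[of e t] e by auto
    have q: "?q > 0" "?q \<ge> 1" "?q * ?q = ?S" using pos S1 by auto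
    have dS: "((\<lambda>t. 1 + e * t\<^sup>2) has_real_derivative 2 * e * t) (at t)" by (auto intro!: derivative_eq_intros)
    have dq: "((\<lambda>t. sqrt (1 + e * t\<^sup>2)) has_real_derivative e * t * inverse ?q) (at t)"
      using pos by (auto intro!: derivative_eq_intros)
    have "((\<lambda>t. (1 + e * t\<^sup>2) * sqrt (1 + e * t\<^sup>2)) has_real_derivative (2 * e * t) * ?q + (e * t * inverse ?q) * ?S) (at t)"
      by (rule DERIV_mult[OF dS dq])
    moreover have "(2 * e * t) * ?q + (e * t * inverse ?q) * ?S = 3 * e * t * ?q"
    proof -
      have "inverse a * (a * a) = a" if "a > 0" for a :: real using that by simp
      from this[OF q(1)] have "inverse ?q * ?S = ?q" unfolding q(3) .
      then have "(e * t * inverse ?q) * ?S = e * t * ?q" by (simp only: mult.assoc)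
      then show ?thesis by simp
    qed
    ultimately have "((\<lambda>t. (1 + e * t\<^sup>2) * sqrt (1 + e * t\<^sup>2)) has_real_derivative 3 * e * t * ?q) (at t)" by simp
    from DERIV_inverse'[OF this]
    show "(soft_clip' e has_real_derivative - (inverse (?S * ?q) * (3 * e * t * ?q) * inverse (?S * ?q))) (at t within UNIV)"
      using pos q by (simp add: soft_clip'_def[abs_def])
    have "\<bar>- (inverse (?S * ?q) * (3 * e * t * ?q) * inverse (?S * ?q))\<bar> = 3 * (e * \<bar>t\<bar>) * (inverse ?S * inverse (?S * ?q))"
      using pos q(1) e by (simp add: abs_mult)
    also have "\<dots> \<le> 3 * (sqrt e * ?q) * (inverse ?S * inverse (?S * ?q))"
    proof (intro mult_right_mono mult_left_mono)
      have "sqrt e * \<bar>t\<bar> = sqrt (e * t\<^sup>2)" using e by (simp add: real_sqrt_mult)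
      also have "\<dots> \<le> ?q" by simp
      finally have "sqrt e * (sqrt e * \<bar>t\<bar>) \<le> sqrt e * ?q" using e by (intro mult_left_mono) auto
      then show "e * \<bar>t\<bar> \<le> sqrt e * ?q" using e by (simp flip: mult.assoc)
    qed (use pos q in auto)
    also have "\<dots> = 3 * sqrt e * (inverse ?S * inverse ?S)" using q(1) by simp
    also have "\<dots> \<le> 3 * sqrt e * (1 * 1)"
      using S1 e by (intro mult_left_mono mult_mono) (auto simp: inverse_le_1_iff)
    finally show "norm (- (inverse (?S * ?q) * (3 * e * t * ?q) * inverse (?S * ?q))) \<le> 3 * sqrt e" by simp
  qed auto
  then show ?thesis by simp
qed

lemma DERIV_signed_powr:
  assumes p: "2 < p"
  shows "((\<lambda>t::real. \<bar>t\<bar> powr (p - 2) * t) has_real_derivative (p - 1) * \<bar>t\<bar> powr (p - 2)) (at t)"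
proof (cases "t = 0")
  case True
  have "((\<lambda>y::real. \<bar>y\<bar> powr (p - 2)) \<longlongrightarrow> \<bar>0\<bar> powr (p - 2)) (at 0)"
    by (rule tendsto_powr') (use p in \<open>auto intro!: tendsto_rabs_zero tendsto_ident_at\<close>)
  then have "((\<lambda>y::real. \<bar>y\<bar> powr (p - 2)) \<longlongrightarrow> 0) (at 0)" by simp
  then have "((\<lambda>y::real. \<bar>y\<bar> powr (p - 2) * y / y) \<longlongrightarrow> 0) (at 0)"
    by (rule Lim_transform_eventually) (auto simp: eventually_at_filter)
  then show ?thesis using True by (simp add: has_field_derivative_iff)
next
  case False
  \<comment> \<open>Away from 0 the function equals |t|^p / t, so the derivative already known for
    |t|^p can be used.\<close>
  have s: "((\<lambda>t::real. \<bar>t\<bar> powr p / t) has_real_derivative ((p * (\<bar>t\<bar> powr (p - 2) * t)) * t - \<bar>t\<bar> powr p * 1) / (t * t)) (at t)"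
    using p False by (intro DERIV_divide DERIV_abs_powr DERIV_ident) auto
  have pow: "\<bar>y\<bar> powr p = \<bar>y\<bar> powr (p - 2) * (y * y)" for y :: real
    using powr_add[of "\<bar>y\<bar>" "p - 2" 2] by (cases "y = 0") (auto simp: power2_eq_square)
  have "((p * (\<bar>t\<bar> powr (p - 2) * t)) * t - \<bar>t\<bar> powr p * 1) / (t * t) = (p - 1) * \<bar>t\<bar> powr (p - 2)"
    unfolding pow using False by (simp add: field_simps)
  with s have "((\<lambda>t::real. \<bar>t\<bar> powr p / t) has_real_derivative (p - 1) * \<bar>t\<bar> powr (p - 2)) (at t)" by simp
  then show ?thesis
    by (rule has_field_derivative_transform_within_open[of _ _ t "- {0}"]) (use False pow in auto)
qed

lemma signed_powr_Lipschitz: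
  fixes x y M :: real
  assumes p: "2 < p" and M: "\<bar>x\<bar> \<le> M" "\<bar>y\<bar> \<le> M"
  shows "\<bar>\<bar>x\<bar> powr (p - 2) * x - \<bar>y\<bar> powr (p - 2) * y\<bar> \<le> (p - 1) * M powr (p - 2) * \<bar>x - y\<bar>"
proof -
  have "norm (\<bar>x\<bar> powr (p - 2) * x - \<bar>y\<bar> powr (p - 2) * y) \<le> ((p - 1) * M powr (p - 2)) * norm (x - y)"
  proof (rule field_differentiable_bound[where S="{-M..M}"])
    fix z assume z: "z \<in> {-M..M}"
    show "((\<lambda>t::real. \<bar>t\<bar> powr (p - 2) * t) has_real_derivative (p - 1) * \<bar>z\<bar> powr (p - 2)) (at z within {-M..M})"
      by (rule has_field_derivative_at_within[OF DERIV_signed_powr[OF p]])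
    have "\<bar>z\<bar> powr (p - 2) \<le> M powr (p - 2)" using z p by (intro powr_mono2) auto
    then show "norm ((p - 1) * \<bar>z\<bar> powr (p - 2)) \<le> (p - 1) * M powr (p - 2)" using p by (simp add: abs_mult mult_left_mono)
  qed (use M in auto)
  then show ?thesis by simp
qed

lemma soft_clip_tendsto: "(\<lambda>n. soft_clip (null_step n) t) \<longlonglongrightarrow> t" "(\<lambda>n. soft_clip' (null_step n) t) \<longlonglongrightarrow> 1"
proof -
  have "(\<lambda>n. t / sqrt (1 + null_step n * t\<^sup>2)) \<longlonglongrightarrow> t / sqrt (1 + 0 * t\<^sup>2)"
    by (intro tendsto_intros null_step) auto
  then show "(\<lambda>n. soft_clip (null_step n) t) \<longlonglongrightarrow> t" by (simp add: soft_clip_def)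
  have "(\<lambda>n. inverse ((1 + null_step n * t\<^sup>2) * sqrt (1 + null_step n * t\<^sup>2))) \<longlonglongrightarrow> inverse ((1 + 0 * t\<^sup>2) * sqrt (1 + 0 * t\<^sup>2))"
    by (intro tendsto_intros null_step) auto
  then show "(\<lambda>n. soft_clip' (null_step n) t) \<longlonglongrightarrow> 1" by (simp add: soft_clip'_def)
qed

lemma L2_field_inner:
  assumes X: "C1_field X X' K" and w: "L2 w"
  shows "L2 (\<lambda>x. X x \<bullet> w x)"
proof (rule L2_bound[OF w])
  note [measurable] = L2_measurable[OF w] borel_measurable_continuous_onI[OF C1_fieldD(5)[OF X]]
  show "(\<lambda>x. X x \<bullet> w x) \<in> borel_measurable borel" by measurable
  show "norm (X x \<bullet> w x) \<le> K * norm (w x)" for x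
    using order_trans[OF Cauchy_Schwarz_ineq2 mult_right_mono[OF C1_fieldD(3)[OF X] norm_ge_zero]] by simp
qed

text \<open>Chain rule for the clipped power, whose derivative is Lipschitz with a constant
  depending on n. Clipping only decreases |u| and has slope at most 1, so the unclipped terms serve
  as majorants and both sides converge.\<close>

lemma power_field_identity:
  assumes W: "H1_pair u g" and X: "C1_field X X' K" and p: "2 < p" "p \<le> 4"
  shows "(LINT x|lborel. (\<bar>u x\<bar> powr (p - 2) * u x) * (X x \<bullet> g x)) = - (1/p) * (LINT x|lborel. \<bar>u x\<bar> powr p * divergence X' x)"
proof -
  note [measurable] = L2_measurable[OF H1_pairD(1)[OF W]] L2_measurable[OF H1_pairD(2)[OF W]] borel_measurable_continuous_onI[OF C1_fieldD(5)[OF X]]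
    borel_measurable_continuous_onI[OF C1_fieldD(6)[OF X]]
  define N where "N t = \<bar>t\<bar> powr (p - 2) * t" for t :: real
  define \<gamma> where "\<gamma> n t = N (soft_clip (null_step n) t) * soft_clip' (null_step n) t" for n t
  define \<Gamma> where "\<Gamma> n t = 1/p * \<bar>soft_clip (null_step n) t\<bar> powr p" for n t
  have e: "null_step n > 0" "null_step n \<ge> 0" for n using null_step(2)[of n] by auto
  have Nb: "\<bar>N t\<bar> = \<bar>t\<bar> powr (p - 1)" for t using abs_powr_times[of "p - 1" t] p by (simp add: N_def)
  have N_mono: "\<bar>N s\<bar> \<le> \<bar>N t\<bar>" if "\<bar>s\<bar> \<le> \<bar>t\<bar>" for s t unfolding Nb using that p by (intro powr_mono2) auto
  have [measurable]: "N \<in> borel_measurable borel" unfolding N_def[abs_def] by measurable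
  have [measurable]: "soft_clip e \<in> borel_measurable borel" "soft_clip' e \<in> borel_measurable borel" for e
    unfolding soft_clip_def[abs_def] soft_clip'_def[abs_def] by measurable
  have K: "K \<ge> 0" using C1_fieldD(3)[OF X, of 0] norm_ge_zero[of "X 0"] by linarith
  have chain: "(LINT x|lborel. \<Gamma> n (u x) * divergence X' x) = - (LINT x|lborel. \<gamma> n (u x) * (X x \<bullet> g x))" for n
  proof (rule weak_chain_field[OF W _ _ _ _ X])
    let ?e = "null_step n" and ?R = "1 / sqrt (null_step n)"
    show "(\<Gamma> n has_real_derivative \<gamma> n t) (at t)" for t
    proof -
      have "((\<lambda>t. 1/p * \<bar>soft_clip ?e t\<bar> powr p) has_real_derivative 1/p * (p * (\<bar>soft_clip ?e t\<bar> powr (p - 2) * soft_clip ?e t) * soft_clip' ?e t)) (at t)"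
        using p by (intro DERIV_cmult DERIV_chain2[OF DERIV_abs_powr DERIV_soft_clip[OF e(2)]]) auto
      then show ?thesis using p by (simp add: \<Gamma>_def[abs_def] \<gamma>_def N_def mult.assoc)
    qed
    show "\<Gamma> n 0 = 0" "\<gamma> n 0 = 0" using p by (simp_all add: \<Gamma>_def \<gamma>_def N_def soft_clip_def)
    fix a b :: real
    let ?s = "soft_clip ?e" and ?s' = "soft_clip' ?e"
    have sR: "\<bar>?s t\<bar> \<le> ?R" for t by (rule soft_clip_bounds(4)[OF e(2) e(1)])
    have sL: "\<bar>?s a - ?s b\<bar> \<le> 1 * \<bar>a - b\<bar>"
    proof -
      have "norm (?s a - ?s b) \<le> 1 * norm (a - b)"
        by (rule field_differentiable_bound[where S=UNIV and f'="?s'"])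
           (use DERIV_soft_clip[OF e(2)[of n]] soft_clip_bounds(2,3)[OF e(2)[of n]] in auto)
      then show ?thesis by simp
    qed
    have "\<gamma> n a - \<gamma> n b = (N (?s a) - N (?s b)) * ?s' a + N (?s b) * (?s' a - ?s' b)"
      by (simp add: \<gamma>_def algebra_simps)
    then have "\<bar>\<gamma> n a - \<gamma> n b\<bar> \<le> \<bar>N (?s a) - N (?s b)\<bar> * \<bar>?s' a\<bar> + \<bar>N (?s b)\<bar> * \<bar>?s' a - ?s' b\<bar>"
      using abs_triangle_ineq[of "(N (?s a) - N (?s b)) * ?s' a" "N (?s b) * (?s' a - ?s' b)"] by (simp add: abs_mult)
    also have "\<dots> \<le> ((p - 1) * ?R powr (p - 2) * \<bar>?s a - ?s b\<bar>) * 1 + ?R powr (p - 1) * (3 * sqrt ?e * \<bar>a - b\<bar>)"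
    proof (intro add_mono mult_mono)
      show "\<bar>N (?s a) - N (?s b)\<bar> \<le> (p - 1) * ?R powr (p - 2) * \<bar>?s a - ?s b\<bar>"
        unfolding N_def by (rule signed_powr_Lipschitz[OF p(1) sR sR])
      show "\<bar>N (?s b)\<bar> \<le> ?R powr (p - 1)" unfolding Nb using sR p by (intro powr_mono2) auto
      show "\<bar>?s' a\<bar> \<le> 1" using soft_clip_bounds(2,3)[OF e(2)] by simp
      show "\<bar>?s' a - ?s' b\<bar> \<le> 3 * sqrt ?e * \<bar>a - b\<bar>" by (rule soft_clip'_Lipschitz[OF e(1)])
    qed (use p in auto)
    also have "\<dots> \<le> ((p - 1) * ?R powr (p - 2) * (1 * \<bar>a - b\<bar>)) * 1 + ?R powr (p - 1) * (3 * sqrt ?e * \<bar>a - b\<bar>)"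
      using p by (intro add_right_mono mult_right_mono mult_left_mono sL) auto
    also have "\<dots> = ((p - 1) * ?R powr (p - 2) + ?R powr (p - 1) * (3 * sqrt ?e)) * \<bar>a - b\<bar>" by (simp add: algebra_simps)
    finally show "\<bar>\<gamma> n a - \<gamma> n b\<bar> \<le> ((p - 1) * ?R powr (p - 2) + ?R powr (p - 1) * (3 * sqrt ?e)) * \<bar>a - b\<bar>" .
  qed
  have LN: "L2 (\<lambda>x. N (u x))" unfolding N_def by (rule L2_powr_mult[OF W]) (use p in auto)
  have LX: "L2 (\<lambda>x. X x \<bullet> g x)" by (rule L2_field_inner[OF X H1_pairD(2)[OF W]])
  have ip: "integrable lborel (\<lambda>x. \<bar>u x\<bar> powr p)" by (rule H1_powr_integrable[OF W]) (use p in auto)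
  have l1: "(\<lambda>n. LINT x|lborel. \<Gamma> n (u x) * divergence X' x) \<longlonglongrightarrow> (LINT x|lborel. (1/p * \<bar>u x\<bar> powr p) * divergence X' x)"
  proof (rule integral_dominated_convergence)
    show "integrable lborel (\<lambda>x. (1/p * (3 * K)) * \<bar>u x\<bar> powr p)" using ip by simp
    show "AE x in lborel. (\<lambda>n. \<Gamma> n (u x) * divergence X' x) \<longlonglongrightarrow> (1/p * \<bar>u x\<bar> powr p) * divergence X' x"
      unfolding \<Gamma>_def using p by (intro AE_I2 tendsto_mult tendsto_const tendsto_powr' tendsto_rabs soft_clip_tendsto) auto
    show "AE x in lborel. norm (\<Gamma> n (u x) * divergence X' x) \<le> (1/p * (3 * K)) * \<bar>u x\<bar> powr p" for n
    proof (rule AE_I2)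
      fix x
      have "\<bar>soft_clip (null_step n) (u x)\<bar> powr p \<le> \<bar>u x\<bar> powr p"
        using soft_clip_bounds(1)[OF e(2)] p by (intro powr_mono2) auto
      then have "(1/p * \<bar>soft_clip (null_step n) (u x)\<bar> powr p) * \<bar>divergence X' x\<bar> \<le> (1/p * \<bar>u x\<bar> powr p) * (3 * K)"
        using p C1_fieldD(7)[OF X] by (intro mult_mono) (auto simp: divide_right_mono)
      then show "norm (\<Gamma> n (u x) * divergence X' x) \<le> (1/p * (3 * K)) * \<bar>u x\<bar> powr p"
        using p by (simp add: \<Gamma>_def abs_mult mult_ac)
    qed
  qed (simp_all add: \<Gamma>_def)
  have l2: "(\<lambda>n. - (LINT x|lborel. \<gamma> n (u x) * (X x \<bullet> g x))) \<longlonglongrightarrow> - (LINT x|lborel. N (u x) * (X x \<bullet> g x))"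
  proof (rule tendsto_minus, rule integral_dominated_convergence)
    show "integrable lborel (\<lambda>x. norm (N (u x)) * norm (X x \<bullet> g x))" by (rule L2_integrable_norm_mult[OF LN LX])
    show "AE x in lborel. (\<lambda>n. \<gamma> n (u x) * (X x \<bullet> g x)) \<longlonglongrightarrow> N (u x) * (X x \<bullet> g x)"
    proof (rule AE_I2)
      fix x
      have cN: "isCont N (u x)" unfolding N_def[abs_def] by (rule DERIV_isCont[OF DERIV_signed_powr[OF p(1)]])
      have "(\<lambda>n. N (soft_clip (null_step n) (u x)) * soft_clip' (null_step n) (u x) * (X x \<bullet> g x)) \<longlonglongrightarrow> N (u x) * 1 * (X x \<bullet> g x)"
        by (intro tendsto_mult tendsto_const isCont_tendsto_compose[OF cN] soft_clip_tendsto)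
      then show "(\<lambda>n. \<gamma> n (u x) * (X x \<bullet> g x)) \<longlonglongrightarrow> N (u x) * (X x \<bullet> g x)" by (simp add: \<gamma>_def)
    qed
    show "AE x in lborel. norm (\<gamma> n (u x) * (X x \<bullet> g x)) \<le> norm (N (u x)) * norm (X x \<bullet> g x)" for n
    proof (rule AE_I2)
      fix x
      have "\<bar>N (soft_clip (null_step n) (u x))\<bar> * \<bar>soft_clip' (null_step n) (u x)\<bar> \<le> \<bar>N (u x)\<bar> * 1"
        using soft_clip_bounds[OF e(2)] by (intro mult_mono N_mono) auto
      then show "norm (\<gamma> n (u x) * (X x \<bullet> g x)) \<le> norm (N (u x)) * norm (X x \<bullet> g x)"
        by (simp add: \<gamma>_def abs_mult mult_right_mono)
    qed
  qed (simp_all add: \<gamma>_def)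
  have "(LINT x|lborel. (1/p * \<bar>u x\<bar> powr p) * divergence X' x) = - (LINT x|lborel. N (u x) * (X x \<bullet> g x))"
    by (rule LIMSEQ_unique[OF l1[unfolded chain] l2])
  moreover have "(LINT x|lborel. (1/p * \<bar>u x\<bar> powr p) * divergence X' x) = 1/p * (LINT x|lborel. \<bar>u x\<bar> powr p * divergence X' x)"
    by (simp only: mult.assoc integral_mult_right_zero)
  ultimately show ?thesis by (simp add: N_def)
qed

section \<open>The Coulomb term tested with a field\<close>

lemma product_bounded_integrable:
  fixes f h :: "real^3 \<Rightarrow> real"
  assumes f: "integrable lborel f" and h: "integrable lborel h"
    and [measurable]: "(\<lambda>(x, y). B x y) \<in> borel_measurable (lborel \<Otimes>\<^sub>M lborel)" and B: "\<And>x y. \<bar>B x y\<bar> \<le> K"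
  shows "integrable (lborel \<Otimes>\<^sub>M lborel) (\<lambda>(x, y). f x * h y * B x y)"
proof (rule Bochner_Integration.integrable_bound)
  note [measurable] = borel_measurable_integrable[OF f] borel_measurable_integrable[OF h]
  show "integrable (lborel \<Otimes>\<^sub>M lborel) (\<lambda>(x, y). K * (f x * h y))"
  proof (rule lborel_pair.Fubini_integrable)
    show "(\<lambda>(x, y). K * (f x * h y)) \<in> borel_measurable (lborel \<Otimes>\<^sub>M lborel)" by measurable
    have "(LINT y|lborel. norm (case (x, y) of (x, y) \<Rightarrow> K * (f x * h y))) = \<bar>K\<bar> * (\<bar>f x\<bar> * (LINT y|lborel. \<bar>h y\<bar>))" for x
      by (simp add: abs_mult)
    then show "integrable lborel (\<lambda>x. LINT y|lborel. norm (case (x, y) of (x, y) \<Rightarrow> K * (f x * h y)))"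
      using f by simp
    show "AE x in lborel. integrable lborel (\<lambda>y. case (x, y) of (x, y) \<Rightarrow> K * (f x * h y))" using h by simp
  qed
  show "(\<lambda>(x, y). f x * h y * B x y) \<in> borel_measurable (lborel \<Otimes>\<^sub>M lborel)" by measurable
  show "AE z in lborel \<Otimes>\<^sub>M lborel. norm (case z of (x, y) \<Rightarrow> f x * h y * B x y) \<le> norm (case z of (x, y) \<Rightarrow> K * (f x * h y))"
  proof (rule AE_I2, clarify)
    fix x y :: "real^3"
    have "\<bar>f x * h y\<bar> * \<bar>B x y\<bar> \<le> \<bar>f x * h y\<bar> * \<bar>K\<bar>" using B[of x y] by (intro mult_left_mono) auto
    then show "norm (f x * h y * B x y) \<le> norm (K * (f x * h y))" by (simp add: abs_mult mult_ac)
  qed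
qed

lemma AE_pair_neq: "AE z in lborel \<Otimes>\<^sub>M lborel. fst z \<noteq> (snd z :: real^3)"
proof (rule lborel_pair.AE_pair_measure)
  show "{z \<in> space (lborel \<Otimes>\<^sub>M lborel). fst z \<noteq> (snd z :: real^3)} \<in> sets (lborel \<Otimes>\<^sub>M lborel)" by measurable
  show "AE x in lborel. AE y in lborel. fst (x, y) \<noteq> (snd (x, y) :: real^3)"
  proof (rule AE_I2)
    fix x :: "real^3"
    have "AE y in lborel. y \<noteq> x" by (rule AE_lborel_singleton)
    then show "AE y in lborel. fst (x, y) \<noteq> snd (x, y)" by eventually_elim auto
  qed
qed

text \<open>Allows the regularized Coulomb kernel with pole y to be absorbed into the field, so that
  the divergence identity for u^2 applies with y fixed.\<close>

lemma C1_field_scale: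
  assumes X: "C1_field X X' K" and d: "\<And>x. (\<eta> has_derivative \<eta>' x) (at x)" and c: "\<And>h. continuous_on UNIV (\<lambda>x. \<eta>' x h)"
    and b: "\<And>x. \<bar>\<eta> x\<bar> \<le> a" "\<And>x h. \<bar>\<eta>' x h\<bar> \<le> a * norm h"
  shows "C1_field (\<lambda>x. \<eta> x *\<^sub>R X x) (\<lambda>x h. \<eta> x *\<^sub>R X' x h + \<eta>' x h *\<^sub>R X x) (2 * a * K)"
    and "divergence (\<lambda>x h. \<eta> x *\<^sub>R X' x h + \<eta>' x h *\<^sub>R X x) x = \<eta> x * divergence X' x + \<eta>' x (X x)"
proof -
  note Xd = C1_fieldD[OF X]
  have K: "K \<ge> 0" using Xd(3)[of 0] norm_ge_zero[of "X 0"] by linarith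
  have a: "a \<ge> 0" using b(1)[of 0] by linarith
  show "C1_field (\<lambda>x. \<eta> x *\<^sub>R X x) (\<lambda>x h. \<eta> x *\<^sub>R X' x h + \<eta>' x h *\<^sub>R X x) (2 * a * K)"
    unfolding C1_field_def
  proof (intro conjI allI)
    fix x h :: "real^3"
    show "((\<lambda>x. \<eta> x *\<^sub>R X x) has_derivative (\<lambda>h. \<eta> x *\<^sub>R X' x h + \<eta>' x h *\<^sub>R X x)) (at x)"
      by (rule has_derivative_scaleR[OF d Xd(1)])
    show "continuous_on UNIV (\<lambda>x. \<eta> x *\<^sub>R X' x h + \<eta>' x h *\<^sub>R X x)"
      by (intro continuous_intros has_derivative_imp_continuous_on_UNIV[OF d] Xd(2,5) c)
    have "\<bar>\<eta> x\<bar> * norm (X x) \<le> a * K" using a b(1) Xd(3) by (intro mult_mono) auto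
    also have "\<dots> \<le> 2 * a * K" using a K by simp
    finally show "norm (\<eta> x *\<^sub>R X x) \<le> 2 * a * K" by simp
    have "norm (\<eta> x *\<^sub>R X' x h + \<eta>' x h *\<^sub>R X x) \<le> \<bar>\<eta> x\<bar> * norm (X' x h) + \<bar>\<eta>' x h\<bar> * norm (X x)"
      by (rule order_trans[OF norm_triangle_ineq]) simp
    also have "\<dots> \<le> a * (K * norm h) + (a * norm h) * K"
      using a b Xd(3,4) K by (intro add_mono mult_mono) auto
    finally show "norm (\<eta> x *\<^sub>R X' x h + \<eta>' x h *\<^sub>R X x) \<le> 2 * a * K * norm h" by (simp add: mult_ac)
  qed
  have lin: "linear (\<eta>' x)" by (rule bounded_linear.linear[OF has_derivative_bounded_linear[OF d]])
  have "\<eta>' x (X x) = \<eta>' x (\<Sum>b\<in>Basis. (X x \<bullet> b) *\<^sub>R b)" by (simp add: euclidean_representation)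
  also have "\<dots> = (\<Sum>b\<in>Basis. \<eta>' x b * (X x \<bullet> b))" by (simp add: linear_sum[OF lin] linear_cmul[OF lin] mult.commute)
  finally show "divergence (\<lambda>x h. \<eta> x *\<^sub>R X' x h + \<eta>' x h *\<^sub>R X x) x = \<eta> x * divergence X' x + \<eta>' x (X x)"
    by (simp add: divergence_def inner_add_left sum.distrib sum_distrib_left)
qed

text \<open>\<open>smooth_inverse e\<close> regularizes the Coulomb kernel as a function of the squared distance; its derivative is a multiple of \<open>riesz_k e\<close>.\<close>

definition smooth_inverse :: "real \<Rightarrow> real \<Rightarrow> real" where "smooth_inverse e s = inverse (sqrt (s + e))"

lemma DERIV_smooth_inverse:
  assumes "s + e > 0"
  shows "(smooth_inverse e has_real_derivative - (1/2) * riesz_k e s) (at s)"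
proof -
  let ?q = "sqrt (s + e)"
  have q: "?q > 0" using assms by simp
  have "((\<lambda>s. sqrt (s + e)) has_real_derivative inverse ?q / 2) (at s)"
    using assms by (auto intro!: derivative_eq_intros)
  from DERIV_inverse'[OF this]
  have "((\<lambda>s. inverse (sqrt (s + e))) has_real_derivative - (inverse ?q * (inverse ?q / 2) * inverse ?q)) (at s)" using q by simp
  moreover have "- (inverse ?q * (inverse ?q / 2) * inverse ?q) = - (1/2) * inverse ((?q * ?q) * ?q)"
    by (simp only: inverse_mult_distrib)
  moreover have "?q * ?q = s + e" using assms by simp
  ultimately show ?thesis by (simp only: smooth_inverse_def[abs_def] riesz_k_def)
qed

text \<open>The Lipschitz constant L is kept apart from K: for the dilation fields the derivative
  bound stays 3 while the constant K grows with n.\<close>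

lemma C1_field_Lipschitz:
  assumes X: "C1_field X X' K" and L: "\<And>x h. norm (X' x h) \<le> L * norm h"
  shows "norm (X x - X y) \<le> L * norm (x - y)"
proof (rule differentiable_bound[where S=UNIV])
  show "(X has_derivative X' x) (at x within UNIV)" for x using C1_fieldD(1)[OF X] by simp
  show "onorm (X' x) \<le> L" for x by (rule onorm_le[OF L])
qed auto

text \<open>For fixed y the divergence identity is applied to X times the regularized kernel with
  pole y, then integrated against rho(y). Symmetrizing in x and y replaces X(x) . (x-y) by half of
  (X(x)-X(y)) . (x-y), which is of order |x-y|^2; this is what later allows e to tend to 0.\<close>

lemma coulomb_regularized_identity:
  assumes W: "H1_pair u g" and X: "C1_field X X' K" and e: "e > 0"
  defines "\<rho> \<equiv> \<lambda>x. (u x)\<^sup>2"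
  defines "P \<equiv> lborel \<Otimes>\<^sub>M (lborel :: (real^3) measure)"
  shows "(LINT (x, y)|P. \<rho> x * \<rho> y * (smooth_inverse e ((norm (x - y))\<^sup>2) * divergence X' x))
      - 1/2 * (LINT (x, y)|P. \<rho> x * \<rho> y * (riesz_k e ((norm (x - y))\<^sup>2) * ((X x - X y) \<bullet> (x - y))))
    = - 2 * (LINT (x, y)|P. (u x * (X x \<bullet> g x)) * \<rho> y * smooth_inverse e ((norm (x - y))\<^sup>2))"
proof -
  note Xd = C1_fieldD[OF X]
  note [measurable] = L2_measurable[OF H1_pairD(1)[OF W]] L2_measurable[OF H1_pairD(2)[OF W]] borel_measurable_continuous_onI[OF Xd(5)]
    borel_measurable_continuous_onI[OF Xd(6)]
  have K: "K \<ge> 0" using Xd(3)[of 0] norm_ge_zero[of "X 0"] by linarith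
  let ?k = "smooth_inverse e" and ?r = "riesz_k e"
  have [measurable]: "?k \<in> borel_measurable borel" "?r \<in> borel_measurable borel"
    unfolding smooth_inverse_def[abs_def] riesz_k_def[abs_def] by measurable
  define q where "q x = u x * (X x \<bullet> g x)" for x
  have \<rho>: "integrable lborel \<rho>" unfolding \<rho>_def using L2_integrable[OF H1_pairD(1)[OF W]] by simp
  have q: "integrable lborel q" unfolding q_def by (rule L2_integrable_mult[OF H1_pairD(1)[OF W] L2_field_inner[OF X H1_pairD(2)[OF W]]])
  have [measurable]: "\<rho> \<in> borel_measurable borel" "q \<in> borel_measurable borel" using \<rho> q by auto
  define a where "a = 1 / sqrt e + (1 / e + 4 / (e * sqrt e))"
  have kb: "\<bar>?k ((norm x)\<^sup>2)\<bar> \<le> a" for x :: "real^3"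
  proof -
    have "inverse (sqrt ((norm x)\<^sup>2 + e)) \<le> inverse (sqrt e)" using e by (intro le_imp_inverse_le) auto
    then show ?thesis using e power2_add_pos[OF e, of x] by (simp add: smooth_inverse_def a_def divide_inverse add_increasing2)
  qed
  have rb: "\<bar>?r ((norm (x - y))\<^sup>2)\<bar> * norm (x - y) \<le> a" for x y :: "real^3"
    using C1_fieldD(3)[OF C1_riesz_field[OF e, of y], of x] e by (simp add: radial_field_def a_def add_increasing)
  have rb': "\<bar>?r ((norm (x - y))\<^sup>2) * ((x - y) \<bullet> h)\<bar> \<le> a * norm h" for x y h :: "real^3"
  proof -
    have "\<bar>?r ((norm (x - y))\<^sup>2)\<bar> * \<bar>(x - y) \<bullet> h\<bar> \<le> \<bar>?r ((norm (x - y))\<^sup>2)\<bar> * (norm (x - y) * norm h)"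
      by (intro mult_left_mono Cauchy_Schwarz_ineq2) auto
    also have "\<dots> \<le> a * norm h" using mult_right_mono[OF rb[of x y] norm_ge_zero[of h]] by (simp add: mult.assoc)
    finally show ?thesis by (simp add: abs_mult)
  qed
  have a: "a \<ge> 0" using kb[of 0] by linarith
  let ?F1 = "\<lambda>x y. \<rho> x * \<rho> y * (?k ((norm (x - y))\<^sup>2) * divergence X' x)"
  let ?F2 = "\<lambda>x y. \<rho> x * \<rho> y * (?r ((norm (x - y))\<^sup>2) * ((x - y) \<bullet> X x))"
  let ?F3 = "\<lambda>x y. q x * \<rho> y * ?k ((norm (x - y))\<^sup>2)"
  have i1: "integrable P (\<lambda>(x, y). ?F1 x y)"
    unfolding P_def
  proof (rule product_bounded_integrable[OF \<rho> \<rho>])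
    show "(\<lambda>(x, y). ?k ((norm (x - y))\<^sup>2) * divergence X' x) \<in> borel_measurable (lborel \<Otimes>\<^sub>M lborel)" by measurable
    show "\<bar>?k ((norm (x - y))\<^sup>2) * divergence X' x\<bar> \<le> a * (3 * K)" for x y
      unfolding abs_mult by (intro mult_mono kb Xd(7) a) auto
  qed
  have i2: "integrable P (\<lambda>(x, y). ?F2 x y)"
    unfolding P_def
  proof (rule product_bounded_integrable[OF \<rho> \<rho>])
    show "(\<lambda>(x, y). ?r ((norm (x - y))\<^sup>2) * ((x - y) \<bullet> X x)) \<in> borel_measurable (lborel \<Otimes>\<^sub>M lborel)" by measurable
    show "\<bar>?r ((norm (x - y))\<^sup>2) * ((x - y) \<bullet> X x)\<bar> \<le> a * K" for x y
      by (rule order_trans[OF rb']) (intro mult_left_mono Xd(3) a)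
  qed
  have i3: "integrable P (\<lambda>(x, y). ?F3 x y)"
    unfolding P_def
  proof (rule product_bounded_integrable[OF q \<rho>])
    show "(\<lambda>(x, y). ?k ((norm (x - y))\<^sup>2)) \<in> borel_measurable (lborel \<Otimes>\<^sub>M lborel)" by measurable
    show "\<bar>?k ((norm (x - y))\<^sup>2)\<bar> \<le> a" for x y :: "real^3" by (rule kb)
  qed
  have ident: "(LINT x|lborel. ?F1 x y - ?F2 x y) = - 2 * (LINT x|lborel. ?F3 x y)" for y
  proof -
    define \<eta>' where "\<eta>' x h = 2 * (- (1/2) * ?r ((norm (x - y))\<^sup>2)) * ((x - y) \<bullet> h)" for x h
    have pos: "s + e > 0" if "0 \<le> s" for s using that e by simp
    have d: "((\<lambda>x. ?k ((norm (x - y))\<^sup>2)) has_derivative \<eta>' x) (at x)" for x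
      unfolding \<eta>'_def by (rule radial_has_derivative) (rule DERIV_smooth_inverse[OF pos])
    have c: "continuous_on UNIV (\<lambda>x. \<eta>' x h)" for h
    proof -
      have "continuous_on UNIV (\<lambda>x. ?r ((norm (x - y))\<^sup>2))"
        by (rule has_derivative_imp_continuous_on_UNIV, rule radial_has_derivative) (rule DERIV_riesz_k[OF pos])
      then show ?thesis unfolding \<eta>'_def by (intro continuous_intros)
    qed
    have \<eta>'e: "\<eta>' x h = - (?r ((norm (x - y))\<^sup>2) * ((x - y) \<bullet> h))" for x h by (simp add: \<eta>'_def)
    have b: "\<bar>\<eta>' x h\<bar> \<le> a * norm h" for x h unfolding \<eta>'e abs_minus_cancel by (rule rb')
    note Y = C1_field_scale[OF X d c kb b]
    have "(LINT x|lborel. (u x)\<^sup>2 * (?k ((norm (x - y))\<^sup>2) * divergence X' x + \<eta>' x (X x)))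
      = - 2 * (LINT x|lborel. u x * ((?k ((norm (x - y))\<^sup>2) *\<^sub>R X x) \<bullet> g x))"
      using weak_square_field[OF W Y(1)] unfolding Y(2) .
    then have "\<rho> y * (LINT x|lborel. (u x)\<^sup>2 * (?k ((norm (x - y))\<^sup>2) * divergence X' x + \<eta>' x (X x)))
      = - 2 * (\<rho> y * (LINT x|lborel. u x * ((?k ((norm (x - y))\<^sup>2) *\<^sub>R X x) \<bullet> g x)))" by simp
    moreover have "\<rho> y * (LINT x|lborel. (u x)\<^sup>2 * (?k ((norm (x - y))\<^sup>2) * divergence X' x + \<eta>' x (X x))) = (LINT x|lborel. ?F1 x y - ?F2 x y)"
      unfolding integral_mult_right_zero[symmetric] \<eta>'e by (intro Bochner_Integration.integral_cong refl) (simp add: \<rho>_def algebra_simps)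
    moreover have "\<rho> y * (LINT x|lborel. u x * ((?k ((norm (x - y))\<^sup>2) *\<^sub>R X x) \<bullet> g x)) = (LINT x|lborel. ?F3 x y)"
      unfolding integral_mult_right_zero[symmetric] by (intro Bochner_Integration.integral_cong refl) (simp add: q_def mult_ac)
    ultimately show ?thesis by simp
  qed
  have i12: "integrable P (\<lambda>(x, y). ?F1 x y - ?F2 x y)"
    using Bochner_Integration.integrable_diff[OF i1 i2] by (simp add: case_prod_beta')
  have "(LINT y|lborel. LINT x|lborel. ?F1 x y - ?F2 x y) = (LINT (x, y)|P. ?F1 x y - ?F2 x y)"
    using lborel_pair.integral_snd[OF i12[unfolded P_def]] by (simp add: P_def)
  also have "\<dots> = (LINT (x, y)|P. ?F1 x y) - (LINT (x, y)|P. ?F2 x y)"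
    using Bochner_Integration.integral_diff[OF i1 i2] by (simp add: case_prod_beta')
  finally have A: "(LINT (x, y)|P. ?F1 x y) - (LINT (x, y)|P. ?F2 x y) = - 2 * (LINT (x, y)|P. ?F3 x y)"
    using lborel_pair.integral_snd[OF i3[unfolded P_def]] by (simp add: P_def ident)
  have swap: "(LINT (x, y)|P. ?F2 y x) = (LINT (x, y)|P. ?F2 x y)"
    using lborel_pair.integral_product_swap[of "\<lambda>(x, y). ?F2 x y"] i2 by (simp add: P_def)
  have iswap: "integrable P (\<lambda>(x, y). ?F2 y x)"
    using lborel_pair.integrable_product_swap[OF i2[unfolded P_def]] by (simp add: P_def)
  have "(LINT (x, y)|P. \<rho> x * \<rho> y * (?r ((norm (x - y))\<^sup>2) * ((X x - X y) \<bullet> (x - y)))) = (LINT (x, y)|P. ?F2 x y + ?F2 y x)"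
  proof (intro Bochner_Integration.integral_cong refl)
    fix z
    have eq: "\<rho> x * \<rho> y * (?r ((norm (x - y))\<^sup>2) * ((X x - X y) \<bullet> (x - y))) = ?F2 x y + ?F2 y x" for x y
    proof -
      have "(norm (y - x))\<^sup>2 = (norm (x - y))\<^sup>2" by (simp add: norm_minus_commute)
      moreover have "(X x - X y) \<bullet> (x - y) = (x - y) \<bullet> X x + (y - x) \<bullet> X y"
        by (simp add: inner_diff_left inner_diff_right inner_commute)
      ultimately show ?thesis by (simp only: distrib_left mult.commute[of "\<rho> y" "\<rho> x"])
    qed
    show "(case z of (x, y) \<Rightarrow> \<rho> x * \<rho> y * (?r ((norm (x - y))\<^sup>2) * ((X x - X y) \<bullet> (x - y)))) = (case z of (x, y) \<Rightarrow> ?F2 x y + ?F2 y x)"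
      by (cases z) (simp only: prod.case eq)
  qed
  also have "\<dots> = (LINT (x, y)|P. ?F2 x y) + (LINT (x, y)|P. ?F2 y x)"
    using Bochner_Integration.integral_add[OF i2 iswap] by (simp add: case_prod_beta')
  finally have B: "(LINT (x, y)|P. \<rho> x * \<rho> y * (?r ((norm (x - y))\<^sup>2) * ((X x - X y) \<bullet> (x - y)))) = 2 * (LINT (x, y)|P. ?F2 x y)"
    using swap by simp
  show ?thesis using A unfolding B by (simp add: q_def)
qed

lemma smooth_inverse_tendsto:
  assumes r: "r > 0"
  shows "(\<lambda>n. smooth_inverse (null_step n) (r\<^sup>2)) \<longlonglongrightarrow> inverse r" "(\<lambda>n. riesz_k (null_step n) (r\<^sup>2)) \<longlonglongrightarrow> inverse (r ^ 3)"
proof -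
  have "(\<lambda>n. inverse (sqrt (r\<^sup>2 + null_step n))) \<longlonglongrightarrow> inverse (sqrt (r\<^sup>2 + 0))"
    using r by (intro tendsto_intros null_step) auto
  then show "(\<lambda>n. smooth_inverse (null_step n) (r\<^sup>2)) \<longlonglongrightarrow> inverse r" using r by (simp add: smooth_inverse_def)
  have "(\<lambda>n. inverse ((r\<^sup>2 + null_step n) * sqrt (r\<^sup>2 + null_step n))) \<longlonglongrightarrow> inverse ((r\<^sup>2 + 0) * sqrt (r\<^sup>2 + 0))"
    using r by (intro tendsto_intros null_step) auto
  moreover have "(r\<^sup>2 + 0) * sqrt (r\<^sup>2 + 0) = r ^ 3" using r by (simp add: power2_eq_square power3_eq_cube)
  ultimately show "(\<lambda>n. riesz_k (null_step n) (r\<^sup>2)) \<longlonglongrightarrow> inverse (r ^ 3)" by (simp only: riesz_k_def)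
qed

lemma smooth_inverse_le: "r > 0 \<Longrightarrow> e > 0 \<Longrightarrow> \<bar>smooth_inverse e (r\<^sup>2)\<bar> \<le> inverse r"
proof -
  assume r: "r > 0" and e: "e > 0"
  have "r \<le> sqrt (r\<^sup>2 + e)" using e real_le_rsqrt by auto
  then have "inverse (sqrt (r\<^sup>2 + e)) \<le> inverse r" using r by (intro le_imp_inverse_le) auto
  then show ?thesis using e by (simp add: smooth_inverse_def)
qed

lemma integrable_square:
  assumes "H1_pair u g" shows "integrable lborel (\<lambda>x. (u x)\<^sup>2)"
  using L2_integrable[OF H1_pairD(1)[OF assms]] by simp

lemma coulomb_pair:
  assumes f: "pot_bounded f" and h: "pot_bounded h"
  shows "(LINT (x, y)|(lborel \<Otimes>\<^sub>M lborel). f x * h y / norm (x - y)) = coulomb f h"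
  using lborel_pair.integral_fst[OF coulomb_pair_integrable[OF pot_bounded_integrable[OF f] h]] by (simp add: coulomb_eq_double)

text \<open>After the symmetrization every integrand is dominated by an integrable one with
  singularity 1/|x-y|, so dominated convergence removes the regularization.\<close>

theorem coulomb_field_identity:
  assumes W: "H1_pair u g" and X: "C1_field X X' K"
  defines "\<rho> \<equiv> \<lambda>x. (u x)\<^sup>2"
  defines "P \<equiv> lborel \<Otimes>\<^sub>M (lborel :: (real^3) measure)"
  shows "(LINT (x, y)|P. \<rho> x * \<rho> y * (inverse (norm (x - y)) * divergence X' x))
      - 1/2 * (LINT (x, y)|P. \<rho> x * \<rho> y * (inverse (norm (x - y) ^ 3) * ((X x - X y) \<bullet> (x - y))))
    = - 2 * (LINT x|lborel. potential \<rho> x * u x * (X x \<bullet> g x))"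
proof -
  note Xd = C1_fieldD[OF X]
  note [measurable] = L2_measurable[OF H1_pairD(1)[OF W]] L2_measurable[OF H1_pairD(2)[OF W]] borel_measurable_continuous_onI[OF Xd(5)]
    borel_measurable_continuous_onI[OF Xd(6)]
  have K: "K \<ge> 0" using Xd(3)[of 0] norm_ge_zero[of "X 0"] by linarith
  have [measurable]: "smooth_inverse e \<in> borel_measurable borel" "riesz_k e \<in> borel_measurable borel" for e
    unfolding smooth_inverse_def[abs_def] riesz_k_def[abs_def] by measurable
  define q where "q x = u x * (X x \<bullet> g x)" for x
  have q: "integrable lborel q" unfolding q_def by (rule L2_integrable_mult[OF H1_pairD(1)[OF W] L2_field_inner[OF X H1_pairD(2)[OF W]]])
  have \<rho>b: "pot_bounded \<rho>" unfolding \<rho>_def by (rule pot_bounded_square[OF W])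
  have \<rho>: "integrable lborel \<rho>" by (rule pot_bounded_integrable[OF \<rho>b])
  have [measurable]: "\<rho> \<in> borel_measurable borel" "q \<in> borel_measurable borel" using \<rho> q by auto
  have \<rho>0: "\<rho> x \<ge> 0" for x by (simp add: \<rho>_def)
  have iB: "integrable P (\<lambda>(x, y). \<rho> x * \<rho> y / norm (x - y))" unfolding P_def by (rule coulomb_pair_integrable[OF \<rho> \<rho>b])
  have iq: "integrable P (\<lambda>(x, y). q x * \<rho> y / norm (x - y))" unfolding P_def by (rule coulomb_pair_integrable[OF q \<rho>b])
  have AEP: "AE z in P. fst z \<noteq> snd z" unfolding P_def by (rule AE_pair_neq)
  have Lip: "norm (X x - X y) \<le> K * norm (x - y)" for x y by (rule C1_field_Lipschitz[OF X Xd(4)])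
  let ?e = null_step
  have e: "?e n > 0" for n by (rule null_step)
  let ?F1 = "\<lambda>n x y. \<rho> x * \<rho> y * (smooth_inverse (?e n) ((norm (x - y))\<^sup>2) * divergence X' x)"
  let ?F2 = "\<lambda>n x y. \<rho> x * \<rho> y * (riesz_k (?e n) ((norm (x - y))\<^sup>2) * ((X x - X y) \<bullet> (x - y)))"
  let ?F3 = "\<lambda>n x y. q x * \<rho> y * smooth_inverse (?e n) ((norm (x - y))\<^sup>2)"
  have l1: "(\<lambda>n. LINT (x, y)|P. ?F1 n x y) \<longlonglongrightarrow> (LINT (x, y)|P. \<rho> x * \<rho> y * (inverse (norm (x - y)) * divergence X' x))"
  proof (rule integral_dominated_convergence)
    show "integrable P (\<lambda>z. (3 * K) * (case z of (x, y) \<Rightarrow> \<rho> x * \<rho> y / norm (x - y)))" using iB by simp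
    show "AE z in P. (\<lambda>n. case z of (x, y) \<Rightarrow> ?F1 n x y) \<longlonglongrightarrow> (case z of (x, y) \<Rightarrow> \<rho> x * \<rho> y * (inverse (norm (x - y)) * divergence X' x))"
      using AEP
    proof eventually_elim
      case (elim z)
      then show ?case
        by (cases z) (auto intro!: tendsto_mult tendsto_const smooth_inverse_tendsto)
    qed
    show "AE z in P. norm (case z of (x, y) \<Rightarrow> ?F1 n x y) \<le> (3 * K) * (case z of (x, y) \<Rightarrow> \<rho> x * \<rho> y / norm (x - y))" for n
      using AEP
    proof eventually_elim
      case (elim z)
      obtain x y where z: "z = (x, y)" by (cases z)
      have r: "norm (x - y) > 0" using elim z by simp
      have "\<bar>smooth_inverse (?e n) ((norm (x - y))\<^sup>2)\<bar> * \<bar>divergence X' x\<bar> \<le> inverse (norm (x - y)) * (3 * K)"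
        using Xd(7) r by (intro mult_mono smooth_inverse_le e) auto
      then have "(\<rho> x * \<rho> y) * (\<bar>smooth_inverse (?e n) ((norm (x - y))\<^sup>2)\<bar> * \<bar>divergence X' x\<bar>) \<le> (\<rho> x * \<rho> y) * (inverse (norm (x - y)) * (3 * K))"
        using \<rho>0 by (intro mult_left_mono) auto
      then show ?case using \<rho>0 by (simp add: z abs_mult divide_inverse mult_ac)
    qed
  qed (unfold P_def, measurable)
  have l2: "(\<lambda>n. LINT (x, y)|P. ?F2 n x y) \<longlonglongrightarrow> (LINT (x, y)|P. \<rho> x * \<rho> y * (inverse (norm (x - y) ^ 3) * ((X x - X y) \<bullet> (x - y))))"
  proof (rule integral_dominated_convergence)
    show "integrable P (\<lambda>z. K * (case z of (x, y) \<Rightarrow> \<rho> x * \<rho> y / norm (x - y)))" using iB by simp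
    show "AE z in P. (\<lambda>n. case z of (x, y) \<Rightarrow> ?F2 n x y) \<longlonglongrightarrow> (case z of (x, y) \<Rightarrow> \<rho> x * \<rho> y * (inverse (norm (x - y) ^ 3) * ((X x - X y) \<bullet> (x - y))))"
      using AEP
    proof eventually_elim
      case (elim z)
      then show ?case
        by (cases z) (auto intro!: tendsto_mult tendsto_const smooth_inverse_tendsto)
    qed
    show "AE z in P. norm (case z of (x, y) \<Rightarrow> ?F2 n x y) \<le> K * (case z of (x, y) \<Rightarrow> \<rho> x * \<rho> y / norm (x - y))" for n
      using AEP
    proof eventually_elim
      case (elim z)
      obtain x y where z: "z = (x, y)" by (cases z)
      let ?r = "norm (x - y)"
      have r: "?r > 0" using elim z by simp
      have "\<bar>riesz_k (?e n) (?r\<^sup>2)\<bar> * \<bar>(X x - X y) \<bullet> (x - y)\<bar> \<le> \<bar>riesz_k (?e n) (?r\<^sup>2)\<bar> * ((K * ?r) * ?r)"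
        by (intro mult_left_mono order_trans[OF Cauchy_Schwarz_ineq2] mult_right_mono Lip) auto
      also have "\<dots> = (\<bar>riesz_k (?e n) (?r\<^sup>2)\<bar> * ?r) * (K * ?r)" by simp
      \<comment> \<open>The Lipschitz bound of X and the factor x - y absorb two powers of the cubic
        singularity; 1/|x-y| is left.\<close>
      also have "\<dots> \<le> (1 / ?r\<^sup>2) * (K * ?r)"
        using norm_riesz_field_le[OF e, of n y x] K by (intro mult_right_mono) (auto simp: radial_field_def)
      also have "\<dots> = K / ?r" using r by (simp add: power2_eq_square)
      finally have "(\<rho> x * \<rho> y) * (\<bar>riesz_k (?e n) (?r\<^sup>2)\<bar> * \<bar>(X x - X y) \<bullet> (x - y)\<bar>) \<le> (\<rho> x * \<rho> y) * (K / ?r)"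
        using \<rho>0 by (intro mult_left_mono) auto
      then show ?case using \<rho>0 by (simp add: z abs_mult mult_ac)
    qed
  qed (unfold P_def, measurable)
  have l3: "(\<lambda>n. LINT (x, y)|P. ?F3 n x y) \<longlonglongrightarrow> (LINT (x, y)|P. q x * \<rho> y / norm (x - y))"
  proof (rule integral_dominated_convergence)
    show "integrable P (\<lambda>z. norm (case z of (x, y) \<Rightarrow> q x * \<rho> y / norm (x - y)))" using iq by (rule integrable_norm)
    show "AE z in P. (\<lambda>n. case z of (x, y) \<Rightarrow> ?F3 n x y) \<longlonglongrightarrow> (case z of (x, y) \<Rightarrow> q x * \<rho> y / norm (x - y))"
      using AEP
    proof eventually_elim
      case (elim z)
      then show ?case
        by (cases z) (auto simp: divide_inverse intro!: tendsto_mult tendsto_const smooth_inverse_tendsto)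
    qed
    show "AE z in P. norm (case z of (x, y) \<Rightarrow> ?F3 n x y) \<le> norm (case z of (x, y) \<Rightarrow> q x * \<rho> y / norm (x - y))" for n
      using AEP
    proof eventually_elim
      case (elim z)
      obtain x y where z: "z = (x, y)" by (cases z)
      have r: "norm (x - y) > 0" using elim z by simp
      have "\<bar>q x * \<rho> y\<bar> * \<bar>smooth_inverse (?e n) ((norm (x - y))\<^sup>2)\<bar> \<le> \<bar>q x * \<rho> y\<bar> * inverse (norm (x - y))"
        using r by (intro mult_left_mono smooth_inverse_le e) auto
      then show ?case by (simp add: z abs_mult divide_inverse)
    qed
  qed (unfold P_def, measurable)
  have "(\<lambda>n. (LINT (x, y)|P. ?F1 n x y) - 1/2 * (LINT (x, y)|P. ?F2 n x y)) \<longlonglongrightarrow>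
      (LINT (x, y)|P. \<rho> x * \<rho> y * (inverse (norm (x - y)) * divergence X' x)) - 1/2 * (LINT (x, y)|P. \<rho> x * \<rho> y * (inverse (norm (x - y) ^ 3) * ((X x - X y) \<bullet> (x - y))))"
    by (intro tendsto_diff tendsto_mult tendsto_const l1 l2)
  moreover have "(\<lambda>n. (LINT (x, y)|P. ?F1 n x y) - 1/2 * (LINT (x, y)|P. ?F2 n x y)) \<longlonglongrightarrow> - 2 * (LINT (x, y)|P. q x * \<rho> y / norm (x - y))"
    using tendsto_mult[OF tendsto_const[of "-2"] l3] coulomb_regularized_identity[OF W X e] by (simp add: \<rho>_def P_def q_def)
  ultimately have "(LINT (x, y)|P. \<rho> x * \<rho> y * (inverse (norm (x - y)) * divergence X' x)) - 1/2 * (LINT (x, y)|P. \<rho> x * \<rho> y * (inverse (norm (x - y) ^ 3) * ((X x - X y) \<bullet> (x - y))))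
     = - 2 * (LINT (x, y)|P. q x * \<rho> y / norm (x - y))"
    by (rule LIMSEQ_unique)
  also have "(LINT (x, y)|P. q x * \<rho> y / norm (x - y)) = (LINT x|lborel. LINT y|lborel. q x * \<rho> y / norm (x - y))"
    using lborel_pair.integral_fst[OF iq[unfolded P_def]] by (simp add: P_def)
  also have "\<dots> = (LINT x|lborel. potential \<rho> x * u x * (X x \<bullet> g x))"
    unfolding potential_def by (simp only: times_divide_eq_right[symmetric] integral_mult_right_zero) (simp add: q_def mult_ac)
  finally show ?thesis .
qed

text \<open>Tests the equation with X . grad u and rewrites each of the three terms of the
  nonlinearity by its own field identity, so that the right-hand side contains no derivative of
  u.\<close>

lemma critical_field_identity:
  assumes W: "H1_pair u g" and X: "C1_field X X' K" and p: "2 < p" "p \<le> 4"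
    and eq: "\<And>v h. H1_pair v h \<Longrightarrow> (LINT x|lborel. g x \<bullet> h x) = (LINT x|lborel. nonlinearity p \<mu> u x * v x)"
  shows "(LINT x|lborel. X' x (g x) \<bullet> g x) - 1/2 * (LINT x|lborel. (norm (g x))\<^sup>2 * divergence X' x)
    = - (\<mu>/2) * (LINT x|lborel. (u x)\<^sup>2 * divergence X' x)
      + 1/2 * ((LINT (x, y)|(lborel \<Otimes>\<^sub>M lborel). (u x)\<^sup>2 * (u y)\<^sup>2 * (inverse (norm (x - y)) * divergence X' x))
        - 1/2 * (LINT (x, y)|(lborel \<Otimes>\<^sub>M lborel). (u x)\<^sup>2 * (u y)\<^sup>2 * (inverse (norm (x - y) ^ 3) * ((X x - X y) \<bullet> (x - y)))))
      - 1/p * (LINT x|lborel. \<bar>u x\<bar> powr p * divergence X' x)"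
proof -
  have p': "2 \<le> p" using p by simp
  let ?Xg = "\<lambda>x. X x \<bullet> g x" and ?V = "potential (\<lambda>x. (u x)\<^sup>2)"
  have LX: "L2 ?Xg" by (rule L2_field_inner[OF X H1_pairD(2)[OF W]])
  have "(LINT x|lborel. nonlinearity p \<mu> u x * ?Xg x) = \<mu> * (LINT x|lborel. u x * ?Xg x) - (LINT x|lborel. ?V x * u x * ?Xg x) + (LINT x|lborel. (\<bar>u x\<bar> powr (p - 2) * u x) * ?Xg x)"
    unfolding nonlinearity_def
    using L2_integrable_mult[OF H1_pairD(1)[OF W] LX] L2_integrable_mult[OF L2_potential_mult[OF W] LX] L2_integrable_mult[OF L2_powr_mult[OF W p' p(2)] LX]
    by (simp add: distrib_right left_diff_distrib mult.assoc[of \<mu>])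
  moreover have "(LINT x|lborel. X' x (g x) \<bullet> g x) - 1/2 * (LINT x|lborel. divergence X' x * (norm (g x))\<^sup>2) = (LINT x|lborel. nonlinearity p \<mu> u x * ?Xg x)"
    by (rule weak_equation_field[OF W X L2_nonlinearity[OF W p' p(2)] eq])
  ultimately show ?thesis
    using weak_square_field[OF W X] coulomb_field_identity[OF W X] power_field_identity[OF W X p] by (simp add: mult.commute)
qed

section \<open>The Pohozaev identity and nonexistence\<close>

text \<open>This profile makes the dilation field bounded while its derivative stays bounded
  uniformly in n; a smooth rational cutoff creates no boundary terms.\<close>

definition dilation_k :: "nat \<Rightarrow> real \<Rightarrow> real" where "dilation_k n s = inverse (1 + null_step n * s)"
definition dilation_k' :: "nat \<Rightarrow> real \<Rightarrow> real" where "dilation_k' n s = - (null_step n * (inverse (1 + null_step n * s) * inverse (1 + null_step n * s)))"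

abbreviation dilation_field :: "nat \<Rightarrow> real^3 \<Rightarrow> real^3" where "dilation_field n \<equiv> radial_field (dilation_k n) 0"
abbreviation dilation_deriv :: "nat \<Rightarrow> real^3 \<Rightarrow> real^3 \<Rightarrow> real^3" where "dilation_deriv n \<equiv> radial_field_deriv (dilation_k n) (dilation_k' n) 0"

text \<open>The second bound is uniform in n and drives the limits. The third degenerates with n and
  serves only to make each single field admissible.\<close>

lemma dilation_bounds:
  assumes s: "0 \<le> s"
  shows "0 \<le> dilation_k n s" "\<bar>dilation_k n s\<bar> + 2 * \<bar>dilation_k' n s\<bar> * s \<le> 3" "\<bar>dilation_k n (s\<^sup>2)\<bar> * s \<le> 1 + 1 / null_step n"
proof -
  let ?e = "null_step n"
  have e: "?e > 0" by (rule null_step)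
  have es: "0 \<le> ?e * s" "0 \<le> ?e * s\<^sup>2" using e s by auto
  show k0: "0 \<le> dilation_k n s" using es by (simp add: dilation_k_def)
  have k1: "dilation_k n s \<le> 1" using es by (simp add: dilation_k_def inverse_le_1_iff)
  have ks: "dilation_k n s * (?e * s) \<le> 1"
  proof -
    have "dilation_k n s * (?e * s) \<le> dilation_k n s * (1 + ?e * s)" using k0 by (intro mult_left_mono) auto
    also have "\<dots> = 1" using es by (simp add: dilation_k_def add_nonneg_eq_0_iff)
    finally show ?thesis .
  qed
  have "\<bar>dilation_k' n s\<bar> * s = dilation_k n s * (dilation_k n s * (?e * s))"
  proof -
    have "0 < 1 + ?e * s" using es by linarith
    then show ?thesis using e by (simp add: dilation_k'_def dilation_k_def abs_mult abs_of_pos)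
  qed
  also have "\<dots> \<le> 1 * 1" using k0 k1 ks es by (intro mult_mono) auto
  finally show "\<bar>dilation_k n s\<bar> + 2 * \<bar>dilation_k' n s\<bar> * s \<le> 3" using k0 k1 by (simp add: mult.assoc)
  have "s \<le> 1 + s\<^sup>2" using sum_squares_bound[of s 1] s by simp
  also have "\<dots> \<le> (1 + 1 / ?e) * (1 + ?e * s\<^sup>2)" using e by (simp add: algebra_simps)
  finally have "dilation_k n (s\<^sup>2) * s \<le> dilation_k n (s\<^sup>2) * ((1 + 1 / ?e) * (1 + ?e * s\<^sup>2))"
    using es by (intro mult_left_mono) (auto simp: dilation_k_def)
  also have "\<dots> = 1 + 1 / ?e"
  proof -
    have "inverse t * (a * t) = a" if "t > 0" for a t :: real using that by simp
    from this[of "1 + ?e * s\<^sup>2" "1 + 1 / ?e"] es show ?thesis by (simp add: dilation_k_def)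
  qed
  finally show "\<bar>dilation_k n (s\<^sup>2)\<bar> * s \<le> 1 + 1 / ?e" using es by (simp add: dilation_k_def)
qed

lemma C1_dilation_field: "C1_field (dilation_field n) (dilation_deriv n) (4 + 1 / null_step n)"
proof (rule C1_radial_field)
  have e: "null_step n > 0" by (rule null_step)
  have ne: "1 + null_step n * s \<noteq> 0" if "0 \<le> s" for s using e that by (simp add: add_nonneg_eq_0_iff)
  fix s :: real assume s: "0 \<le> s"
  show "(dilation_k n has_real_derivative dilation_k' n s) (at s)"
    unfolding dilation_k_def[abs_def] dilation_k'_def using ne[OF s] by (auto intro!: derivative_eq_intros)
  have "0 \<le> 1 / null_step n" using e by simp
  then show "\<bar>dilation_k n (s\<^sup>2)\<bar> * s \<le> 4 + 1 / null_step n" "\<bar>dilation_k n s\<bar> + 2 * \<bar>dilation_k' n s\<bar> * s \<le> 4 + 1 / null_step n"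
    using dilation_bounds[OF s, of n] by linarith+
next
  have "1 + null_step n * s \<noteq> 0" if "0 \<le> s" for s using null_step(2)[of n] that by (simp add: add_nonneg_eq_0_iff)
  then show "continuous_on {0..} (dilation_k' n)"
    unfolding dilation_k'_def[abs_def] by (auto intro!: continuous_intros)
qed

lemma dilation_tendsto: "(\<lambda>n. dilation_k n s) \<longlonglongrightarrow> 1" "(\<lambda>n. dilation_k' n s) \<longlonglongrightarrow> 0"
proof -
  have "(\<lambda>n. inverse (1 + null_step n * s)) \<longlonglongrightarrow> inverse (1 + 0 * s)" by (intro tendsto_intros null_step) auto
  then show k: "(\<lambda>n. dilation_k n s) \<longlonglongrightarrow> 1" by (simp add: dilation_k_def)
  have "(\<lambda>n. - (null_step n * (dilation_k n s * dilation_k n s))) \<longlonglongrightarrow> - (0 * (1 * 1))"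
    by (intro tendsto_intros null_step k)
  then show "(\<lambda>n. dilation_k' n s) \<longlonglongrightarrow> 0" by (simp add: dilation_k'_def dilation_k_def)
qed

lemma dilation_field_tendsto: "(\<lambda>n. dilation_field n x) \<longlonglongrightarrow> x"
proof -
  have "(\<lambda>n. dilation_k n ((norm (x - 0))\<^sup>2) *\<^sub>R (x - 0)) \<longlonglongrightarrow> 1 *\<^sub>R (x - 0)" by (intro tendsto_intros dilation_tendsto)
  then show ?thesis by (simp add: radial_field_def)
qed

lemma dilation_deriv_tendsto: "(\<lambda>n. dilation_deriv n x h) \<longlonglongrightarrow> h"
proof -
  have "(\<lambda>n. dilation_k n ((norm (x - 0))\<^sup>2) *\<^sub>R h + (2 * dilation_k' n ((norm (x - 0))\<^sup>2) * ((x - 0) \<bullet> h)) *\<^sub>R (x - 0)) \<longlonglongrightarrow> 1 *\<^sub>R h + (2 * 0 * ((x - 0) \<bullet> h)) *\<^sub>R (x - 0)"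
    by (intro tendsto_intros dilation_tendsto)
  then show ?thesis by (simp add: radial_field_deriv_def)
qed

lemma dilation_deriv_bound: "norm (dilation_deriv n x h) \<le> 3 * norm h"
  by (rule radial_field_deriv_bound) (rule dilation_bounds(2))

lemma dilation_divergence_tendsto: "(\<lambda>n. divergence (dilation_deriv n) x) \<longlonglongrightarrow> 3"
proof -
  have "(\<lambda>n. divergence (dilation_deriv n) x) \<longlonglongrightarrow> (\<Sum>b\<in>(Basis::(real^3) set). b \<bullet> b)"
    unfolding divergence_def by (intro tendsto_intros dilation_deriv_tendsto)
  then show ?thesis by (simp add: inner_same_Basis)
qed

lemma dilation_divergence_bound: "\<bar>divergence (dilation_deriv n) x\<bar> \<le> 9"
proof -
  have "\<bar>divergence (dilation_deriv n) x\<bar> \<le> (\<Sum>b\<in>(Basis::(real^3) set). 3)"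
    unfolding divergence_def
  proof (rule order_trans[OF sum_abs], rule sum_mono)
    fix b :: "real^3" assume b: "b \<in> Basis"
    show "\<bar>dilation_deriv n x b \<bullet> b\<bar> \<le> 3"
      using Basis_le_norm[OF b, of "dilation_deriv n x b"] dilation_deriv_bound[of n x b] b by simp
  qed
  then show ?thesis by simp
qed

lemma dilation_divergence_integral:
  assumes f: "integrable lborel f"
  shows "(\<lambda>n. LINT x|lborel. f x * divergence (dilation_deriv n) x) \<longlonglongrightarrow> 3 * (LINT x|lborel. f x)"
proof -
  note [measurable] = borel_measurable_continuous_onI[OF C1_fieldD(6)[OF C1_dilation_field]] borel_measurable_integrable[OF f]
  have "(\<lambda>n. LINT x|lborel. f x * divergence (dilation_deriv n) x) \<longlonglongrightarrow> (LINT x|lborel. f x * 3)"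
  proof (rule integral_dominated_convergence)
    show "integrable lborel (\<lambda>x. 9 * norm (f x))" using f by simp
    show "AE x in lborel. (\<lambda>n. f x * divergence (dilation_deriv n) x) \<longlonglongrightarrow> f x * 3"
      by (intro AE_I2 tendsto_intros dilation_divergence_tendsto)
    show "AE x in lborel. norm (f x * divergence (dilation_deriv n) x) \<le> 9 * norm (f x)" for n
      using mult_left_mono[OF dilation_divergence_bound abs_ge_zero] by (auto simp: abs_mult mult.commute)
  qed measurable
  then show ?thesis by (simp add: mult.commute)
qed

text \<open>Along the dilation fields the derivative tends to the identity, the divergence to 3 and
  (X(x)-X(y)) . (x-y) to |x-y|^2. The bounds 3 |h|, 9 and 3 |x-y|^2 are uniform in n, so dominated
  convergence applies to every term.\<close>

theorem pohozaev:
  assumes W: "H1_pair u g" and p: "2 < p" "p \<le> 4"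
    and eq: "\<And>v h. H1_pair v h \<Longrightarrow> (LINT x|lborel. g x \<bullet> h x) = (LINT x|lborel. nonlinearity p \<mu> u x * v x)"
  shows "- (1/2) * (LINT x|lborel. (norm (g x))\<^sup>2) = - (3/2) * \<mu> * (LINT x|lborel. (u x)\<^sup>2)
     + 5/4 * coulomb (\<lambda>x. (u x)\<^sup>2) (\<lambda>x. (u x)\<^sup>2) - 3/p * (LINT x|lborel. \<bar>u x\<bar> powr p)"
proof -
  let ?D = dilation_deriv and ?X = dilation_field and ?P = "lborel \<Otimes>\<^sub>M (lborel :: (real^3) measure)"
  let ?A = "LINT x|lborel. (norm (g x))\<^sup>2" and ?c = "LINT x|lborel. (u x)\<^sup>2" and ?C = "LINT x|lborel. \<bar>u x\<bar> powr p"
  let ?B = "coulomb (\<lambda>x. (u x)\<^sup>2) (\<lambda>x. (u x)\<^sup>2)"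
  note [measurable] = L2_measurable[OF H1_pairD(1)[OF W]] L2_measurable[OF H1_pairD(2)[OF W]]
    borel_measurable_continuous_onI[OF C1_fieldD(5)[OF C1_dilation_field]] borel_measurable_continuous_onI[OF C1_fieldD(6)[OF C1_dilation_field]]
  have \<rho>b: "pot_bounded (\<lambda>x. (u x)\<^sup>2)" by (rule pot_bounded_square[OF W])
  have iA: "integrable lborel (\<lambda>x. (norm (g x))\<^sup>2)" by (rule L2_integrable[OF H1_pairD(2)[OF W]])
  have iC: "integrable lborel (\<lambda>x. \<bar>u x\<bar> powr p)" by (rule H1_powr_integrable[OF W]) (use p in auto)
  have iB: "integrable ?P (\<lambda>(x, y). (u x)\<^sup>2 * (u y)\<^sup>2 / norm (x - y))" by (rule coulomb_pair_integrable[OF pot_bounded_integrable[OF \<rho>b] \<rho>b])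
  have B: "(LINT (x, y)|?P. (u x)\<^sup>2 * (u y)\<^sup>2 / norm (x - y)) = ?B" by (rule coulomb_pair[OF \<rho>b \<rho>b])
  have Lip: "norm (?X n x - ?X n y) \<le> 3 * norm (x - y)" for n x y
    by (rule C1_field_Lipschitz[OF C1_dilation_field dilation_deriv_bound])
  have t1: "(\<lambda>n. LINT x|lborel. ?D n x (g x) \<bullet> g x) \<longlonglongrightarrow> ?A"
  proof -
    have [measurable]: "(\<lambda>x. ?D n x (g x)) \<in> borel_measurable borel" for n
      by (rule C1_field_apply(2)[OF C1_dilation_field L2_measurable[OF H1_pairD(2)[OF W]]])
    have "(\<lambda>n. LINT x|lborel. ?D n x (g x) \<bullet> g x) \<longlonglongrightarrow> (LINT x|lborel. g x \<bullet> g x)"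
    proof (rule integral_dominated_convergence)
      show "integrable lborel (\<lambda>x. 3 * (norm (g x))\<^sup>2)" using iA by simp
      show "AE x in lborel. (\<lambda>n. ?D n x (g x) \<bullet> g x) \<longlonglongrightarrow> g x \<bullet> g x"
        by (intro AE_I2 tendsto_intros dilation_deriv_tendsto)
      show "AE x in lborel. norm (?D n x (g x) \<bullet> g x) \<le> 3 * (norm (g x))\<^sup>2" for n
      proof (rule AE_I2)
        fix x
        have "norm (?D n x (g x) \<bullet> g x) \<le> norm (?D n x (g x)) * norm (g x)" by (simp add: Cauchy_Schwarz_ineq2)
        also have "\<dots> \<le> (3 * norm (g x)) * norm (g x)" by (intro mult_right_mono dilation_deriv_bound) auto
        finally show "norm (?D n x (g x) \<bullet> g x) \<le> 3 * (norm (g x))\<^sup>2" by (simp add: power2_eq_square)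
      qed
    qed measurable
    then show ?thesis by (simp add: power2_norm_eq_inner)
  qed
  have t4: "(\<lambda>n. LINT (x, y)|?P. (u x)\<^sup>2 * (u y)\<^sup>2 * (inverse (norm (x - y)) * divergence (?D n) x)) \<longlonglongrightarrow> 3 * ?B"
  proof -
    have "(\<lambda>n. LINT (x, y)|?P. (u x)\<^sup>2 * (u y)\<^sup>2 * (inverse (norm (x - y)) * divergence (?D n) x)) \<longlonglongrightarrow> (LINT z|?P. 3 * (case z of (x, y) \<Rightarrow> (u x)\<^sup>2 * (u y)\<^sup>2 / norm (x - y)))"
    proof (rule integral_dominated_convergence)
      show "integrable ?P (\<lambda>z. 9 * (case z of (x, y) \<Rightarrow> (u x)\<^sup>2 * (u y)\<^sup>2 / norm (x - y)))" using iB by simp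
      show "AE z in ?P. (\<lambda>n. case z of (x, y) \<Rightarrow> (u x)\<^sup>2 * (u y)\<^sup>2 * (inverse (norm (x - y)) * divergence (?D n) x)) \<longlonglongrightarrow> 3 * (case z of (x, y) \<Rightarrow> (u x)\<^sup>2 * (u y)\<^sup>2 / norm (x - y))"
      proof (rule AE_I2, clarify)
        fix x y
        have "(\<lambda>n. (u x)\<^sup>2 * (u y)\<^sup>2 * (inverse (norm (x - y)) * divergence (?D n) x)) \<longlonglongrightarrow> (u x)\<^sup>2 * (u y)\<^sup>2 * (inverse (norm (x - y)) * 3)"
          by (intro tendsto_mult tendsto_const dilation_divergence_tendsto)
        then show "(\<lambda>n. (u x)\<^sup>2 * (u y)\<^sup>2 * (inverse (norm (x - y)) * divergence (?D n) x)) \<longlonglongrightarrow> 3 * ((u x)\<^sup>2 * (u y)\<^sup>2 / norm (x - y))"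
          by (simp add: divide_inverse mult_ac)
      qed
      show "AE z in ?P. norm (case z of (x, y) \<Rightarrow> (u x)\<^sup>2 * (u y)\<^sup>2 * (inverse (norm (x - y)) * divergence (?D n) x)) \<le> 9 * (case z of (x, y) \<Rightarrow> (u x)\<^sup>2 * (u y)\<^sup>2 / norm (x - y))" for n
      proof (rule AE_I2, clarify)
        fix x y
        have "((u x)\<^sup>2 * (u y)\<^sup>2 * inverse (norm (x - y))) * \<bar>divergence (?D n) x\<bar> \<le> ((u x)\<^sup>2 * (u y)\<^sup>2 * inverse (norm (x - y))) * 9"
          by (intro mult_left_mono dilation_divergence_bound) auto
        then show "norm ((u x)\<^sup>2 * (u y)\<^sup>2 * (inverse (norm (x - y)) * divergence (?D n) x)) \<le> 9 * ((u x)\<^sup>2 * (u y)\<^sup>2 / norm (x - y))"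
          by (simp add: abs_mult divide_inverse mult_ac)
      qed
    qed measurable
    then show ?thesis by (simp add: B)
  qed
  have t5: "(\<lambda>n. LINT (x, y)|?P. (u x)\<^sup>2 * (u y)\<^sup>2 * (inverse (norm (x - y) ^ 3) * ((?X n x - ?X n y) \<bullet> (x - y)))) \<longlonglongrightarrow> ?B"
  proof -
    have "(\<lambda>n. LINT (x, y)|?P. (u x)\<^sup>2 * (u y)\<^sup>2 * (inverse (norm (x - y) ^ 3) * ((?X n x - ?X n y) \<bullet> (x - y)))) \<longlonglongrightarrow> (LINT (x, y)|?P. (u x)\<^sup>2 * (u y)\<^sup>2 / norm (x - y))"
    proof (rule integral_dominated_convergence)
      show "integrable ?P (\<lambda>z. 3 * (case z of (x, y) \<Rightarrow> (u x)\<^sup>2 * (u y)\<^sup>2 / norm (x - y)))" using iB by simp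
      \<comment> \<open>True at r = 0 as well because \<open>inverse 0 = 0\<close>, so the diagonal
        needs no exclusion.\<close>
      have r3: "inverse (r ^ 3) * (r * r) = inverse r" for r :: real by (cases "r = 0") (auto simp: power3_eq_cube field_simps)
      show "AE z in ?P. (\<lambda>n. case z of (x, y) \<Rightarrow> (u x)\<^sup>2 * (u y)\<^sup>2 * (inverse (norm (x - y) ^ 3) * ((?X n x - ?X n y) \<bullet> (x - y)))) \<longlonglongrightarrow> (case z of (x, y) \<Rightarrow> (u x)\<^sup>2 * (u y)\<^sup>2 / norm (x - y))"
      proof (rule AE_I2, clarify)
        fix x y
        have "(\<lambda>n. (u x)\<^sup>2 * (u y)\<^sup>2 * (inverse (norm (x - y) ^ 3) * ((?X n x - ?X n y) \<bullet> (x - y)))) \<longlonglongrightarrow> (u x)\<^sup>2 * (u y)\<^sup>2 * (inverse (norm (x - y) ^ 3) * ((x - y) \<bullet> (x - y)))"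
          by (intro tendsto_mult tendsto_const tendsto_inner tendsto_diff dilation_field_tendsto)
        then show "(\<lambda>n. (u x)\<^sup>2 * (u y)\<^sup>2 * (inverse (norm (x - y) ^ 3) * ((?X n x - ?X n y) \<bullet> (x - y)))) \<longlonglongrightarrow> (u x)\<^sup>2 * (u y)\<^sup>2 / norm (x - y)"
          by (simp only: power2_norm_eq_inner[symmetric] power2_eq_square[of "norm _"] r3 divide_inverse)
      qed
      show "AE z in ?P. norm (case z of (x, y) \<Rightarrow> (u x)\<^sup>2 * (u y)\<^sup>2 * (inverse (norm (x - y) ^ 3) * ((?X n x - ?X n y) \<bullet> (x - y)))) \<le> 3 * (case z of (x, y) \<Rightarrow> (u x)\<^sup>2 * (u y)\<^sup>2 / norm (x - y))" for n
      proof (rule AE_I2, clarify)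
        fix x y
        let ?r = "norm (x - y)" and ?d = "(?X n x - ?X n y) \<bullet> (x - y)"
        have "\<bar>?d\<bar> \<le> (3 * ?r) * ?r"
          by (intro order_trans[OF Cauchy_Schwarz_ineq2] mult_right_mono Lip) auto
        then have "inverse (?r ^ 3) * \<bar>?d\<bar> \<le> inverse (?r ^ 3) * ((3 * ?r) * ?r)" by (intro mult_left_mono) auto
        also have "\<dots> = 3 * inverse ?r" using r3[of ?r] by (simp add: mult_ac)
        finally have "((u x)\<^sup>2 * (u y)\<^sup>2) * (inverse (?r ^ 3) * \<bar>?d\<bar>) \<le> ((u x)\<^sup>2 * (u y)\<^sup>2) * (3 * inverse ?r)" by (intro mult_left_mono) auto
        then show "norm ((u x)\<^sup>2 * (u y)\<^sup>2 * (inverse (?r ^ 3) * ?d)) \<le> 3 * ((u x)\<^sup>2 * (u y)\<^sup>2 / ?r)"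
          by (simp add: abs_mult divide_inverse mult_ac)
      qed
    qed measurable
    then show ?thesis by (simp add: B)
  qed
  let ?lhs = "\<lambda>n. (LINT x|lborel. ?D n x (g x) \<bullet> g x) - 1/2 * (LINT x|lborel. (norm (g x))\<^sup>2 * divergence (?D n) x)"
  let ?rhs = "\<lambda>n. - (\<mu>/2) * (LINT x|lborel. (u x)\<^sup>2 * divergence (?D n) x)
      + 1/2 * ((LINT (x, y)|?P. (u x)\<^sup>2 * (u y)\<^sup>2 * (inverse (norm (x - y)) * divergence (?D n) x))
        - 1/2 * (LINT (x, y)|?P. (u x)\<^sup>2 * (u y)\<^sup>2 * (inverse (norm (x - y) ^ 3) * ((?X n x - ?X n y) \<bullet> (x - y)))))
      - 1/p * (LINT x|lborel. \<bar>u x\<bar> powr p * divergence (?D n) x)"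
  have id: "?lhs n = ?rhs n" for n
    by (rule critical_field_identity[OF W C1_dilation_field p eq])
  have "?lhs \<longlonglongrightarrow> ?A - 1/2 * (3 * ?A)"
    by (intro tendsto_diff tendsto_mult tendsto_const t1 dilation_divergence_integral iA)
  \<comment> \<open>The Coulomb coefficient is half of 3 - 1/2, that is 5/4: the divergence
    contributes 3 and the differentiated kernel 1/2.\<close>
  moreover have "?rhs \<longlonglongrightarrow> - (\<mu>/2) * (3 * ?c) + 1/2 * (3 * ?B - 1/2 * ?B) - 1/p * (3 * ?C)"
    by (intro tendsto_diff tendsto_add tendsto_mult tendsto_const t4 t5 dilation_divergence_integral iC pot_bounded_integrable[OF \<rho>b])
  ultimately have "?A - 1/2 * (3 * ?A) = - (\<mu>/2) * (3 * ?c) + 1/2 * (3 * ?B - 1/2 * ?B) - 1/p * (3 * ?C)"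
    unfolding id by (rule LIMSEQ_unique)
  then show ?thesis by (simp add: field_simps)
qed

theorem nehari_pohozaev:
  assumes W: "H1_pair u g" and p: "2 < p" "p \<le> 4"
    and d: "H1_has_derivative (energy p) (\<lambda>v. \<mu> * (LINT x|lborel. u x * v x)) u"
  shows "(LINT x|lborel. (norm (g x))\<^sup>2) + 1/4 * coulomb (\<lambda>x. (u x)\<^sup>2) (\<lambda>x. (u x)\<^sup>2) = (3/2 - 3/p) * (LINT x|lborel. \<bar>u x\<bar> powr p)"
proof -
  let ?A = "LINT x|lborel. (norm (g x))\<^sup>2" and ?c = "LINT x|lborel. (u x)\<^sup>2" and ?C = "LINT x|lborel. \<bar>u x\<bar> powr p"
  let ?B = "coulomb (\<lambda>x. (u x)\<^sup>2) (\<lambda>x. (u x)\<^sup>2)" and ?V = "potential (\<lambda>x. (u x)\<^sup>2)"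
  have p': "2 \<le> p" using p by simp
  have eq: "(LINT x|lborel. g x \<bullet> h x) = (LINT x|lborel. nonlinearity p \<mu> u x * v x)" if "H1_pair v h" for v h
    by (rule critical_point_weak_equation[OF d W that p])
  have "?A = (LINT x|lborel. nonlinearity p \<mu> u x * u x)" using eq[OF W] by (simp add: power2_norm_eq_inner)
  also have "\<dots> = \<mu> * (LINT x|lborel. u x * u x) - (LINT x|lborel. ?V x * u x * u x) + (LINT x|lborel. (\<bar>u x\<bar> powr (p - 2) * u x) * u x)"
    unfolding nonlinearity_def
    using L2_integrable_mult[OF H1_pairD(1)[OF W] H1_pairD(1)[OF W]] L2_integrable_mult[OF L2_potential_mult[OF W] H1_pairD(1)[OF W]] L2_integrable_mult[OF L2_powr_mult[OF W p' p(2)] H1_pairD(1)[OF W]]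
    by (simp add: distrib_right left_diff_distrib mult.assoc[of \<mu>])
  also have "(LINT x|lborel. ?V x * u x * u x) = ?B" unfolding coulomb_def by (simp add: power2_eq_square mult_ac)
  also have "(LINT x|lborel. (\<bar>u x\<bar> powr (p - 2) * u x) * u x) = ?C"
  proof (intro Bochner_Integration.integral_cong refl)
    fix x
    show "\<bar>u x\<bar> powr (p - 2) * u x * u x = \<bar>u x\<bar> powr p"
      using powr_add[of "\<bar>u x\<bar>" "p - 2" 2] by (cases "u x = 0") (auto simp: power2_eq_square)
  qed
  finally have "?A = \<mu> * ?c - ?B + ?C" by (simp add: power2_eq_square)
  \<comment> \<open>Three halves of the Nehari identity just obtained, added to the Pohozaev
    identity as stated, cancel the multiplier.\<close>
  with pohozaev[OF W p eq] show ?thesis by (simp add: algebra_simps)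
qed

section \<open>Comparison of the identities with the inequalities\<close>

lemma coulomb_square_nonneg: "0 \<le> coulomb (\<lambda>x. (u x)\<^sup>2) (\<lambda>x. (u x)\<^sup>2)"
  unfolding coulomb_def potential_def by (auto intro!: integral_nonneg_AE AE_I2 mult_nonneg_nonneg)

text \<open>The weight 1/4 is the one for which AM-GM is exact: (A + B/4)^2 - A B = (A - B/4)^2. The
  right-hand side is the very combination that appears in the Nehari-Pohozaev identity.\<close>

lemma cube_le:
  assumes W: "H1_pair u g"
  shows "(LINT x|lborel. \<bar>u x\<bar> ^ 3) \<le> (LINT x|lborel. (norm (g x))\<^sup>2) + 1/4 * coulomb (\<lambda>x. (u x)\<^sup>2) (\<lambda>x. (u x)\<^sup>2)"
proof (rule power2_le_imp_le)
  let ?A = "LINT x|lborel. (norm (g x))\<^sup>2" and ?B = "coulomb (\<lambda>x. (u x)\<^sup>2) (\<lambda>x. (u x)\<^sup>2)"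
  have "0 \<le> (?A - 1/4 * ?B)\<^sup>2" by simp
  then have "?A * ?B \<le> (?A + 1/4 * ?B)\<^sup>2" by (simp add: power2_eq_square algebra_simps)
  with cube_bound(2)[OF W] show "(LINT x|lborel. \<bar>u x\<bar> ^ 3)\<^sup>2 \<le> (?A + 1/4 * ?B)\<^sup>2" by linarith
  show "0 \<le> ?A + 1/4 * ?B" using coulomb_square_nonneg[of u] by simp
qed

text \<open>By the Sobolev inequality a vanishing Dirichlet integral forces u = 0 almost everywhere.
  The strict sign supplies the final contradictions and lets A appear in denominators.\<close>

lemma gradient_pos:
  assumes W: "H1_pair u g" and c: "0 < (LINT x|lborel. (u x)\<^sup>2)"
  shows "0 < (LINT x|lborel. (norm (g x))\<^sup>2)"
proof (rule ccontr)
  assume "\<not> ?thesis"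
  then have "(LINT x|lborel. (norm (g x))\<^sup>2) = 0" by (simp add: order_antisym)
  then have "(LINT x|lborel. (u x) ^ 6) \<le> 0" using H1_six_integrable(2)[OF W] by simp
  moreover have "0 \<le> (LINT x|lborel. (u x) ^ 6)" by (intro integral_nonneg_AE) (simp add: zero_le_even_power)
  ultimately have "(LINT x|lborel. (u x) ^ 6) = 0" by simp
  then have "AE x in lborel. (u x) ^ 6 = 0"
    using integral_nonneg_eq_0_iff_AE[OF H1_six_integrable(1)[OF W]] by (simp add: zero_le_even_power)
  then have "AE x in lborel. (u x)\<^sup>2 = 0" by eventually_elim simp
  then have "(LINT x|lborel. (u x)\<^sup>2) = 0" by (rule integral_eq_zero_AE)
  with c show False by simp
qed

text \<open>The mass is written as t^3 so that c^(2/3) becomes t^2. Instead of Hoelder's inequality,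
  the pointwise splitting s^(10/3) <= lam s^2 + lam^(-2) s^6 at the level s^(4/3) = lam is
  integrated and the Sobolev inequality applied to the last term.\<close>

lemma gagliardo_nirenberg:
  assumes W: "H1_pair u g" and t: "t > 0" "(LINT x|lborel. (u x)\<^sup>2) = t ^ 3"
  shows "(LINT x|lborel. \<bar>u x\<bar> powr (10/3)) \<le> 3 * t\<^sup>2 * (LINT x|lborel. (norm (g x))\<^sup>2)"
proof -
  let ?A = "LINT x|lborel. (norm (g x))\<^sup>2"
  \<comment> \<open>With this choice the two terms become t^2 A and 2 t^2 A.\<close>
  define lam where "lam = ?A / t"
  have A: "?A > 0" by (rule gradient_pos[OF W]) (use t in simp)
  have l: "lam > 0" using A t by (simp add: lam_def)
  have pt: "s powr (10/3) \<le> lam * s\<^sup>2 + inverse (lam\<^sup>2) * s ^ 6" if s: "s > 0" for s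
  proof (cases "s powr (4/3) \<le> lam")
    case True
    have "s powr (10/3) = s powr (4/3) * s\<^sup>2" using s powr_add[of s "4/3" 2] by simp
    also have "\<dots> \<le> lam * s\<^sup>2" by (intro mult_right_mono True) auto
    also have "\<dots> \<le> lam * s\<^sup>2 + inverse (lam\<^sup>2) * s ^ 6" using s by simp
    finally show ?thesis .
  next
    case False
    then have "lam\<^sup>2 \<le> (s powr (4/3))\<^sup>2" using l by (intro power_mono) auto
    then have "lam\<^sup>2 * s powr (10/3) \<le> (s powr (4/3))\<^sup>2 * s powr (10/3)" by (intro mult_right_mono) auto
    also have "\<dots> = s powr 6" using s by (simp add: power2_eq_square powr_add[symmetric])
    also have "\<dots> = s ^ 6" using s by (simp add: powr_numeral)
    finally have "s powr (10/3) \<le> inverse (lam\<^sup>2) * s ^ 6" using l by (simp add: field_simps)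
    then show ?thesis using l s by (simp add: add_increasing)
  qed
  have iu: "integrable lborel (\<lambda>x. (u x)\<^sup>2)" by (rule integrable_square[OF W])
  have "(LINT x|lborel. \<bar>u x\<bar> powr (10/3)) \<le> (LINT x|lborel. lam * (u x)\<^sup>2 + inverse (lam\<^sup>2) * (u x) ^ 6)"
  proof (rule integral_mono)
    show "integrable lborel (\<lambda>x. \<bar>u x\<bar> powr (10/3))" by (rule H1_powr_integrable[OF W]) auto
    show "integrable lborel (\<lambda>x. lam * (u x)\<^sup>2 + inverse (lam\<^sup>2) * (u x) ^ 6)" using iu H1_six_integrable(1)[OF W] by simp
    fix x
    show "\<bar>u x\<bar> powr (10/3) \<le> lam * (u x)\<^sup>2 + inverse (lam\<^sup>2) * (u x) ^ 6"
      using pt[of "\<bar>u x\<bar>"] by (cases "u x = 0") (auto simp: power_even_abs)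
  qed
  also have "\<dots> = lam * t ^ 3 + inverse (lam\<^sup>2) * (LINT x|lborel. (u x) ^ 6)"
    using iu H1_six_integrable(1)[OF W] t by simp
  also have "\<dots> \<le> lam * t ^ 3 + inverse (lam\<^sup>2) * (2 * ?A ^ 3)"
    by (intro add_left_mono mult_left_mono H1_six_integrable(2)[OF W]) auto
  also have "\<dots> = 3 * t\<^sup>2 * ?A"
    using A t by (simp add: lam_def power2_eq_square power3_eq_cube field_simps)
  finally show ?thesis .
qed

theorem no_critical_point_3:
  assumes c: "c > 0" shows "\<not> constrained_critical_point 3 c u"
proof
  assume "constrained_critical_point 3 c u"
  then obtain \<mu> where u: "u \<in> H1" "(LINT x|lborel. \<bar>u x\<bar>\<^sup>2) = c" and d: "H1_has_derivative (energy 3) (\<lambda>v. \<mu> * (LINT x|lborel. u x * v x)) u"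
    by (auto simp: constrained_critical_point_def mass_sphere_def)
  obtain g where W: "H1_pair u g" using H1_imp_H1_pair[OF u(1)] .
  let ?A = "LINT x|lborel. (norm (g x))\<^sup>2" and ?B = "coulomb (\<lambda>x. (u x)\<^sup>2) (\<lambda>x. (u x)\<^sup>2)"
  have A: "?A > 0" by (rule gradient_pos[OF W]) (use u c in simp)
  have "?A + 1/4 * ?B = (3/2 - 3/3) * (LINT x|lborel. \<bar>u x\<bar> powr 3)"
    by (rule nehari_pohozaev[OF W _ _ d]) auto
  then have "?A + 1/4 * ?B = 1/2 * (LINT x|lborel. \<bar>u x\<bar> ^ 3)" by (simp add: powr_numeral)
  with cube_le[OF W] have "?A + 1/4 * ?B \<le> 0" by linarith
  with A coulomb_square_nonneg[of u] show False by linarith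
qed

text \<open>Mass below 1/27 = (1/3)^3 makes the Gagliardo-Nirenberg factor 3 t^2 at most 1/3, and
  3/5 is the value of 3/2 - 3/p at p = 10/3. The identity then gives A + B/4 <= (3/5)(1 + 1/3)(A +
  B/4), a contradiction since the factor is 4/5. The threshold does not depend on p.\<close>

theorem no_critical_point_small_mass:
  assumes p: "3 < p" "p \<le> 10/3" and c: "0 < c" "c < 1/27"
  shows "\<not> constrained_critical_point p c u"
proof
  assume "constrained_critical_point p c u"
  then obtain \<mu> where u: "u \<in> H1" "(LINT x|lborel. \<bar>u x\<bar>\<^sup>2) = c" and d: "H1_has_derivative (energy p) (\<lambda>v. \<mu> * (LINT x|lborel. u x * v x)) u"
    by (auto simp: constrained_critical_point_def mass_sphere_def)
  obtain g where W: "H1_pair u g" using H1_imp_H1_pair[OF u(1)] .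
  let ?A = "LINT x|lborel. (norm (g x))\<^sup>2" and ?B = "coulomb (\<lambda>x. (u x)\<^sup>2) (\<lambda>x. (u x)\<^sup>2)"
  let ?C = "LINT x|lborel. \<bar>u x\<bar> powr p" and ?C3 = "LINT x|lborel. \<bar>u x\<bar> ^ 3" and ?C4 = "LINT x|lborel. \<bar>u x\<bar> powr (10/3)"
  have A: "?A > 0" by (rule gradient_pos[OF W]) (use u c in simp)
  define t where "t = root 3 c"
  have t: "t > 0" "t ^ 3 = c" using c by (auto simp: t_def)
  have "t < 1/3"
  proof (rule ccontr)
    assume "\<not> t < 1/3"
    then have "(1/3) ^ 3 \<le> t ^ 3" by (intro power_mono) auto
    with c t show False by (simp add: power3_eq_cube)
  qed
  then have "t * t \<le> (1/3) * (1/3)" using t by (intro mult_mono) auto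
  then have t2: "t\<^sup>2 \<le> 1/9" by (simp add: power2_eq_square)
  have C4: "?C4 \<le> 1/3 * ?A"
  proof -
    have "?C4 \<le> 3 * t\<^sup>2 * ?A" by (rule gagliardo_nirenberg[OF W t(1)]) (use u t in simp)
    also have "\<dots> \<le> 1/3 * ?A" using t2 A by (intro mult_right_mono) auto
    finally show ?thesis .
  qed
  have i: "integrable lborel (\<lambda>x. \<bar>u x\<bar> powr p)" "integrable lborel (\<lambda>x. \<bar>u x\<bar> powr (10/3))"
    using p by (auto intro!: H1_powr_integrable[OF W])
  have "?C \<le> (LINT x|lborel. \<bar>u x\<bar> ^ 3 + \<bar>u x\<bar> powr (10/3))"
  proof (rule integral_mono)
    show "integrable lborel (\<lambda>x. \<bar>u x\<bar> ^ 3 + \<bar>u x\<bar> powr (10/3))" using i cube_bound(1)[OF W] by simp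
    fix x
    show "\<bar>u x\<bar> powr p \<le> \<bar>u x\<bar> ^ 3 + \<bar>u x\<bar> powr (10/3)"
    proof (cases "\<bar>u x\<bar> \<le> 1")
      case True
      then have "\<bar>u x\<bar> powr p \<le> \<bar>u x\<bar> powr 3" using p by (intro powr_mono') auto
      then show ?thesis by (simp add: powr_numeral add_increasing2)
    next
      case False
      then have "\<bar>u x\<bar> powr p \<le> \<bar>u x\<bar> powr (10/3)" using p by (intro powr_mono) auto
      then show ?thesis by (simp add: add_increasing)
    qed
  qed (rule i)
  also have "\<dots> = ?C3 + ?C4" using i cube_bound(1)[OF W] by simp
  finally have C: "?C \<le> ?C3 + ?C4" .
  have C0: "?C \<ge> 0" by (auto intro!: integral_nonneg_AE)
  have "?A + 1/4 * ?B = (3/2 - 3/p) * ?C"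
    by (rule nehari_pohozaev[OF W _ _ d]) (use p in auto)
  also have "\<dots> \<le> 3/5 * ?C"
  proof (rule mult_right_mono[OF _ C0])
    show "3/2 - 3/p \<le> 3/5" using p by (simp add: field_simps)
  qed
  also have "\<dots> \<le> 3/5 * ((?A + 1/4 * ?B) + 1/3 * ?A)" using C C4 cube_le[OF W] by simp
  finally have "?A + 1/4 * ?B \<le> 3/5 * ((?A + 1/4 * ?B) + 1/3 * ?A)" .
  with A coulomb_square_nonneg[of u] show False by simp
qed

theorem theorem1p3:
  shows "(\<forall>p::real. 3 < p \<and> p \<le> 10 / 3 \<longrightarrow>
            (\<exists>cbar>0. \<forall>c. 0 < c \<and> c < cbar \<longrightarrow>
               \<not> (\<exists>u. constrained_critical_point p c u)))
       \<and> (\<forall>c>0. \<not> (\<exists>u. constrained_critical_point 3 c u))"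
proof (intro conjI allI impI)
  fix p :: real assume "3 < p \<and> p \<le> 10 / 3"
  then show "\<exists>cbar>0. \<forall>c. 0 < c \<and> c < cbar \<longrightarrow> \<not> (\<exists>u. constrained_critical_point p c u)"
    using no_critical_point_small_mass by (intro exI[of _ "1/27"]) auto
qed (use no_critical_point_3 in auto)

end
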